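(* Let $V$ be a reduced, equidimensional, non-degenerate subvariety of $\mathbb{P}^n$ ($n\ge 3$) of codimension $2$ and degree $d$ ($V$ may be reducible and/or singular; note that $d\ge 2$ since $V$ is non-degenerate, with $V$ being two codimension $2$ linear spaces if $d=2$). Let $P\in\mathbb{P}^n$ be a general point. Then the cone $S_P$ over $V$ with vertex $P$ is an unexpected hypersurface for $V$ of degree $d$ and multiplicity $d$ at $P$. It is the unique unexpected hypersurface of this degree and multiplicity.
   Context: $\mathbb{K}$ is an algebraically closed field of characteristic $0$, $\mathbb{P}^n=\mathbb{P}^n_{\mathbb{K}}$, $R=\mathbb{K}[x_0,\ldots,x_n]$. For a closed subscheme $V\subseteq\mathbb{P}^n$, $I_V\subseteq R$ is its saturated homogeneous ideal, and $[I]_t$ is the $\mathbb{K}$-vector space of forms of degree $t$ in a homogeneous ideal $I$. For a point $P$, $I_P$ is the ideal generated by the forms vanishing at $P$. Given $V$, a general point $P$ and integers $d\ge m$, $V$ admits an unexpected hypersurface of degree $d$ with multiplicity $m$ at $P$ if $$\dim [I_V\cap (I_P)^m]_d>\max\left\{0,\ \dim [I_V]_d-\binom{m-1+n}{n}\right\};$$ in that case the hypersurfaces defined by the nonzero elements of $[I_V\cap (I_P)^m]_d$ are called unexpected hypersurfaces for $V$ of degree $d$ and multiplicity $m$ at $P$. "General point" means that the assertion holds for all $P$ in a nonempty Zariski open subset. Non-degenerate means not contained in any hyperplane. The cone over $V$ with vertex $P$ is the union of all lines joining $P$ to points of $V$. *)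

theory Defs
  imports
    Complex_Main
    "HOL-Library.Poly_Mapping"
    "HOL-Computational_Algebra.Polynomial"
    "HOL-Algebra.Ideal_Product"
begin

section \<open>The graded ring \<open>\<bbbK>[x\<^sub>0, \<dots>, x\<^sub>n]\<close>\<close>

text \<open>Polynomials in variables indexed by \<open>nat\<close>: finitely supported functions from exponent
  vectors to coefficients. The ring \<open>\<bbbK>[x\<^sub>0, \<dots>, x\<^sub>n]\<close> consists of those that involve only
  variables with index at most \<open>n\<close>.\<close>

type_synonym 'k mpoly = "(nat \<Rightarrow>\<^sub>0 nat) \<Rightarrow>\<^sub>0 'k"

definition poly_ring :: "nat \<Rightarrow> ('k::comm_ring_1) mpoly ring" where
  "poly_ring n = \<lparr> carrier = {F. \<forall>m\<in>Poly_Mapping.keys F. Poly_Mapping.keys m \<subseteq> {..n}},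
                   mult = (*), one = 1, zero = 0, add = (+) \<rparr>"

definition monom_deg :: "(nat \<Rightarrow>\<^sub>0 nat) \<Rightarrow> nat" where
  "monom_deg m = (\<Sum>i\<in>Poly_Mapping.keys m. Poly_Mapping.lookup m i)"

text \<open>As usual, \<open>0\<close> counts as a form of every degree.\<close>

definition forms :: "nat \<Rightarrow> nat \<Rightarrow> ('k::comm_ring_1) mpoly set" where
  "forms n t = {F \<in> carrier (poly_ring n). \<forall>m\<in>Poly_Mapping.keys F. monom_deg m = t}"

definition graded_part :: "nat \<Rightarrow> ('k::comm_ring_1) mpoly set \<Rightarrow> nat \<Rightarrow> 'k mpoly set" where
  "graded_part n I t = I \<inter> forms n t"

definition peval :: "('k::comm_ring_1) mpoly \<Rightarrow> (nat \<Rightarrow> 'k) \<Rightarrow> 'k" where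
  "peval F a = (\<Sum>m\<in>Poly_Mapping.keys F. Poly_Mapping.lookup F m *
                  (\<Prod>i\<in>Poly_Mapping.keys m. a i ^ Poly_Mapping.lookup m i))"

definition pscale :: "'k::field \<Rightarrow> 'k mpoly \<Rightarrow> 'k mpoly" where
  "pscale c F = Poly_Mapping.single 0 c * F"

global_interpretation mpoly: vector_space "pscale :: 'k::field \<Rightarrow> 'k mpoly \<Rightarrow> 'k mpoly"
  by unfold_locales
    (simp_all add: pscale_def algebra_simps single_add mult_single flip: mult.assoc)


section \<open>Projective space and its Zariski topology\<close>

text \<open>A point of \<open>\<bbbP>\<^sup>n\<close> is the class of its coordinate vectors \<open>(a\<^sub>0, \<dots>, a\<^sub>n) \<noteq> 0\<close> up to
  nonzero scalars; vectors are extended by \<open>0\<close> beyond index \<open>n\<close>.\<close>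

type_synonym 'k point = "(nat \<Rightarrow> 'k) set"

definition coords :: "nat \<Rightarrow> (nat \<Rightarrow> 'k::field) set" where
  "coords n = {a. (\<exists>i. a i \<noteq> 0) \<and> (\<forall>i>n. a i = 0)}"

definition proj_rel :: "nat \<Rightarrow> ((nat \<Rightarrow> 'k::field) \<times> (nat \<Rightarrow> 'k)) set" where
  "proj_rel n = {(a, b). a \<in> coords n \<and> b \<in> coords n \<and> (\<exists>c. c \<noteq> 0 \<and> b = (\<lambda>i. c * a i))}"

definition proj_space :: "nat \<Rightarrow> ('k::field) point set" where
  "proj_space n = coords n // proj_rel n"

definition vanishes_at :: "('k::field) mpoly \<Rightarrow> 'k point \<Rightarrow> bool" where
  "vanishes_at F P \<longleftrightarrow> (\<forall>a\<in>P. peval F a = 0)"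

definition zeros :: "nat \<Rightarrow> ('k::field) mpoly set \<Rightarrow> 'k point set" where
  "zeros n T = {P \<in> proj_space n. \<forall>F\<in>T. vanishes_at F P}"

definition zclosed :: "nat \<Rightarrow> ('k::field) point set \<Rightarrow> bool" where
  "zclosed n Z \<longleftrightarrow> (\<exists>T \<subseteq> (\<Union>t. forms n t). Z = zeros n T)"

definition zopen :: "nat \<Rightarrow> ('k::field) point set \<Rightarrow> bool" where
  "zopen n U \<longleftrightarrow> (\<exists>Z. zclosed n Z \<and> U = proj_space n - Z)"

definition irreducible_closed :: "nat \<Rightarrow> ('k::field) point set \<Rightarrow> bool" where
  "irreducible_closed n Z \<longleftrightarrow> zclosed n Z \<and> Z \<noteq> {} \<and>
     (\<forall>A B. zclosed n A \<longrightarrow> zclosed n B \<longrightarrow> Z = A \<union> B \<longrightarrow> Z = A \<or> Z = B)"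

definition irreducible_components :: "nat \<Rightarrow> ('k::field) point set \<Rightarrow> 'k point set set" where
  "irreducible_components n V = {Z. irreducible_closed n Z \<and> Z \<subseteq> V \<and>
     (\<forall>W. irreducible_closed n W \<longrightarrow> Z \<subseteq> W \<longrightarrow> W \<subseteq> V \<longrightarrow> W = Z)}"

definition has_irreducible_chain :: "nat \<Rightarrow> ('k::field) point set \<Rightarrow> nat \<Rightarrow> bool" where
  "has_irreducible_chain n V r \<longleftrightarrow>
     (\<exists>C :: nat \<Rightarrow> 'k point set. (\<forall>i\<le>r. irreducible_closed n (C i) \<and> C i \<subseteq> V) \<and>
        (\<forall>i<r. C i \<subset> C (Suc i)))"

text \<open>Dimension as the supremum of the lengths of chains of irreducible closed subsets. It is a
  relation, so that the empty set has no dimension.\<close>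

definition has_dim :: "nat \<Rightarrow> ('k::field) point set \<Rightarrow> nat \<Rightarrow> bool" where
  "has_dim n V r \<longleftrightarrow>
     has_irreducible_chain n V r \<and> (\<forall>k. has_irreducible_chain n V k \<longrightarrow> k \<le> r)"

definition has_codim :: "nat \<Rightarrow> ('k::field) point set \<Rightarrow> nat \<Rightarrow> bool" where
  "has_codim n V c \<longleftrightarrow> (\<exists>r. has_dim n V r \<and> r + c = n)"

definition equidimensional :: "nat \<Rightarrow> ('k::field) point set \<Rightarrow> bool" where
  "equidimensional n V \<longleftrightarrow> (\<exists>r. \<forall>Z\<in>irreducible_components n V. has_dim n Z r)"

definition nondegenerate :: "nat \<Rightarrow> ('k::field) point set \<Rightarrow> bool" where
  "nondegenerate n V \<longleftrightarrow> (\<forall>L\<in>forms n 1. L \<noteq> 0 \<longrightarrow> \<not> V \<subseteq> zeros n {L})"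

definition linear_space :: "nat \<Rightarrow> ('k::field) point set \<Rightarrow> bool" where
  "linear_space n L \<longleftrightarrow> (\<exists>T \<subseteq> forms n 1. L = zeros n T)"


section \<open>Ideals of closed subschemes, degree\<close>

text \<open>Over an algebraically closed field a reduced closed subscheme \<open>V\<close> of \<open>\<bbbP>\<^sup>n\<close> is the same thing
  as a Zariski closed set of points, and its saturated homogeneous ideal is generated by the forms
  vanishing on \<open>V\<close>. For \<open>V = {P}\<close> this is the ideal of the point \<open>P\<close>.\<close>

definition vanishing_ideal :: "nat \<Rightarrow> ('k::field) point set \<Rightarrow> 'k mpoly set" where
  "vanishing_ideal n V =
     genideal (poly_ring n) {F. (\<exists>t. F \<in> forms n t) \<and> (\<forall>P\<in>V. vanishes_at F P)}"

text \<open>The Hilbert function of \<open>\<bbbK>[x\<^sub>0, \<dots>, x\<^sub>n] / I\<close>.\<close>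

definition hilbert_fun :: "nat \<Rightarrow> ('k::field) mpoly set \<Rightarrow> nat \<Rightarrow> int" where
  "hilbert_fun n I t =
     int (mpoly.dim (forms n t :: 'k mpoly set)) - int (mpoly.dim (graded_part n I t))"

definition is_hilbert_poly :: "nat \<Rightarrow> ('k::field) mpoly set \<Rightarrow> rat poly \<Rightarrow> bool" where
  "is_hilbert_poly n I h \<longleftrightarrow>
     (\<forall>\<^sub>F t in sequentially. poly h (of_nat t) = of_int (hilbert_fun n I t))"

text \<open>The degree of the closed subscheme with homogeneous ideal \<open>I\<close> is \<open>r!\<close> times the leading
  coefficient of its Hilbert polynomial, \<open>r\<close> being the degree of that polynomial.\<close>

definition has_degree :: "nat \<Rightarrow> ('k::field) mpoly set \<Rightarrow> nat \<Rightarrow> bool" where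
  "has_degree n I d \<longleftrightarrow>
     (\<exists>h. is_hilbert_poly n I h \<and> fact (Polynomial.degree h) * lead_coeff h = of_nat d)"


section \<open>Cones and unexpected hypersurfaces\<close>

definition proj_line :: "nat \<Rightarrow> ('k::field) point \<Rightarrow> 'k point \<Rightarrow> 'k point set" where
  "proj_line n P Q =
     {X \<in> proj_space n. \<exists>a\<in>P. \<exists>b\<in>Q. \<exists>s t. (\<lambda>i. s * a i + t * b i) \<in> X}"

definition cone :: "nat \<Rightarrow> ('k::field) point \<Rightarrow> 'k point set \<Rightarrow> 'k point set" where
  "cone n P V = (\<Union>Q\<in>V. proj_line n P Q)"

text \<open>\<open>[I \<inter> I\<^sub>P\<^sup>m]\<^sub>d\<close>; the power is formed in the monoid of ideals of the polynomial ring.\<close>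

definition mult_forms ::
  "nat \<Rightarrow> ('k::field) mpoly set \<Rightarrow> nat \<Rightarrow> nat \<Rightarrow> 'k point \<Rightarrow> 'k mpoly set" where
  "mult_forms n I d m P =
     graded_part n (I \<inter> (vanishing_ideal n {P} [^]\<^bsub>ideals_set (poly_ring n)\<^esub> m)) d"

definition admits_unexpected ::
  "nat \<Rightarrow> ('k::field) mpoly set \<Rightarrow> nat \<Rightarrow> nat \<Rightarrow> 'k point \<Rightarrow> bool" where
  "admits_unexpected n I d m P \<longleftrightarrow> m \<le> d \<and>
     int (mpoly.dim (mult_forms n I d m P)) >
       max 0 (int (mpoly.dim (graded_part n I d)) - int ((m + n - 1) choose n))"

text \<open>The unexpected hypersurfaces of degree \<open>d\<close> and multiplicity \<open>m\<close> at \<open>P\<close> for the closed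
  subscheme with saturated homogeneous ideal \<open>I\<close>. A hypersurface \<open>F = 0\<close> is a closed subscheme,
  possibly nonreduced, and is represented by its saturated ideal \<open>(F)\<close>; so two forms define the
  same hypersurface iff they are proportional.\<close>

definition unexpected_hypersurfaces ::
  "nat \<Rightarrow> ('k::field) mpoly set \<Rightarrow> nat \<Rightarrow> nat \<Rightarrow> 'k point \<Rightarrow> 'k mpoly set set" where
  "unexpected_hypersurfaces n I d m P =
     {cgenideal (poly_ring n) F | F. admits_unexpected n I d m P \<and> F \<in> mult_forms n I d m P \<and> F \<noteq> 0}"

end

(* After a linear change of coordinates taking the general point P to (0, ..., 0, 1), put m = n - 1.
   Since V has dimension n - 2 and is closed, the coordinates can moreover be chosen such that no
   point of V has all of its first m coordinates zero. The coordinate ring R/I of V is then integral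
   over K[x_0, ..., x_(m-1)], and it is torsion-free because a closed subset mapping into a
   hypersurface of the base has too slow a Hilbert function to contain a chain of length n - 2.

   Torsion-freeness makes the ideal of the projection of V from P principal, generated by a form F
   monic in x_m of some degree e; F is an equation of the cone over V with vertex P. The inclusion of
   K[x_0, ..., x_m]/(F) into R/I gives e <= d. In characteristic 0, differentiating a minimal
   equation of x_m + t x_(m+1) with respect to t expresses x_(m+1) by it rationally, so that some
   projection is birational, and there e = d. As "no nonzero form of degree d - 1 in I is invariant
   under translation by P" is an open condition on P, it follows that e = d for general P.

   The forms of degree d in I_P^d are those invariant under translation by P, so those in
   I are exactly the multiples of F. The strict inequality amounts to
   dim I_d <= dim K[x_0, ..., x_n]_(d-1): otherwise x_0^k x_n and x_1^k x_n, with k = d - 1, would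
   both lie in I_d + K[x_0, ..., x_m]_d, and I would contain a linear form.

   If d = 2, every projection yields a quadric, and comparing those for x_m, x_(m+1) and their
   linear combinations shows that the quadrics split into linear factors. *)
theory Submission
  imports Defs
begin


section \<open>Polynomials and substitution\<close>

text \<open>Dimension is given by chains of irreducible sets and degree by the Hilbert polynomial,
  and both are reached by counting forms. A chain of length k forces growth of order t^k, and each
  monic relation multiplies an upper bound by a constant, so that chains and integral extensions can
  be compared by growth alone. Torsion-freeness replaces the passage to the fraction field of the
  base: ideals of one-variable polynomials are handled by pseudo-division, and Gauss's lemma leads
  back to a monic generator. Birationality enters only as a relation a * x_n = B with a in the base;
  a power of a carries R/I into K[x_0, ..., x_m]/(F) at the price of a shift in degree, which the
  leading coefficient does not see. This yields one good vertex, and e <= d elsewhere; if e < d at a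
  vertex, F times linear forms vanishing there is an invariant form of degree d - 1, which explains
  the degree in the open condition. Since the forms with multiplicity d at P turn out to be
  one-dimensional, unexpectedness means that dim I_d is at most (d - 1 + n) choose n, which is dim
  K[x_0, ..., x_n]_(d-1).\<close>

locale rhom =
  fixes f :: "'a::comm_ring_1 \<Rightarrow> 'b::comm_ring_1"
  assumes add: "f (a + b) = f a + f b" and mult: "f (a * b) = f a * f b" and one: "f 1 = 1"
begin

lemma zero [simp]: "f 0 = 0"
  using add[of 0 0] by simp

lemma uminus: "f (- a) = - f a"
  using add[of a "-a"] by (simp add: minus_unique)

lemma diff: "f (a - b) = f a - f b"
  using add[of a "-b"] by (simp add: uminus)

lemma sum: "f (\<Sum>i\<in>S. g i) = (\<Sum>i\<in>S. f (g i))"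
  by (induction S rule: infinite_finite_induct) (simp_all add: add)

lemma prod: "f (\<Prod>i\<in>S. g i) = (\<Prod>i\<in>S. f (g i))"
  by (induction S rule: infinite_finite_induct) (simp_all add: mult one)

lemma power: "f (a ^ n) = f a ^ n"
  by (induction n) (simp_all add: mult one)

lemma of_nat: "f (of_nat n) = of_nat n"
  by (induction n) (simp_all add: add one)

lemma coeff_map: "coeff (map_poly f p) n = f (coeff p n)"
  by (simp add: coeff_map_poly)

lemma map_poly_add: "map_poly f (p + q) = map_poly f p + map_poly f q"
  by (rule poly_eqI) (simp add: coeff_map add)

lemma map_poly_mult: "map_poly f (p * q) = map_poly f p * map_poly f q"
  by (rule poly_eqI) (simp add: coeff_map coeff_mult sum mult)

lemma map_poly_pCons: "map_poly f (pCons a p) = pCons (f a) (map_poly f p)"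
  by (rule poly_eqI) (simp add: coeff_map coeff_pCons split: nat.splits)

lemma map_poly_smult: "map_poly f (smult a p) = smult (f a) (map_poly f p)"
  by (rule poly_eqI) (simp add: coeff_map mult)

lemma rhom_map_poly: "rhom (map_poly f)"
  by unfold_locales (simp_all add: map_poly_add map_poly_mult one_pCons map_poly_pCons one)

lemma rhom_poly_map: "rhom (\<lambda>p. poly (map_poly f p) z)"
  by unfold_locales (simp_all add: map_poly_add map_poly_mult one_pCons map_poly_pCons one)

lemma poly_map: "f (poly p z) = poly (map_poly f p) (f z)"
  by (induction p) (simp_all add: map_poly_pCons add mult)

end

lemma rhom_map_poly_pderiv:
  fixes f :: "'a::idom \<Rightarrow> 'b::idom"
  assumes "rhom f" shows "map_poly f (pderiv p) = pderiv (map_poly f p)"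
proof -
  interpret rhom f by fact
  show ?thesis by (rule poly_eqI) (simp add: coeff_map coeff_pderiv mult of_nat add one)
qed

lemma rhom_comp: "rhom f \<Longrightarrow> rhom g \<Longrightarrow> rhom (\<lambda>x. f (g x))"
  unfolding rhom_def by simp

lemma rhom_poly: "rhom (\<lambda>p. poly p z)"
  by unfold_locales simp_all

definition monom_eval :: "(nat \<Rightarrow> 'b::comm_semiring_1) \<Rightarrow> (nat \<Rightarrow>\<^sub>0 nat) \<Rightarrow> 'b" where
  "monom_eval g m = (\<Prod>i\<in>Poly_Mapping.keys m. g i ^ Poly_Mapping.lookup m i)"

lemma monom_eval_superset:
  assumes "finite S" "Poly_Mapping.keys m \<subseteq> S"
  shows "monom_eval g m = (\<Prod>i\<in>S. g i ^ Poly_Mapping.lookup m i)"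
  unfolding monom_eval_def using assms
  by (intro prod.mono_neutral_left) (auto simp: in_keys_iff)

lemma monom_eval_add: "monom_eval g (m + m') = monom_eval g m * monom_eval g m'"
proof -
  let ?S = "Poly_Mapping.keys m \<union> Poly_Mapping.keys m'"
  have "Poly_Mapping.keys (m + m') \<subseteq> ?S" by (rule Poly_Mapping.keys_add)
  then show ?thesis
    by (simp add: monom_eval_superset[of ?S] lookup_add power_add prod.distrib)
qed

lemma monom_eval_0 [simp]: "monom_eval g 0 = 1"
  by (simp add: monom_eval_def)

lemma monom_eval_single [simp]: "monom_eval g (Poly_Mapping.single i e) = g i ^ e"
  by (simp add: monom_eval_def)

lemma monom_eval_scale: "monom_eval (\<lambda>i. c * g i) m = c ^ monom_deg m * monom_eval g m"
  by (simp add: monom_eval_def monom_deg_def power_mult_distrib prod.distrib power_sum)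

lemma monom_deg_superset:
  assumes "finite S" "Poly_Mapping.keys m \<subseteq> S"
  shows "monom_deg m = (\<Sum>i\<in>S. Poly_Mapping.lookup m i)"
  unfolding monom_deg_def using assms
  by (intro sum.mono_neutral_left) (auto simp: in_keys_iff)

lemma monom_deg_add: "monom_deg (m + m') = monom_deg m + monom_deg m'"
proof -
  let ?S = "Poly_Mapping.keys m \<union> Poly_Mapping.keys m'"
  have "Poly_Mapping.keys (m + m') \<subseteq> ?S" by (rule Poly_Mapping.keys_add)
  then show ?thesis
    by (simp add: monom_deg_superset[of ?S] lookup_add sum.distrib)
qed

lemma monom_deg_single [simp]: "monom_deg (Poly_Mapping.single i e) = e"
  by (simp add: monom_deg_def)

definition Cst :: "'k::comm_ring_1 \<Rightarrow> 'k mpoly" where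
  "Cst c = Poly_Mapping.single 0 c"

definition X :: "nat \<Rightarrow> 'k::comm_ring_1 mpoly" where
  "X i = Poly_Mapping.single (Poly_Mapping.single i 1) 1"

lemma rhom_Cst: "rhom Cst"
  by unfold_locales (simp_all add: Cst_def single_add mult_single)

lemma Cst_0 [simp]: "Cst 0 = 0" and Cst_1 [simp]: "Cst 1 = 1"
  by (simp_all add: Cst_def)

lemma Cst_eq_0_iff [simp]: "Cst c = 0 \<longleftrightarrow> c = 0"
  by (metis Cst_def inj_single injD single_zero)

lemma X_power: "X i ^ e = Poly_Mapping.single (Poly_Mapping.single i e) 1"
  by (induction e) (simp_all add: X_def mult_single flip: single_add)

lemma prod_single_one:
  "(\<Prod>i\<in>S. Poly_Mapping.single (h i) (1::'k::comm_ring_1)) = Poly_Mapping.single (\<Sum>i\<in>S. h i) 1"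
  for h :: "nat \<Rightarrow> nat \<Rightarrow>\<^sub>0 nat"
  by (induction S rule: infinite_finite_induct) (simp_all add: mult_single)

lemma sum_singles:
  fixes F :: "'a \<Rightarrow>\<^sub>0 'b::comm_monoid_add"
  shows "(\<Sum>m\<in>Poly_Mapping.keys F. Poly_Mapping.single m (Poly_Mapping.lookup F m)) = F"
proof (rule poly_mapping_eqI)
  fix k
  show "Poly_Mapping.lookup (\<Sum>m\<in>Poly_Mapping.keys F. Poly_Mapping.single m (Poly_Mapping.lookup F m)) k
      = Poly_Mapping.lookup F k"
    by (cases "k \<in> Poly_Mapping.keys F")
       (auto simp: lookup_sum lookup_single when_def in_keys_iff sum.delta)
qed

lemma monom_eval_X: "monom_eval X m = Poly_Mapping.single m (1::'k::comm_ring_1)"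
  by (simp add: monom_eval_def X_power prod_single_one sum_singles)

lemma single_eq: "Poly_Mapping.single m c = Cst c * monom_eval X m"
  by (simp add: monom_eval_X Cst_def mult_single)

text \<open>The target is an arbitrary commutative ring, so that evaluation at a point, substitution
  of polynomials, singling out a variable and restriction to a line are instances of one
  homomorphism.\<close>

definition msubst ::
  "('k::comm_ring_1 \<Rightarrow> 'b::comm_ring_1) \<Rightarrow> (nat \<Rightarrow> 'b) \<Rightarrow> 'k mpoly \<Rightarrow> 'b" where
  "msubst f g F = (\<Sum>m\<in>Poly_Mapping.keys F. f (Poly_Mapping.lookup F m) * monom_eval g m)"

lemma peval_eq_msubst: "peval F a = msubst (\<lambda>c. c) a F"
  by (simp add: peval_def msubst_def monom_eval_def)

context rhom begin

lemma msubst_superset: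
  assumes "finite S" "Poly_Mapping.keys F \<subseteq> S"
  shows "msubst f g F = (\<Sum>m\<in>S. f (Poly_Mapping.lookup F m) * monom_eval g m)"
  unfolding msubst_def using assms
  by (intro sum.mono_neutral_left) (auto simp: in_keys_iff)

lemma msubst_add: "msubst f g (F + G) = msubst f g F + msubst f g G"
proof -
  let ?S = "Poly_Mapping.keys F \<union> Poly_Mapping.keys G"
  have "Poly_Mapping.keys (F + G) \<subseteq> ?S" by (rule Poly_Mapping.keys_add)
  then show ?thesis
    by (simp add: msubst_superset[of ?S] lookup_add add sum.distrib distrib_right)
qed

lemma msubst_0 [simp]: "msubst f g 0 = 0"
  by (simp add: msubst_def)

lemma msubst_sum: "msubst f g (\<Sum>i\<in>S. h i) = (\<Sum>i\<in>S. msubst f g (h i))"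
  by (induction S rule: infinite_finite_induct) (simp_all add: msubst_add msubst_0)

lemma msubst_single: "msubst f g (Poly_Mapping.single m c) = f c * monom_eval g m"
  by (simp add: msubst_def)

lemma msubst_mult: "msubst f g (F * G) = msubst f g F * msubst f g G"
proof -
  have "msubst f g (F * G) = msubst f g
     ((\<Sum>m\<in>Poly_Mapping.keys F. Poly_Mapping.single m (Poly_Mapping.lookup F m)) *
      (\<Sum>m\<in>Poly_Mapping.keys G. Poly_Mapping.single m (Poly_Mapping.lookup G m)))"
    by (simp add: sum_singles)
  also have "\<dots> = (\<Sum>m\<in>Poly_Mapping.keys F. \<Sum>m'\<in>Poly_Mapping.keys G.
       f (Poly_Mapping.lookup F m) * monom_eval g m * (f (Poly_Mapping.lookup G m') * monom_eval g m'))"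
    by (simp add: sum_product msubst_sum mult_single msubst_single mult monom_eval_add mult_ac)
  finally show ?thesis by (simp add: msubst_def sum_product)
qed

lemma rhom_msubst: "rhom (msubst f g)"
  by unfold_locales (simp_all add: msubst_add msubst_mult, simp add: msubst_def one)

lemma msubst_Cst [simp]: "msubst f g (Cst c) = f c"
  by (simp add: Cst_def msubst_single)

lemma msubst_X [simp]: "msubst f g (X i) = g i"
  by (simp add: X_def msubst_single one)

end

lemma rhom_mpoly_eq_msubst:
  assumes "rhom \<phi>" shows "\<phi> F = msubst (\<lambda>c. \<phi> (Cst c)) (\<lambda>i. \<phi> (X i)) F"
proof -
  interpret rhom \<phi> by fact
  have "\<phi> F = \<phi> (\<Sum>m\<in>Poly_Mapping.keys F. Poly_Mapping.single m (Poly_Mapping.lookup F m))"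
    by (simp add: sum_singles)
  also have "\<dots> = msubst (\<lambda>c. \<phi> (Cst c)) (\<lambda>i. \<phi> (X i)) F"
    by (simp add: sum single_eq mult msubst_def monom_eval_def prod power)
  finally show ?thesis .
qed

text \<open>The uniqueness half of the universal property of the polynomial ring. Composites of
  evaluations and substitutions are identified with its help below.\<close>

lemma rhom_mpoly_eqI:
  assumes "rhom \<phi>" "rhom \<psi>" "\<And>c. \<phi> (Cst c) = \<psi> (Cst c)" "\<And>i. \<phi> (X i) = \<psi> (X i)"
  shows "\<phi> F = \<psi> F"
  using rhom_mpoly_eq_msubst[OF assms(1), of F] rhom_mpoly_eq_msubst[OF assms(2), of F]
  by (simp add: assms(3,4))

lemma rhom_id: "rhom (\<lambda>c. c)"
  by unfold_locales simp_all

interpretation peval: rhom "\<lambda>F. peval F a" for a :: "nat \<Rightarrow> 'k::comm_ring_1"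
  unfolding peval_eq_msubst by (rule rhom.rhom_msubst[OF rhom_id])

lemma peval_Cst [simp]: "peval (Cst c) a = c"
  unfolding peval_eq_msubst by (rule rhom.msubst_Cst[OF rhom_id])

lemma peval_X [simp]: "peval (X i) a = a i"
  unfolding peval_eq_msubst by (rule rhom.msubst_X[OF rhom_id])

lemma peval_0 [simp]: "peval 0 a = 0" and peval_1 [simp]: "peval 1 a = 1"
  by (simp_all add: peval.one)

lemma peval_msubst:
  fixes f :: "'k::comm_ring_1 \<Rightarrow> 'l::comm_ring_1 mpoly"
  assumes "rhom f" shows "peval (msubst f g F) a = msubst (\<lambda>c. peval (f c) a) (\<lambda>i. peval (g i) a) F"
proof -
  interpret f: rhom f by fact
  have "rhom (\<lambda>F. peval (msubst f g F) a)"
    by (rule rhom_comp[OF peval.rhom_axioms f.rhom_msubst])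
  from rhom_mpoly_eq_msubst[OF this, of F] show ?thesis by simp
qed

lemma peval_msubst_Cst: "peval (msubst Cst g F) a = peval F (\<lambda>i. peval (g i) a)"
  by (simp add: peval_msubst[OF rhom_Cst] peval_eq_msubst[of F])

subsection \<open>Polynomials in finitely many variables\<close>

text \<open>The index counts variables: \<open>polys (Suc n)\<close> is the coordinate ring of P^n,
  and its subring \<open>polys n\<close> is that of the target of the projection from the last unit
  vector.\<close>

definition polys :: "nat \<Rightarrow> 'k::comm_ring_1 mpoly set" where
  "polys k = {F. \<forall>m\<in>Poly_Mapping.keys F. Poly_Mapping.keys m \<subseteq> {..<k}}"

lemma carrier_poly_ring: "carrier (poly_ring n) = polys (Suc n)"
  by (simp add: poly_ring_def polys_def lessThan_Suc_atMost)

lemma polys_add: "F \<in> polys k \<Longrightarrow> G \<in> polys k \<Longrightarrow> F + G \<in> polys k"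
  using Poly_Mapping.keys_add[of F G] unfolding polys_def by blast

lemma polys_0 [simp]: "0 \<in> polys k" and polys_1 [simp]: "1 \<in> polys k"
  and polys_Cst [simp]: "Cst c \<in> polys k"
  by (auto simp: polys_def Cst_def split: if_splits)

lemma polys_mult: "F \<in> polys k \<Longrightarrow> G \<in> polys k \<Longrightarrow> F * G \<in> polys k"
proof -
  assume a: "F \<in> polys k" "G \<in> polys k"
  { fix m assume "m \<in> Poly_Mapping.keys (F * G)"
    then obtain p q where "m = p + q" "p \<in> Poly_Mapping.keys F" "q \<in> Poly_Mapping.keys G"
      using keys_mult[of F G] by auto
    with a have "Poly_Mapping.keys m \<subseteq> {..<k}"
      using Poly_Mapping.keys_add[of p q] unfolding polys_def by blast }
  then show ?thesis by (simp add: polys_def)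
qed

lemma polys_X [simp]: "i < k \<Longrightarrow> X i \<in> polys k"
  by (auto simp: polys_def X_def split: if_splits)

lemma polys_uminus: "F \<in> polys k \<Longrightarrow> - F \<in> polys k"
  by (auto simp: polys_def in_keys_iff)

lemma polys_diff: "F \<in> polys k \<Longrightarrow> G \<in> polys k \<Longrightarrow> F - G \<in> polys k"
  using polys_add[of F k "- G"] polys_uminus[of G k] by simp

lemma polys_sum: "(\<And>i. i \<in> S \<Longrightarrow> h i \<in> polys k) \<Longrightarrow> (\<Sum>i\<in>S. h i) \<in> polys k"
  by (induction S rule: infinite_finite_induct) (simp_all add: polys_add)

lemma polys_prod: "(\<And>i. i \<in> S \<Longrightarrow> h i \<in> polys k) \<Longrightarrow> (\<Prod>i\<in>S. h i) \<in> polys k"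
  by (induction S rule: infinite_finite_induct) (simp_all add: polys_mult)

lemma polys_power: "F \<in> polys k \<Longrightarrow> F ^ n \<in> polys k"
  by (induction n) (simp_all add: polys_mult)

lemmas polys_closed = polys_add polys_mult polys_uminus polys_diff polys_sum polys_prod polys_power

lemma polys_mono: "F \<in> polys k \<Longrightarrow> k \<le> l \<Longrightarrow> F \<in> polys l"
  unfolding polys_def by fastforce

lemma ex_polys: "\<exists>k. F \<in> polys k"
proof -
  have "finite (\<Union>m\<in>Poly_Mapping.keys F. Poly_Mapping.keys m)" by simp
  then obtain k where "\<forall>i\<in>(\<Union>m\<in>Poly_Mapping.keys F. Poly_Mapping.keys m). i < k"
    using finite_nat_set_iff_bounded by blast
  then have "F \<in> polys k" by (auto simp: polys_def)
  then show ?thesis ..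
qed

lemma msubst_closed:
  assumes "F \<in> polys k" "\<And>c. P (f c)" "\<And>i. i < k \<Longrightarrow> P (g i)"
    and "\<And>a b. P a \<Longrightarrow> P b \<Longrightarrow> P (a + b)" "\<And>a b. P a \<Longrightarrow> P b \<Longrightarrow> P (a * b)" "P 0" "P 1"
  shows "P (msubst f g F)"
proof -
  have pw: "P a \<Longrightarrow> P (a ^ n)" for a n by (induction n) (simp_all add: assms)
  have pr: "(\<And>i. i \<in> S \<Longrightarrow> P (h i)) \<Longrightarrow> P (\<Prod>i\<in>S. h i)" for S and h :: "nat \<Rightarrow> _"
    by (induction S rule: infinite_finite_induct) (simp_all add: assms)
  have sm: "(\<And>i. i \<in> S \<Longrightarrow> P (h i)) \<Longrightarrow> P (\<Sum>i\<in>S. h i)" for S and h :: "(nat \<Rightarrow>\<^sub>0 nat) \<Rightarrow> _"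
    by (induction S rule: infinite_finite_induct) (simp_all add: assms)
  show ?thesis
    unfolding msubst_def monom_eval_def
    using assms(1) by (intro sm assms(5) assms(2) pr pw assms(3)) (auto simp: polys_def)
qed

lemma msubst_polys: "F \<in> polys k \<Longrightarrow> (\<And>i. i < k \<Longrightarrow> g i \<in> polys l) \<Longrightarrow> msubst Cst g F \<in> polys l"
  by (rule msubst_closed) (simp_all add: polys_closed)

lemma msubst_cong:
  assumes "F \<in> polys k" "\<And>i. i < k \<Longrightarrow> g i = h i" shows "msubst f g F = msubst f h F"
  using assms unfolding msubst_def monom_eval_def polys_def
  by (intro sum.cong arg_cong2[where f = "(*)"] prod.cong refl) (auto simp: subset_iff)

lemma peval_cong: "F \<in> polys k \<Longrightarrow> (\<And>i. i < k \<Longrightarrow> a i = b i) \<Longrightarrow> peval F a = peval F b"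
  unfolding peval_eq_msubst by (rule msubst_cong)

subsection \<open>Singling out a variable\<close>

text \<open>The coefficients remain in the full polynomial ring although they do not involve
  \<open>X k\<close>. One type thus serves for all subrings, and coefficients may carry additional
  variables as parameters.\<close>

definition in_var :: "nat \<Rightarrow> 'k::comm_ring_1 mpoly \<Rightarrow> 'k mpoly poly" where
  "in_var k = msubst (\<lambda>c. [:Cst c:]) (\<lambda>i. if i = k then [:0, 1:] else [:X i:])"

definition eval2 :: "(nat \<Rightarrow> 'k::comm_ring_1) \<Rightarrow> 'k mpoly poly \<Rightarrow> 'k \<Rightarrow> 'k" where
  "eval2 b G z = poly (map_poly (\<lambda>c. peval c b) G) z"

lemma rhom_const_Cst: "rhom (\<lambda>c::'k::comm_ring_1. [:Cst c:])"
  by unfold_locales (simp_all add: rhom.add[OF rhom_Cst] rhom.mult[OF rhom_Cst] one_pCons)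

interpretation in_var: rhom "in_var k :: 'k::comm_ring_1 mpoly \<Rightarrow> _"
  unfolding in_var_def by (rule rhom.rhom_msubst[OF rhom_const_Cst])

interpretation eval2: rhom "\<lambda>G. eval2 b G z"
  unfolding eval2_def by (rule peval.rhom_poly_map)

lemma in_var_Cst [simp]: "in_var k (Cst c) = [:Cst c:]"
  and in_var_X: "in_var k (X i) = (if i = k then [:0, 1:] else [:X i:])"
  unfolding in_var_def by (simp_all add: rhom.msubst_Cst rhom.msubst_X rhom_const_Cst)

lemma eval2_pCons [simp]: "eval2 b (pCons c G) z = peval c b + z * eval2 b G z"
  by (simp add: eval2_def peval.map_poly_pCons)

lemma eval2_0 [simp]: "eval2 b 0 z = 0" by (rule eval2.zero)

lemma eval2_smult [simp]: "eval2 b (smult c G) z = peval c b * eval2 b G z"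
  by (simp add: eval2_def peval.map_poly_smult)

lemma eval2_in_var: "eval2 b (in_var k F) z = peval F (b(k := z))"
  by (rule rhom_mpoly_eqI[OF rhom_comp[OF eval2.rhom_axioms in_var.rhom_axioms] peval.rhom_axioms])
     (simp_all add: in_var_X)

lemma poly_in_var: "poly (in_var k F) (X k) = F"
  by (rule rhom_mpoly_eqI[OF rhom_comp[OF rhom_poly in_var.rhom_axioms] rhom_id])
     (simp_all add: in_var_X)

lemma peval_poly: "peval (poly G H) a = eval2 a G (peval H a)"
  by (simp add: eval2_def peval.poly_map)

lemma coeff_in_var_polys: "F \<in> polys (Suc k) \<Longrightarrow> coeff (in_var k F) j \<in> polys k"
proof -
  assume "F \<in> polys (Suc k)"
  then have "\<forall>j. coeff (in_var k F) j \<in> polys k"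
    unfolding in_var_def
  proof (rule msubst_closed, goal_cases)
    case 2 then show ?case by (auto simp: coeff_pCons split: nat.splits)
  next
    case 4 then show ?case by (auto simp: coeff_mult intro!: polys_closed)
  qed (auto simp: coeff_pCons polys_closed one_pCons split: nat.splits)
  then show ?thesis by simp
qed

lemma in_var_eq_const: "F \<in> polys k \<Longrightarrow> in_var k F = [:F:]"
proof -
  assume F: "F \<in> polys k"
  have "rhom (\<lambda>F. [:F:] :: 'a mpoly poly)" by unfold_locales (simp_all add: one_pCons)
  from rhom_mpoly_eq_msubst[OF this, of F]
  have "[:F:] = msubst (\<lambda>c. [:Cst c:]) (\<lambda>i. [:X i:]) F" .
  also have "\<dots> = in_var k F" unfolding in_var_def by (rule msubst_cong[OF F]) auto
  finally show ?thesis by simp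
qed

lemma in_var_poly:
  assumes "\<forall>j. coeff G j \<in> polys k" shows "in_var k (poly G (X k)) = G"
proof -
  have "in_var k (poly G (X k)) = poly (map_poly (in_var k) G) [:0, 1:]"
    by (simp add: in_var.poly_map in_var_X)
  also have "map_poly (in_var k) G = map_poly (\<lambda>c. [:c:]) G"
    by (rule poly_eqI) (simp add: coeff_map_poly in_var_eq_const assms)
  also have "poly (map_poly (\<lambda>c. [:c:]) G) [:0, 1:] = G"
    by (metis pcompose_altdef pcompose_idR)
  finally show ?thesis .
qed

lemma polys_poly:
  "\<forall>j. coeff G j \<in> polys k \<Longrightarrow> H \<in> polys k \<Longrightarrow> poly G H \<in> polys k"
  by (simp add: poly_altdef polys_closed)

text \<open>A field of characteristic 0 is infinite. Once the other coordinates are fixed, a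
  univariate polynomial in the last variable vanishes everywhere, so its coefficients vanish at
  every point and the induction hypothesis applies to them. From here on, polynomial identities are
  mostly proved pointwise.\<close>

lemma peval_inj_polys:
  fixes F :: "'k::field_char_0 mpoly"
  shows "F \<in> polys k \<Longrightarrow> (\<forall>a. (\<forall>i\<ge>k. a i = 0) \<longrightarrow> peval F a = 0) \<Longrightarrow> F = 0"
proof (induction k arbitrary: F)
  case 0
  then have "Poly_Mapping.keys F \<subseteq> {0}" by (auto simp: polys_def)
  then have F: "F = Cst (Poly_Mapping.lookup F 0)"
    by (intro poly_mapping_eqI) (auto simp: Cst_def lookup_single when_def in_keys_iff)
  have "peval F (\<lambda>_. 0) = 0" by (rule mp[OF spec[OF 0(2), of "\<lambda>_. 0"]]) simp
  with F show ?case by (metis peval_Cst Cst_0)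
next
  case (Suc k)
  have "coeff (in_var k F) j = 0" for j
  proof (rule Suc.IH)
    show "coeff (in_var k F) j \<in> polys k" by (rule coeff_in_var_polys[OF Suc.prems(1)])
    show "\<forall>a. (\<forall>i\<ge>k. a i = 0) \<longrightarrow> peval (coeff (in_var k F) j) a = 0"
    proof (intro allI impI)
      fix a :: "nat \<Rightarrow> 'k" assume a: "\<forall>i\<ge>k. a i = 0"
      have "poly (map_poly (\<lambda>c. peval c a) (in_var k F)) z = 0" for z
        using Suc.prems(2) a eval2_in_var[of a k F z] by (simp add: eval2_def)
      then have "map_poly (\<lambda>c. peval c a) (in_var k F) = 0"
        using poly_all_0_iff_0 by blast
      then show "peval (coeff (in_var k F) j) a = 0"
        by (metis peval.coeff_map coeff_0)
    qed
  qed
  then have "in_var k F = 0" by (simp add: poly_eqI)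
  with poly_in_var[of k F] show ?case by simp
qed

lemma peval_inj:
  fixes F G :: "'k::field_char_0 mpoly"
  assumes "\<And>a. peval F a = peval G a" shows "F = G"
proof -
  obtain k where "F - G \<in> polys k" using ex_polys by blast
  with peval_inj_polys[of "F - G" k] assms show ?thesis by (simp add: peval.diff)
qed

lemma ex_peval_nonzero:
  fixes F :: "'k::field_char_0 mpoly"
  assumes "F \<noteq> 0" shows "\<exists>a. peval F a \<noteq> 0"
  using assms peval_inj[of F 0] by auto

lemma ex_peval_nonzero_polys:
  fixes F :: "'k::field_char_0 mpoly"
  assumes "F \<noteq> 0" "F \<in> polys k" shows "\<exists>a. (\<forall>i\<ge>k. a i = 0) \<and> peval F a \<noteq> 0"
  using assms peval_inj_polys by blast

subsection \<open>Homogeneous components\<close>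

definition hpoly :: "nat \<Rightarrow> nat \<Rightarrow> 'k::comm_ring_1 mpoly set" where
  "hpoly k t = {F \<in> polys k. \<forall>m\<in>Poly_Mapping.keys F. monom_deg m = t}"

lemma forms_eq_hpoly: "forms n t = hpoly (Suc n) t"
  by (simp add: forms_def hpoly_def carrier_poly_ring)

definition hcomp :: "nat \<Rightarrow> 'k::comm_ring_1 mpoly \<Rightarrow> 'k mpoly" where
  "hcomp t F = (\<Sum>m\<in>{m\<in>Poly_Mapping.keys F. monom_deg m = t}. Poly_Mapping.single m (Poly_Mapping.lookup F m))"

text \<open>The restriction of \<open>F\<close> to the line through the origin and \<open>a\<close>.
  Its coefficients are the values at \<open>a\<close> of the homogeneous components of
  \<open>F\<close>, so that statements on components become statements on univariate
  polynomials.\<close>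

definition scaling_poly :: "'k::comm_ring_1 mpoly \<Rightarrow> (nat \<Rightarrow> 'k) \<Rightarrow> 'k poly" where
  "scaling_poly F a = (\<Sum>m\<in>Poly_Mapping.keys F. monom (Poly_Mapping.lookup F m * monom_eval a m) (monom_deg m))"

lemma lookup_hcomp:
  "Poly_Mapping.lookup (hcomp t F) m = (if monom_deg m = t then Poly_Mapping.lookup F m else 0)"
  unfolding hcomp_def
  by (auto simp: lookup_sum lookup_single when_def in_keys_iff sum.delta)

lemma poly_scaling_poly: "poly (scaling_poly F a) s = peval F (\<lambda>i. s * a i)"
  by (simp add: scaling_poly_def poly_sum poly_monom peval_eq_msubst msubst_def monom_eval_scale mult_ac)

lemma keys_hcomp: "Poly_Mapping.keys (hcomp t F) = {m\<in>Poly_Mapping.keys F. monom_deg m = t}"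
  by (auto simp: in_keys_iff lookup_hcomp split: if_splits)

lemma coeff_scaling_poly: "coeff (scaling_poly F a) t = peval (hcomp t F) a"
proof -
  have "peval (hcomp t F) a = (\<Sum>m\<in>Poly_Mapping.keys F. if monom_deg m = t then Poly_Mapping.lookup F m * monom_eval a m else 0)"
    unfolding peval_eq_msubst msubst_def keys_hcomp
    by (subst sum.inter_filter[symmetric]) (auto simp: lookup_hcomp intro: sum.cong)
  then show ?thesis by (simp add: scaling_poly_def coeff_sum cong: if_cong sum.cong)
qed

lemma hcomp_hpoly: "F \<in> polys k \<Longrightarrow> hcomp t F \<in> hpoly k t"
  by (auto simp: hpoly_def keys_hcomp polys_def)

lemma hcomp_of_hpoly: "F \<in> hpoly k t \<Longrightarrow> hcomp s F = (if s = t then F else 0)"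
  by (intro poly_mapping_eqI) (auto simp: lookup_hcomp hpoly_def in_keys_iff)

lemma sum_hcomp: "\<exists>D. F = (\<Sum>t\<le>D. hcomp t F)"
proof -
  define D where "D = Max (insert 0 (monom_deg ` Poly_Mapping.keys F))"
  have "monom_deg m \<le> D" if "m \<in> Poly_Mapping.keys F" for m
    using that by (simp add: D_def)
  then have "F = (\<Sum>t\<le>D. hcomp t F)"
    by (intro poly_mapping_eqI) (auto simp: lookup_sum lookup_hcomp in_keys_iff sum.delta)
  then show ?thesis ..
qed

lemma hcomp_eq_0D: "(\<And>t. hcomp t F = 0) \<Longrightarrow> F = 0"
  using sum_hcomp[of F] by simp

lemma hpoly_polys: "F \<in> hpoly k t \<Longrightarrow> F \<in> polys k"
  by (simp add: hpoly_def)

lemma peval_hpoly_scale: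
  "F \<in> hpoly k t \<Longrightarrow> peval F (\<lambda>i. s * a i) = s ^ t * peval F a"
  unfolding peval_eq_msubst msubst_def hpoly_def
  by (auto simp: monom_eval_scale sum_distrib_left mult_ac intro!: sum.cong)

text \<open>If \<open>F\<close> scales with weight \<open>t\<close> at every point, each
  \<open>scaling_poly F a\<close> is a monomial of degree \<open>t\<close>, hence the other
  components vanish everywhere.\<close>

lemma hpI:
  fixes F :: "'k::field_char_0 mpoly"
  assumes "F \<in> polys k" "\<And>s a. peval F (\<lambda>i. s * a i) = s ^ t * peval F a"
  shows "F \<in> hpoly k t"
proof -
  have "scaling_poly F a = monom (peval F a) t" for a
    using assms(2) by (intro poly_ext) (simp add: poly_scaling_poly poly_monom)
  then have "peval (hcomp s F) a = (if s = t then peval F a else 0)" for s a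
    unfolding coeff_scaling_poly[symmetric] by simp
  then have "hcomp t F = F" by (intro peval_inj) simp
  with hcomp_hpoly[OF assms(1), of t] show ?thesis by simp
qed

lemma hpoly_0 [simp]: "0 \<in> hpoly k t"
  by (simp add: hpoly_def)

lemma hpoly_add: "F \<in> hpoly k t \<Longrightarrow> G \<in> hpoly k t \<Longrightarrow> F + G \<in> hpoly k t"
  using Poly_Mapping.keys_add[of F G] by (auto simp: hpoly_def polys_add)

lemma hpoly_uminus: "F \<in> hpoly k t \<Longrightarrow> - F \<in> hpoly k t"
  by (auto simp: hpoly_def polys_uminus in_keys_iff)

lemma hpoly_diff: "F \<in> hpoly k t \<Longrightarrow> G \<in> hpoly k t \<Longrightarrow> F - G \<in> hpoly k t"
  using hpoly_add[of F k t "- G"] hpoly_uminus[of G k t] by simp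

lemma hpoly_sum: "(\<And>i. i \<in> S \<Longrightarrow> h i \<in> hpoly k t) \<Longrightarrow> (\<Sum>i\<in>S. h i) \<in> hpoly k t"
  by (induction S rule: infinite_finite_induct) (simp_all add: hpoly_add)

lemma hpoly_mult: "F \<in> hpoly k s \<Longrightarrow> G \<in> hpoly k t \<Longrightarrow> F * G \<in> hpoly k (s + t)"
proof -
  assume a: "F \<in> hpoly k s" "G \<in> hpoly k t"
  { fix m assume "m \<in> Poly_Mapping.keys (F * G)"
    then obtain p q where "m = p + q" "p \<in> Poly_Mapping.keys F" "q \<in> Poly_Mapping.keys G"
      using keys_mult[of F G] by auto
    with a have "monom_deg m = s + t" by (simp add: hpoly_def monom_deg_add) }
  with a show ?thesis by (simp add: hpoly_def polys_mult)
qed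

lemma hpoly_Cst [simp]: "Cst c \<in> hpoly k 0"
  by (auto simp: hpoly_def Cst_def polys_def monom_deg_def split: if_splits)

lemma hpoly_1 [simp]: "1 \<in> hpoly k 0"
  using hpoly_Cst[of 1 k] by simp

lemma hpoly_X [simp]: "i < k \<Longrightarrow> X i \<in> hpoly k 1"
  by (auto simp: hpoly_def X_def polys_def split: if_splits)

lemma hpoly_power: "F \<in> hpoly k s \<Longrightarrow> F ^ n \<in> hpoly k (n * s)"
  by (induction n) (simp_all add: hpoly_mult)

lemma hpoly_mono: "F \<in> hpoly k t \<Longrightarrow> k \<le> l \<Longrightarrow> F \<in> hpoly l t"
  using polys_mono by (auto simp: hpoly_def)

lemma hcomp_mult_hpoly:
  fixes F G :: "'k::field_char_0 mpoly"
  assumes "G \<in> hpoly k s" shows "hcomp (t + s) (G * F) = G * hcomp t F"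
proof (rule peval_inj)
  fix a
  have "scaling_poly (G * F) a = monom (peval G a) s * scaling_poly F a"
    by (rule poly_ext) (simp add: poly_scaling_poly poly_monom peval.mult peval_hpoly_scale[OF assms])
  then have "peval (hcomp (t + s) (G * F)) a = coeff (monom (peval G a) s * scaling_poly F a) (t + s)"
    by (metis coeff_scaling_poly)
  then show "peval (hcomp (t + s) (G * F)) a = peval (G * hcomp t F) a"
    by (simp add: coeff_monom_mult coeff_scaling_poly peval.mult)
qed

lemma pscale_eq: "pscale c F = Cst c * F"
  by (simp add: pscale_def Cst_def)

lemma hpoly_pscale: "F \<in> hpoly k t \<Longrightarrow> pscale c F \<in> hpoly k t"
  using hpoly_mult[of "Cst c" k 0 F t] by (simp add: pscale_eq)



section \<open>Finite-dimensional spaces of polynomials\<close>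

text \<open>\<open>mpoly.dim\<close> is informative only in finite dimension, so finiteness is
  bundled with being a subspace.\<close>

definition fin_dim :: "'k::field mpoly set \<Rightarrow> bool" where
  "fin_dim U \<longleftrightarrow> mpoly.subspace U \<and> (\<exists>B. finite B \<and> U \<subseteq> mpoly.span B)"

lemma fin_dim_subspace: "fin_dim U \<Longrightarrow> mpoly.subspace U"
  by (simp add: fin_dim_def)

lemma fin_dim_subset: "fin_dim W \<Longrightarrow> mpoly.subspace U \<Longrightarrow> U \<subseteq> W \<Longrightarrow> fin_dim U"
  unfolding fin_dim_def by blast

lemma fin_dim_independent_finite: "fin_dim U \<Longrightarrow> mpoly.independent B \<Longrightarrow> B \<subseteq> U \<Longrightarrow> finite B"
  unfolding fin_dim_def using mpoly.independent_span_bound by (meson order_trans)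

lemma fin_dim_extend_basis:
  assumes "fin_dim U" "mpoly.independent B" "B \<subseteq> U"
  obtains C where "B \<subseteq> C" "C \<subseteq> U" "mpoly.independent C" "finite C" "mpoly.span C = U" "card C = mpoly.dim U"
proof -
  obtain C where C: "B \<subseteq> C" "C \<subseteq> U" "mpoly.independent C" "U \<subseteq> mpoly.span C"
    using mpoly.maximal_independent_subset_extend[OF assms(3,2)] by blast
  moreover have "mpoly.span C \<subseteq> U"
    using C assms(1) by (intro mpoly.span_minimal) (auto simp: fin_dim_def)
  moreover have "card C = mpoly.dim U"
    by (rule mpoly.basis_card_eq_dim) (use C in auto)
  ultimately show thesis
    using that fin_dim_independent_finite[OF assms(1)] by blast
qed

lemma fin_dim_basis:
  assumes "fin_dim U"
  obtains C where "C \<subseteq> U" "mpoly.independent C" "finite C" "mpoly.span C = U" "card C = mpoly.dim U"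
  by (rule fin_dim_extend_basis[OF assms mpoly.independent_empty empty_subsetI]) (rule that)

lemma fin_dim_span: "finite B \<Longrightarrow> fin_dim (mpoly.span B)"
  unfolding fin_dim_def by auto

lemma fin_dim_dim_mono:
  assumes "fin_dim W" "U \<subseteq> W" shows "mpoly.dim U \<le> mpoly.dim W"
proof -
  obtain C where C: "finite C" "mpoly.span C = W" "card C = mpoly.dim W"
    by (rule fin_dim_basis[OF assms(1)])
  have "mpoly.dim U \<le> card C" by (rule mpoly.dim_le_card) (use C assms in auto)
  with C show ?thesis by simp
qed

lemma fin_dim_dim_strict_mono:
  assumes "fin_dim W" "mpoly.subspace U" "U \<subset> W" shows "mpoly.dim U < mpoly.dim W"
proof -
  have U: "fin_dim U" using fin_dim_subset[OF assms(1,2)] assms(3) by blast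
  obtain C where C: "C \<subseteq> U" "mpoly.independent C" "finite C" "mpoly.span C = U" "card C = mpoly.dim U"
    by (rule fin_dim_basis[OF U])
  obtain x where x: "x \<in> W" "x \<notin> U" using assms(3) by blast
  have "mpoly.independent (insert x C)"
    using C x by (intro mpoly.independent_insertI) auto
  then have "card (insert x C) = mpoly.dim (insert x C)"
    using mpoly.dim_eq_card_independent by metis
  also have "\<dots> \<le> mpoly.dim W"
    by (rule fin_dim_dim_mono[OF assms(1)]) (use C x assms in auto)
  finally have "card (insert x C) \<le> mpoly.dim W" .
  moreover have "x \<notin> C" using C(1) x by blast
  ultimately show ?thesis using C(3,5) by simp
qed

definition sum_space :: "'k::field mpoly set \<Rightarrow> 'k mpoly set \<Rightarrow> 'k mpoly set" where
  "sum_space U W = {x + y | x y. x \<in> U \<and> y \<in> W}"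

lemma span_Int_independent:
  assumes "mpoly.independent (B \<union> D)" "B \<inter> D = {}" "finite B" "finite D"
    and x: "x \<in> mpoly.span B" "x \<in> mpoly.span D"
  shows "x = 0"
proof -
  obtain f where f: "x = (\<Sum>v\<in>B. pscale (f v) v)"
    using x assms(3) by (auto simp: mpoly.span_finite)
  obtain g where g: "x = (\<Sum>v\<in>D. pscale (g v) v)"
    using x assms(4) by (auto simp: mpoly.span_finite)
  let ?u = "\<lambda>v. if v \<in> B then f v else - g v"
  have "(\<Sum>v\<in>B \<union> D. pscale (?u v) v) = (\<Sum>v\<in>B. pscale (?u v) v) + (\<Sum>v\<in>D. pscale (?u v) v)"
    using assms by (intro sum.union_disjoint) auto
  also have "(\<Sum>v\<in>B. pscale (?u v) v) = x" unfolding f by (rule sum.cong) auto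
  also have "(\<Sum>v\<in>D. pscale (?u v) v) = (\<Sum>v\<in>D. - pscale (g v) v)"
    using assms(2) by (intro sum.cong) auto
  also have "x + \<dots> = 0" unfolding g by (simp add: sum_negf)
  finally have s0: "(\<Sum>v\<in>B \<union> D. pscale (?u v) v) = 0" .
  have "f v = 0" if "v \<in> B" for v
    using mpoly.independentD[OF assms(1) _ order_refl s0, of v] that assms(3,4) by simp
  then show ?thesis unfolding f by simp
qed

text \<open>Grassmann's formula: a basis \<open>B\<close> of the intersection is extended to bases
  \<open>C\<close> of \<open>U\<close> and \<open>D\<close> of \<open>W\<close>, and
  \<open>C\<close> together with \<open>D - B\<close> is a basis of the sum.\<close>

lemma fin_dim_dim_sum_space:
  assumes U: "fin_dim U" and W: "fin_dim W"
  shows "fin_dim (sum_space U W)" "mpoly.dim (sum_space U W) + mpoly.dim (U \<inter> W) = mpoly.dim U + mpoly.dim W"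
proof -
  have sub: "mpoly.subspace (U \<inter> W)"
    using U W mpoly.subspace_inter by (auto simp: fin_dim_def)
  have UW: "fin_dim (U \<inter> W)" using fin_dim_subset[OF U sub] by blast
  obtain B where B: "B \<subseteq> U \<inter> W" "mpoly.independent B" "finite B" "mpoly.span B = U \<inter> W" "card B = mpoly.dim (U \<inter> W)"
    by (rule fin_dim_basis[OF UW])
  obtain C where C: "B \<subseteq> C" "C \<subseteq> U" "mpoly.independent C" "finite C" "mpoly.span C = U" "card C = mpoly.dim U"
    by (rule fin_dim_extend_basis[OF U B(2)]) (use B in auto)
  obtain D where D: "B \<subseteq> D" "D \<subseteq> W" "mpoly.independent D" "finite D" "mpoly.span D = W" "card D = mpoly.dim W"
    by (rule fin_dim_extend_basis[OF W B(2)]) (use B in auto)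
  define E where "E = D - B"
  have DE: "D = B \<union> E" "B \<inter> E = {}" "finite E" using D by (auto simp: E_def)
  have indE: "mpoly.independent E"
    using D(3) DE mpoly.independent_mono by blast
  have CE0: "x = 0" if "x \<in> mpoly.span C" "x \<in> mpoly.span E" for x
  proof -
    have "x \<in> W" using that(2) mpoly.span_mono[of E D] DE D by blast
    then have "x \<in> mpoly.span B" using that C B by auto
    then show ?thesis
      using span_Int_independent[of B E x] that D DE B by auto
  qed
  have disj: "C \<inter> E = {}"
  proof (rule ccontr)
    assume "C \<inter> E \<noteq> {}"
    then obtain x where x: "x \<in> C" "x \<in> E" by blast
    then have "x = 0" using CE0 mpoly.span_base by blast
    with x C(3) show False using mpoly.dependent_zero by blast
  qed
  have ind: "mpoly.independent (C \<union> E)"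
  proof (rule mpoly.independent_if_scalars_zero)
    show "finite (C \<union> E)" using C DE by simp
    fix f x assume s: "(\<Sum>x\<in>C \<union> E. pscale (f x) x) = 0" and x: "x \<in> C \<union> E"
    have s2: "(\<Sum>x\<in>C. pscale (f x) x) + (\<Sum>x\<in>E. pscale (f x) x) = 0"
      using s disj C DE by (simp add: sum.union_disjoint)
    have cC: "(\<Sum>x\<in>C. pscale (f x) x) \<in> mpoly.span C"
      by (intro mpoly.span_sum mpoly.span_scale mpoly.span_base)
    have eE: "(\<Sum>x\<in>E. pscale (f x) x) \<in> mpoly.span E"
      by (intro mpoly.span_sum mpoly.span_scale mpoly.span_base)
    have "(\<Sum>x\<in>C. pscale (f x) x) = - (\<Sum>x\<in>E. pscale (f x) x)"
      using s2 by (simp add: eq_neg_iff_add_eq_0)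
    then have "(\<Sum>x\<in>C. pscale (f x) x) \<in> mpoly.span E"
      using mpoly.span_neg[OF eE] by simp
    from CE0[OF cC this] have c0: "(\<Sum>x\<in>C. pscale (f x) x) = 0" .
    with s2 have e0: "(\<Sum>x\<in>E. pscale (f x) x) = 0" by simp
    show "f x = 0"
      using x mpoly.independentD[OF C(3) C(4) order_refl c0] mpoly.independentD[OF indE DE(3) order_refl e0]
      by auto
  qed
  have sum_sub: "mpoly.subspace (sum_space U W)"
    unfolding sum_space_def using U W by (intro mpoly.subspace_sums) (auto simp: fin_dim_def)
  have spanning: "sum_space U W \<subseteq> mpoly.span (C \<union> E)"
  proof
    fix z assume "z \<in> sum_space U W"
    then obtain x y where xy: "z = x + y" "x \<in> U" "y \<in> W" by (auto simp: sum_space_def)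
    have "x \<in> mpoly.span (C \<union> E)" using xy C mpoly.span_mono[of C "C \<union> E"] by blast
    moreover have "y \<in> mpoly.span (C \<union> E)" using xy D DE C mpoly.span_mono[of D "C \<union> E"] by blast
    ultimately show "z \<in> mpoly.span (C \<union> E)" unfolding xy by (rule mpoly.span_add)
  qed
  have 0: "0 \<in> U" "0 \<in> W" using U W mpoly.subspace_0 by (auto simp: fin_dim_def)
  have sub2: "C \<union> E \<subseteq> sum_space U W"
  proof
    fix x assume "x \<in> C \<union> E"
    then have "x \<in> U \<or> x \<in> W" using C D DE by blast
    then show "x \<in> sum_space U W" 
      unfolding sum_space_def using 0 add_0_right[of x] add_0_left[of x] by (smt (verit, best) mem_Collect_eq)
  qed
  show "fin_dim (sum_space U W)" using sum_sub spanning C DE by (auto simp: fin_dim_def)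
  have "card (C \<union> E) = mpoly.dim (sum_space U W)"
    by (rule mpoly.basis_card_eq_dim[OF sub2 spanning ind])
  moreover have "card (C \<union> E) = card C + card E" using disj C DE by (simp add: card_Un_disjoint)
  moreover have "card D = card B + card E" using DE B by (simp add: card_Un_disjoint)
  ultimately show "mpoly.dim (sum_space U W) + mpoly.dim (U \<inter> W) = mpoly.dim U + mpoly.dim W"
    using B C D by simp
qed

lemma sum_space_subset: "mpoly.subspace W \<Longrightarrow> U \<subseteq> W \<Longrightarrow> U' \<subseteq> W \<Longrightarrow> sum_space U U' \<subseteq> W"
  unfolding sum_space_def using mpoly.subspace_add by blast

lemma fin_dim_dim_image:
  assumes U: "fin_dim U" and add: "\<And>a b. \<phi> (a + b) = \<phi> a + \<phi> b" and sc: "\<And>c a. \<phi> (pscale c a) = pscale c (\<phi> a)"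
    and inj: "\<And>a. a \<in> U \<Longrightarrow> \<phi> a = 0 \<Longrightarrow> a = 0"
  shows "fin_dim (\<phi> ` U)" "mpoly.dim (\<phi> ` U) = mpoly.dim U"
proof -
  have phi0: "\<phi> 0 = 0" using sc[of 0 0] by simp
  have phisum: "\<phi> (\<Sum>i\<in>S. h i) = (\<Sum>i\<in>S. \<phi> (h i))" for S and h :: "'b \<Rightarrow> 'a mpoly"
    by (induction S rule: infinite_finite_induct) (simp_all add: add phi0)
  have phid: "\<phi> (a - b) = \<phi> a - \<phi> b" for a b
    using add[of "a - b" b] by (simp add: algebra_simps)
  have subU: "mpoly.subspace U" using U by (simp add: fin_dim_def)
  have injU: "inj_on \<phi> U"
    by (rule inj_onI) (metis inj phid right_minus_eq mpoly.subspace_diff[OF subU])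
  obtain C where C: "C \<subseteq> U" "mpoly.independent C" "finite C" "mpoly.span C = U" "card C = mpoly.dim U"
    by (rule fin_dim_basis[OF U])
  have phisum': "\<phi> (\<Sum>i\<in>C. h i) = (\<Sum>i\<in>C. \<phi> (h i))" for h
    using C(3) by (induction C rule: finite_induct) (simp_all add: add phi0)
  have sub: "mpoly.subspace (\<phi> ` U)"
    unfolding mpoly.subspace_def
  proof (intro conjI ballI allI)
    show "0 \<in> \<phi> ` U" using mpoly.subspace_0[OF subU] phi0 by force
  next
    fix x y assume "x \<in> \<phi> ` U" "y \<in> \<phi> ` U"
    then obtain u v where "x = \<phi> u" "y = \<phi> v" "u \<in> U" "v \<in> U" by blast
    then show "x + y \<in> \<phi> ` U" using mpoly.subspace_add[OF subU] by (auto simp flip: add)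
  next
    fix c x assume "x \<in> \<phi> ` U"
    then obtain u where "x = \<phi> u" "u \<in> U" by blast
    then show "pscale c x \<in> \<phi> ` U" using mpoly.subspace_scale[OF subU] by (auto simp flip: sc)
  qed
  have scaling_poly: "\<phi> ` U \<subseteq> mpoly.span (\<phi> ` C)"
  proof
    fix y assume "y \<in> \<phi> ` U"
    then obtain x where x: "y = \<phi> x" "x \<in> mpoly.span C" using C by blast
    then obtain f where "x = (\<Sum>v\<in>C. pscale (f v) v)" using C(3) by (auto simp: mpoly.span_finite)
    then have "y = (\<Sum>v\<in>C. pscale (f v) (\<phi> v))" using x by (simp add: phisum' sc)
    then show "y \<in> mpoly.span (\<phi> ` C)"
      by (simp only:) (intro mpoly.span_sum mpoly.span_scale mpoly.span_base imageI)
  qed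
  have injC: "inj_on \<phi> C" using injU C(1) inj_on_subset by blast
  have "mpoly.independent (\<phi> ` C)"
  proof (rule mpoly.independent_if_scalars_zero)
    show "finite (\<phi> ` C)" using C by simp
    fix f x assume s: "(\<Sum>x\<in>\<phi> ` C. pscale (f x) x) = 0" and x: "x \<in> \<phi> ` C"
    have "\<phi> (\<Sum>v\<in>C. pscale (f (\<phi> v)) v) = 0"
      using s injC by (simp add: phisum' sc sum.reindex)
    moreover have "(\<Sum>v\<in>C. pscale (f (\<phi> v)) v) \<in> U"
      using C by (intro mpoly.subspace_sum[OF subU] mpoly.subspace_scale[OF subU]) auto
    ultimately have "(\<Sum>v\<in>C. pscale (f (\<phi> v)) v) = 0" by (rule inj[rotated])
    from mpoly.independentD[OF C(2,3) order_refl this] x show "f x = 0" by blast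
  qed
  then have "card (\<phi> ` C) = mpoly.dim (\<phi> ` U)"
    using mpoly.basis_card_eq_dim[of "\<phi> ` C" "\<phi> ` U"] scaling_poly C(1) by blast
  then show "mpoly.dim (\<phi> ` U) = mpoly.dim U" using C injC by (simp add: card_image)
  show "fin_dim (\<phi> ` U)" using sub scaling_poly C by (auto simp: fin_dim_def)
qed

lemma fin_dim_dim_mult:
  fixes f :: "'k::field_char_0 mpoly"
  assumes "fin_dim U" "f \<noteq> 0" shows "fin_dim ((*) f ` U)" "mpoly.dim ((*) f ` U) = mpoly.dim U"
  using fin_dim_dim_image[of U "(*) f"] assms by (simp_all add: distrib_left pscale_eq mult_ac)

subsection \<open>Forms of given degree\<close>

definition mons :: "nat \<Rightarrow> nat \<Rightarrow> (nat \<Rightarrow>\<^sub>0 nat) set" where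
  "mons k t = {m. Poly_Mapping.keys m \<subseteq> {..<k} \<and> monom_deg m = t}"

text \<open>Stars and bars: listing the exponents identifies these monomials with the lists of
  length \<open>Suc k\<close> and sum \<open>t\<close>.\<close>

lemma card_mons: "finite (mons (Suc k) t) \<and> card (mons (Suc k) t) = (t + k) choose k"
proof -
  let ?L = "{l::nat list. size l = Suc k \<and> sum_list l = t}"
  let ?f = "\<lambda>m::nat \<Rightarrow>\<^sub>0 nat. map (Poly_Mapping.lookup m) [0..<Suc k]"
  have inj: "inj_on ?f (mons (Suc k) t)"
    proof (rule inj_onI)
      fix m m' assume a: "m \<in> mons (Suc k) t" "m' \<in> mons (Suc k) t" "?f m = ?f m'"
      have "Poly_Mapping.lookup m i = Poly_Mapping.lookup m' i" for i
      proof (cases "i < Suc k")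
        case True
        then show ?thesis using a(3) unfolding map_eq_conv by (metis atLeast0LessThan lessThan_iff set_upt)
      next
        case False
        then have "i \<notin> Poly_Mapping.keys m" "i \<notin> Poly_Mapping.keys m'"
          using a(1,2) unfolding mons_def by auto
        then show ?thesis by (simp add: in_keys_iff)
      qed
      then show "m = m'" by (rule poly_mapping_eqI)
    qed
  have im: "?f ` mons (Suc k) t = ?L"
  proof (intro subset_antisym subsetI)
    fix l :: "nat list" assume "l \<in> ?f ` mons (Suc k) t"
    then obtain m where m: "m \<in> mons (Suc k) t" "l = ?f m" by blast
    have "sum_list l = (\<Sum>i<Suc k. Poly_Mapping.lookup m i)"
      unfolding m by (simp only: interv_sum_list_conv_sum_set_nat lessThan_atLeast0 set_upt)
    also have "\<dots> = monom_deg m"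
      using m by (intro monom_deg_superset[symmetric]) (auto simp: mons_def)
    finally show "l \<in> ?L" using m by (simp add: mons_def)
  next
    fix l :: "nat list" assume l: "l \<in> ?L"
    define m where "m = (\<Sum>i<Suc k. Poly_Mapping.single i (l ! i))"
    have lk: "Poly_Mapping.lookup m i = (if i < Suc k then l ! i else 0)" for i
      unfolding m_def by (simp only: lookup_sum lookup_single when_def) (simp add: sum.delta)
    have k: "Poly_Mapping.keys m \<subseteq> {..<Suc k}" by (auto simp: in_keys_iff lk split: if_splits)
    have "?f m = l" using l by (intro nth_equalityI) (auto simp: lk nth_append simp del: upt_Suc)
    moreover have "monom_deg m = (\<Sum>i<Suc k. l ! i)"
      using monom_deg_superset[OF _ k] by (simp add: lk)
    moreover have "(\<Sum>i<Suc k. l ! i) = t"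
      using l by (auto simp: sum_list_sum_nth atLeast0LessThan)
    ultimately show "l \<in> ?f ` mons (Suc k) t" using k by (force simp: mons_def)
  qed
  have bij: "bij_betw ?f (mons (Suc k) t) ?L" using inj im by (simp only: bij_betw_def)
  have cL: "card ?L = (t + k) choose k"
    using card_length_sum_list[of "Suc k" t] by (simp add: binomial_symmetric[of k "t + k"])
  have fL: "finite ?L"
    by (rule finite_subset[OF _ finite_lists_length_eq[of "{..t}" "Suc k"]])
       (auto intro: member_le_sum_list)
  show ?thesis using bij_betw_finite[OF bij] bij_betw_same_card[OF bij] fL cL by simp
qed

lemma hpoly_subspace: "mpoly.subspace (hpoly k t)"
  unfolding mpoly.subspace_def by (simp add: hpoly_add hpoly_pscale)

lemma single_pscale: "Poly_Mapping.single m c = pscale c (Poly_Mapping.single m 1)"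
  by (simp add: pscale_def mult_single)

lemma hpoly_eq_span: "(hpoly k t :: 'a::field mpoly set) = mpoly.span ((\<lambda>m. Poly_Mapping.single m 1) ` mons k t)"
  (is "?H = ?R")
proof
  show "?H \<subseteq> ?R"
  proof
    fix F :: "'a mpoly" assume F: "F \<in> hpoly k t"
    have e: "F = (\<Sum>m\<in>Poly_Mapping.keys F. pscale (Poly_Mapping.lookup F m) (Poly_Mapping.single m 1))"
      using sum_singles[of F] by (simp only: single_pscale[symmetric])
    have "(\<Sum>m\<in>Poly_Mapping.keys F. pscale (Poly_Mapping.lookup F m) (Poly_Mapping.single m 1)) \<in> ?R"
      using F by (intro mpoly.span_sum mpoly.span_scale mpoly.span_base) (auto simp: hpoly_def polys_def mons_def)
    then show "F \<in> ?R"
      by (subst e)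
  qed
  show "?R \<subseteq> ?H"
    by (rule mpoly.span_minimal[OF _ hpoly_subspace]) (auto simp: hpoly_def polys_def mons_def)
qed

lemma independent_monomials:
  assumes "finite M"
  shows "mpoly.independent ((\<lambda>m. Poly_Mapping.single m (1::'k::field)) ` M)"
proof (rule mpoly.independent_if_scalars_zero)
  let ?s = "\<lambda>m::nat \<Rightarrow>\<^sub>0 nat. Poly_Mapping.single m (1::'k)"
  have inj: "inj_on ?s M" by (rule inj_onI) (metis keys_single singleton_inject one_neq_zero)
  show "finite (?s ` M)" using assms by simp
  fix f x assume s: "(\<Sum>x\<in>?s ` M. pscale (f x) x) = 0" and x: "x \<in> ?s ` M"
  then obtain m where m: "x = ?s m" "m \<in> M" by blast
  have "(\<Sum>m\<in>M. Poly_Mapping.single m (f (?s m))) = 0"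
    using s inj by (simp add: sum.reindex single_pscale[symmetric])
  then have "Poly_Mapping.lookup (\<Sum>m\<in>M. Poly_Mapping.single m (f (?s m))) m = 0" by simp
  then show "f x = 0" using m assms by (simp add: lookup_sum lookup_single when_def sum.delta)
qed

lemma fin_dim_hpoly: "fin_dim (hpoly (Suc k) t)"
  unfolding hpoly_eq_span using card_mons by (intro fin_dim_span) blast

lemma dim_hpoly: "mpoly.dim (hpoly (Suc k) t :: 'k::field mpoly set) = (t + k) choose k"
proof -
  let ?s = "\<lambda>m::nat \<Rightarrow>\<^sub>0 nat. Poly_Mapping.single m (1::'k)"
  have inj: "inj_on ?s (mons (Suc k) t)" by (rule inj_onI) (metis keys_single singleton_inject one_neq_zero)
  have "mpoly.dim (hpoly (Suc k) t :: 'k mpoly set) = card (?s ` mons (Suc k) t)"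
    unfolding hpoly_eq_span
    by (rule mpoly.dim_span_eq_card_independent[OF independent_monomials]) (use card_mons in blast)
  also have "\<dots> = (t + k) choose k" using card_mons inj by (simp add: card_image)
  finally show ?thesis .
qed

lemma fin_dim_hp': "k > 0 \<Longrightarrow> fin_dim (hpoly k t)"
  using fin_dim_hpoly[of "k - 1" t] by simp



section \<open>Ideals of univariate polynomials\<close>

text \<open>Gaussian elimination from the top degree. Cross-multiplication with the last row cancels
  the coefficients of degree \<open>Suc k\<close>; since \<open>e\<close> kills that coefficient in
  every other row, the image of each other row under \<open>e\<close> is only scaled by a nonzero
  factor, and the triangular shape persists until a constant remains.\<close>

lemma triangular_elimination:
  fixes J :: "'a::comm_ring_1 poly set" and e :: "'a \<Rightarrow> 'b::idom"
  assumes "rhom e" and add: "\<And>p q. p \<in> J \<Longrightarrow> q \<in> J \<Longrightarrow> p - q \<in> J" and mult: "\<And>r p. p \<in> J \<Longrightarrow> r * p \<in> J"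
  shows "(\<And>i. i \<le> k \<Longrightarrow> p i \<in> J \<and> degree (p i) \<le> k \<and> (\<forall>j>i. e (coeff (p i) j) = 0) \<and> e (coeff (p i) i) \<noteq> 0)
    \<Longrightarrow> \<exists>g. [:g:] \<in> J \<and> e g \<noteq> 0"
proof (induction k arbitrary: p)
  case 0
  then have "p 0 \<in> J" "degree (p 0) = 0" "e (coeff (p 0) 0) \<noteq> 0" by auto
  moreover from this(2) obtain c where "p 0 = [:c:]" by (rule degree_eq_zeroE)
  ultimately show ?case by auto
next
  case (Suc k)
  interpret e: rhom e by fact
  let ?l = "coeff (p (Suc k)) (Suc k)"
  define p' where "p' i = smult ?l (p i) - smult (coeff (p i) (Suc k)) (p (Suc k))" for i
  have l: "e ?l \<noteq> 0" using Suc.prems[of "Suc k"] by simp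
  show ?case
  proof (rule Suc.IH[of p'])
    fix i assume i: "i \<le> k"
    have "p' i = [:?l:] * p i - [:coeff (p i) (Suc k):] * p (Suc k)" by (simp add: p'_def)
    moreover have "[:?l:] * p i - [:coeff (p i) (Suc k):] * p (Suc k) \<in> J"
      by (intro add mult) (use Suc.prems i in auto)
    ultimately have "p' i \<in> J" by metis
    moreover have "degree (p' i) \<le> k"
    proof (rule degree_le, intro allI impI)
      fix j assume "k < j"
      then consider "j = Suc k" | "j > Suc k" by linarith
      then show "coeff (p' i) j = 0"
      proof cases
        case 2
        then have "coeff (p i) j = 0" "coeff (p (Suc k)) j = 0"
          using Suc.prems[of i] Suc.prems[of "Suc k"] i by (auto intro!: coeff_eq_0)
        then show ?thesis by (simp add: p'_def)
      qed (simp add: p'_def mult.commute)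
    qed
    moreover have "e (coeff (p' i) j) = 0" if "j > i" for j
      using Suc.prems[of i] i that by (simp add: p'_def e.diff e.mult)
    moreover have "e (coeff (p' i) i) \<noteq> 0"
      using Suc.prems[of i] i l by (simp add: p'_def e.diff e.mult)
    ultimately show "p' i \<in> J \<and> degree (p' i) \<le> k \<and> (\<forall>j>i. e (coeff (p' i) j) = 0) \<and> e (coeff (p' i) i) \<noteq> 0"
      by blast
  qed
qed

text \<open>The rows of the Sylvester matrix of \<open>f1\<close> and \<open>f0\<close> become triangular under \<open>e\<close>, so that
  elimination of the variable amounts to computing the resultant.\<close>

lemma resultant_elimination:
  fixes J :: "'a::comm_ring_1 poly set" and e :: "'a \<Rightarrow> 'b::idom"
  assumes e: "rhom e" and add: "\<And>p q. p \<in> J \<Longrightarrow> q \<in> J \<Longrightarrow> p - q \<in> J" and mult: "\<And>r p. p \<in> J \<Longrightarrow> r * p \<in> J"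
    and f0: "f0 \<in> J" "e (lead_coeff f0) \<noteq> 0"
    and f1: "f1 \<in> J" "e (coeff f1 0) \<noteq> 0" "\<And>j. j > 0 \<Longrightarrow> e (coeff f1 j) = 0"
  shows "\<exists>g. [:g:] \<in> J \<and> e g \<noteq> 0"
proof -
  interpret e: rhom e by fact
  define N where "N = degree f0"
  define M where "M = degree f1"
  show ?thesis
  proof (cases "N + M = 0")
    case True
    then obtain c where "f1 = [:c:]" using degree_eq_zeroE[of f1] by (auto simp: M_def)
    then show ?thesis using f1 by auto
  next
    case False
    \<comment> \<open>Under \<open>e\<close> the polynomial \<open>f1\<close> becomes a nonzero
      constant, so its \<open>i\<close>-th shift has its diagonal entry in degree \<open>i\<close>.
      The shift of \<open>f0\<close> by \<open>i - N\<close> has its leading term in degree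
      \<open>i\<close>, since \<open>N\<close> is the degree of \<open>f0\<close>.\<close>
    let ?p = "\<lambda>i. if i < N then monom 1 i * f1 else monom 1 (i - N) * f0"
    show ?thesis
    proof (rule triangular_elimination[OF e add mult, where k = "N + M - 1" and p = ?p])
      fix i assume i: "i \<le> N + M - 1"
      show "?p i \<in> J \<and> degree (?p i) \<le> N + M - 1 \<and> (\<forall>j>i. e (coeff (?p i) j) = 0) \<and> e (coeff (?p i) i) \<noteq> 0"
      proof (cases "i < N")
        case True
        have "degree (monom 1 i * f1) \<le> i + M"
          using degree_mult_le[of "monom 1 i" f1] degree_monom_le[of "1::'a" i] by (simp add: M_def)
        then show ?thesis using True False f1 mult by (auto simp: coeff_monom_mult)
      next
        case False
        have "degree (monom 1 (i - N) * f0) \<le> i"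
          using degree_mult_le[of "monom 1 (i - N)" f0] degree_monom_le[of "1::'a" "i - N"] False by (simp add: N_def)
        moreover have "coeff f0 (j - (i - N)) = 0" if "j > i" for j
          by (rule coeff_eq_0) (use that False in \<open>simp add: N_def\<close>)
        ultimately show ?thesis using False i f0 mult by (auto simp: coeff_monom_mult N_def)
      qed
    qed
  qed
qed

text \<open>Such a \<open>J\<close> behaves like a radical ideal over the fraction field of
  \<open>'a\<close>, where it would be principal. Torsion-freeness allows clearing denominators, so
  everything can be phrased over \<open>'a\<close> itself with pseudo-division.\<close>

locale tf_radical_ideal =
  fixes J :: "'a::idom poly set"
  assumes zero: "0 \<in> J" and add: "p \<in> J \<Longrightarrow> q \<in> J \<Longrightarrow> p + q \<in> J" and mult: "p \<in> J \<Longrightarrow> r * p \<in> J"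
    and tf: "smult c p \<in> J \<Longrightarrow> c \<noteq> 0 \<Longrightarrow> p \<in> J" and rad: "p ^ n \<in> J \<Longrightarrow> p \<in> J"
    and one: "1 \<notin> J" and nz: "\<exists>p\<in>J. p \<noteq> 0"
begin

lemma uminus: "p \<in> J \<Longrightarrow> - p \<in> J"
  using mult[of p "-1"] by simp

lemma diff: "p \<in> J \<Longrightarrow> q \<in> J \<Longrightarrow> p - q \<in> J"
  using add[of p "-q"] uminus by simp

lemma smult_in: "p \<in> J \<Longrightarrow> smult c p \<in> J"
  using mult[of p "[:c:]"] by simp

lemma const: "[:c:] \<in> J \<Longrightarrow> c = 0"
  using tf[of c 1] one by (auto simp: smult_pCons one_pCons)

definition is_min where
  "is_min G \<longleftrightarrow> G \<in> J \<and> G \<noteq> 0 \<and> (\<forall>H\<in>J. H \<noteq> 0 \<longrightarrow> degree G \<le> degree H)"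

lemma ex_min: "\<exists>G. is_min G"
proof -
  define G where "G = arg_min degree (\<lambda>p. p \<in> J \<and> p \<noteq> 0)"
  obtain p where "p \<in> J \<and> p \<noteq> 0" using nz by blast
  then have "is_min G" unfolding is_min_def G_def
    using arg_min_nat_lemma[of "\<lambda>p. p \<in> J \<and> p \<noteq> 0" p degree] by blast
  then show ?thesis ..
qed

lemma is_minD: "is_min G \<Longrightarrow> G \<in> J" "is_min G \<Longrightarrow> G \<noteq> 0" "is_min G \<Longrightarrow> H \<in> J \<Longrightarrow> degree H < degree G \<Longrightarrow> H = 0"
  unfolding is_min_def by (auto simp: not_less[symmetric])

lemma is_min_degree: "is_min G \<Longrightarrow> degree G > 0"
proof (rule ccontr)
  assume G: "is_min G" and "\<not> degree G > 0"
  then obtain c where c: "G = [:c:]" using degree_eq_zeroE[of G] by auto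
  with G show False using const[of c] by (auto simp: is_min_def)
qed

lemma is_min_dvd:
  assumes "is_min G" "H \<in> J" shows "\<exists>c q. c \<noteq> 0 \<and> smult c H = G * q"
proof -
  obtain a q where aq: "a \<noteq> 0" "smult a H = G * q + pseudo_mod H G"
    using pseudo_mod(1)[of G H] assms(1) by (auto simp: is_min_def)
  have "pseudo_mod H G = smult a H - q * G" using aq by (simp add: mult.commute)
  then have "pseudo_mod H G \<in> J" using assms diff mult smult_in by (simp add: is_min_def)
  moreover have "pseudo_mod H G = 0 \<or> degree (pseudo_mod H G) < degree G"
    using pseudo_mod(2)[of G H] assms(1) by (auto simp: is_min_def)
  ultimately have "pseudo_mod H G = 0" using is_minD(3)[OF assms(1)] by blast
  with aq show ?thesis by auto
qed

text \<open>Over the fraction field, \<open>G\<close> is squarefree because \<open>J\<close> is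
  radical, hence in characteristic 0 coprime to its derivative. Factorisation is avoided by showing
  inductively that \<open>g ^ k\<close> times the \<open>k\<close>-th derivative of \<open>G\<close>
  lies in \<open>J\<close>: differentiate the previous member of the sequence, multiply by
  \<open>g\<close>, and use that \<open>g * pderiv G\<close> lies in \<open>J\<close>. At
  \<open>k = degree G\<close> the derivative is a nonzero constant, and torsion-freeness and
  radicality finish.\<close>

lemma is_min_pderiv:
  assumes G: "is_min G" and ch: "inj (of_nat :: nat \<Rightarrow> 'a)" and g: "g * pderiv G \<in> J"
  shows "g \<in> J"
proof -
  have of_nat0: "of_nat n = (0::'a) \<longleftrightarrow> n = 0" for n
    using injD[OF ch, of n 0] by auto
  have deg: "degree (pderiv p) = degree p - 1 \<and> (degree p > 0 \<longrightarrow> pderiv p \<noteq> 0)" for p :: "'a poly"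
  proof (cases "degree p = 0")
    case True
    then obtain c where "p = [:c:]" by (rule degree_eq_zeroE)
    then show ?thesis by (simp add: pderiv_pCons)
  next
    case False
    have "coeff (pderiv p) (degree p - 1) = of_nat (degree p) * lead_coeff p"
      using False by (simp add: coeff_pderiv)
    also have "\<dots> \<noteq> 0"
    proof -
      have "p \<noteq> 0" using False by auto
      then show ?thesis using of_nat0[of "degree p"] False by (simp del: of_nat_eq_0_iff)
    qed
    finally have nz: "coeff (pderiv p) (degree p - 1) \<noteq> 0" .
    moreover have "degree (pderiv p) \<le> degree p - 1"
      by (rule degree_le) (auto simp: coeff_pderiv coeff_eq_0)
    ultimately show ?thesis using le_degree[OF nz] by auto
  qed
  define d where "d k = (pderiv ^^ k) G" for k
  have d: "d k \<noteq> 0 \<and> degree (d k) = degree G - k" if "k \<le> degree G" for k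
    using that
  proof (induction k)
    case 0 then show ?case using G by (simp add: d_def is_min_def)
  next
    case (Suc k)
    then have "degree (d k) > 0" "degree (d k) = degree G - k" by simp_all
    moreover have "d (Suc k) = pderiv (d k)" by (simp add: d_def)
    ultimately show ?case using deg[of "d k"] by simp
  qed
  have J: "g ^ k * d k \<in> J" for k
  proof (induction k)
    case 0 then show ?case using G by (simp add: d_def is_min_def)
  next
    case (Suc k)
    define H where "H = g ^ k * d k"
    have HJ: "H \<in> J" using Suc by (simp only: H_def)
    obtain c q where cq: "c \<noteq> 0" "smult c H = G * q"
      using is_min_dvd[OF G, of H] Suc by (auto simp: H_def)
    have "smult c (pderiv H) = pderiv (G * q)" by (simp add: pderiv_smult flip: cq(2))
    then have "smult c (g * pderiv H) = q * (g * pderiv G) + (g * pderiv q) * G"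
      by (simp add: pderiv_mult algebra_simps flip: mult_smult_right)
    then have "smult c (g * pderiv H) \<in> J" using add mult g is_minD(1)[OF G] by simp
    then have gH: "g * pderiv H \<in> J" using tf cq by blast
    have dS: "d (Suc k) = pderiv (d k)" by (simp add: d_def)
    have dg: "g * pderiv (g ^ k) = of_nat k * (g ^ k * pderiv g)"
    proof (cases k)
      case (Suc l)
      have "pderiv (g ^ k) = of_nat k * (g ^ l * pderiv g)"
        unfolding Suc pderiv_power_Suc by (simp add: of_nat_poly)
      then show ?thesis by (simp add: Suc)
    qed simp
    have "g * pderiv H = (g * pderiv (g ^ k)) * d k + g ^ Suc k * pderiv (d k)"
      by (simp add: H_def pderiv_mult algebra_simps)
    also have "\<dots> = of_nat k * pderiv g * H + g ^ Suc k * d (Suc k)"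
      unfolding dg dS H_def by (simp only: mult_ac)
    finally have "g ^ Suc k * d (Suc k) = g * pderiv H - (of_nat k * pderiv g) * H"
      by simp
    then show ?case using diff[OF gH mult[OF HJ]] by simp
  qed
  obtain c where c: "d (degree G) = [:c:]" "c \<noteq> 0"
  proof -
    have "degree (d (degree G)) = 0" using d[of "degree G"] by simp
    then obtain c where "d (degree G) = [:c:]" by (rule degree_eq_zeroE)
    then show thesis using d[of "degree G"] by (intro that) auto
  qed
  have "smult c (g ^ degree G) \<in> J" using J[of "degree G"] c by (simp add: mult.commute)
  from rad[OF tf[OF this c(2)]] show ?thesis .
qed

text \<open>A Bezout identity for \<open>G\<close> and its derivative, with denominators cleared. A
  nonzero element \<open>h\<close> of least degree in \<open>J + (pderiv G)\<close> divides both up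
  to constants; the cofactor \<open>q\<close> of \<open>h\<close> in \<open>G\<close> satisfies
  \<open>q * pderiv G \<in> J\<close>, so \<open>q \<in> J\<close> and \<open>degree q\<close> is at
  least \<open>degree G\<close>. This leaves degree 0 for \<open>h\<close>.\<close>

lemma is_min_bezout_pderiv:
  assumes G: "is_min G" and ch: "inj (of_nat :: nat \<Rightarrow> 'a)"
  shows "\<exists>A b. b \<noteq> 0 \<and> [:b:] - A * pderiv G \<in> J"
proof -
  define K where "K = {h. \<exists>A. h - A * pderiv G \<in> J}"
  have JK: "p \<in> J \<Longrightarrow> p \<in> K" for p unfolding K_def by (auto intro!: exI[of _ 0])
  have Kd: "p \<in> K \<Longrightarrow> q \<in> K \<Longrightarrow> p - q \<in> K" for p q
  proof -
    assume "p \<in> K" "q \<in> K"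
    then obtain A B where "p - A * pderiv G \<in> J" "q - B * pderiv G \<in> J" by (auto simp: K_def)
    from diff[OF this] have "(p - q) - (A - B) * pderiv G \<in> J" by (simp add: algebra_simps)
    then show "p - q \<in> K" unfolding K_def by blast
  qed
  have Km: "r * p \<in> K" if p: "p \<in> K" for p r
  proof -
    obtain A where "p - A * pderiv G \<in> J" using p by (auto simp: K_def)
    from mult[OF this, of r] have "r * p - (r * A) * pderiv G \<in> J" by (simp add: algebra_simps)
    then show ?thesis unfolding K_def by blast
  qed
  have G'K: "pderiv G \<in> K" unfolding K_def using zero by (auto intro!: exI[of _ 1])
  have GK: "G \<in> K" using JK G by (simp add: is_min_def)
  define h where "h = arg_min degree (\<lambda>p. p \<in> K \<and> p \<noteq> 0)"
  have h: "h \<in> K" "h \<noteq> 0" "\<And>p. p \<in> K \<Longrightarrow> p \<noteq> 0 \<Longrightarrow> degree h \<le> degree p"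
    using arg_min_nat_lemma[of "\<lambda>p. p \<in> K \<and> p \<noteq> 0" G degree] GK G unfolding h_def is_min_def by blast+
  have dv: "\<exists>a q. a \<noteq> 0 \<and> smult a p = h * q" if p: "p \<in> K" for p
  proof -
    obtain a q where aq: "a \<noteq> 0" "smult a p = h * q + pseudo_mod p h"
      using pseudo_mod(1)[of h p] h(2) by auto
    have "pseudo_mod p h = [:a:] * p - q * h" using aq by (simp add: mult.commute)
    then have "pseudo_mod p h \<in> K" using Kd Km p h(1) by presburger
    moreover have "pseudo_mod p h = 0 \<or> degree (pseudo_mod p h) < degree h"
      using pseudo_mod(2)[of h p] h(2) by auto
    ultimately have "pseudo_mod p h = 0" using h(3) leD by blast
    with aq show ?thesis by auto
  qed
  obtain a q where aq: "a \<noteq> 0" "smult a G = h * q" using dv[OF GK] by blast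
  obtain a' q' where aq': "a' \<noteq> 0" "smult a' (pderiv G) = h * q'" using dv[OF G'K] by blast
  have "smult a' (q * pderiv G) = q * (h * q')" by (simp flip: aq'(2))
  also have "\<dots> = (smult a q') * G" by (metis aq(2) mult.commute mult.assoc mult_smult_left)
  finally have "smult a' (q * pderiv G) \<in> J" using mult[OF is_minD(1)[OF G]] by metis
  then have "q * pderiv G \<in> J" using tf aq' by blast
  then have qJ: "q \<in> J" by (rule is_min_pderiv[OF G ch])
  have q0: "q \<noteq> 0" using aq G by (auto simp: is_min_def)
  have "degree G = degree h + degree q"
    using degree_mult_eq[OF h(2) q0] aq by (metis degree_smult_eq)
  moreover have "degree G \<le> degree q" using G qJ q0 by (auto simp: is_min_def)
  ultimately have "degree h = 0" by simp
  then obtain b where "h = [:b:]" by (rule degree_eq_zeroE)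
  then show ?thesis using h(1,2) by (auto simp: K_def)
qed

end

subsection \<open>Monic factors\<close>

text \<open>Gauss's lemma over a polynomial ring in one variable. As \<open>f\<close> is monic, a
  root \<open>r\<close> of \<open>lead_coeff G\<close> is a root of \<open>A\<close>. Evaluation of
  the coefficients at \<open>r\<close> makes \<open>G * Q\<close> vanish, so one factor is divisible
  by the linear polynomial with root \<open>r\<close>, which is cancelled on both sides; the degree
  of \<open>A\<close> drops.\<close>

lemma content_dvd_coeff_line:
  fixes G Q f :: "'k::alg_closed_field poly poly"
  shows "A \<noteq> 0 \<Longrightarrow> smult A f = G * Q \<Longrightarrow> lead_coeff f = 1 \<Longrightarrow> lead_coeff G dvd coeff G i"
proof (induction "degree A" arbitrary: A G Q rule: less_induct)
  case less
  have f0: "f \<noteq> 0" using less.prems by auto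
  then have "smult A f \<noteq> 0" using less.prems(1) by simp
  then have "G * Q \<noteq> 0" unfolding less.prems(2) .
  then have GQ: "G \<noteq> 0" "Q \<noteq> 0" by auto
  have lc: "A = lead_coeff G * lead_coeff Q"
    using less.prems lead_coeff_mult[of G Q] by (metis lead_coeff_smult mult.right_neutral)
  show ?case
  proof (cases "degree (lead_coeff G) = 0")
    case True
    then show ?thesis using GQ by (metis is_unit_iff_degree leading_coeff_0_iff unit_imp_dvd)
  next
    case False
    then obtain r where r: "poly (lead_coeff G) r = 0" using alg_closed_imp_poly_has_root by blast
    let ?l = "[:-r, 1:]"
    let ?E = "map_poly (\<lambda>p. poly p r)"
    have rh: "rhom (\<lambda>p. poly p r)" by (rule rhom_poly)
    have "?l dvd A" unfolding lc using r by (intro dvd_mult2) (simp add: poly_eq_0_iff_dvd)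
    then obtain A1 where A1: "A = ?l * A1" by (rule dvdE)
    have A10: "A1 \<noteq> 0" using A1 less.prems by auto
    have dA: "degree A1 < degree A" unfolding A1 using A10 by (subst degree_mult_eq) auto
    have "?E G * ?E Q = ?E (smult A f)" using less.prems by (simp add: rhom.map_poly_mult[OF rh])
    also have "\<dots> = 0" using A1 by (simp add: rhom.map_poly_smult[OF rh])
    finally have "?E G = 0 \<or> ?E Q = 0" by simp
    moreover have div: "\<exists>p'. p = smult ?l p'" if "?E p = 0" for p
    proof -
      have "?l dvd coeff p n" for n
        using that by (metis coeff_0 coeff_map_poly poly_0 poly_eq_0_iff_dvd)
      then have "[:?l:] dvd p" by (simp add: const_poly_dvd_iff)
      then obtain p' where "p = [:?l:] * p'" by (rule dvdE)
      then have "p = smult ?l p'" by simp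
      then show ?thesis by (rule exI)
    qed
    ultimately consider G1 where "G = smult ?l G1" | Q1 where "Q = smult ?l Q1" by blast
    then show ?thesis
    proof cases
      case 1
      have "smult ?l (smult A1 f) = smult ?l (G1 * Q)" using less.prems(2) 1 A1 by simp
      then have "smult A1 f = G1 * Q" by (metis smult_cancel pCons_eq_0_iff one_neq_zero)
      from less.hyps[OF dA A10 this less.prems(3)] have "lead_coeff G1 dvd coeff G1 i" .
      then have "?l * lead_coeff G1 dvd ?l * coeff G1 i" by (rule mult_dvd_mono[OF dvd_refl])
      then show ?thesis unfolding 1 lead_coeff_smult by (simp only: coeff_smult)
    next
      case 2
      have "smult ?l (smult A1 f) = smult ?l (G * Q1)" using less.prems(2) 2 A1 by simp
      then have "smult A1 f = G * Q1" by (metis smult_cancel pCons_eq_0_iff one_neq_zero)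
      from less.hyps[OF dA A10 this less.prems(3)] show ?thesis .
    qed
  qed
qed

section \<open>Restriction of polynomials to lines\<close>

lemma coeff_mult_degree_le:
  fixes p q :: "'a::comm_ring_1 poly"
  assumes "degree p \<le> d" "degree q \<le> e"
  shows "coeff (p * q) (d + e) = coeff p d * coeff q e"
proof -
  have "coeff (p * q) (d + e) = (\<Sum>i\<le>d + e. coeff p i * coeff q (d + e - i))" by (rule coeff_mult)
  also have "\<dots> = (\<Sum>i\<in>{d}. coeff p i * coeff q (d + e - i))"
  proof (rule sum.mono_neutral_right)
    show "\<forall>i\<in>{..d + e} - {d}. coeff p i * coeff q (d + e - i) = 0"
    proof
      fix i assume i: "i \<in> {..d + e} - {d}"
      show "coeff p i * coeff q (d + e - i) = 0"
      proof (cases "i < d")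
        case True
        then have "coeff q (d + e - i) = 0" using assms i by (intro coeff_eq_0) auto
        then show ?thesis by simp
      next
        case False
        then have "coeff p i = 0" using assms i by (intro coeff_eq_0) auto
        then show ?thesis by simp
      qed
    qed
  qed auto
  finally show ?thesis by simp
qed

lemma monom_eval_line:
  fixes x v :: "nat \<Rightarrow> 'b::comm_ring_1"
  shows "degree (monom_eval (\<lambda>i. [:x i, v i:]) m) \<le> monom_deg m \<and> coeff (monom_eval (\<lambda>i. [:x i, v i:]) m) (monom_deg m) = monom_eval v m"
proof -
  let ?g = "\<lambda>i. [:x i, v i:]"
  have pw: "degree (?g i ^ n) \<le> n \<and> coeff (?g i ^ n) n = v i ^ n" for i n
  proof (induction n)
    case (Suc n)
    have d: "degree (?g i) \<le> 1" by (simp add: degree_pCons_le order_trans)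
    have "degree (?g i ^ Suc n) \<le> degree (?g i) + degree (?g i ^ n)" using degree_mult_le[of "?g i" "?g i ^ n"] by simp
    then have "degree (?g i ^ Suc n) \<le> Suc n" using d Suc by linarith
    moreover have "coeff (?g i ^ Suc n) (Suc n) = v i ^ Suc n"
      using coeff_mult_degree_le[OF d, of "?g i ^ n" n] Suc by simp
    ultimately show ?case by blast
  qed simp
  have "degree (\<Prod>i\<in>S. ?g i ^ l i) \<le> (\<Sum>i\<in>S. l i) \<and> coeff (\<Prod>i\<in>S. ?g i ^ l i) (\<Sum>i\<in>S. l i) = (\<Prod>i\<in>S. v i ^ l i)"
    if "finite S" for S and l :: "nat \<Rightarrow> nat"
    using that
  proof (induction S rule: finite_induct)
    case (insert i S)
    have "degree (?g i ^ l i * (\<Prod>i\<in>S. ?g i ^ l i)) \<le> l i + (\<Sum>i\<in>S. l i)"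
      by (rule order_trans[OF degree_mult_le add_mono]) (use pw insert in auto)
    moreover have "coeff (?g i ^ l i * (\<Prod>i\<in>S. ?g i ^ l i)) (l i + (\<Sum>i\<in>S. l i)) = v i ^ l i * (\<Prod>i\<in>S. v i ^ l i)"
      using coeff_mult_degree_le[of "?g i ^ l i" "l i" "\<Prod>i\<in>S. ?g i ^ l i" "\<Sum>i\<in>S. l i"] pw insert by simp
    ultimately show ?case using insert by simp
  qed simp
  from this[of "Poly_Mapping.keys m" "Poly_Mapping.lookup m"] show ?thesis by (simp add: monom_eval_def monom_deg_def)
qed

definition top_deg :: "'k::comm_ring_1 mpoly \<Rightarrow> nat" where
  "top_deg F = Max (insert 0 (monom_deg ` Poly_Mapping.keys F))"

lemma monom_deg_le_top: "m \<in> Poly_Mapping.keys F \<Longrightarrow> monom_deg m \<le> top_deg F"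
  by (simp add: top_deg_def)

lemma top_component_nonzero: "F \<noteq> 0 \<Longrightarrow> hcomp (top_deg F) F \<noteq> 0"
proof -
  assume F: "F \<noteq> 0"
  then have ne: "Poly_Mapping.keys F \<noteq> {}" by simp
  then have "top_deg F = Max (monom_deg ` Poly_Mapping.keys F)"
    unfolding top_deg_def by (subst Max_insert) (auto simp: max_def)
  also have "\<dots> \<in> monom_deg ` Poly_Mapping.keys F" using ne by (intro Max_in) auto
  finally obtain m where "m \<in> Poly_Mapping.keys F" "monom_deg m = top_deg F" by auto
  then have "m \<in> Poly_Mapping.keys (hcomp (top_deg F) F)" by (simp add: keys_hcomp)
  then show ?thesis by auto
qed

lemma msubst_line:
  fixes f :: "'k::comm_ring_1 \<Rightarrow> 'b::comm_ring_1"
  assumes "rhom f"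
  shows "degree (msubst (\<lambda>c. [:f c:]) (\<lambda>i. [:x i, v i:]) F) \<le> top_deg F \<and>
    coeff (msubst (\<lambda>c. [:f c:]) (\<lambda>i. [:x i, v i:]) F) (top_deg F) = msubst f v (hcomp (top_deg F) F)"
proof
  interpret rhom f by fact
  let ?m = "\<lambda>m. monom_eval (\<lambda>i. [:x i, v i:]) m"
  have "degree ([:f (Poly_Mapping.lookup F m):] * ?m m) \<le> top_deg F" if "m \<in> Poly_Mapping.keys F" for m
    using degree_smult_le[of "f (Poly_Mapping.lookup F m)" "?m m"] monom_eval_line[of x v m] monom_deg_le_top[OF that] by simp
  then show "degree (msubst (\<lambda>c. [:f c:]) (\<lambda>i. [:x i, v i:]) F) \<le> top_deg F"
    unfolding msubst_def by (rule degree_sum_le[OF finite_keys])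
  have c: "coeff ([:f (Poly_Mapping.lookup F m):] * ?m m) (top_deg F) =
      (if monom_deg m = top_deg F then f (Poly_Mapping.lookup F m) * monom_eval v m else 0)" if "m \<in> Poly_Mapping.keys F" for m
  proof (cases "monom_deg m = top_deg F")
    case True then show ?thesis using monom_eval_line[of x v m] by simp
  next
    case False
    then have "monom_deg m < top_deg F" using monom_deg_le_top[OF that] by simp
    then have "coeff (?m m) (top_deg F) = 0" using monom_eval_line[of x v m] by (intro coeff_eq_0) linarith
    then show ?thesis using False by simp
  qed
  have "msubst f v (hcomp (top_deg F) F) = (\<Sum>m\<in>Poly_Mapping.keys F. if monom_deg m = top_deg F then f (Poly_Mapping.lookup F m) * monom_eval v m else 0)"
    unfolding msubst_def keys_hcomp
    by (subst sum.inter_filter[symmetric]) (auto simp: lookup_hcomp intro: sum.cong)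
  then show "coeff (msubst (\<lambda>c. [:f c:]) (\<lambda>i. [:x i, v i:]) F) (top_deg F) = msubst f v (hcomp (top_deg F) F)"
    unfolding msubst_def coeff_sum using c by (simp cong: sum.cong)
qed

text \<open>Restriction to the generic line of direction \<open>v\<close>: the base point consists
  of the variables themselves. Specialising the base point to \<open>x\<close> gives
  \<open>line x v F\<close>, and parameter 0 gives back \<open>F\<close>.\<close>

definition lin_sub :: "(nat \<Rightarrow> 'k::comm_ring_1) \<Rightarrow> 'k mpoly \<Rightarrow> 'k mpoly poly" where
  "lin_sub v = msubst (\<lambda>c. [:Cst c:]) (\<lambda>i. [:X i, Cst (v i):])"

definition line :: "(nat \<Rightarrow> 'k::comm_ring_1) \<Rightarrow> (nat \<Rightarrow> 'k) \<Rightarrow> 'k mpoly \<Rightarrow> 'k poly" where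
  "line x v = msubst (\<lambda>c. [:c:]) (\<lambda>i. [:x i, v i:])"

lemma rhom_const: "rhom (\<lambda>c::'k::comm_ring_1. [:c:])"
  by unfold_locales (simp_all add: one_pCons)

interpretation line: rhom "line x v"
  unfolding line_def by (rule rhom.rhom_msubst[OF rhom_const])

interpretation lin_sub: rhom "lin_sub v"
  unfolding lin_sub_def by (rule rhom.rhom_msubst[OF rhom_const_Cst])

lemma line_Cst [simp]: "line x v (Cst c) = [:c:]" and line_X [simp]: "line x v (X i) = [:x i, v i:]"
  unfolding line_def by (simp_all add: rhom.msubst_Cst rhom.msubst_X rhom_const)

lemma lin_sub_Cst [simp]: "lin_sub v (Cst c) = [:Cst c:]" and lin_sub_X [simp]: "lin_sub v (X i) = [:X i, Cst (v i):]"
  unfolding lin_sub_def by (simp_all add: rhom.msubst_Cst rhom.msubst_X rhom_const_Cst)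

lemma poly_line: "poly (line x v F) s = peval F (\<lambda>i. x i + s * v i)"
  by (rule rhom_mpoly_eqI[OF rhom_comp[OF rhom_poly line.rhom_axioms] peval.rhom_axioms]) simp_all

lemma map_poly_lin_sub: "map_poly (\<lambda>c. peval c x) (lin_sub v F) = line x v F"
  by (rule rhom_mpoly_eqI[OF rhom_comp[OF peval.rhom_map_poly lin_sub.rhom_axioms] line.rhom_axioms])
     (simp_all add: peval.map_poly_pCons)

lemma poly_lin_sub_0: "poly (lin_sub v F) 0 = F"
  by (rule rhom_mpoly_eqI[OF rhom_comp[OF rhom_poly lin_sub.rhom_axioms] rhom_id]) simp_all

lemma line_degree: "degree (line x v F) \<le> top_deg F" "coeff (line x v F) (top_deg F) = peval (hcomp (top_deg F) F) v"
  unfolding line_def peval_eq_msubst using msubst_line[OF rhom_id] by auto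

lemma lin_sub_degree: "degree (lin_sub v F) \<le> top_deg F" "coeff (lin_sub v F) (top_deg F) = Cst (peval (hcomp (top_deg F) F) v)"
proof -
  show "degree (lin_sub v F) \<le> top_deg F"
    unfolding lin_sub_def using msubst_line[OF rhom_Cst, of X "\<lambda>i. Cst (v i)" F] by auto
  have "coeff (lin_sub v F) (top_deg F) = msubst Cst (\<lambda>i. Cst (v i)) (hcomp (top_deg F) F)"
    unfolding lin_sub_def using msubst_line[OF rhom_Cst, of X "\<lambda>i. Cst (v i)" F] by auto
  also have "\<dots> = Cst (peval (hcomp (top_deg F) F) v)"
    by (rule sym, rule trans[OF rhom_mpoly_eq_msubst[OF rhom_comp[OF rhom_Cst peval.rhom_axioms]]]) simp
  finally show "coeff (lin_sub v F) (top_deg F) = Cst (peval (hcomp (top_deg F) F) v)" .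
qed

text \<open>In a direction where the top component of \<open>a\<close> does not vanish,
  \<open>a\<close> has degree exactly \<open>top_deg a\<close> on every line, with one and the same
  constant as leading coefficient. Pseudo-division of \<open>b\<close> by \<open>a\<close> along the
  generic line leaves a remainder of smaller degree, which must vanish on each actual line by
  divisibility there; parameter 0 gives the result.\<close>

lemma dvd_if_dvd_on_lines:
  fixes a b :: "'k::field_char_0 mpoly"
  assumes v: "peval (hcomp (top_deg a) a) v \<noteq> 0" and dv: "\<And>x. line x v a dvd line x v b"
  shows "a dvd b"
proof -
  define \<kappa> where "\<kappa> = peval (hcomp (top_deg a) a) v"
  define e where "e = Suc (degree (lin_sub v b)) - degree (lin_sub v a)"
  have c: "coeff (lin_sub v a) (top_deg a) = Cst \<kappa>" by (simp add: lin_sub_degree \<kappa>_def)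
  then have da: "degree (lin_sub v a) = top_deg a"
    using le_degree[of "lin_sub v a" "top_deg a"] lin_sub_degree(1)[of v a] v by (simp add: \<kappa>_def)
  have a0: "lin_sub v a \<noteq> 0" using c v by (auto simp: \<kappa>_def)
  obtain q r where qr: "pseudo_divmod (lin_sub v b) (lin_sub v a) = (q, r)" by fastforce
  from pseudo_divmod[OF a0 qr] have eq: "smult (Cst \<kappa> ^ e) (lin_sub v b) = lin_sub v a * q + r"
    and r: "r = 0 \<or> degree r < top_deg a"
    by (simp_all add: da c e_def)
  have "map_poly (\<lambda>c. peval c x) r = 0" for x
  proof (rule ccontr)
    let ?M = "map_poly (\<lambda>c. peval c x)"
    assume r0: "?M r \<noteq> 0"
    have "?M (smult (Cst \<kappa> ^ e) (lin_sub v b)) = ?M (lin_sub v a * q + r)" by (simp only: eq)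
    then have "smult (\<kappa> ^ e) (line x v b) = line x v a * ?M q + ?M r"
      by (simp add: peval.map_poly_smult peval.map_poly_add peval.map_poly_mult map_poly_lin_sub peval.power)
    then have "?M r = smult (\<kappa> ^ e) (line x v b) - line x v a * ?M q" by simp
    then have "line x v a dvd ?M r" using dv[of x] by (simp add: dvd_smult)
    then have "degree (line x v a) \<le> degree (?M r)" using r0 by (rule dvd_imp_degree_le)
    moreover have "top_deg a \<le> degree (line x v a)"
      using v by (intro le_degree) (simp add: line_degree)
    moreover have "degree (?M r) \<le> degree r"
      by (rule degree_le) (simp add: peval.coeff_map coeff_eq_0)
    moreover have "r \<noteq> 0" using r0 by auto
    ultimately show False using r by simp
  qed
  then have "peval (coeff r n) x = 0" for n x by (metis peval.coeff_map coeff_0)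
  then have "coeff r n = 0" for n by (intro peval_inj) simp
  then have "r = 0" by (intro poly_eqI) simp
  with eq have "smult (Cst \<kappa> ^ e) (lin_sub v b) = lin_sub v a * q" by simp
  then have "poly (smult (Cst \<kappa> ^ e) (lin_sub v b)) 0 = poly (lin_sub v a * q) 0" by simp
  then have "Cst \<kappa> ^ e * b = a * poly q 0" by (simp add: poly_lin_sub_0)
  moreover have "Cst (inverse \<kappa>) ^ e * Cst \<kappa> ^ e = 1"
    using v by (simp add: \<kappa>_def flip: power_mult_distrib rhom.mult[OF rhom_Cst])
  ultimately have "b = Cst (inverse \<kappa>) ^ e * (a * poly q 0)"
    by (metis mult.assoc mult.left_neutral)
  then have "b = a * (Cst (inverse \<kappa>) ^ e * poly q 0)" by (simp only: mult_ac)
  then show ?thesis by (rule dvdI)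
qed

text \<open>Gauss's lemma, proved by restriction to lines, where a linear factor of the leading coefficient
  can be detected by evaluation.\<close>

lemma lead_coeff_dvd_of_monic_multiple:
  fixes f G Q :: "'k::{alg_closed_field,field_char_0} mpoly poly"
  assumes "c \<noteq> 0" "smult c f = G * Q" "lead_coeff f = 1"
  shows "\<exists>F. lead_coeff F = 1 \<and> G = smult (lead_coeff G) F"
proof -
  have "smult c f \<noteq> 0" using assms by auto
  then have GQ: "G \<noteq> 0" "Q \<noteq> 0" using assms by auto
  let ?a = "lead_coeff G"
  \<comment> \<open>In this direction neither the leading coefficient of \<open>G\<close> nor
    \<open>c\<close> becomes zero on any line, so that the monic multiple survives restriction and
    the one-variable case applies.\<close>
  have "hcomp (top_deg ?a) ?a * hcomp (top_deg c) c \<noteq> 0"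
    using GQ assms(1) by (simp add: top_component_nonzero)
  from ex_peval_nonzero[OF this]
  obtain v where v: "peval (hcomp (top_deg ?a) ?a) v \<noteq> 0" "peval (hcomp (top_deg c) c) v \<noteq> 0"
    by (auto simp: peval.mult)
  have "?a dvd coeff G i" for i
  proof (rule dvd_if_dvd_on_lines[OF v(1)])
    fix x
    let ?M = "map_poly (line x v)"
    have c0: "line x v c \<noteq> 0" using v(2) line_degree(2)[of x v c] by auto
    have a0: "line x v ?a \<noteq> 0" using v(1) line_degree(2)[of x v ?a] by auto
    have lc: "lead_coeff (?M p) = line x v (lead_coeff p)" if "line x v (lead_coeff p) \<noteq> 0" for p
    proof -
      have "degree (?M p) \<le> degree p"
        by (rule degree_le) (simp add: line.coeff_map coeff_eq_0)
      moreover have "degree p \<le> degree (?M p)"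
        using that by (intro le_degree) (simp add: line.coeff_map)
      ultimately have "degree (?M p) = degree p" by simp
      then show ?thesis by (simp add: line.coeff_map)
    qed
    have "smult (line x v c) (?M f) = ?M G * ?M Q"
      using assms(2) by (simp flip: line.map_poly_mult line.map_poly_smult)
    moreover have "lead_coeff (?M f) = 1" using lc[of f] assms(3) by (simp add: line.one)
    ultimately have "lead_coeff (?M G) dvd coeff (?M G) i"
      by (rule content_dvd_coeff_line[OF c0])
    then show "line x v ?a dvd line x v (coeff G i)" using lc[OF a0] by (simp add: line.coeff_map)
  qed
  then have "[:?a:] dvd G" by (simp add: const_poly_dvd_iff)
  then obtain F where "G = [:?a:] * F" by (rule dvdE)
  then have F: "G = smult ?a F" by simp
  then have "?a = ?a * lead_coeff F" by (metis lead_coeff_smult)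
  then show ?thesis using F GQ by auto
qed

lemma (in tf_radical_ideal) monic_mod_0:
  assumes "is_min G" "F \<in> J" "lead_coeff F = 1" "degree F = degree G" "H \<in> J"
  shows "F dvd H"
proof -
  have F0: "F \<noteq> 0" using assms(3) by auto
  obtain q r where qr: "pseudo_divmod H F = (q, r)" by fastforce
  from pseudo_divmod[OF F0 qr] assms(3) have eq: "H = F * q + r" and r: "r = 0 \<or> degree r < degree G"
    by (simp_all add: assms(4))
  have "r = H - q * F" using eq by (simp add: mult.commute)
  then have "r \<in> J" using diff mult assms by simp
  then have "r = 0" using r is_minD(3)[OF assms(1)] by blast
  with eq show ?thesis by simp
qed

text \<open>An element of least degree divides the monic \<open>f\<close> up to a constant, so by
  Gauss's lemma it is itself a constant multiple of a monic polynomial. That polynomial lies in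
  \<open>J\<close> by torsion-freeness, and division by it needs no denominators.\<close>

lemma ex_monic_generator:
  fixes J :: "'k::{alg_closed_field,field_char_0} mpoly poly set"
  assumes "tf_radical_ideal J" "f \<in> J" "lead_coeff f = 1"
  shows "\<exists>F\<in>J. lead_coeff F = 1 \<and> degree F > 0 \<and> (\<forall>H\<in>J. F dvd H)"
proof -
  interpret tf_radical_ideal J by fact
  obtain G where G: "is_min G" using ex_min by blast
  obtain c q where cq: "c \<noteq> 0" "smult c f = G * q" using is_min_dvd[OF G assms(2)] by blast
  obtain F where F: "lead_coeff F = 1" "G = smult (lead_coeff G) F"
    using lead_coeff_dvd_of_monic_multiple[OF cq assms(3)] by blast
  have G0: "lead_coeff G \<noteq> 0" using is_minD(2)[OF G] by simp
  have "F \<in> J" using tf[OF _ G0] F(2) is_minD(1)[OF G] by metis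
  moreover have dF: "degree F = degree G" using F(2) G0 by (metis degree_smult_eq)
  ultimately show ?thesis using monic_mod_0[OF G] F(1) is_min_degree[OF G] by metis
qed



section \<open>Closed sets, irreducibility and chains in terms of coordinate vectors\<close>

text \<open>Projective closed sets are replaced by the sets of nonzero vectors representing their
  points, that is, by punctured affine cones. \<open>vpolys n A\<close> is the ideal of such a
  cone.\<close>

definition vpolys :: "nat \<Rightarrow> (nat \<Rightarrow> 'k::field) set \<Rightarrow> 'k mpoly set" where
  "vpolys n A = {F \<in> polys (Suc n). \<forall>x\<in>A. peval F x = 0}"

definition vclosed :: "nat \<Rightarrow> (nat \<Rightarrow> 'k::field) set \<Rightarrow> bool" where
  "vclosed n A \<longleftrightarrow> (\<exists>T \<subseteq> (\<Union>t. hpoly (Suc n) t). A = {x \<in> coords n. \<forall>F\<in>T. peval F x = 0})"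

definition virreducible :: "nat \<Rightarrow> (nat \<Rightarrow> 'k::field) set \<Rightarrow> bool" where
  "virreducible n Z \<longleftrightarrow> vclosed n Z \<and> Z \<noteq> {} \<and> (\<forall>A B. vclosed n A \<longrightarrow> vclosed n B \<longrightarrow> Z = A \<union> B \<longrightarrow> Z = A \<or> Z = B)"

definition vchain :: "nat \<Rightarrow> (nat \<Rightarrow> 'k::field) set \<Rightarrow> nat \<Rightarrow> bool" where
  "vchain n A r \<longleftrightarrow> (\<exists>C. (\<forall>i\<le>r. virreducible n (C i) \<and> C i \<subseteq> A) \<and> (\<forall>i<r. C i \<subset> C (Suc i)))"

definition vclosure :: "nat \<Rightarrow> (nat \<Rightarrow> 'k::field) set \<Rightarrow> (nat \<Rightarrow> 'k) set" where
  "vclosure n S = {x \<in> coords n. \<forall>t. \<forall>F\<in>hpoly (Suc n) t. (\<forall>y\<in>S. peval F y = 0) \<longrightarrow> peval F x = 0}"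

lemma vpolys_polys: "F \<in> vpolys n A \<Longrightarrow> F \<in> polys (Suc n)"
  and vidD: "F \<in> vpolys n A \<Longrightarrow> x \<in> A \<Longrightarrow> peval F x = 0"
  by (simp_all add: vpolys_def)

lemma vidI: "F \<in> polys (Suc n) \<Longrightarrow> (\<And>x. x \<in> A \<Longrightarrow> peval F x = 0) \<Longrightarrow> F \<in> vpolys n A"
  by (simp add: vpolys_def)

lemma vpolys_0 [simp]: "0 \<in> vpolys n A"
  by (simp add: vpolys_def)

lemma vpolys_add: "F \<in> vpolys n A \<Longrightarrow> G \<in> vpolys n A \<Longrightarrow> F + G \<in> vpolys n A"
  by (simp add: vpolys_def polys_add peval.add)

lemma vpolys_diff: "F \<in> vpolys n A \<Longrightarrow> G \<in> vpolys n A \<Longrightarrow> F - G \<in> vpolys n A"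
  by (simp add: vpolys_def polys_diff peval.diff)

lemma vpolys_mult: "F \<in> vpolys n A \<Longrightarrow> G \<in> polys (Suc n) \<Longrightarrow> G * F \<in> vpolys n A"
  by (simp add: vpolys_def polys_mult peval.mult)

lemma vpolys_mono: "A \<subseteq> B \<Longrightarrow> vpolys n B \<subseteq> vpolys n A"
  by (auto simp: vpolys_def)

lemma vpolys_subspace: "mpoly.subspace (vpolys n A)"
  unfolding mpoly.subspace_def by (simp add: vpolys_add pscale_eq vpolys_mult)

lemma coords_scale: "x \<in> coords n \<Longrightarrow> c \<noteq> 0 \<Longrightarrow> (\<lambda>i. c * x i) \<in> coords n"
  by (auto simp: coords_def)

lemma coordsD: "x \<in> coords n \<Longrightarrow> i > n \<Longrightarrow> x i = 0"
  by (simp add: coords_def)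

lemma vclosed_coords: "vclosed n A \<Longrightarrow> A \<subseteq> coords n"
  by (auto simp: vclosed_def)

lemma vclosed_scale: "vclosed n A \<Longrightarrow> x \<in> A \<Longrightarrow> c \<noteq> 0 \<Longrightarrow> (\<lambda>i. c * x i) \<in> A"
  unfolding vclosed_def by (fastforce simp: coords_scale peval_hpoly_scale)

lemma poly_0_if_0_on_units:
  fixes p :: "'k::field_char_0 poly"
  assumes "\<And>s. s \<noteq> 0 \<Longrightarrow> poly p s = 0" shows "p = 0"
proof (rule ccontr)
  assume "p \<noteq> 0"
  then have "finite {s. poly p s = 0}" by (rule poly_roots_finite)
  then have "finite (insert 0 {s. poly p s = 0})" by simp
  moreover have "insert 0 {s. poly p s = 0} = UNIV" using assms by auto
  ultimately show False using infinite_UNIV_char_0 by metis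
qed

text \<open>The ideal of a cone is homogeneous: along each scaled vector, \<open>F\<close> is a
  polynomial in the scalar with infinitely many zeros.\<close>

lemma vpolys_hcomp:
  fixes A :: "(nat \<Rightarrow> 'k::field_char_0) set"
  assumes "vclosed n A" "F \<in> vpolys n A" shows "hcomp t F \<in> vpolys n A"
proof (rule vidI)
  show "hcomp t F \<in> polys (Suc n)" using hpoly_polys[OF hcomp_hpoly[OF vpolys_polys[OF assms(2)]]] .
  fix x assume x: "x \<in> A"
  have "scaling_poly F x = 0"
    by (rule poly_0_if_0_on_units) (simp add: poly_scaling_poly vidD[OF assms(2)] vclosed_scale[OF assms(1) x])
  then show "peval (hcomp t F) x = 0" using coeff_scaling_poly[of F x t] by simp
qed

lemma vclosed_sep:
  assumes "vclosed n A" "x \<in> coords n" "x \<notin> A"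
  shows "\<exists>t F. F \<in> hpoly (Suc n) t \<and> F \<in> vpolys n A \<and> peval F x \<noteq> 0"
proof -
  obtain T where T: "T \<subseteq> (\<Union>t. hpoly (Suc n) t)" "A = {x \<in> coords n. \<forall>F\<in>T. peval F x = 0}"
    using assms(1) by (auto simp: vclosed_def)
  then obtain F where F: "F \<in> T" "peval F x \<noteq> 0" using assms by blast
  then obtain t where "F \<in> hpoly (Suc n) t" using T by blast
  moreover have "F \<in> vpolys n A" using calculation hpoly_polys F T by (auto simp: vpolys_def)
  ultimately show ?thesis using F by blast
qed

lemma vclosed_zeros: "T \<subseteq> (\<Union>t. hpoly (Suc n) t) \<Longrightarrow> vclosed n {x \<in> coords n. \<forall>F\<in>T. peval F x = 0}"
  by (auto simp: vclosed_def)

lemma vclosed_Int: "vclosed n A \<Longrightarrow> vclosed n B \<Longrightarrow> vclosed n (A \<inter> B)"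
proof -
  assume "vclosed n A" "vclosed n B"
  then obtain S T where "S \<subseteq> (\<Union>t. hpoly (Suc n) t)" "A = {x \<in> coords n. \<forall>F\<in>S. peval F x = 0}"
    "T \<subseteq> (\<Union>t. hpoly (Suc n) t)" "B = {x \<in> coords n. \<forall>F\<in>T. peval F x = 0}" by (auto simp: vclosed_def)
  then show ?thesis unfolding vclosed_def by (intro exI[of _ "S \<union> T"]) blast
qed

lemma vclosed_vclosure: "vclosed n (vclosure n S)"
proof -
  have "vclosure n S = {x \<in> coords n. \<forall>F\<in>{F. (\<exists>t. F \<in> hpoly (Suc n) t) \<and> (\<forall>y\<in>S. peval F y = 0)}. peval F x = 0}"
    unfolding vclosure_def by blast
  then show ?thesis using vclosed_zeros[of "{F. (\<exists>t. F \<in> hpoly (Suc n) t) \<and> (\<forall>y\<in>S. peval F y = 0)}" n] by auto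
qed

lemma vclosure_superset: "S \<subseteq> coords n \<Longrightarrow> S \<subseteq> vclosure n S"
  by (auto simp: vclosure_def)

lemma vclosure_minimal: "vclosed n A \<Longrightarrow> S \<subseteq> A \<Longrightarrow> vclosure n S \<subseteq> A"
proof
  fix x assume a: "vclosed n A" "S \<subseteq> A" "x \<in> vclosure n S"
  show "x \<in> A"
  proof (rule ccontr)
    assume "x \<notin> A"
    moreover have "x \<in> coords n" using a(3) by (simp add: vclosure_def)
    ultimately obtain t F where F: "F \<in> hpoly (Suc n) t" "F \<in> vpolys n A" "peval F x \<noteq> 0"
      using vclosed_sep[OF a(1)] by blast
    have "\<forall>y\<in>S. peval F y = 0" using vidD[OF F(2)] a(2) by blast
    then show False using a(3) F(1,3) by (auto simp: vclosure_def)
  qed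
qed

lemma virreducible_vclosure_singleton:
  assumes "x \<in> coords n" shows "virreducible n (vclosure n {x})" "x \<in> vclosure n {x}"
proof -
  show x: "x \<in> vclosure n {x}" using vclosure_superset[of "{x}" n] assms by auto
  show "virreducible n (vclosure n {x})"
    unfolding virreducible_def
  proof (intro conjI allI impI vclosed_vclosure)
    show "vclosure n {x} \<noteq> {}" using x by blast
    fix A B assume "vclosed n A" "vclosed n B" "vclosure n {x} = A \<union> B"
    then show "vclosure n {x} = A \<or> vclosure n {x} = B"
      using vclosure_minimal[of n A "{x}"] vclosure_minimal[of n B "{x}"] x by blast
  qed
qed

lemma kirrD:
  assumes "virreducible n Z" "vclosed n A" "vclosed n B" "Z \<subseteq> A \<union> B" shows "Z \<subseteq> A \<or> Z \<subseteq> B"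
proof -
  have "Z = (Z \<inter> A) \<union> (Z \<inter> B)" using assms by blast
  then have "Z = Z \<inter> A \<or> Z = Z \<inter> B" using assms vclosed_Int unfolding virreducible_def by meson
  then show ?thesis by blast
qed

text \<open>For factors that need not be homogeneous, \<open>D\<close> is covered by the closed sets
  on which all components of \<open>F\<close>, respectively of \<open>G\<close>, vanish: at each
  point the product of the two scaling polynomials is 0, hence one of them is.\<close>

lemma virreducible_prime:
  fixes D :: "(nat \<Rightarrow> 'k::field_char_0) set"
  assumes D: "virreducible n D" and F: "F \<in> polys (Suc n)" and G: "G \<in> polys (Suc n)" and FG: "F * G \<in> vpolys n D"
  shows "F \<in> vpolys n D \<or> G \<in> vpolys n D"
proof -
  define Z where "Z H = {x \<in> coords n. \<forall>F\<in>range (\<lambda>t. hcomp t H). peval F x = 0}" for H :: "'k mpoly"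
  have Z: "vclosed n (Z H)" if "H \<in> polys (Suc n)" for H
    unfolding Z_def by (rule vclosed_zeros) (use hcomp_hpoly[OF that] in blast)
  have cl: "vclosed n D" using D by (simp add: virreducible_def)
  have ZI: "x \<in> Z H" if "x \<in> D" "scaling_poly H x = 0" for x H
    using that coeff_scaling_poly[of H x] vclosed_coords[OF cl] by (auto simp: Z_def simp flip: coeff_scaling_poly)
  have "D \<subseteq> Z F \<union> Z G"
  proof
    fix x assume x: "x \<in> D"
    have "scaling_poly F x * scaling_poly G x = 0"
    proof (rule poly_0_if_0_on_units)
      fix s :: 'k assume "s \<noteq> 0"
      then have "peval (F * G) (\<lambda>i. s * x i) = 0" using vidD[OF FG] vclosed_scale[OF cl x] by blast
      then show "poly (scaling_poly F x * scaling_poly G x) s = 0" by (simp add: poly_scaling_poly peval.mult)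
    qed
    then show "x \<in> Z F \<union> Z G" using ZI[OF x] by auto
  qed
  then have "D \<subseteq> Z F \<or> D \<subseteq> Z G" by (rule kirrD[OF D Z[OF F] Z[OF G]])
  moreover have "H \<in> vpolys n D" if H: "H \<in> polys (Suc n)" "D \<subseteq> Z H" for H
  proof (rule vidI[OF H(1)])
    fix x assume "x \<in> D"
    then have "peval (hcomp t H) x = 0" for t using H by (auto simp: Z_def)
    then show "peval H x = 0" using sum_hcomp[of H] by (metis (no_types, lifting) peval.sum sum.neutral)
  qed
  ultimately show ?thesis using F G by blast
qed

text \<open>Existence of components by Zorn's lemma; the upper bound of a chain of irreducible sets
  is the closure of its union, which is again irreducible.\<close>

lemma virreducible_maximal:
  assumes W: "virreducible n W" "W \<subseteq> A" and A: "vclosed n A"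
  shows "\<exists>Z. virreducible n Z \<and> W \<subseteq> Z \<and> Z \<subseteq> A \<and> (\<forall>Y. virreducible n Y \<longrightarrow> Z \<subseteq> Y \<longrightarrow> Y \<subseteq> A \<longrightarrow> Y = Z)"
proof -
  let ?F = "{Z. virreducible n Z \<and> W \<subseteq> Z \<and> Z \<subseteq> A}"
  have "\<exists>M\<in>?F. \<forall>X\<in>?F. M \<subseteq> X \<longrightarrow> X = M"
  proof (rule subset_Zorn)
    fix C assume C: "subset.chain ?F C"
    show "\<exists>U\<in>?F. \<forall>X\<in>C. X \<subseteq> U"
    proof (cases "C = {}")
      case True then show ?thesis using W by blast
    next
      case False
      have CF: "C \<subseteq> ?F" and tot: "\<And>X Y. X \<in> C \<Longrightarrow> Y \<in> C \<Longrightarrow> X \<subseteq> Y \<or> Y \<subseteq> X"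
        using C by (auto simp: subset_chain_def)
      define U where "U = vclosure n (\<Union>C)"
      have co: "\<Union>C \<subseteq> coords n" using CF vclosed_coords[OF A] by blast
      have sup: "\<Union>C \<subseteq> U" unfolding U_def by (rule vclosure_superset[OF co])
      have UA: "U \<subseteq> A" unfolding U_def by (rule vclosure_minimal[OF A]) (use CF in blast)
      have WU: "W \<subseteq> U" using False CF sup by blast
      have "virreducible n U"
        unfolding virreducible_def
      proof (intro conjI allI impI)
        show "vclosed n U" unfolding U_def by (rule vclosed_vclosure)
        show "U \<noteq> {}" using WU W by (auto simp: virreducible_def)
        fix P Q assume PQ: "vclosed n P" "vclosed n Q" "U = P \<union> Q"
        have "\<Union>C \<subseteq> P \<or> \<Union>C \<subseteq> Q"
        proof (rule ccontr)
          assume "\<not> ?thesis"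
          then obtain X Y where XY: "X \<in> C" "\<not> X \<subseteq> P" "Y \<in> C" "\<not> Y \<subseteq> Q" by blast
          have sub: "Z \<subseteq> P \<or> Z \<subseteq> Q" if "Z \<in> C" for Z
            by (rule kirrD[OF _ PQ(1,2)]) (use that CF sup PQ(3) in auto)
          from tot[OF XY(1,3)] show False using sub[OF XY(1)] sub[OF XY(3)] XY by blast
        qed
        then have "U \<subseteq> P \<or> U \<subseteq> Q" unfolding U_def using vclosure_minimal PQ(1,2) by metis
        then show "U = P \<or> U = Q" using PQ(3) by blast
      qed
      then show ?thesis using WU UA sup by blast
    qed
  qed
  then obtain M where "M \<in> ?F" "\<forall>X\<in>?F. M \<subseteq> X \<longrightarrow> X = M" by (rule bexE)
  then show ?thesis by (intro exI[of _ M]) auto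
qed

lemma vchain_mono: "vchain n A r \<Longrightarrow> A \<subseteq> B \<Longrightarrow> vchain n B r"
  unfolding vchain_def by (meson order_trans)

subsection \<open>Projective closed sets\<close>

lemma proj_spaceE:
  assumes "P \<in> proj_space n" "a \<in> P"
  shows "a \<in> coords n" "P = {b. \<exists>c. c \<noteq> 0 \<and> b = (\<lambda>i. c * a i)}"
proof -
  obtain x where x: "x \<in> coords n" "P = proj_rel n `` {x}"
    using assms(1) by (auto simp: proj_space_def elim: quotientE)
  then obtain c where c: "c \<noteq> 0" "a = (\<lambda>i. c * x i)" and a: "a \<in> coords n"
    using assms(2) by (auto simp: proj_rel_def)
  show "a \<in> coords n" by fact
  show "P = {b. \<exists>c. c \<noteq> 0 \<and> b = (\<lambda>i. c * a i)}"
  proof (intro subset_antisym subsetI)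
    fix b assume "b \<in> P"
    then obtain d where d: "d \<noteq> 0" "b = (\<lambda>i. d * x i)" using x by (auto simp: proj_rel_def)
    then have "b = (\<lambda>i. (d / c) * a i)" using c by auto
    then show "b \<in> {b. \<exists>c. c \<noteq> 0 \<and> b = (\<lambda>i. c * a i)}" using c d by (intro CollectI exI[of _ "d / c"]) auto
  next
    fix b assume "b \<in> {b. \<exists>c. c \<noteq> 0 \<and> b = (\<lambda>i. c * a i)}"
    then obtain d where d: "d \<noteq> 0" "b = (\<lambda>i. d * a i)" by blast
    then have "b = (\<lambda>i. (d * c) * x i)" using c by (auto simp: mult.assoc)
    then show "b \<in> P" using x a c d coords_scale[OF x(1), of "d * c"]
      by (auto simp: proj_rel_def intro!: exI[of _ "d * c"])
  qed
qed

definition cls :: "nat \<Rightarrow> (nat \<Rightarrow> 'k::field) \<Rightarrow> 'k point" where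
  "cls n a = {b. \<exists>c. c \<noteq> 0 \<and> b = (\<lambda>i. c * a i)}"

lemma cls_in: "a \<in> coords n \<Longrightarrow> cls n a \<in> proj_space n" and self_in_cls: "a \<in> cls n a"
proof -
  show "a \<in> cls n a" by (auto simp: cls_def intro!: exI[of _ 1])
  assume a: "a \<in> coords n"
  then have "cls n a = proj_rel n `` {a}" by (auto simp: cls_def proj_rel_def coords_scale)
  then show "cls n a \<in> proj_space n" using a by (auto simp: proj_space_def intro: quotientI)
qed

lemma proj_space_nonempty:
  assumes "P \<in> proj_space n" shows "\<exists>a. a \<in> P"
proof -
  obtain x where x: "x \<in> coords n" "P = proj_rel n `` {x}"
    using assms by (auto simp: proj_space_def elim: quotientE)
  then have "x \<in> P" by (auto simp: proj_rel_def intro!: exI[of _ 1])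
  then show "\<exists>a. a \<in> P" by blast
qed

lemma vanishes_at_iff:
  assumes "F \<in> hpoly k t" "P \<in> proj_space n" "a \<in> P"
  shows "vanishes_at F P \<longleftrightarrow> peval F a = 0"
  unfolding vanishes_at_def using proj_spaceE(2)[OF assms(2,3)] assms(3)
  by (auto simp: peval_hpoly_scale[OF assms(1)])

definition pset :: "nat \<Rightarrow> (nat \<Rightarrow> 'k::field) set \<Rightarrow> 'k point set" where
  "pset n A = {P \<in> proj_space n. P \<subseteq> A}"

lemma zeros_eq_pset:
  assumes "T \<subseteq> (\<Union>t. hpoly (Suc n) t)"
  shows "zeros n T = pset n {x \<in> coords n. \<forall>F\<in>T. peval F x = 0}"
proof -
  have "(\<forall>F\<in>T. vanishes_at F P) \<longleftrightarrow> P \<subseteq> {x \<in> coords n. \<forall>F\<in>T. peval F x = 0}" if "P \<in> proj_space n" for P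
    using proj_spaceE(1)[OF that] by (auto simp: vanishes_at_def)
  then show ?thesis by (auto simp: zeros_def pset_def)
qed

lemma Union_pset: "vclosed n A \<Longrightarrow> \<Union> (pset n A) = A"
proof
  assume A: "vclosed n A"
  show "A \<subseteq> \<Union> (pset n A)"
  proof
    fix x assume x: "x \<in> A"
    then have "x \<in> coords n" using vclosed_coords[OF A] by blast
    moreover have "cls n x \<subseteq> A" using vclosed_scale[OF A x] by (auto simp: cls_def)
    ultimately have "cls n x \<in> pset n A" using cls_in by (auto simp: pset_def)
    then show "x \<in> \<Union> (pset n A)" using self_in_cls by blast
  qed
qed (auto simp: pset_def)

lemma zclosed_pset: "vclosed n A \<Longrightarrow> zclosed n (pset n A)"
proof -
  assume "vclosed n A"
  then obtain T where T: "T \<subseteq> (\<Union>t. hpoly (Suc n) t)" "A = {x \<in> coords n. \<forall>F\<in>T. peval F x = 0}"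
    unfolding vclosed_def by (elim exE conjE)
  then show ?thesis
    unfolding zclosed_def forms_eq_hpoly using zeros_eq_pset[OF T(1)] by (intro exI[of _ T]) simp
qed

lemma zclosedD:
  assumes "zclosed n V" shows "vclosed n (\<Union>V)" "V = pset n (\<Union>V)"
proof -
  obtain T where T: "T \<subseteq> (\<Union>t. hpoly (Suc n) t)" "V = zeros n T"
    using assms by (auto simp: zclosed_def forms_eq_hpoly)
  have k: "vclosed n {x \<in> coords n. \<forall>F\<in>T. peval F x = 0}" by (rule vclosed_zeros[OF T(1)])
  have V: "V = pset n {x \<in> coords n. \<forall>F\<in>T. peval F x = 0}" using T zeros_eq_pset by blast
  show "vclosed n (\<Union>V)" "V = pset n (\<Union>V)" using k Union_pset[OF k] V by simp_all
qed

lemma pset_subset_iff: "vclosed n A \<Longrightarrow> pset n A \<subseteq> pset n B \<longleftrightarrow> A \<subseteq> B"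
  using Union_pset[of n A] by (auto simp: pset_def)

lemma pset_Un:
  assumes "vclosed n A" "vclosed n B" shows "pset n (A \<union> B) = pset n A \<union> pset n B"
proof
  show "pset n (A \<union> B) \<subseteq> pset n A \<union> pset n B"
  proof
    fix P assume P: "P \<in> pset n (A \<union> B)"
    then have Pp: "P \<in> proj_space n" by (simp add: pset_def)
    obtain a where a: "a \<in> P" using proj_space_nonempty[OF Pp] by blast
    have e: "P = {b. \<exists>c. c \<noteq> 0 \<and> b = (\<lambda>i. c * a i)}" by (rule proj_spaceE(2)[OF Pp a])
    have "a \<in> A \<or> a \<in> B" using P a by (auto simp: pset_def)
    then have "P \<subseteq> A \<or> P \<subseteq> B" using e vclosed_scale[OF assms(1)] vclosed_scale[OF assms(2)] by blast
    then show "P \<in> pset n A \<union> pset n B" using Pp by (auto simp: pset_def)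
  qed
qed (auto simp: pset_def)

lemma pset_eq_iff: "vclosed n A \<Longrightarrow> vclosed n B \<Longrightarrow> pset n A = pset n B \<longleftrightarrow> A = B"
  using Union_pset by metis

lemma irreducible_closed_pset:
  assumes A: "vclosed n A" shows "irreducible_closed n (pset n A) \<longleftrightarrow> virreducible n A"
proof -
  have ne: "pset n A \<noteq> {} \<longleftrightarrow> A \<noteq> {}"
    using Union_pset[OF A] proj_space_nonempty by (fastforce simp: pset_def)
  have "(\<forall>B C. zclosed n B \<longrightarrow> zclosed n C \<longrightarrow> pset n A = B \<union> C \<longrightarrow> pset n A = B \<or> pset n A = C) \<longleftrightarrow>
    (\<forall>B C. vclosed n B \<longrightarrow> vclosed n C \<longrightarrow> A = B \<union> C \<longrightarrow> A = B \<or> A = C)"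
  proof (intro iffI allI impI)
    fix B C assume h: "\<forall>B C. zclosed n B \<longrightarrow> zclosed n C \<longrightarrow> pset n A = B \<union> C \<longrightarrow> pset n A = B \<or> pset n A = C"
      and BC: "vclosed n B" "vclosed n C" "A = B \<union> C"
    have "pset n A = pset n B \<union> pset n C" using pset_Un BC by blast
    then have "pset n A = pset n B \<or> pset n A = pset n C"
      using h zclosed_pset BC(1,2) by blast
    then show "A = B \<or> A = C" using pset_eq_iff A BC(1,2) by blast
  next
    fix B C assume h: "\<forall>B C. vclosed n B \<longrightarrow> vclosed n C \<longrightarrow> A = B \<union> C \<longrightarrow> A = B \<or> A = C"
      and BC: "zclosed n B" "zclosed n C" "pset n A = B \<union> C"
    have "A = \<Union>B \<union> \<Union>C" using Union_pset[OF A] BC(3) by auto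
    then have "A = \<Union>B \<or> A = \<Union>C" using h zclosedD(1) BC(1,2) by blast
    then show "pset n A = B \<or> pset n A = C" using zclosedD(2)[OF BC(1)] zclosedD(2)[OF BC(2)] by auto
  qed
  then show ?thesis using zclosed_pset[OF A] A ne by (simp add: irreducible_closed_def virreducible_def)
qed

lemma irreducible_closedD: "irreducible_closed n Z \<Longrightarrow> virreducible n (\<Union>Z) \<and> Z = pset n (\<Union>Z)"
  using irreducible_closed_pset zclosedD by (metis irreducible_closed_def)

lemma has_irreducible_chain_pset:
  assumes A: "vclosed n A" shows "has_irreducible_chain n (pset n A) r \<longleftrightarrow> vchain n A r"
proof
  assume "has_irreducible_chain n (pset n A) r"
  then obtain C where C: "\<forall>i\<le>r. irreducible_closed n (C i) \<and> C i \<subseteq> pset n A" "\<forall>i<r. C i \<subset> C (Suc i)"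
    by (auto simp: has_irreducible_chain_def)
  have D: "virreducible n (\<Union>(C i)) \<and> C i = pset n (\<Union>(C i))" if "i \<le> r" for i
    using irreducible_closedD C(1) that by blast
  show "vchain n A r"
    unfolding vchain_def
  proof (intro exI[of _ "\<lambda>i. \<Union>(C i)"] conjI allI impI)
    fix i assume i: "i \<le> r"
    show "virreducible n (\<Union>(C i))" using D i by blast
    show "\<Union>(C i) \<subseteq> A" using C(1) i by (auto simp: pset_def)
  next
    fix i assume "i < r"
    then have "C i \<subset> C (Suc i)" "C i = pset n (\<Union>(C i))" "C (Suc i) = pset n (\<Union>(C (Suc i)))"
      using C(2) D by auto
    then show "\<Union>(C i) \<subset> \<Union>(C (Suc i))" by (metis Union_mono psubset_eq)
  qed
next
  assume "vchain n A r"
  then obtain C where C: "\<forall>i\<le>r. virreducible n (C i) \<and> C i \<subseteq> A" "\<forall>i<r. C i \<subset> C (Suc i)"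
    by (auto simp: vchain_def)
  have k: "vclosed n (C i)" if "i \<le> r" for i using C(1) that by (auto simp: virreducible_def)
  show "has_irreducible_chain n (pset n A) r"
    unfolding has_irreducible_chain_def
  proof (intro exI[of _ "\<lambda>i. pset n (C i)"] conjI allI impI)
    fix i assume i: "i \<le> r"
    show "irreducible_closed n (pset n (C i))" using irreducible_closed_pset[OF k[OF i]] C(1) i by blast
    show "pset n (C i) \<subseteq> pset n A" using pset_subset_iff[OF k[OF i]] C(1) i by blast
  next
    fix i assume i: "i < r"
    then show "pset n (C i) \<subset> pset n (C (Suc i))"
      using C(2) pset_subset_iff[OF k, of i "C (Suc i)"] pset_eq_iff[OF k k, of i "Suc i"] by (auto simp: psubset_eq)
  qed
qed

text \<open>The hypotheses on the variety in the form in which they are used. Equidimensionality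
  appears pointwise: each point lies on an irreducible closed subset that itself contains a chain of
  length \<open>n - 2\<close>.\<close>

definition admissible :: "nat \<Rightarrow> (nat \<Rightarrow> 'k::field) set \<Rightarrow> bool" where
  "admissible n A \<longleftrightarrow> vclosed n A \<and> A \<noteq> {} \<and> \<not> vchain n A (n - 1) \<and>
     (\<forall>x\<in>A. \<exists>Z. virreducible n Z \<and> x \<in> Z \<and> Z \<subseteq> A \<and> vchain n Z (n - 2)) \<and>
     (\<forall>L\<in>hpoly (Suc n) 1. L \<in> vpolys n A \<longrightarrow> L = 0)"

text \<open>Equidimensionality supplies a common dimension \<open>r\<close> of the components,
  codimension 2 a longest chain of length \<open>n - 2\<close>. The component containing the top of
  that chain has dimension at least \<open>n - 2\<close> and at most that of \<open>V\<close>,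
  whence \<open>r = n - 2\<close>.\<close>

lemma goodI:
  assumes "n \<ge> 2" "zclosed n V" "equidimensional n V" "has_codim n V 2" "nondegenerate n V"
  shows "admissible n (\<Union>V)"
proof -
  define A where "A = \<Union>V"
  have A: "vclosed n A" and V: "V = pset n A" using zclosedD[OF assms(2)] by (simp_all add: A_def)
  obtain r where r: "\<And>Z. Z \<in> irreducible_components n V \<Longrightarrow> has_dim n Z r"
    using assms(3) by (auto simp: equidimensional_def)
  have dV: "has_dim n V (n - 2)" using assms(4) by (auto simp: has_codim_def)
  have comp: "\<exists>Z. virreducible n Z \<and> W \<subseteq> Z \<and> Z \<subseteq> A \<and> has_dim n (pset n Z) r" if W: "virreducible n W" "W \<subseteq> A" for W
  proof -
    obtain Z where Z: "virreducible n Z" "W \<subseteq> Z" "Z \<subseteq> A" "\<forall>Y. virreducible n Y \<longrightarrow> Z \<subseteq> Y \<longrightarrow> Y \<subseteq> A \<longrightarrow> Y = Z"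
      using virreducible_maximal[OF W A] by blast
    have kZ: "vclosed n Z" using Z by (simp add: virreducible_def)
    have "pset n Z \<in> irreducible_components n V"
      unfolding irreducible_components_def
    proof (intro CollectI conjI allI impI)
      show "irreducible_closed n (pset n Z)" using irreducible_closed_pset[OF kZ] Z by simp
      show "pset n Z \<subseteq> V" using V Z(3) by (auto simp: pset_def)
      fix W assume W: "irreducible_closed n W" "pset n Z \<subseteq> W" "W \<subseteq> V"
      have "virreducible n (\<Union>W)" and eW: "W = pset n (\<Union>W)" using irreducible_closedD[OF W(1)] by auto
      moreover have "Z \<subseteq> \<Union>W" using W(2) Union_pset[OF kZ] by blast
      moreover have "\<Union>W \<subseteq> A" using W(3) A_def by blast
      ultimately have "\<Union>W = Z" using Z(4) by blast
      then show "W = pset n Z" using eW by simp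
    qed
    then show ?thesis using r Z by blast
  qed
  obtain C where C: "\<forall>i\<le>n - 2. virreducible n (C i) \<and> C i \<subseteq> A" "\<forall>i<n - 2. C i \<subset> C (Suc i)"
    using dV has_irreducible_chain_pset[OF A] V by (auto simp: has_dim_def vchain_def)
  obtain Z0 where Z0: "virreducible n Z0" "C (n - 2) \<subseteq> Z0" "Z0 \<subseteq> A" "has_dim n (pset n Z0) r"
    using comp C(1) by blast
  have kZ0: "vclosed n Z0" using Z0 by (simp add: virreducible_def)
  have Cm: "C i \<subseteq> C (n - 2)" if "i \<le> n - 2" for i
    using that by (induction rule: inc_induct) (use C(2) in blast)+
  have "vchain n Z0 (n - 2)"
    unfolding vchain_def using C Cm Z0(2) by (intro exI[of _ C]) blast
  then have "n - 2 \<le> r" using Z0(4) has_irreducible_chain_pset[OF kZ0] by (auto simp: has_dim_def)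
  moreover have "vchain n Z0 r" using Z0(4) has_irreducible_chain_pset[OF kZ0] by (auto simp: has_dim_def)
  then have "vchain n A r" by (rule vchain_mono[OF _ Z0(3)])
  then have "r \<le> n - 2" using dV has_irreducible_chain_pset[OF A] V by (auto simp: has_dim_def)
  ultimately have r2: "r = n - 2" by simp
  have "admissible n A"
    unfolding admissible_def
  proof (intro conjI ballI impI)
    show "vclosed n A" by fact
    show "A \<noteq> {}" using Z0 by (auto simp: virreducible_def)
    show "\<not> vchain n A (n - 1)"
    proof
      assume "vchain n A (n - 1)"
      then have "n - 1 \<le> n - 2" using dV has_irreducible_chain_pset[OF A] V by (auto simp: has_dim_def)
      then show False using assms(1) by simp
    qed
    show "\<exists>Z. virreducible n Z \<and> x \<in> Z \<and> Z \<subseteq> A \<and> vchain n Z (n - 2)" if x: "x \<in> A" for x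
    proof -
      have xc: "x \<in> coords n" using vclosed_coords[OF A] x by blast
      have "vclosure n {x} \<subseteq> A" using vclosure_minimal[OF A] x by blast
      then obtain Z where Z: "virreducible n Z" "vclosure n {x} \<subseteq> Z" "Z \<subseteq> A" "has_dim n (pset n Z) r"
        using comp virreducible_vclosure_singleton(1)[OF xc] by blast
      have "vchain n Z (n - 2)"
        using Z has_irreducible_chain_pset[of n Z] r2 by (auto simp: has_dim_def virreducible_def)
      then show ?thesis using Z virreducible_vclosure_singleton(2)[OF xc] by blast
    qed
    fix L assume L: "L \<in> hpoly (Suc n) 1" "L \<in> vpolys n A"
    have "V \<subseteq> zeros n {L}"
    proof
      fix P assume P: "P \<in> V"
      then have "P \<in> proj_space n" using V by (simp add: pset_def)
      moreover have "vanishes_at L P" using P L(2) by (auto simp: vanishes_at_def vpolys_def A_def)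
      ultimately show "P \<in> zeros n {L}" by (simp add: zeros_def)
    qed
    then show "L = 0" using assms(5) L(1) by (auto simp: nondegenerate_def forms_eq_hpoly)
  qed
  then show ?thesis by (simp add: A_def)
qed



section \<open>Growth of Hilbert functions and lengths of chains\<close>

definition ideal_dim :: "nat \<Rightarrow> (nat \<Rightarrow> 'k::field) set \<Rightarrow> nat \<Rightarrow> nat" where
  "ideal_dim n A t = mpoly.dim (hpoly (Suc n) t \<inter> vpolys n A)"

definition hilb :: "nat \<Rightarrow> (nat \<Rightarrow> 'k::field) set \<Rightarrow> nat \<Rightarrow> int" where
  "hilb n A t = int (mpoly.dim (hpoly (Suc n) t :: 'k mpoly set)) - int (ideal_dim n A t)"

lemma fin_dim_hpoly_vpolys: "k > 0 \<Longrightarrow> fin_dim (hpoly k t \<inter> vpolys n A)"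
  by (rule fin_dim_subset[OF fin_dim_hp' mpoly.subspace_inter[OF hpoly_subspace vpolys_subspace]]) auto

lemma hilb_mono: "A \<subseteq> B \<Longrightarrow> hilb n A t \<le> hilb n B t"
  using fin_dim_dim_mono[OF fin_dim_hpoly_vpolys[of "Suc n" t n A], of "hpoly (Suc n) t \<inter> vpolys n B"] vpolys_mono[of A B n]
  by (auto simp: hilb_def ideal_dim_def)

lemma mult_vpolys_Int:
  fixes C :: "(nat \<Rightarrow> 'k::field_char_0) set"
  assumes "virreducible n C" "f \<in> hpoly (Suc n) s" "f \<notin> vpolys n C"
  shows "(hpoly (Suc n) (s + t) \<inter> vpolys n C) \<inter> (*) f ` hpoly (Suc n) t = (*) f ` (hpoly (Suc n) t \<inter> vpolys n C)"
proof
  show "(hpoly (Suc n) (s + t) \<inter> vpolys n C) \<inter> (*) f ` hpoly (Suc n) t \<subseteq> (*) f ` (hpoly (Suc n) t \<inter> vpolys n C)"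
  proof
    fix g assume "g \<in> (hpoly (Suc n) (s + t) \<inter> vpolys n C) \<inter> (*) f ` hpoly (Suc n) t"
    then obtain h where h: "g = f * h" "h \<in> hpoly (Suc n) t" "f * h \<in> vpolys n C" by auto
    then have "h \<in> vpolys n C"
      using virreducible_prime[OF assms(1) hpoly_polys[OF assms(2)] hpoly_polys[OF h(2)]] assms(3) by blast
    then show "g \<in> (*) f ` (hpoly (Suc n) t \<inter> vpolys n C)" using h by blast
  qed
  show "(*) f ` (hpoly (Suc n) t \<inter> vpolys n C) \<subseteq> (hpoly (Suc n) (s + t) \<inter> vpolys n C) \<inter> (*) f ` hpoly (Suc n) t"
    using hpoly_mult[OF assms(2)] vpolys_mult hpoly_polys[OF assms(2)] by auto
qed

text \<open>Inside \<open>W\<close> lie the ideal in degree \<open>s + t\<close> and all multiples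
  of \<open>f\<close>. By primality they meet exactly in the multiples of \<open>f\<close> by
  elements of the ideal, so Grassmann's formula gives the bound. It is applied with \<open>W\<close>
  either all forms or those vanishing on a smaller set.\<close>

lemma ideal_dim_mult:
  fixes C :: "(nat \<Rightarrow> 'k::field_char_0) set"
  assumes "virreducible n C" "f \<in> hpoly (Suc n) s" "f \<notin> vpolys n C"
  shows "fin_dim W \<Longrightarrow> hpoly (Suc n) (s + t) \<inter> vpolys n C \<subseteq> W \<Longrightarrow> (*) f ` hpoly (Suc n) t \<subseteq> W \<Longrightarrow>
    ideal_dim n C (s + t) + mpoly.dim (hpoly (Suc n) t :: 'k mpoly set) \<le> mpoly.dim W + ideal_dim n C t"
proof -
  assume W: "fin_dim W" "hpoly (Suc n) (s + t) \<inter> vpolys n C \<subseteq> W" "(*) f ` hpoly (Suc n) t \<subseteq> W"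
  have f0: "f \<noteq> 0" using assms(3) by auto
  let ?U = "hpoly (Suc n) (s + t) \<inter> vpolys n C"
  let ?V = "(*) f ` hpoly (Suc n) t"
  have "mpoly.dim (sum_space ?U ?V) + mpoly.dim (?U \<inter> ?V) = mpoly.dim ?U + mpoly.dim ?V"
    by (rule fin_dim_dim_sum_space(2)[OF fin_dim_hpoly_vpolys fin_dim_dim_mult(1)[OF fin_dim_hpoly f0]]) simp
  moreover have "mpoly.dim (?U \<inter> ?V) = ideal_dim n C t"
    unfolding mult_vpolys_Int[OF assms] ideal_dim_def by (rule fin_dim_dim_mult(2)[OF fin_dim_hpoly_vpolys f0]) simp
  moreover have "mpoly.dim ?V = mpoly.dim (hpoly (Suc n) t :: 'k mpoly set)" by (rule fin_dim_dim_mult(2)[OF fin_dim_hpoly f0])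
  moreover have "mpoly.dim (sum_space ?U ?V) \<le> mpoly.dim W"
    by (rule fin_dim_dim_mono[OF W(1) sum_space_subset[OF fin_dim_subspace[OF W(1)] W(2,3)]])
  ultimately show ?thesis by (simp add: ideal_dim_def)
qed

lemma hilb_mult_mono:
  fixes C :: "(nat \<Rightarrow> 'k::field_char_0) set"
  assumes "virreducible n C" shows "hilb n C t \<le> hilb n C (t + j)"
proof (induction j)
  case (Suc j)
  obtain x where x: "x \<in> C" using assms by (auto simp: virreducible_def)
  then have "x \<in> coords n" using assms vclosed_coords by (auto simp: virreducible_def)
  then obtain i where i: "x i \<noteq> 0" "i \<le> n" by (auto simp: coords_def) (metis not_le)
  have "X i \<notin> vpolys n C" using x i by (auto simp: vpolys_def)
  then have "ideal_dim n C (1 + (t + j)) + mpoly.dim (hpoly (Suc n) (t + j) :: 'k mpoly set) \<le>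
      mpoly.dim (hpoly (Suc n) (1 + (t + j)) :: 'k mpoly set) + ideal_dim n C (t + j)"
  proof (intro ideal_dim_mult[OF assms hpoly_X _ fin_dim_hpoly])
    show "(*) (X i) ` hpoly (Suc n) (t + j) \<subseteq> hpoly (Suc n) (1 + (t + j))"
      using i(2) by (intro image_subsetI hpoly_mult[OF hpoly_X]) auto
  qed (use i in auto)
  then show ?case using Suc by (simp add: hilb_def)
qed simp

text \<open>Take a form \<open>f\<close> of degree \<open>s\<close> that vanishes on
  \<open>C'\<close> but not on \<open>C\<close>. Multiplication by \<open>f\<close> is injective
  modulo the prime ideal of \<open>C\<close>, and its image dies on \<open>C'\<close>.\<close>

lemma hilb_step:
  fixes C :: "(nat \<Rightarrow> 'k::field_char_0) set"
  assumes C: "virreducible n C" and C': "virreducible n C'" "C' \<subset> C"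
  shows "\<exists>s. \<forall>t. hilb n C' (s + t) + hilb n C t \<le> hilb n C (s + t)"
proof -
  obtain x where x: "x \<in> C" "x \<notin> C'" using C'(2) by blast
  have xc: "x \<in> coords n" using x C vclosed_coords by (auto simp: virreducible_def)
  obtain s f where f: "f \<in> hpoly (Suc n) s" "f \<in> vpolys n C'" "peval f x \<noteq> 0"
    using vclosed_sep[OF _ xc x(2)] C' by (auto simp: virreducible_def)
  have fC: "f \<notin> vpolys n C" using f x by (auto simp: vpolys_def)
  have "hilb n C' (s + t) + hilb n C t \<le> hilb n C (s + t)" for t
  proof -
    have "ideal_dim n C (s + t) + mpoly.dim (hpoly (Suc n) t :: 'k mpoly set) \<le>
      mpoly.dim (hpoly (Suc n) (s + t) \<inter> vpolys n C') + ideal_dim n C t"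
    proof (rule ideal_dim_mult[OF C f(1) fC fin_dim_hpoly_vpolys])
      show "hpoly (Suc n) (s + t) \<inter> vpolys n C \<subseteq> hpoly (Suc n) (s + t) \<inter> vpolys n C'"
        using vpolys_mono[of C' C n] C'(2) by blast
      show "(*) f ` hpoly (Suc n) t \<subseteq> hpoly (Suc n) (s + t) \<inter> vpolys n C'"
      proof
        fix g assume "g \<in> (*) f ` hpoly (Suc n) t"
        then obtain h where h: "g = f * h" "h \<in> hpoly (Suc n) t" by blast
        then show "g \<in> hpoly (Suc n) (s + t) \<inter> vpolys n C'"
          using hpoly_mult[OF f(1) h(2)] vpolys_mult[OF f(2) hpoly_polys[OF h(2)]] by (simp add: mult.commute)
      qed
    qed simp
    then show ?thesis by (simp add: hilb_def ideal_dim_def)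
  qed
  then show ?thesis by blast
qed

text \<open>Each step of the chain raises the order of growth by one, by summing
  \<open>hilb_step\<close> over many consecutive shifts. The factor \<open>c\<close> restricts to a
  sequence of degrees along which the bound has no further constants.\<close>

lemma chain_growth:
  fixes C :: "nat \<Rightarrow> (nat \<Rightarrow> 'k::field_char_0) set"
  shows "\<forall>i\<le>k. virreducible n (C i) \<Longrightarrow> \<forall>i<k. C i \<subset> C (Suc i) \<Longrightarrow>
    \<exists>c\<ge>1. \<forall>T. (int T + 1) ^ k \<le> hilb n (C k) (c * T)"
proof (induction k)
  case 0
  then have C: "virreducible n (C 0)" by simp
  then obtain x where x: "x \<in> C 0" by (auto simp: virreducible_def)
  have "hpoly (Suc n) 0 \<inter> vpolys n (C 0) \<subset> hpoly (Suc n) 0"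
  proof -
    have "1 \<notin> vpolys n (C 0)" using x by (auto simp: vpolys_def)
    then show ?thesis using hpoly_1 by blast
  qed
  from fin_dim_dim_strict_mono[OF fin_dim_hpoly fin_dim_subspace[OF fin_dim_hpoly_vpolys] this]
  have "1 \<le> hilb n (C 0) 0" by (simp add: hilb_def ideal_dim_def)
  then have "(int T + 1) ^ 0 \<le> hilb n (C 0) (1 * T)" for T
    using hilb_mult_mono[OF C, of 0 T] by simp
  then show ?case by blast
next
  case (Suc k)
  have Ck: "virreducible n (C k)" "virreducible n (C (Suc k))" "C k \<subset> C (Suc k)" using Suc.prems by auto
  obtain c where c: "c \<ge> 1" "\<forall>T. (int T + 1) ^ k \<le> hilb n (C k) (c * T)"
    using Suc.IH Suc.prems by auto
  obtain s where s: "\<forall>t. hilb n (C k) (s + t) + hilb n (C (Suc k)) t \<le> hilb n (C (Suc k)) (s + t)"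
    using hilb_step[OF Ck(2,1,3)] by blast
  \<comment> \<open>Applying \<open>hilb_step\<close> successively \<open>j\<close> times, each
    application contributes at least \<open>hilb n (C k) T\<close>, by monotonicity in the
    degree.\<close>
  have tel: "(int j + 1) * hilb n (C k) T \<le> hilb n (C (Suc k)) (T + j * s)" for j T
  proof (induction j)
    case 0
    then show ?case using hilb_mono[of "C k" "C (Suc k)" n T] Ck by auto
  next
    case (Suc j)
    have "hilb n (C k) (s + (T + j * s)) + hilb n (C (Suc k)) (T + j * s) \<le> hilb n (C (Suc k)) (s + (T + j * s))"
      using s by blast
    moreover have "hilb n (C k) T \<le> hilb n (C k) (s + (T + j * s))"
      using hilb_mult_mono[OF Ck(1), of T "s + j * s"] by (simp add: algebra_simps)
    ultimately show ?case using Suc by (simp add: algebra_simps)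
  qed
  have "(int T + 1) ^ Suc k \<le> hilb n (C (Suc k)) ((c * (1 + s)) * T)" for T
  proof -
    have "1 * int T \<le> int c * int T" using c(1) by (intro mult_right_mono) auto
    then have "int T \<le> int (c * T)" by simp
    then have "(int T + 1) * (int T + 1) ^ k \<le> (int (c * T) + 1) * hilb n (C k) (c * T)"
      using c(2) by (intro mult_mono) auto
    also have "\<dots> \<le> hilb n (C (Suc k)) (c * T + (c * T) * s)" by (rule tel)
    finally show ?thesis by (simp add: algebra_simps)
  qed
  moreover have "c * (1 + s) \<ge> 1" using c(1) by simp
  ultimately show ?case by blast
qed

lemma chain_length_le:
  fixes Z :: "(nat \<Rightarrow> 'k::field_char_0) set"
  assumes "vchain n Z k" and bd: "\<And>t. hilb n Z t \<le> int K * (int t + 1) ^ r"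
  shows "k \<le> r"
proof (rule ccontr)
  assume "\<not> k \<le> r"
  then obtain l where l: "k = Suc (r + l)" by (metis add_Suc_right less_iff_Suc_add not_le)
  obtain C where C: "\<forall>i\<le>k. virreducible n (C i) \<and> C i \<subseteq> Z" "\<forall>i<k. C i \<subset> C (Suc i)"
    using assms(1) by (auto simp: vchain_def)
  obtain c where c: "c \<ge> 1" "\<forall>T. (int T + 1) ^ k \<le> hilb n (C k) (c * T)"
    using chain_growth[of k n C] C by auto
  \<comment> \<open>With this value the upper bound \<open>K * c ^ r * (T + 1) ^ r\<close> equals
    \<open>T * (T + 1) ^ r\<close>, just below the lower bound
    \<open>(T + 1) ^ Suc r\<close>.\<close>
  define T where "T = K * c ^ r"
  have "(int T + 1) ^ Suc r \<le> (int T + 1) ^ k"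
    unfolding l by (rule power_increasing) auto
  also have "\<dots> \<le> hilb n (C k) (c * T)" using c by blast
  also have "\<dots> \<le> hilb n Z (c * T)" by (rule hilb_mono) (use C in auto)
  also have "\<dots> \<le> int K * (int (c * T) + 1) ^ r" by (rule bd)
  also have "\<dots> \<le> int K * (int c * (int T + 1)) ^ r"
    using c(1) by (intro mult_left_mono power_mono) (auto simp: algebra_simps)
  also have "\<dots> = (int K * int c ^ r) * (int T + 1) ^ r" by (simp only: power_mult_distrib mult_ac)
  also have "int K * int c ^ r = int T" by (simp add: T_def)
  finally have "(int T + 1) * (int T + 1) ^ r \<le> int T * (int T + 1) ^ r" by simp
  moreover have "(int T + 1) ^ r > 0" by simp
  ultimately show False by (simp add: distrib_right)
qed

subsection \<open>Coefficients of a form with respect to one variable\<close>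

text \<open>Homogeneity of total degree \<open>s\<close> when the variable of the univariate
  polynomial counts with degree 1. The case \<open>j > s\<close> is separate because
  \<open>s - j\<close> truncates.\<close>

definition graded :: "nat \<Rightarrow> nat \<Rightarrow> 'k::comm_ring_1 mpoly poly \<Rightarrow> bool" where
  "graded k s G \<longleftrightarrow> (\<forall>j. if j \<le> s then coeff G j \<in> hpoly k (s - j) else coeff G j = 0)"

lemma graded_mult: "graded k s G \<Longrightarrow> graded k t H \<Longrightarrow> graded k (s + t) (G * H)"
proof -
  assume G: "graded k s G" and H: "graded k t H"
  have z: "coeff G i * coeff H (j - i) \<in> hpoly k (s + t - j)" if "i \<le> j" "j \<le> s + t" for i j
  proof (cases "i \<le> s \<and> j - i \<le> t")
    case True
    then have "coeff G i * coeff H (j - i) \<in> hpoly k ((s - i) + (t - (j - i)))"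
      using G H by (intro hpoly_mult) (auto simp: graded_def split: if_splits)
    moreover have "(s - i) + (t - (j - i)) = s + t - j" using that True by auto
    ultimately show ?thesis by simp
  next
    case False
    then have "coeff G i = 0 \<or> coeff H (j - i) = 0"
      using G H unfolding graded_def by (metis not_le)
    then show ?thesis by auto
  qed
  have z2: "coeff G i * coeff H (j - i) = 0" if "j > s + t" for i j
  proof -
    have "i > s \<or> j - i > t" using that by linarith
    then have "coeff G i = 0 \<or> coeff H (j - i) = 0"
      using G H unfolding graded_def by (metis not_le)
    then show ?thesis by auto
  qed
  show ?thesis
    unfolding graded_def
  proof (intro allI)
    fix j
    show "if j \<le> s + t then coeff (G * H) j \<in> hpoly k (s + t - j) else coeff (G * H) j = 0"
      unfolding coeff_mult using z z2 by (auto intro!: hpoly_sum sum.neutral)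
  qed
qed

lemma graded_add: "graded k s G \<Longrightarrow> graded k s H \<Longrightarrow> graded k s (G + H)"
  unfolding graded_def by (auto simp: hpoly_add split: if_splits)

lemma graded_0 [simp]: "graded k s 0"
  by (simp add: graded_def)

lemma graded_const: "c \<in> hpoly k s \<Longrightarrow> graded k s [:c:]"
  by (auto simp: graded_def coeff_pCons split: nat.splits)

lemma graded_power: "graded k s G \<Longrightarrow> graded k (e * s) (G ^ e)"
  by (induction e) (auto simp: graded_mult one_pCons intro: graded_const)

lemma graded_prod: "(\<And>i. i \<in> S \<Longrightarrow> graded k (l i) (h i)) \<Longrightarrow> graded k (\<Sum>i\<in>S. l i) (\<Prod>i\<in>S. h i)"
  by (induction S rule: infinite_finite_induct) (auto simp: graded_mult one_pCons intro: graded_const)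

lemma graded_sum: "(\<And>i. i \<in> S \<Longrightarrow> graded k s (h i)) \<Longrightarrow> graded k s (\<Sum>i\<in>S. h i)"
  by (induction S rule: infinite_finite_induct) (auto simp: graded_add)

lemma graded_in_var: "F \<in> hpoly (Suc k) s \<Longrightarrow> graded k s (in_var k F)"
proof -
  assume F: "F \<in> hpoly (Suc k) s"
  show ?thesis
    unfolding in_var_def msubst_def
  proof (rule graded_sum)
    fix m assume m: "m \<in> Poly_Mapping.keys F"
    let ?g = "\<lambda>i. if i = k then [:0, 1:] else [:X i:] :: 'a mpoly poly"
    have g: "graded k 1 (?g i)" if "i \<in> Poly_Mapping.keys m" for i
    proof -
      have "i < Suc k" using that m F by (auto simp: hpoly_def polys_def)
      then show ?thesis using hpoly_X[of i k] by (auto simp: graded_def coeff_pCons split: nat.splits)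
    qed
    have "graded k (\<Sum>i\<in>Poly_Mapping.keys m. Poly_Mapping.lookup m i * 1) (monom_eval ?g m)"
      unfolding monom_eval_def by (rule graded_prod, rule graded_power, rule g)
    moreover have "(\<Sum>i\<in>Poly_Mapping.keys m. Poly_Mapping.lookup m i * 1) = s"
      using m F by (auto simp: hpoly_def monom_deg_def)
    ultimately have "graded k s (monom_eval ?g m)" by metis
    from graded_mult[OF graded_const[OF hpoly_Cst] this]
    show "graded k s ([:Cst (Poly_Mapping.lookup F m):] * monom_eval ?g m)" by simp
  qed
qed

definition unit_vec :: "nat \<Rightarrow> nat \<Rightarrow> 'k::zero_neq_one" where
  "unit_vec k i = (if i = k then 1 else 0)"

lemma hpoly_0_const: "F \<in> hpoly k 0 \<Longrightarrow> \<exists>c. F = Cst c"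
proof -
  assume F: "F \<in> hpoly k 0"
  have "m = 0" if "m \<in> Poly_Mapping.keys F" for m
  proof (rule poly_mapping_eqI)
    fix i
    have "(\<Sum>i\<in>Poly_Mapping.keys m. Poly_Mapping.lookup m i) = 0" using F that by (auto simp: hpoly_def monom_deg_def)
    then show "Poly_Mapping.lookup m i = Poly_Mapping.lookup 0 i"
      by (cases "i \<in> Poly_Mapping.keys m") (auto simp: in_keys_iff)
  qed
  then have "F = Cst (Poly_Mapping.lookup F 0)"
    by (intro poly_mapping_eqI) (auto simp: Cst_def lookup_single when_def in_keys_iff)
  then show ?thesis by blast
qed

text \<open>A form that does not vanish at the unit vector of index \<open>k\<close> is thus monic
  in \<open>X k\<close> up to a scalar. This links points outside a closed set with integral
  equations.\<close>

lemma in_var_lead: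
  fixes F :: "'k::field_char_0 mpoly"
  assumes F: "F \<in> hpoly (Suc k) s"
  shows "degree (in_var k F) \<le> s" "coeff (in_var k F) s = Cst (peval F (unit_vec k))"
proof -
  have g: "graded k s (in_var k F)" by (rule graded_in_var[OF F])
  show d: "degree (in_var k F) \<le> s" by (rule degree_le) (use g in \<open>auto simp: graded_def split: if_splits\<close>)
  obtain c where c: "coeff (in_var k F) s = Cst c"
  proof -
    have "coeff (in_var k F) s \<in> hpoly k 0" using g unfolding graded_def by (metis diff_self_eq_0 order_refl)
    then show thesis using hpoly_0_const that by blast
  qed
  have z: "peval (coeff (in_var k F) j) (\<lambda>_. 0) = 0" if "j < s" for j
  proof -
    have "coeff (in_var k F) j \<in> hpoly k (s - j)" using g that by (auto simp: graded_def dest: spec[of _ j])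
    from peval_hpoly_scale[OF this, of 0 "\<lambda>_. 0"] show ?thesis using that by (simp add: power_0_left)
  qed
  have u: "(unit_vec k :: nat \<Rightarrow> 'k) = (\<lambda>_. 0)(k := 1)" by (auto simp: unit_vec_def fun_eq_iff)
  have "peval F (unit_vec k) = eval2 (\<lambda>_. 0) (in_var k F) 1" unfolding u eval2_in_var ..
  also have "\<dots> = (\<Sum>j\<le>degree (in_var k F). peval (coeff (in_var k F) j) (\<lambda>_. 0))"
  proof -
    have "degree (map_poly (\<lambda>c. peval c (\<lambda>_. 0::'k)) (in_var k F)) \<le> degree (in_var k F)"
      by (rule degree_le) (simp add: peval.coeff_map coeff_eq_0)
    then have "poly (map_poly (\<lambda>c. peval c (\<lambda>_. 0::'k)) (in_var k F)) 1 =
        (\<Sum>j\<le>degree (in_var k F). coeff (map_poly (\<lambda>c. peval c (\<lambda>_. 0::'k)) (in_var k F)) j * 1 ^ j)"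
      unfolding poly_altdef by (intro sum.mono_neutral_left) (auto simp: coeff_eq_0)
    then show ?thesis unfolding eval2_def by (simp add: peval.coeff_map)
  qed
  also have "\<dots> = (\<Sum>j\<le>s. peval (coeff (in_var k F) j) (\<lambda>_. 0))"
    using d by (intro sum.mono_neutral_left) (auto simp: coeff_eq_0)
  also have "\<dots> = (\<Sum>j\<in>{s}. peval (coeff (in_var k F) j) (\<lambda>_. 0))"
    by (rule sum.mono_neutral_right) (auto simp: z)
  finally show "coeff (in_var k F) s = Cst (peval F (unit_vec k))" by (simp add: c)
qed

lemma hpoly_expand:
  assumes "F \<in> hpoly (Suc k) t"
  shows "F = (\<Sum>j\<le>t. coeff (in_var k F) j * X k ^ j)" "j \<le> t \<Longrightarrow> coeff (in_var k F) j \<in> hpoly k (t - j)"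
proof -
  have g: "graded k t (in_var k F)" by (rule graded_in_var[OF assms])
  have d: "degree (in_var k F) \<le> t" by (rule degree_le) (use g in \<open>auto simp: graded_def split: if_splits\<close>)
  have "F = poly (in_var k F) (X k)" by (simp add: poly_in_var)
  also have "\<dots> = (\<Sum>j\<le>degree (in_var k F). coeff (in_var k F) j * X k ^ j)" by (rule poly_altdef)
  also have "\<dots> = (\<Sum>j\<le>t. coeff (in_var k F) j * X k ^ j)"
    using d by (intro sum.mono_neutral_left) (auto simp: coeff_eq_0)
  finally show "F = (\<Sum>j\<le>t. coeff (in_var k F) j * X k ^ j)" .
  show "j \<le> t \<Longrightarrow> coeff (in_var k F) j \<in> hpoly k (t - j)" using g by (auto simp: graded_def dest: spec[of _ j])
qed

lemma sum_space_left: "0 \<in> W \<Longrightarrow> U \<subseteq> sum_space U W"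
  unfolding sum_space_def by (metis (mono_tags, lifting) add_0_right mem_Collect_eq subsetI)

lemma sum_space_right: "0 \<in> U \<Longrightarrow> W \<subseteq> sum_space U W"
  unfolding sum_space_def by (metis (mono_tags, lifting) add_0 mem_Collect_eq subsetI)

subsection \<open>Hilbert functions in the presence of monic relations\<close>

text \<open>The Hilbert function of the subring generated by the first \<open>k\<close> variables in
  the coordinate ring of \<open>A\<close>.\<close>

definition quot_dim :: "nat \<Rightarrow> (nat \<Rightarrow> 'k::field) set \<Rightarrow> nat \<Rightarrow> nat \<Rightarrow> nat" where
  "quot_dim n A k t = mpoly.dim (hpoly k t :: 'k mpoly set) - mpoly.dim (hpoly k t \<inter> vpolys n A)"

lemma quot_dim_eq:
  fixes A :: "(nat \<Rightarrow> 'k::field) set"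
  shows "k > 0 \<Longrightarrow> mpoly.dim (hpoly k t :: 'k mpoly set) = quot_dim n A k t + mpoly.dim (hpoly k t \<inter> vpolys n A)"
  using fin_dim_dim_mono[OF fin_dim_hp'[of k t], of "hpoly k t \<inter> vpolys n A"] by (simp add: quot_dim_def)

lemma hilb_quot_dim: "hilb n A t = int (quot_dim n A (Suc n) t)"
  using quot_dim_eq[of "Suc n" t n A] by (simp add: hilb_def ideal_dim_def)

text \<open>Powers of \<open>X k\<close> from the exponent \<open>s\<close> on are rewritten modulo
  the monic \<open>f\<close>, by induction on the exponent; the discarded multiples of
  \<open>f\<close> lie in the ideal and so in \<open>U\<close>.\<close>

lemma monic_reduction:
  fixes f :: "'k::field_char_0 mpoly"
  assumes k: "k \<le> n" and f: "f \<in> hpoly (Suc k) s" "f \<in> vpolys n A" "peval f (unit_vec k) \<noteq> 0"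
    and U: "mpoly.subspace U" and I: "hpoly (Suc k) t \<inter> vpolys n A \<subseteq> U"
    and low: "\<And>c j. j < s \<Longrightarrow> j \<le> t \<Longrightarrow> c \<in> hpoly k (t - j) \<Longrightarrow> c * X k ^ j \<in> U"
  shows "hpoly (Suc k) t \<subseteq> U"
proof -
  define \<kappa> where "\<kappa> = peval f (unit_vec k)"
  have red: "c * X k ^ j \<in> U" if "j \<le> t" "c \<in> hpoly k (t - j)" for c j
    using that
  proof (induction j arbitrary: c rule: less_induct)
    case (less j)
    show ?case
    proof (cases "j < s")
      case True
      then show ?thesis using low less.prems by blast
    next
      case False
      define c' where "c' = Cst (inverse \<kappa>) * c"
      have c': "c' \<in> hpoly k (t - j)" using hpoly_mult[OF hpoly_Cst less.prems(2)] by (simp add: c'_def)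
      have "f = (\<Sum>i\<le>s. coeff (in_var k f) i * X k ^ i)" by (rule hpoly_expand(1)[OF f(1)])
      also have "\<dots> = (\<Sum>i<s. coeff (in_var k f) i * X k ^ i) + Cst \<kappa> * X k ^ s"
        unfolding lessThan_Suc_atMost[symmetric] by (simp add: in_var_lead(2)[OF f(1)] \<kappa>_def)
      finally have fe: "f = (\<Sum>i<s. coeff (in_var k f) i * X k ^ i) + Cst \<kappa> * X k ^ s" .
      from arg_cong[OF fe, of "\<lambda>z. c' * X k ^ (j - s) * z"]
      have "c' * X k ^ (j - s) * f = (\<Sum>i<s. (c' * coeff (in_var k f) i) * (X k ^ (j - s) * X k ^ i)) +
          (Cst \<kappa> * Cst (inverse \<kappa>)) * c * (X k ^ (j - s) * X k ^ s)"
        by (simp add: distrib_left sum_distrib_left mult_ac c'_def)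
      also have "Cst \<kappa> * Cst (inverse \<kappa>) = 1"
        using f(3) by (simp add: \<kappa>_def flip: rhom.mult[OF rhom_Cst])
      finally have eq: "c * X k ^ j = c' * X k ^ (j - s) * f - (\<Sum>i<s. (c' * coeff (in_var k f) i) * X k ^ (j - s + i))"
        using False by (simp flip: power_add)
      have "c' * X k ^ (j - s) * f \<in> hpoly (Suc k) ((t - j) + (j - s) * 1 + s)"
        by (intro hpoly_mult hpoly_power hpoly_X hpoly_mono[OF c'] f) auto
      moreover have "(t - j) + (j - s) * 1 + s = t" using False less.prems by simp
      ultimately have h1: "c' * X k ^ (j - s) * f \<in> hpoly (Suc k) t" by metis
      have "c' * X k ^ (j - s) \<in> polys (Suc n)"
        using k by (intro polys_mult polys_power polys_X polys_mono[OF hpoly_polys[OF c']]) auto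
      then have "c' * X k ^ (j - s) * f \<in> U" using h1 vpolys_mult[OF f(2)] I by auto
      moreover have "(c' * coeff (in_var k f) i) * X k ^ (j - s + i) \<in> U" if "i < s" for i
      proof (rule less.IH)
        show "j - s + i < j" using that False by simp
        show "j - s + i \<le> t" using that False less.prems by simp
        have "c' * coeff (in_var k f) i \<in> hpoly k ((t - j) + (s - i))"
          by (rule hpoly_mult[OF c' hpoly_expand(2)[OF f(1)]]) (use that in simp)
        moreover have "(t - j) + (s - i) = t - (j - s + i)" using that False less.prems by simp
        ultimately show "c' * coeff (in_var k f) i \<in> hpoly k (t - (j - s + i))" by simp
      qed
      ultimately show ?thesis
        unfolding eq by (intro mpoly.subspace_diff[OF U] mpoly.subspace_sum[OF U]) auto
    qed
  qed
  show ?thesis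
  proof
    fix F :: "'k mpoly" assume F: "F \<in> hpoly (Suc k) t"
    have "(\<Sum>j\<le>t. coeff (in_var k F) j * X k ^ j) \<in> U"
      by (intro mpoly.subspace_sum[OF U] red hpoly_expand(2)[OF F]) auto
    then show "F \<in> U" using hpoly_expand(1)[OF F] by simp
  qed
qed

text \<open>A new variable with a monic equation of degree \<open>s\<close> contributes only its
  powers below \<open>s\<close>. The space of all forms is exhausted by adding the subspaces
  \<open>W j\<close> one at a time to the ideal, and each adds at most \<open>B\<close> dimensions,
  because multiples of ideal elements are present from the start.\<close>

lemma quot_dim_step:
  fixes A :: "(nat \<Rightarrow> 'k::field_char_0) set"
  assumes k: "k > 0" "k \<le> n" and f: "f \<in> hpoly (Suc k) s" "f \<in> vpolys n A" "peval f (unit_vec k) \<noteq> 0"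
    and bd: "\<And>t'. t' \<le> t \<Longrightarrow> quot_dim n A k t' \<le> B"
  shows "quot_dim n A (Suc k) t \<le> s * B"
proof -
  define I where "I = hpoly (Suc k) t \<inter> vpolys n A"
  define W where "W j = (*) (X k ^ j) ` (hpoly k (t - j) :: 'k mpoly set)" for j
  \<comment> \<open>The guard \<open>j \<le> t\<close> skips powers exceeding the degree, for which
    \<open>t - j\<close> would truncate to 0.\<close>
  define E where "E r = rec_nat I (\<lambda>j U. if j \<le> t then sum_space U (W j) else U) r" for r
  have E0: "E 0 = I" and ES: "E (Suc r) = (if r \<le> t then sum_space (E r) (W r) else E r)" for r
    by (simp_all add: E_def)
  have X0: "X k ^ j \<noteq> (0::'k mpoly)" for j
    by (metis peval_0 peval_X peval.power power_not_zero one_neq_zero)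
  have fdI: "fin_dim I" unfolding I_def by (rule fin_dim_hpoly_vpolys) simp
  have fdW: "fin_dim (W j)" "mpoly.dim (W j) = mpoly.dim (hpoly k (t - j) :: 'k mpoly set)" for j
    unfolding W_def using fin_dim_dim_mult[OF fin_dim_hp'[OF k(1)] X0] by auto
  have fdE: "fin_dim (E r)" for r by (induction r) (auto simp: E0 ES fdI fin_dim_dim_sum_space(1) fdW)
  have 0: "0 \<in> W j" "0 \<in> E r" for j r
    using fdW(1) fdE mpoly.subspace_0 fin_dim_subspace by blast+
  have EI: "I \<subseteq> E r" for r
  proof (induction r)
    case (Suc r)
    have "E r \<subseteq> sum_space (E r) (W r)" by (rule sum_space_left[OF 0(1)])
    then show ?case using Suc by (auto simp: ES)
  qed (simp add: E0)
  have EW: "W j \<subseteq> E r" if "j < r" "j \<le> t" for j r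
    using that
  proof (induction r)
    case (Suc r)
    have a: "E r \<subseteq> sum_space (E r) (W r)" by (rule sum_space_left[OF 0(1)])
    have b: "W r \<subseteq> sum_space (E r) (W r)" by (rule sum_space_right[OF 0(2)])
    show ?case
    proof (cases "j = r")
      case True then show ?thesis using b Suc.prems by (simp add: ES)
    next
      case False
      then have "W j \<subseteq> E r" using Suc by simp
      then show ?thesis using a by (auto simp: ES)
    qed
  qed simp
  have dimE: "mpoly.dim (E r) \<le> mpoly.dim I + r * B" for r
  proof (induction r)
    case (Suc r)
    show ?case
    proof (cases "r \<le> t")
      case True
      have s: "mpoly.dim (sum_space (E r) (W r)) + mpoly.dim (E r \<inter> W r) = mpoly.dim (E r) + mpoly.dim (W r)"
        by (rule fin_dim_dim_sum_space(2)[OF fdE fdW(1)])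
      have "(*) (X k ^ r) ` (hpoly k (t - r) \<inter> vpolys n A) \<subseteq> E r \<inter> W r"
      proof
        fix g assume "g \<in> (*) (X k ^ r) ` (hpoly k (t - r) \<inter> vpolys n A)"
        then obtain h where h: "g = X k ^ r * h" "h \<in> hpoly k (t - r)" "h \<in> vpolys n A" by blast
        have "X k ^ r * h \<in> hpoly (Suc k) (r * 1 + (t - r))"
          using h by (intro hpoly_mult hpoly_power hpoly_X hpoly_mono[OF h(2)]) auto
        then have "g \<in> I" using True h k by (auto simp: I_def intro!: vpolys_mult polys_power polys_X)
        then show "g \<in> E r \<inter> W r" using EI h by (auto simp: W_def)
      qed
      then have "mpoly.dim ((*) (X k ^ r) ` (hpoly k (t - r) \<inter> vpolys n A)) \<le> mpoly.dim (E r \<inter> W r)"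
        by (rule fin_dim_dim_mono[rotated]) (rule fin_dim_subset[OF fdE mpoly.subspace_inter], auto intro: fin_dim_subspace fdE fdW)
      then have "mpoly.dim (hpoly k (t - r) \<inter> vpolys n A) \<le> mpoly.dim (E r \<inter> W r)"
        by (simp add: fin_dim_dim_mult(2)[OF fin_dim_hpoly_vpolys[OF k(1)] X0])
      moreover have "mpoly.dim (W r) = quot_dim n A k (t - r) + mpoly.dim (hpoly k (t - r) \<inter> vpolys n A)"
        using fdW(2) quot_dim_eq[OF k(1)] by metis
      moreover have "quot_dim n A k (t - r) \<le> B" by (rule bd) simp
      ultimately have "mpoly.dim (sum_space (E r) (W r)) \<le> mpoly.dim (E r) + B" using s by linarith
      then show ?thesis using Suc True by (simp add: ES)
    next
      case False
      then show ?thesis using Suc by (simp add: ES)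
    qed
  qed (simp add: E0)
  have "hpoly (Suc k) t \<subseteq> E s"
  proof (rule monic_reduction[OF k(2) f fin_dim_subspace[OF fdE] EI[unfolded I_def]])
    fix c :: "'k mpoly" and j assume j: "j < s" "j \<le> t" "c \<in> hpoly k (t - j)"
    have "c * X k ^ j \<in> W j" using j(3) by (auto simp: W_def mult.commute)
    then show "c * X k ^ j \<in> E s" using EW[OF j(1,2)] by (rule subsetD[rotated])
  qed
  then have "mpoly.dim (hpoly (Suc k) t :: 'k mpoly set) \<le> mpoly.dim I + s * B"
    using fin_dim_dim_mono[OF fdE] dimE le_trans by metis
  then show ?thesis by (simp add: quot_dim_def I_def)
qed

lemma choose_diff_bound:
  "((t + Suc l) choose Suc l) - (if a \<le> t then (t - a + Suc l) choose Suc l else 0) \<le> a * ((t + l) choose l)"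
proof -
  define b where "b x = (x + Suc l) choose Suc l" for x
  define u where "u = (t + l) choose l"
  have "b t - (if a \<le> t then b (t - a) else 0) \<le> a * u"
  proof (induction a)
    case (Suc a)
    show ?case
    proof (cases "a < t")
      case True
      then obtain r where r: "t - a = Suc r" "t - Suc a = r" by (metis Suc_diff_Suc)
      have "b (t - a) = b (t - Suc a) + ((t - a + l) choose l)"
        unfolding r b_def by simp
      moreover have "(t - a + l) choose l \<le> u" unfolding u_def by (rule binomial_right_mono) simp
      ultimately show ?thesis using Suc True by simp
    next
      case False
      have "0 < u" unfolding u_def by (rule zero_less_binomial) simp
      moreover have "b 0 = 1" by (simp add: b_def)
      ultimately show ?thesis using Suc False by (cases "a = t") auto
    qed
  qed simp
  then show ?thesis by (simp only: b_def u_def)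
qed

text \<open>The multiples of \<open>a\<close> already account for all forms of degree
  \<open>t - \<alpha>\<close>, and the remaining difference of binomial coefficients is a sum of at
  most \<alpha> terms of order \<open>l\<close>: the growth of a hypersurface in P^(l+1).\<close>

lemma quot_dim_base:
  fixes A :: "(nat \<Rightarrow> 'k::field_char_0) set"
  assumes m: "m = Suc (Suc l)" "m \<le> Suc n" and a: "a \<in> hpoly m \<alpha>" "a \<noteq> 0" "a \<in> vpolys n A"
  shows "quot_dim n A m t \<le> \<alpha> * ((t + l) choose l)"
proof -
  have d: "mpoly.dim (hpoly m t :: 'k mpoly set) = (t + Suc l) choose Suc l" for t
    unfolding m(1) by (rule dim_hpoly)
  have "(if \<alpha> \<le> t then (t - \<alpha> + Suc l) choose Suc l else 0) \<le> mpoly.dim (hpoly m t \<inter> vpolys n A)"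
  proof (cases "\<alpha> \<le> t")
    case True
    have "(*) a ` hpoly m (t - \<alpha>) \<subseteq> hpoly m t \<inter> vpolys n A"
    proof
      fix g assume "g \<in> (*) a ` hpoly m (t - \<alpha>)"
      then obtain h where h: "g = a * h" "h \<in> hpoly m (t - \<alpha>)" by blast
      have "a * h \<in> hpoly m (\<alpha> + (t - \<alpha>))" by (rule hpoly_mult[OF a(1) h(2)])
      moreover have "h * a \<in> vpolys n A" by (rule vpolys_mult[OF a(3) polys_mono[OF hpoly_polys[OF h(2)] m(2)]])
      ultimately show "g \<in> hpoly m t \<inter> vpolys n A" using True h by (simp add: mult.commute)
    qed
    then have "mpoly.dim ((*) a ` hpoly m (t - \<alpha>)) \<le> mpoly.dim (hpoly m t \<inter> vpolys n A)"
      by (rule fin_dim_dim_mono[rotated]) (rule fin_dim_hpoly_vpolys, simp add: m)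
    then show ?thesis using True by (simp add: fin_dim_dim_mult(2)[OF fin_dim_hp' a(2)] m d[unfolded m])
  qed simp
  then show ?thesis using choose_diff_bound[of t l \<alpha>] unfolding quot_dim_def d by linarith
qed



section \<open>Projections\<close>

text \<open>The coordinates of index at least \<open>m\<close> of \<open>b\<close> are free parameters, so that coefficients can be
  taken in the whole polynomial ring instead of a subring. With \<open>\<epsilon> = 1\<close> the value of \<open>X m\<close> is the
  slope of a variable projection.\<close>

definition rel_ideal :: "nat \<Rightarrow> 'k::comm_ring_1 \<Rightarrow> (nat \<Rightarrow> 'k) set \<Rightarrow> 'k mpoly poly set" where
  "rel_ideal m \<epsilon> A = {G. \<forall>x\<in>A. \<forall>b. (\<forall>i<m. b i = x i) \<longrightarrow> eval2 b G (x m + \<epsilon> * b m * x (Suc m)) = 0}"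

lemma rel_ideal_add: "G \<in> rel_ideal m \<epsilon> A \<Longrightarrow> H \<in> rel_ideal m \<epsilon> A \<Longrightarrow> G + H \<in> rel_ideal m \<epsilon> A"
  by (simp add: rel_ideal_def eval2.add)

lemma rel_ideal_diff: "G \<in> rel_ideal m \<epsilon> A \<Longrightarrow> H \<in> rel_ideal m \<epsilon> A \<Longrightarrow> G - H \<in> rel_ideal m \<epsilon> A"
  by (simp add: rel_ideal_def eval2.diff)

lemma rel_ideal_mult: "G \<in> rel_ideal m \<epsilon> A \<Longrightarrow> H * G \<in> rel_ideal m \<epsilon> A"
  by (simp add: rel_ideal_def eval2.mult)

lemma rel_ideal_power: "G ^ n \<in> rel_ideal m \<epsilon> A \<Longrightarrow> G \<in> rel_ideal m (\<epsilon>::'k::field) A"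
  by (simp add: rel_ideal_def eval2.power)

lemma rel_ideal_in_var:
  assumes "F \<in> vpolys n A" "F \<in> polys (Suc k)" shows "in_var k F \<in> rel_ideal k 0 A"
  unfolding rel_ideal_def
proof (intro CollectI ballI allI impI)
  fix x b assume x: "x \<in> A" and b: "\<forall>i<k. b i = x i"
  have "peval F (b(k := x k)) = peval F x"
    by (rule peval_cong[OF assms(2)]) (use b in \<open>auto simp: less_Suc_eq\<close>)
  then show "eval2 b (in_var k F) (x k + 0 * b k * x (Suc k)) = 0"
    using vidD[OF assms(1) x] by (simp add: eval2_in_var)
qed

text \<open>The Nullstellensatz in one variable: a nonzero element of least degree divides the whole
  ideal, so any root of it would be a common root.\<close>

lemma ex_common_root_or_unit:
  fixes \<aa> :: "'k::alg_closed_field poly set"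
  assumes add: "\<And>p q. p \<in> \<aa> \<Longrightarrow> q \<in> \<aa> \<Longrightarrow> p - q \<in> \<aa>" and mult: "\<And>p r. p \<in> \<aa> \<Longrightarrow> r * p \<in> \<aa>"
    and root: "\<And>c. \<exists>p\<in>\<aa>. poly p c \<noteq> 0"
  shows "\<exists>\<kappa>. \<kappa> \<noteq> 0 \<and> [:\<kappa>:] \<in> \<aa>"
proof -
  define p where "p = arg_min degree (\<lambda>p. p \<in> \<aa> \<and> p \<noteq> 0)"
  obtain p0 where "p0 \<in> \<aa>" "poly p0 0 \<noteq> 0" using root[of 0] by blast
  then have "p0 \<in> \<aa> \<and> p0 \<noteq> 0" by auto
  then have p: "p \<in> \<aa>" "p \<noteq> 0" "\<And>q. q \<in> \<aa> \<Longrightarrow> q \<noteq> 0 \<Longrightarrow> degree p \<le> degree q"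
    using arg_min_nat_lemma[of "\<lambda>p. p \<in> \<aa> \<and> p \<noteq> 0" p0 degree] unfolding p_def by blast+
  have dv: "p dvd q" if q: "q \<in> \<aa>" for q
  proof -
    obtain a r where ar: "a \<noteq> 0" "smult a q = p * r + pseudo_mod q p"
      using pseudo_mod(1)[OF p(2), of q] by auto
    have "pseudo_mod q p = [:a:] * q - r * p" using ar by (simp add: mult.commute)
    moreover have "[:a:] * q - r * p \<in> \<aa>" by (rule add[OF mult[OF q] mult[OF p(1)]])
    ultimately have "pseudo_mod q p \<in> \<aa>" by metis
    then have "pseudo_mod q p = 0"
      using pseudo_mod(2)[OF p(2), of q] p(3) leD by blast
    then have "p dvd smult a q" using ar by simp
    then show ?thesis using ar(1) by (rule dvd_smult_cancel)
  qed
  have "degree p = 0"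
  proof (rule ccontr)
    assume "degree p \<noteq> 0"
    then obtain c where c: "poly p c = 0" using alg_closed_imp_poly_has_root by blast
    obtain q where "q \<in> \<aa>" "poly q c \<noteq> 0" using root by blast
    then show False using dv[of q] c by (auto elim!: dvdE)
  qed
  then obtain \<kappa> where "p = [:\<kappa>:]" by (rule degree_eq_zeroE)
  then show ?thesis using p by auto
qed

lemma unit_vec_coords: "k \<le> n \<Longrightarrow> unit_vec k \<in> coords n"
  by (auto simp: coords_def unit_vec_def)

lemma in_var_lead_coeff:
  fixes F :: "'k::field_char_0 mpoly"
  assumes "F \<in> hpoly (Suc k) s" "peval F (unit_vec k) \<noteq> 0"
  shows "degree (in_var k F) = s" "lead_coeff (in_var k F) = Cst (peval F (unit_vec k))"
proof -
  show "degree (in_var k F) = s"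
    using in_var_lead[OF assms(1)] assms(2) by (intro antisym le_degree) auto
  then show "lead_coeff (in_var k F) = Cst (peval F (unit_vec k))" using in_var_lead(2)[OF assms(1)] by simp
qed

text \<open>The image of \<open>A\<close> under the projection from a point outside \<open>A\<close>
  is closed. Over a point \<open>y\<close> not in the image, the relations specialise to an ideal
  containing a nonzero constant; a relation with this specialisation and a monic one yield, by
  elimination, a relation free of the last variable that does not vanish at
  \<open>y\<close>.\<close>

lemma projection_sep:
  fixes A :: "(nat \<Rightarrow> 'k::{alg_closed_field,field_char_0}) set"
  assumes A: "vclosed n A" and e: "unit_vec n \<notin> A"
    and y: "y \<in> coords n" "y n = 0" and nA: "\<And>c. y(n := c) \<notin> A"
  shows "\<exists>t g. g \<in> hpoly n t \<and> g \<in> vpolys n A \<and> peval g y \<noteq> 0"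
proof -
  let ?J = "rel_ideal n 0 A"
  let ?e = "\<lambda>F. peval F y"
  obtain s f0 where f0: "f0 \<in> hpoly (Suc n) s" "f0 \<in> vpolys n A" "peval f0 (unit_vec n) \<noteq> 0"
    using vclosed_sep[OF A unit_vec_coords e] by auto
  have t0: "in_var n f0 \<in> ?J" "?e (lead_coeff (in_var n f0)) \<noteq> 0"
    using rel_ideal_in_var[OF f0(2) hpoly_polys[OF f0(1)]] in_var_lead_coeff(2)[OF f0(1,3)] f0(3) by simp_all
  let ?M = "map_poly ?e"
  \<comment> \<open>A common root \<open>c\<close> of the specialised relations would make
    \<open>y(n := c)\<close> a point of \<open>A\<close>.\<close>
  have "\<exists>\<kappa>. \<kappa> \<noteq> 0 \<and> [:\<kappa>:] \<in> ?M ` ?J"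
  proof (rule ex_common_root_or_unit)
    fix p q assume "p \<in> ?M ` ?J" "q \<in> ?M ` ?J"
    then obtain P Q where "p = ?M P" "q = ?M Q" "P \<in> ?J" "Q \<in> ?J" by blast
    moreover have "?M (P - Q) = ?M P - ?M Q" by (rule rhom.diff[OF peval.rhom_map_poly])
    ultimately show "p - q \<in> ?M ` ?J" using rel_ideal_diff by (metis imageI)
  next
    fix p r assume "p \<in> ?M ` ?J"
    then obtain P where P: "p = ?M P" "P \<in> ?J" by blast
    have "?M (map_poly Cst r) = r" by (rule poly_eqI) (simp add: peval.coeff_map rhom.coeff_map[OF rhom_Cst])
    then have "r * p = ?M (map_poly Cst r * P)" by (simp add: P peval.map_poly_mult)
    then show "r * p \<in> ?M ` ?J" using rel_ideal_mult[OF P(2)] by blast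
  next
    fix c
    have "y(n := c) \<in> coords n" using y by (fastforce simp: coords_def)
    then obtain t F where F: "F \<in> hpoly (Suc n) t" "F \<in> vpolys n A" "peval F (y(n := c)) \<noteq> 0"
      using vclosed_sep[OF A _ nA] by blast
    have "poly (?M (in_var n F)) c = peval F (y(n := c))" using eval2_in_var[of y n F c] by (simp add: eval2_def)
    then show "\<exists>p\<in>?M ` ?J. poly p c \<noteq> 0"
      using F(3) by (intro bexI[of _ "?M (in_var n F)"] imageI rel_ideal_in_var[OF F(2) hpoly_polys[OF F(1)]]) simp
  qed
  then obtain \<kappa> f1 where f1: "\<kappa> \<noteq> 0" "f1 \<in> ?J" "?M f1 = [:\<kappa>:]" by (metis imageE)
  have cf: "?e (coeff f1 j) = coeff [:\<kappa>:] j" for j using f1(3) peval.coeff_map by metis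
  have "\<exists>g. [:g:] \<in> ?J \<and> ?e g \<noteq> 0"
  proof (rule resultant_elimination[OF peval.rhom_axioms rel_ideal_diff rel_ideal_mult t0 f1(2)])
    show "?e (coeff f1 0) \<noteq> 0" using cf[of 0] f1(1) by simp
    show "\<And>j. j > 0 \<Longrightarrow> ?e (coeff f1 j) = 0" using cf by (simp add: coeff_pCons split: nat.splits)
  qed
  then obtain g where g: "[:g:] \<in> ?J" "peval g y \<noteq> 0" by blast
  \<comment> \<open>The relation holds for all values of the free parameters, that is, of the
    variables of index at least \<open>n\<close>. Freezing them at the values of \<open>y\<close>
    keeps it nonzero at \<open>y\<close>.\<close>
  define g' where "g' = msubst Cst (\<lambda>i. if i < n then X i else Cst (y i)) g"
  have g'p: "g' \<in> polys n"
  proof -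
    obtain k where "g \<in> polys k" using ex_polys by blast
    then show ?thesis unfolding g'_def by (rule msubst_polys) auto
  qed
  have pg': "peval g' b = peval g (\<lambda>i. if i < n then b i else y i)" for b
    unfolding g'_def peval_msubst_Cst by (rule arg_cong[of _ _ "peval g"]) auto
  have g'v: "g' \<in> vpolys n A"
  proof (rule vidI)
    show "g' \<in> polys (Suc n)" by (rule polys_mono[OF g'p]) simp
    fix x assume "x \<in> A"
    then have "\<forall>b. (\<forall>i<n. b i = x i) \<longrightarrow> eval2 b [:g:] (x n + 0 * b n * x (Suc n)) = 0"
      using g(1) unfolding rel_ideal_def by blast
    from spec[OF this, of "\<lambda>i. if i < n then x i else y i"]
    show "peval g' x = 0" by (simp add: pg')
  qed
  have "peval g' y \<noteq> 0" using g(2) by (simp add: pg' if_distrib)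
  then obtain t where "peval (hcomp t g') y \<noteq> 0"
    using sum_hcomp[of g'] by (metis (no_types, lifting) peval.sum sum.neutral)
  then show ?thesis using hcomp_hpoly[OF g'p] vpolys_hcomp[OF A g'v] by blast
qed

lemma X_nonzero [simp]: "X i \<noteq> (0::'k::comm_ring_1 mpoly)"
proof
  assume "X i = (0::'k mpoly)"
  then have "peval (X i) (\<lambda>_. 1::'k) = peval 0 (\<lambda>_. 1)" by simp
  then show False by simp
qed

subsection \<open>Closed sets with finite surjective projection have long chains\<close>

text \<open>Surjectivity of the projection that forgets coordinate \<open>n\<close>, onto the linear
  subspace where all coordinates of index above \<open>k\<close> vanish; it is used for
  \<open>k < n\<close>.\<close>

definition surj_onto :: "nat \<Rightarrow> nat \<Rightarrow> (nat \<Rightarrow> 'k::field) set \<Rightarrow> bool" where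
  "surj_onto n k W \<longleftrightarrow> (\<forall>y\<in>coords n. (\<forall>i>k. y i = 0) \<longrightarrow> (\<exists>c. y(n := c) \<in> W))"

lemma vclosed_Inter: "C \<noteq> {} \<Longrightarrow> (\<And>B. B \<in> C \<Longrightarrow> vclosed n B) \<Longrightarrow> vclosed n (\<Inter>C)"
proof -
  assume C: "C \<noteq> {}" "\<And>B. B \<in> C \<Longrightarrow> vclosed n B"
  have "vclosure n (\<Inter>C) \<subseteq> \<Inter>C" using vclosure_minimal[OF C(2)] by blast
  moreover have "\<Inter>C \<subseteq> vclosure n (\<Inter>C)" by (rule vclosure_superset) (use C vclosed_coords in blast)
  ultimately have "vclosure n (\<Inter>C) = \<Inter>C" by simp
  then show ?thesis using vclosed_vclosure by metis
qed

text \<open>Zorn's lemma for complements. Surjectivity passes to the intersection of a chain since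
  the fibres are finite, being contained in the zeros of a monic polynomial: along the chain, a
  fibre with fewest elements is contained in all the others.\<close>

lemma minimal_surj_onto:
  fixes W :: "(nat \<Rightarrow> 'k::{alg_closed_field,field_char_0}) set"
  assumes W: "vclosed n W" "unit_vec n \<notin> W" "surj_onto n k W"
  shows "\<exists>B. vclosed n B \<and> B \<subseteq> W \<and> surj_onto n k B \<and> (\<forall>B'. vclosed n B' \<longrightarrow> B' \<subseteq> B \<longrightarrow> surj_onto n k B' \<longrightarrow> B' = B)"
proof -
  let ?F = "{U. vclosed n (- U) \<and> - U \<subseteq> W \<and> surj_onto n k (- U)}"
  obtain s f0 where f0: "f0 \<in> hpoly (Suc n) s" "f0 \<in> vpolys n W" "peval f0 (unit_vec n) \<noteq> 0"
    using vclosed_sep[OF W(1) unit_vec_coords W(2)] by auto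
  have fin: "finite {c. y(n := c) \<in> W}" for y
  proof -
    let ?p = "map_poly (\<lambda>c. peval c y) (in_var n f0)"
    have "coeff ?p s = peval f0 (unit_vec n)" by (simp add: peval.coeff_map in_var_lead(2)[OF f0(1)])
    then have "?p \<noteq> 0" using f0(3) by auto
    then have "finite {c. poly ?p c = 0}" by (rule poly_roots_finite)
    moreover have "poly ?p c = peval f0 (y(n := c))" for c using eval2_in_var[of y n f0 c] by (simp add: eval2_def)
    moreover have "{c. y(n := c) \<in> W} \<subseteq> {c. poly ?p c = 0}"
      using calculation vidD[OF f0(2)] by auto
    ultimately show ?thesis using finite_subset by blast
  qed
  have "\<exists>M\<in>?F. \<forall>X\<in>?F. M \<subseteq> X \<longrightarrow> X = M"
  proof (rule subset_Zorn)
    fix C assume C: "subset.chain ?F C"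
    show "\<exists>U\<in>?F. \<forall>X\<in>C. X \<subseteq> U"
    proof (cases "C = {}")
      case True
      have "- W \<in> ?F" using W by simp
      then show ?thesis using True by blast
    next
      case False
      have CF: "\<And>U. U \<in> C \<Longrightarrow> vclosed n (- U) \<and> - U \<subseteq> W \<and> surj_onto n k (- U)"
        and tot: "\<And>X Y. X \<in> C \<Longrightarrow> Y \<in> C \<Longrightarrow> X \<subseteq> Y \<or> Y \<subseteq> X"
        using C by (auto simp: subset_chain_def)
      have e: "- (\<Union>C) = \<Inter>(uminus ` C)" by auto
      have "vclosed n (- (\<Union>C))" unfolding e by (rule vclosed_Inter) (use False CF in auto)
      moreover have "- (\<Union>C) \<subseteq> W" using False CF by blast
      moreover have "surj_onto n k (- (\<Union>C))"
        unfolding surj_onto_def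
      proof (intro ballI impI)
        fix y :: "nat \<Rightarrow> 'k" assume y: "y \<in> coords n" "\<forall>i>k. y i = 0"
        define f where "f U = {c. y(n := c) \<in> - U}" for U :: "(nat \<Rightarrow> 'k) set"
        have ff: "finite (f U)" if "U \<in> C" for U
          by (rule finite_subset[OF _ fin[of y]]) (use CF[OF that] in \<open>auto simp: f_def\<close>)
        obtain U1 where "U1 \<in> C" using False by blast
        then obtain U0 where U0: "U0 \<in> C" "\<And>U. U \<in> C \<Longrightarrow> card (f U0) \<le> card (f U)"
          using ex_has_least_nat[of "\<lambda>U. U \<in> C" U1 "\<lambda>U. card (f U)"] by blast
        have sub: "f U0 \<subseteq> f U" if U: "U \<in> C" for U
        proof (cases "U \<subseteq> U0")
          case True then show ?thesis by (auto simp: f_def)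
        next
          case False
          then have "f U \<subseteq> f U0" using tot[OF U U0(1)] by (auto simp: f_def)
          then show ?thesis using card_seteq[OF ff[OF U0(1)]] U0(2)[OF U] by blast
        qed
        obtain c where "y(n := c) \<in> - U0" using CF[OF U0(1)] y by (auto simp: surj_onto_def)
        then have "c \<in> f U0" by (simp add: f_def)
        then have "c \<in> f U" if "U \<in> C" for U using sub[OF that] by blast
        then have "\<forall>U\<in>C. y(n := c) \<in> - U" by (auto simp: f_def)
        then have "y(n := c) \<in> - \<Union>C" by blast
        then show "\<exists>c. y(n := c) \<in> - \<Union>C" by (rule exI)
      qed
      ultimately have "\<Union>C \<in> ?F" by blast
      moreover have "\<forall>X\<in>C. X \<subseteq> \<Union>C" by blast
      ultimately show ?thesis by (rule bexI[rotated])
    qed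
  qed
  then obtain M where M: "M \<in> ?F" "\<forall>X\<in>?F. M \<subseteq> X \<longrightarrow> X = M" by (rule bexE)
  show ?thesis
  proof (intro exI[of _ "- M"] conjI allI impI)
    show "vclosed n (- M)" "- M \<subseteq> W" "surj_onto n k (- M)" using M(1) by simp_all
    fix B assume B: "vclosed n B" "B \<subseteq> - M" "surj_onto n k B"
    have "B \<subseteq> W" using B(2) M(1) by blast
    then have "- B \<in> ?F" using B by simp
    from bspec[OF M(2) this] have "M \<subseteq> - B \<longrightarrow> - B = M" .
    moreover have "M \<subseteq> - B" using B(2) by blast
    ultimately have "- B = M" by (rule mp)
    then show "B = - M" by auto
  qed
qed

text \<open>A minimal closed set \<open>B\<close> mapping onto the subspace is irreducible: if
  neither of two closed parts covering \<open>B\<close> were onto, the product of separating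
  polynomials would vanish on the whole subspace. Its section with \<open>X k = 0\<close> is proper
  and maps onto the next smaller subspace, so a chain found there is prolonged by
  \<open>B\<close>.\<close>

lemma surj_chain:
  fixes W :: "(nat \<Rightarrow> 'k::{alg_closed_field,field_char_0}) set"
  shows "vclosed n W \<Longrightarrow> unit_vec n \<notin> W \<Longrightarrow> k < n \<Longrightarrow> surj_onto n k W \<Longrightarrow> vchain n W k"
proof (induction k arbitrary: W rule: less_induct)
  case (less k W)
  note W = less.prems
  obtain B where B: "vclosed n B" "B \<subseteq> W" "surj_onto n k B"
    and min: "\<And>B'. vclosed n B' \<Longrightarrow> B' \<subseteq> B \<Longrightarrow> surj_onto n k B' \<Longrightarrow> B' = B"
    using minimal_surj_onto[OF W(1,2,4)] by blast
  have sep: "\<exists>g. g \<in> polys (Suc k) \<and> g \<noteq> 0 \<and> (\<forall>y c. y(n := c) \<in> P \<longrightarrow> (\<forall>i>k. y i = 0) \<longrightarrow> peval g y = 0)"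
    if P: "vclosed n P" "P \<subseteq> B" "\<not> surj_onto n k P" for P
  proof -
    obtain y where y: "y \<in> coords n" "\<forall>i>k. y i = 0" "\<And>c. y(n := c) \<notin> P"
      using P(3) by (auto simp: surj_onto_def)
    obtain t g where g: "g \<in> hpoly n t" "g \<in> vpolys n P" "peval g y \<noteq> 0"
      using projection_sep[OF P(1) _ y(1) _ y(3)] W(2,3) B(2) P(2) y(2) by blast
    define g' where "g' = msubst Cst (\<lambda>i. if i \<le> k then X i else 0) g"
    have pg: "peval g' b = peval g b" if "\<forall>i>k. b i = 0" for b
      unfolding g'_def peval_msubst_Cst using that by (intro arg_cong[of _ _ "peval g"]) auto
    have "g' \<in> polys (Suc k)"
      unfolding g'_def by (rule msubst_polys[OF hpoly_polys[OF g(1)]]) auto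
    moreover have "g' \<noteq> 0" using pg[OF y(2)] g(3) by auto
    moreover have "peval g' z = 0" if z: "z(n := c) \<in> P" "\<forall>i>k. z i = 0" for z c
    proof -
      have "peval g z = peval g (z(n := c))" by (rule peval_cong[OF hpoly_polys[OF g(1)]]) auto
      then show ?thesis using pg[OF z(2)] vidD[OF g(2) z(1)] by simp
    qed
    ultimately show ?thesis by blast
  qed
  have irr: "virreducible n B"
    unfolding virreducible_def
  proof (intro conjI allI impI)
    show "vclosed n B" by fact
    show "B \<noteq> {}" using B(3) unit_vec_coords[of 0 n] by (auto simp: surj_onto_def unit_vec_def)
    fix P Q assume PQ: "vclosed n P" "vclosed n Q" "B = P \<union> Q"
    have "surj_onto n k P \<or> surj_onto n k Q"
    proof (rule ccontr)
      assume "\<not> ?thesis"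
      then obtain g h where g: "g \<in> polys (Suc k)" "g \<noteq> 0" "\<forall>y c. y(n := c) \<in> P \<longrightarrow> (\<forall>i>k. y i = 0) \<longrightarrow> peval g y = 0"
        and h: "h \<in> polys (Suc k)" "h \<noteq> 0" "\<forall>y c. y(n := c) \<in> Q \<longrightarrow> (\<forall>i>k. y i = 0) \<longrightarrow> peval h y = 0"
        using sep[OF PQ(1)] sep[OF PQ(2)] PQ(3) by auto
      \<comment> \<open>The factor \<open>X 0\<close> forces the point \<open>a\<close> found below
        to have a nonzero coordinate, i.e. to lie in \<open>coords n\<close>.\<close>
      have "g * h * X 0 \<noteq> 0" using g h by simp
      moreover have "g * h * X 0 \<in> polys (Suc k)" using g h by (intro polys_mult polys_X) auto
      ultimately obtain a where a: "\<forall>i\<ge>Suc k. a i = 0" "peval (g * h * X 0) a \<noteq> 0"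
        using ex_peval_nonzero_polys by blast
      have "a \<in> coords n" using a W(3) by (auto simp: coords_def peval.mult)
      then obtain c where "a(n := c) \<in> B" using B(3) a(1) by (auto simp: surj_onto_def)
      then show False using g(3) h(3) a PQ(3) by (auto simp: peval.mult)
    qed
    then show "B = P \<or> B = Q" using min[OF PQ(1)] min[OF PQ(2)] PQ(3) by blast
  qed
  note BW = B irr
  show "vchain n W k"
  proof (cases k)
    case 0
    show ?thesis unfolding vchain_def 0 using BW by (intro exI[of _ "\<lambda>_. B"]) auto
  next
    case (Suc l)
    note kk = W(3)
    let ?H = "{x \<in> coords n. \<forall>F\<in>{X k}. peval F x = 0}"
    let ?W = "B \<inter> ?H"
    have "X k \<in> hpoly (Suc n) 1" using kk by (intro hpoly_X) simp
    then have H: "vclosed n ?H" by (intro vclosed_zeros) blast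
    have "vchain n ?W l"
    proof (rule less.IH)
      show "l < k" using Suc by simp
      show "vclosed n ?W" by (rule vclosed_Int[OF B(1) H])
      show "unit_vec n \<notin> ?W" using W(2) B(2) by blast
      show "l < n" using Suc kk by simp
      show "surj_onto n l ?W"
        unfolding surj_onto_def
      proof (intro ballI impI)
        fix y :: "nat \<Rightarrow> 'k" assume y: "y \<in> coords n" "\<forall>i>l. y i = 0"
        then obtain c where c: "y(n := c) \<in> B" using B(3) Suc by (auto simp: surj_onto_def)
        have "y k = 0" using y Suc by auto
        then have "y(n := c) \<in> ?H" using c vclosed_coords[OF B(1)] kk by auto
        then show "\<exists>c. y(n := c) \<in> ?W" using c by blast
      qed
    qed
    then obtain C where C: "\<forall>i\<le>l. virreducible n (C i) \<and> C i \<subseteq> ?W" "\<forall>i<l. C i \<subset> C (Suc i)"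
      by (auto simp: vchain_def)
    have ne: "?W \<noteq> B"
    proof -
      have "\<forall>i>k. unit_vec k i = (0::'k)" by (simp add: unit_vec_def)
      then obtain c where c: "(unit_vec k)(n := c) \<in> B"
        using B(3) unit_vec_coords[of k n] kk by (auto simp: surj_onto_def)
      have "((unit_vec k)(n := c)) k \<noteq> (0::'k)" using kk by (simp add: unit_vec_def)
      then have "(unit_vec k)(n := c) \<notin> ?H" by simp
      then show ?thesis using c by blast
    qed
    define D where "D i = (if i \<le> l then C i else B)" for i
    show ?thesis
      unfolding vchain_def
    proof (intro exI[of _ D] conjI allI impI)
      fix i assume "i \<le> k"
      show "virreducible n (D i)" using C(1) irr by (simp add: D_def)
      show "D i \<subseteq> W" using C(1) B(2) by (auto simp: D_def)
    next
      fix i assume i: "i < k"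
      show "D i \<subset> D (Suc i)"
      proof (cases "i < l")
        case True then show ?thesis using C(2) by (simp add: D_def)
      next
        case False
        then have "i = l" using i Suc by simp
        then show ?thesis using C(1) ne by (auto simp: D_def)
      qed
    qed
  qed
qed

subsection \<open>Torsion-freeness over the coordinate ring of the base\<close>

text \<open>For \<open>A\<close> in P^(m+1): the line of points whose first \<open>m\<close>
  coordinates vanish does not meet \<open>A\<close>. The projection from that line to P^(m-1), whose
  coordinate ring is the base, is then finite on \<open>A\<close>.\<close>

definition noether :: "nat \<Rightarrow> (nat \<Rightarrow> 'k::zero) set \<Rightarrow> bool" where
  "noether m A \<longleftrightarrow> (\<forall>x\<in>A. \<exists>i<m. x i \<noteq> 0)"

lemma noether_unit_vec: "noether m A \<Longrightarrow> k \<ge> m \<Longrightarrow> unit_vec k \<notin> A"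
  by (auto simp: noether_def unit_vec_def)

text \<open>The equation for \<open>X m\<close> has to avoid \<open>X (Suc m)\<close>. It arises by
  separating the unit vector of index \<open>m\<close> from the projected set, which is possible
  because the whole line through the two unit vectors misses \<open>A\<close>.\<close>

lemma noether_monic:
  fixes A :: "(nat \<Rightarrow> 'k::{alg_closed_field,field_char_0}) set"
  assumes "vclosed (Suc m) A" "noether m A"
  shows "\<exists>s f. f \<in> hpoly (Suc m) s \<and> f \<in> vpolys (Suc m) A \<and> peval f (unit_vec m) \<noteq> 0"
    "\<exists>s f. f \<in> hpoly (Suc (Suc m)) s \<and> f \<in> vpolys (Suc m) A \<and> peval f (unit_vec (Suc m)) \<noteq> 0"
proof -
  have "(unit_vec m)(Suc m := c) \<notin> A" for c
    using assms(2) by (auto simp: noether_def unit_vec_def)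
  then show "\<exists>s f. f \<in> hpoly (Suc m) s \<and> f \<in> vpolys (Suc m) A \<and> peval f (unit_vec m) \<noteq> 0"
    using projection_sep[OF assms(1) noether_unit_vec[OF assms(2)] unit_vec_coords[of m]]
    by (simp add: unit_vec_def)
  show "\<exists>s f. f \<in> hpoly (Suc (Suc m)) s \<and> f \<in> vpolys (Suc m) A \<and> peval f (unit_vec (Suc m)) \<noteq> 0"
    using vclosed_sep[OF assms(1) unit_vec_coords noether_unit_vec[OF assms(2)]] by auto
qed

text \<open>Each \<open>x\<close> in \<open>A\<close> lies on an irreducible \<open>Z\<close> with a
  long chain. If \<open>a\<close> does not vanish on \<open>Z\<close>, then \<open>g\<close> does.
  Otherwise \<open>Z\<close> lies over a hypersurface of the base, and its Hilbert function grows
  too slowly for the chain.\<close>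

lemma torsion_free:
  fixes A :: "(nat \<Rightarrow> 'k::{alg_closed_field,field_char_0}) set"
  assumes m: "m \<ge> 2" and A: "admissible (Suc m) A" "noether m A"
    and a: "a \<in> polys m" "a \<noteq> 0" and g: "g \<in> polys (Suc (Suc m))" "a * g \<in> vpolys (Suc m) A"
  shows "g \<in> vpolys (Suc m) A"
proof (rule vidI[OF g(1)])
  fix x assume x: "x \<in> A"
  let ?n = "Suc m"
  have kA: "vclosed ?n A" using A(1) by (simp add: admissible_def)
  obtain Z where Z: "virreducible ?n Z" "x \<in> Z" "Z \<subseteq> A" "vchain ?n Z (?n - 2)"
    using A(1)[unfolded admissible_def] x by blast
  have ap: "a \<in> polys (Suc ?n)" using a(1) polys_mono by force
  have "a * g \<in> vpolys ?n Z" using g(2) vpolys_mono[OF Z(3)] by blast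
  then consider "a \<in> vpolys ?n Z" | "g \<in> vpolys ?n Z" using virreducible_prime[OF Z(1) ap g(1)] by blast
  then show "peval g x = 0"
  proof cases
    case 2 then show ?thesis using Z(2) vidD by blast
  next
    case 1
    have kZ: "vclosed ?n Z" using Z(1) by (simp add: virreducible_def)
    obtain \<alpha> where a': "hcomp \<alpha> a \<noteq> 0" using hcomp_eq_0D a(2) by blast
    define a' where "a' = hcomp \<alpha> a"
    have a'1: "a' \<in> hpoly m \<alpha>" "a' \<noteq> 0" "a' \<in> vpolys ?n Z"
      using a' hcomp_hpoly[OF a(1)] vpolys_hcomp[OF kZ 1] by (simp_all add: a'_def)
    \<comment> \<open>The dimension of a hypersurface in the base P^(m-1), one less than the length
      \<open>?n - 2 = m - 1\<close> of the chain in \<open>Z\<close>.\<close>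
    define l where "l = m - 2"
    have l: "m = Suc (Suc l)" using m by (simp add: l_def)
    obtain s f where f: "f \<in> hpoly (Suc m) s" "f \<in> vpolys ?n A" "peval f (unit_vec m) \<noteq> 0"
      using noether_monic(1)[OF kA A(2)] by blast
    obtain s' h where h: "h \<in> hpoly (Suc ?n) s'" "h \<in> vpolys ?n A" "peval h (unit_vec ?n) \<noteq> 0"
      using noether_monic(2)[OF kA A(2)] by blast
    have fZ: "f \<in> vpolys ?n Z" "h \<in> vpolys ?n Z" using f h vpolys_mono[OF Z(3)] by blast+
    define b where "b t = \<alpha> * ((t + l) choose l)" for t
    have bm: "b t' \<le> b t" if "t' \<le> t" for t t'
      unfolding b_def using that by (intro mult_left_mono binomial_right_mono) auto
    have q0: "quot_dim ?n Z m t \<le> b t" for t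
      unfolding b_def by (rule quot_dim_base[OF l _ a'1]) simp
    have q1: "quot_dim ?n Z (Suc m) t \<le> s * b t" for t
      by (rule quot_dim_step[OF _ _ f(1) fZ(1) f(3)]) (use m le_trans[OF q0 bm] in auto)
    have q2: "quot_dim ?n Z (Suc ?n) t \<le> s' * (s * b t)" for t
    proof (rule quot_dim_step[OF _ _ h(1) fZ(2) h(3)])
      fix t' assume "t' \<le> t"
      then show "quot_dim ?n Z ?n t' \<le> s * b t" using q1[of t'] bm[of t' t] mult_le_mono2 le_trans by blast
    qed simp_all
    have "hilb ?n Z t \<le> int (s' * s * \<alpha> * Suc l ^ l) * (int t + 1) ^ l" for t
    proof -
      have "(t + l) choose l \<le> (t + l) ^ l" by (rule binomial_le_pow) simp
      also have "\<dots> \<le> (Suc l * (t + 1)) ^ l" by (rule power_mono) auto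
      also have "\<dots> = Suc l ^ l * (t + 1) ^ l" by (rule power_mult_distrib)
      finally have "b t \<le> \<alpha> * (Suc l ^ l * (t + 1) ^ l)"
        unfolding b_def by (rule mult_le_mono2)
      then have "s' * (s * b t) \<le> s' * (s * (\<alpha> * (Suc l ^ l * (t + 1) ^ l)))"
        by (intro mult_le_mono2)
      then have "quot_dim ?n Z (Suc ?n) t \<le> s' * s * \<alpha> * Suc l ^ l * (t + 1) ^ l"
        using q2[of t] by (simp only: mult.assoc)
      then have "int (quot_dim ?n Z (Suc ?n) t) \<le> int (s' * s * \<alpha> * Suc l ^ l * (t + 1) ^ l)"
        by (simp only: of_nat_le_iff)
      then show ?thesis unfolding hilb_quot_dim by (simp add: add.commute)
    qed
    then have "?n - 2 \<le> l" by (rule chain_length_le[OF Z(4)])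
    then show ?thesis using l by simp
  qed
qed

text \<open>The constant \<open>c\<close> may involve the free parameters and vanish at the given
  ones. The parameters are therefore moved along a line \<open>bs s\<close>: whenever
  \<open>c\<close> with parameters \<open>bs s\<close> is a nonzero polynomial of the base,
  torsion-freeness gives the relation for these parameters. This holds outside the zeros of
  \<open>q\<close>, so the polynomial \<open>p\<close> in \<open>s\<close> vanishes identically, in
  particular at \<open>s = 0\<close>.\<close>

lemma rel_ideal_torsion_free:
  fixes A :: "(nat \<Rightarrow> 'k::field_char_0) set"
  assumes tf: "\<And>a g. a \<in> polys m \<Longrightarrow> a \<noteq> 0 \<Longrightarrow> g \<in> polys (Suc (Suc m)) \<Longrightarrow> a * g \<in> vpolys (Suc m) A \<Longrightarrow> g \<in> vpolys (Suc m) A"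
    and c: "c \<noteq> 0" and G: "smult c G \<in> rel_ideal m \<epsilon> A"
  shows "G \<in> rel_ideal m \<epsilon> A"
  unfolding rel_ideal_def
proof (intro CollectI ballI allI impI)
  fix x b assume x: "x \<in> A" and b: "\<forall>i<m. b i = x i"
  obtain b1 where b1: "peval c b1 \<noteq> 0" using ex_peval_nonzero[OF c] by blast
  define v where "v i = (if i < m then 0 else b1 i - b i)" for i
  define bs where "bs s i = b i + s * v i" for s i
  define q where "q = line (\<lambda>i. if i < m then b1 i else b i) v c"
  define p where "p = poly (map_poly (line b v) G) [:x m + \<epsilon> * b m * x (Suc m), \<epsilon> * v m * x (Suc m):]"
  have pq: "poly q s = peval c (\<lambda>i. if i < m then b1 i else bs s i)" for s
    unfolding q_def poly_line by (rule arg_cong[of _ _ "peval c"]) (auto simp: v_def bs_def)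
  have pp: "poly p s = eval2 (bs s) G (x m + \<epsilon> * bs s m * x (Suc m))" for s
  proof -
    have "poly p s = poly (map_poly (\<lambda>p. poly p s) (map_poly (line b v) G)) (poly [:x m + \<epsilon> * b m * x (Suc m), \<epsilon> * v m * x (Suc m):] s)"
      unfolding p_def by (rule rhom.poly_map[OF rhom_poly])
    also have "map_poly (\<lambda>p. poly p s) (map_poly (line b v) G) = map_poly (\<lambda>c. peval c (bs s)) G"
      by (rule poly_eqI) (simp add: coeff_map_poly poly_line bs_def[abs_def])
    also have "poly [:x m + \<epsilon> * b m * x (Suc m), \<epsilon> * v m * x (Suc m):] s = x m + \<epsilon> * bs s m * x (Suc m)"
      by (simp add: bs_def algebra_simps)
    finally show ?thesis by (simp add: eval2_def)
  qed
  have "poly p s = 0" if qs: "poly q s \<noteq> 0" for s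
  proof -
    let ?h = "msubst Cst (\<lambda>i. if i < m then X i else Cst (bs s i)) :: 'k mpoly \<Rightarrow> 'k mpoly"
    interpret h: rhom ?h by (rule rhom.rhom_msubst[OF rhom_Cst])
    have hpoly: "?h F \<in> polys m" for F
    proof -
      obtain k where "F \<in> polys k" using ex_polys by blast
      then show ?thesis by (rule msubst_polys) auto
    qed
    have ph: "peval (?h F) y = peval F (\<lambda>i. if i < m then y i else bs s i)" for F y
      unfolding peval_msubst_Cst by (rule arg_cong[of _ _ "peval F"]) auto
    define g where "g = poly (map_poly ?h G) (X m + Cst (\<epsilon> * bs s m) * X (Suc m))"
    have pg: "peval g y = eval2 (\<lambda>i. if i < m then y i else bs s i) G (y m + \<epsilon> * bs s m * y (Suc m))" for y
      unfolding g_def peval_poly eval2_def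
      by (intro arg_cong2[where f = poly] poly_eqI) (simp_all add: peval.coeff_map h.coeff_map ph peval.add peval.mult)
    have gp: "g \<in> polys (Suc (Suc m))"
    proof -
      have "\<forall>j. coeff (map_poly ?h G) j \<in> polys (Suc (Suc m))"
        by (auto simp: h.coeff_map intro!: polys_mono[OF hpoly])
      then show ?thesis unfolding g_def by (rule polys_poly) (intro polys_add polys_mult polys_X polys_Cst; simp)
    qed
    have "peval (?h c) b1 \<noteq> 0" using qs by (simp add: ph pq)
    then have c0: "?h c \<noteq> 0" by auto
    have "?h c * g \<in> vpolys (Suc m) A"
    proof (rule vidI)
      show "?h c * g \<in> polys (Suc (Suc m))" using hpoly polys_mono[of _ m "Suc (Suc m)"] gp by (intro polys_mult) auto
      fix y assume y: "y \<in> A"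
      have "\<forall>b. (\<forall>i<m. b i = y i) \<longrightarrow> eval2 b (smult c G) (y m + \<epsilon> * b m * y (Suc m)) = 0"
        using G y unfolding rel_ideal_def by blast
      from spec[OF this, of "\<lambda>i. if i < m then y i else bs s i"] show "peval (?h c * g) y = 0" by (simp add: peval.mult ph pg)
    qed
    then have "g \<in> vpolys (Suc m) A" by (rule tf[OF hpoly c0 gp])
    then have "peval g x = 0" using x vidD by blast
    moreover have "(\<lambda>i. if i < m then x i else bs s i) = bs s"
      using b by (auto simp: bs_def v_def fun_eq_iff)
    ultimately show ?thesis by (simp add: pg pp)
  qed
  then have "poly (p * q) s = 0" for s by auto
  then have "p * q = 0" using poly_all_0_iff_0 by blast
  moreover have "poly q 1 \<noteq> 0"
  proof -
    have "(\<lambda>i. if i < m then b1 i else bs 1 i) = b1" by (auto simp: bs_def v_def fun_eq_iff)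
    then show ?thesis using b1 by (simp add: pq)
  qed
  then have "q \<noteq> 0" by auto
  ultimately have "p = 0" by simp
  moreover have "bs 0 = b" by (auto simp: bs_def)
  ultimately show "eval2 b G (x m + \<epsilon> * b m * x (Suc m)) = 0" using pp[of 0] by simp
qed



section \<open>Linear changes of coordinates\<close>

lemma monom_deg_1:
  assumes "monom_deg m = 1" shows "\<exists>i. m = Poly_Mapping.single i 1"
proof -
  have "m \<noteq> 0" using assms by (auto simp: monom_deg_def)
  then obtain i where i: "i \<in> Poly_Mapping.keys m" by (metis keys_eq_empty ex_in_conv)
  have "monom_deg m = Poly_Mapping.lookup m i + (\<Sum>j\<in>Poly_Mapping.keys m - {i}. Poly_Mapping.lookup m j)"
    unfolding monom_deg_def by (rule sum.remove[OF finite_keys i])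
  moreover have "Poly_Mapping.lookup m i > 0" using i by (simp add: in_keys_iff)
  ultimately have l: "Poly_Mapping.lookup m i = 1" "(\<Sum>j\<in>Poly_Mapping.keys m - {i}. Poly_Mapping.lookup m j) = 0"
    using assms by linarith+
  have "Poly_Mapping.lookup m j = Poly_Mapping.lookup (Poly_Mapping.single i 1) j" for j
  proof (cases "j = i")
    case False
    then have "j \<notin> Poly_Mapping.keys m \<or> Poly_Mapping.lookup m j = 0" using l(2) by auto
    then show ?thesis using False by (auto simp: in_keys_iff lookup_single)
  qed (simp add: l)
  then show ?thesis using poly_mapping_eqI by blast
qed

lemma peval_hpoly_1_linear:
  assumes "F \<in> hpoly k 1"
  shows "peval F (\<lambda>i. x i + s * y i) = peval F x + s * peval F y"
proof -
  have "monom_eval (\<lambda>i. x i + s * y i) m = monom_eval x m + s * monom_eval y m" if "m \<in> Poly_Mapping.keys F" for m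
    using monom_deg_1[of m] that assms by (auto simp: hpoly_def)
  then show ?thesis
    unfolding peval_eq_msubst msubst_def by (simp add: sum.distrib sum_distrib_left algebra_simps)
qed

definition lin_map :: "nat \<Rightarrow> (nat \<Rightarrow> 'k::comm_ring_1 mpoly) \<Rightarrow> bool" where
  "lin_map n L \<longleftrightarrow> (\<forall>i\<le>n. L i \<in> hpoly (Suc n) 1) \<and> (\<forall>i>n. L i = X i)"

definition app :: "(nat \<Rightarrow> 'k::comm_ring_1 mpoly) \<Rightarrow> (nat \<Rightarrow> 'k) \<Rightarrow> nat \<Rightarrow> 'k" where
  "app L x = (\<lambda>i. peval (L i) x)"

definition pull :: "(nat \<Rightarrow> 'k::comm_ring_1 mpoly) \<Rightarrow> 'k mpoly \<Rightarrow> 'k mpoly" where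
  "pull L = msubst Cst L"

definition pre :: "(nat \<Rightarrow> 'k::comm_ring_1 mpoly) \<Rightarrow> (nat \<Rightarrow> 'k) set \<Rightarrow> (nat \<Rightarrow> 'k) set" where
  "pre L A = {x. app L x \<in> A}"

lemma peval_pull: "peval (pull L F) x = peval F (app L x)"
  unfolding pull_def app_def by (rule peval_msubst_Cst)

interpretation pull: rhom "pull L"
  unfolding pull_def by (rule rhom.rhom_msubst[OF rhom_Cst])

lemma pull_Cst [simp]: "pull L (Cst c) = Cst c"
  unfolding pull_def by (rule rhom.msubst_Cst[OF rhom_Cst])

lemma app_linear:
  assumes "lin_map n L" shows "app L (\<lambda>i. x i + s * y i) = (\<lambda>i. app L x i + s * app L y i)"
  unfolding app_def fun_eq_iff
proof
  fix i show "peval (L i) (\<lambda>i. x i + s * y i) = peval (L i) x + s * peval (L i) y"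
    using assms peval_hpoly_1_linear[of "L i" "Suc n"] by (cases "i \<le> n") (auto simp: lin_map_def)
qed

lemma app_zero: "lin_map n (L :: nat \<Rightarrow> 'k::field mpoly) \<Longrightarrow> app L (\<lambda>_. 0) = (\<lambda>_. 0)"
  using app_linear[of n L "\<lambda>_. 0" "-1" "\<lambda>_. 0"] by simp

lemma app_scale: "lin_map n (L :: nat \<Rightarrow> 'k::field mpoly) \<Longrightarrow> app L (\<lambda>i. s * x i) = (\<lambda>i. s * app L x i)"
  using app_linear[of n L "\<lambda>_. 0" s x] app_zero[of n L] by simp

text \<open>A linear change of coordinates given with its inverse, both by linear forms. Sets are
  transported by inverse image, so that \<open>pull L\<close> maps the ideal of \<open>A\<close> to
  that of \<open>pre L A\<close>, while a point \<open>p\<close> in the new coordinates is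
  \<open>app L p\<close> in the old ones.\<close>

locale frame =
  fixes n :: nat and L L' :: "nat \<Rightarrow> 'k::field_char_0 mpoly"
  assumes L: "lin_map n L" and L': "lin_map n L'"
    and inv: "app L (app L' x) = x" and inv': "app L' (app L x) = x"
begin

lemma swap: "frame n L' L"
  using L L' inv inv' by unfold_locales

lemma app_coords: "x \<in> coords n \<Longrightarrow> app L x \<in> coords n"
proof -
  assume x: "x \<in> coords n"
  have "app L x i = 0" if "i > n" for i
    using that L x by (auto simp: app_def lin_map_def coords_def)
  moreover have "app L x \<noteq> (\<lambda>_. 0)"
    using inv'[of x] app_zero[OF L'] x by (auto simp: coords_def)
  ultimately show ?thesis by (auto simp: coords_def fun_eq_iff)
qed

lemma pull_polys: "F \<in> polys (Suc n) \<Longrightarrow> pull L F \<in> polys (Suc n)"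
  unfolding pull_def using L by (auto intro!: msubst_polys simp: lin_map_def hpoly_polys less_Suc_eq_le)

lemma pull_hpoly: "F \<in> hpoly (Suc n) t \<Longrightarrow> pull L F \<in> hpoly (Suc n) t"
proof (rule hpI)
  assume F: "F \<in> hpoly (Suc n) t"
  show "pull L F \<in> polys (Suc n)" by (rule pull_polys[OF hpoly_polys[OF F]])
  show "peval (pull L F) (\<lambda>i. s * a i) = s ^ t * peval (pull L F) a" for s a
    by (simp add: peval_pull app_scale[OF L] peval_hpoly_scale[OF F])
qed

lemma pull_pull: "pull L' (pull L F) = F"
  by (rule peval_inj) (simp add: peval_pull inv)

lemma pre_subset_coords: "A \<subseteq> coords n \<Longrightarrow> pre L A \<subseteq> coords n"
proof
  fix x assume "A \<subseteq> coords n" "x \<in> pre L A"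
  then have "app L' (app L x) \<in> coords n"
    using frame.app_coords[OF swap] by (auto simp: pre_def)
  then show "x \<in> coords n" by (simp add: inv')
qed

lemma pre_pre: "pre L' (pre L A) = A"
  by (simp add: pre_def inv)

lemma pre_nonempty: "A \<noteq> {} \<Longrightarrow> pre L A \<noteq> {}"
proof -
  assume "A \<noteq> {}"
  then obtain a where "a \<in> A" by blast
  then have "app L' a \<in> pre L A" by (simp add: pre_def inv)
  then show ?thesis by blast
qed

lemma vclosed_pre: "vclosed n A \<Longrightarrow> vclosed n (pre L A)"
proof -
  assume A: "vclosed n A"
  then obtain T where T: "T \<subseteq> (\<Union>t. hpoly (Suc n) t)" "A = {x \<in> coords n. \<forall>F\<in>T. peval F x = 0}"
    unfolding vclosed_def by (elim exE conjE)
  have "x \<in> pre L A \<longleftrightarrow> x \<in> {x \<in> coords n. \<forall>F\<in>pull L ` T. peval F x = 0}" for x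
  proof (cases "x \<in> coords n")
    case True
    then show ?thesis using app_coords[OF True] unfolding pre_def T(2) by (simp add: peval_pull)
  next
    case False
    then show ?thesis using pre_subset_coords[OF vclosed_coords[OF A]] by blast
  qed
  then have e: "pre L A = {x \<in> coords n. \<forall>F\<in>pull L ` T. peval F x = 0}" by blast
  have "pull L ` T \<subseteq> (\<Union>t. hpoly (Suc n) t)" using T(1) pull_hpoly by blast
  then show ?thesis unfolding e by (rule vclosed_zeros)
qed

lemma virreducible_pre: "virreducible n A \<Longrightarrow> virreducible n (pre L A)"
  unfolding virreducible_def
proof (intro conjI allI impI; elim conjE)
  assume A: "vclosed n A" "A \<noteq> {}" "\<forall>B C. vclosed n B \<longrightarrow> vclosed n C \<longrightarrow> A = B \<union> C \<longrightarrow> A = B \<or> A = C"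
  show "vclosed n (pre L A)" by (rule vclosed_pre[OF A(1)])
  show "pre L A \<noteq> {}" by (rule pre_nonempty[OF A(2)])
  fix B C assume BC: "vclosed n B" "vclosed n C" "pre L A = B \<union> C"
  have "A = pre L' B \<union> pre L' C" using BC(3) pre_pre[of A] by (auto simp: pre_def)
  then have "A = pre L' B \<or> A = pre L' C"
    using A(3) frame.vclosed_pre[OF swap] BC(1,2) by blast
  then show "pre L A = B \<or> pre L A = C" using frame.pre_pre[OF swap] by metis
qed

lemma pre_mono: "A \<subseteq> B \<Longrightarrow> pre L A \<subseteq> pre L B"
  by (auto simp: pre_def)

lemma vchain_pre: "vchain n A r \<Longrightarrow> vchain n (pre L A) r"
proof -
  assume "vchain n A r"
  then obtain C where C: "\<forall>i\<le>r. virreducible n (C i) \<and> C i \<subseteq> A" "\<forall>i<r. C i \<subset> C (Suc i)"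
    by (auto simp: vchain_def)
  have "pre L (C i) \<subset> pre L (C (Suc i))" if "i < r" for i
    using C(2) that pre_mono[of "C i" "C (Suc i)"] pre_pre by (metis psubset_eq)
  then show ?thesis
    unfolding vchain_def using C(1) virreducible_pre pre_mono by (intro exI[of _ "\<lambda>i. pre L (C i)"]) auto
qed

lemma vchain_pre_iff: "vchain n (pre L A) r \<longleftrightarrow> vchain n A r"
  using vchain_pre frame.vchain_pre[OF swap] pre_pre by metis

lemma vpolys_pre: "F \<in> vpolys n A \<Longrightarrow> pull L F \<in> vpolys n (pre L A)"
  by (auto simp: vpolys_def peval_pull pre_def pull_polys)

lemma admissible_pre: "admissible n A \<Longrightarrow> admissible n (pre L A)"
  unfolding admissible_def
proof (intro conjI ballI impI; elim conjE)
  assume A: "vclosed n A" "A \<noteq> {}" "\<not> vchain n A (n - 1)"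
    "\<forall>x\<in>A. \<exists>Z. virreducible n Z \<and> x \<in> Z \<and> Z \<subseteq> A \<and> vchain n Z (n - 2)"
    "\<forall>L\<in>hpoly (Suc n) 1. L \<in> vpolys n A \<longrightarrow> L = 0"
  show "vclosed n (pre L A)" by (rule vclosed_pre[OF A(1)])
  show "pre L A \<noteq> {}" by (rule pre_nonempty[OF A(2)])
  show "\<not> vchain n (pre L A) (n - 1)" using A(3) vchain_pre_iff by blast
  show "\<exists>Z. virreducible n Z \<and> x \<in> Z \<and> Z \<subseteq> pre L A \<and> vchain n Z (n - 2)" if "x \<in> pre L A" for x
  proof -
    obtain Z where Z: "virreducible n Z" "app L x \<in> Z" "Z \<subseteq> A" "vchain n Z (n - 2)"
      using A(4) \<open>x \<in> pre L A\<close> unfolding pre_def by blast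
    then show ?thesis using virreducible_pre vchain_pre pre_mono by (intro exI[of _ "pre L Z"]) (auto simp: pre_def)
  qed
  fix M assume M: "M \<in> hpoly (Suc n) 1" "M \<in> vpolys n (pre L A)"
  have "pull L' M \<in> hpoly (Suc n) 1" by (rule frame.pull_hpoly[OF swap M(1)])
  moreover have "pull L' M \<in> vpolys n A" using frame.vpolys_pre[OF swap M(2)] by (simp add: pre_pre)
  ultimately have "pull L' M = 0" using A(5) by blast
  then have "pull L (pull L' M) = 0" by simp
  then show "M = 0" using frame.pull_pull[OF swap] by metis
qed

lemma ideal_dim_pre: "ideal_dim n (pre L A) t = ideal_dim n A t"
proof -
  have "pull L ` (hpoly (Suc n) t \<inter> vpolys n A) = hpoly (Suc n) t \<inter> vpolys n (pre L A)"
  proof (intro subset_antisym subsetI)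
    fix F assume "F \<in> pull L ` (hpoly (Suc n) t \<inter> vpolys n A)"
    then show "F \<in> hpoly (Suc n) t \<inter> vpolys n (pre L A)" using pull_hpoly vpolys_pre by blast
  next
    fix F assume F: "F \<in> hpoly (Suc n) t \<inter> vpolys n (pre L A)"
    then have "pull L' F \<in> hpoly (Suc n) t \<inter> vpolys n A"
      using frame.pull_hpoly[OF swap] frame.vpolys_pre[OF swap, of F "pre L A"] by (simp add: pre_pre)
    moreover have "F = pull L (pull L' F)" using frame.pull_pull[OF swap] by metis
    ultimately show "F \<in> pull L ` (hpoly (Suc n) t \<inter> vpolys n A)" by blast
  qed
  moreover have "mpoly.dim (pull L ` (hpoly (Suc n) t \<inter> vpolys n A)) = mpoly.dim (hpoly (Suc n) t \<inter> vpolys n A)"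
    by (rule fin_dim_dim_image(2)[OF fin_dim_hpoly_vpolys])
       (use pull_pull in \<open>auto simp: pull.add pull.mult pscale_eq dest: arg_cong[of _ 0 "pull L'"]\<close>)
  ultimately show ?thesis by (simp add: ideal_dim_def)
qed

lemma hilb_pre: "hilb n (pre L A) t = hilb n A t"
  by (simp add: hilb_def ideal_dim_pre)

end

subsection \<open>Elementary changes of coordinates\<close>

text \<open>The identity matrix with column \<open>j\<close> replaced by \<open>p\<close>; for
  \<open>p\<close> supported on the indices up to \<open>n\<close> it sends the \<open>j\<close>-th
  unit vector to \<open>p\<close>.\<close>

definition shear :: "nat \<Rightarrow> nat \<Rightarrow> (nat \<Rightarrow> 'k::comm_ring_1) \<Rightarrow> nat \<Rightarrow> 'k mpoly" where
  "shear n j p i = (if i > n then X i else if i = j then Cst (p j) * X j else X i + Cst (p i) * X j)"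

lemma app_shear: "app (shear n j p) x i =
    (if i > n then x i else if i = j then p j * x j else x i + p i * x j)"
  by (simp add: app_def shear_def peval.add peval.mult)

lemma hpoly_X_le: "i \<le> n \<Longrightarrow> X i \<in> hpoly (Suc n) (Suc 0)"
  using hpoly_X[of i "Suc n"] by simp

lemma hpoly_Cst_mult: "F \<in> hpoly k t \<Longrightarrow> Cst c * F \<in> hpoly k t"
  using hpoly_mult[OF hpoly_Cst] by fastforce

lemma lin_map_shear: "j \<le> n \<Longrightarrow> lin_map n (shear n j p)"
  by (auto simp: lin_map_def shear_def intro!: hpoly_add hpoly_Cst_mult hpoly_X_le)

lemma frame_shear:
  assumes "j \<le> n" "p j \<noteq> (0::'k::field_char_0)"
  shows "frame n (shear n j p) (shear n j (\<lambda>i. if i = j then 1 / p j else - p i / p j))"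
    and "frame n (shear n j (\<lambda>i. if i = j then 1 / p j else - p i / p j)) (shear n j p)"
proof -
  show "frame n (shear n j p) (shear n j (\<lambda>i. if i = j then 1 / p j else - p i / p j))"
    by unfold_locales (use assms in \<open>auto simp: lin_map_shear app_shear fun_eq_iff field_simps\<close>)
  then show "frame n (shear n j (\<lambda>i. if i = j then 1 / p j else - p i / p j)) (shear n j p)"
    by (rule frame.swap)
qed

definition exch :: "nat \<Rightarrow> nat \<Rightarrow> nat \<Rightarrow> 'k::comm_ring_1 mpoly" where
  "exch j k i = (if i = j then X k else if i = k then X j else X i)"

lemma app_exch: "app (exch j k) x i = (if i = j then x k else if i = k then x j else x i)"
  by (simp add: app_def exch_def)

lemma frame_exch: "j \<le> n \<Longrightarrow> k \<le> n \<Longrightarrow> frame n (exch j k) (exch j k :: nat \<Rightarrow> 'k::field_char_0 mpoly)"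
  by unfold_locales (auto simp: lin_map_def exch_def app_exch fun_eq_iff hpoly_X_le)

subsection \<open>Points outside a closed set\<close>

text \<open>Otherwise \<open>A\<close> would be the whole space, and already the hyperplane
  \<open>X n = 0\<close> contains a chain of length \<open>n - 1\<close>.\<close>

lemma admissible_ex_nonzero:
  fixes A :: "(nat \<Rightarrow> 'k::{alg_closed_field,field_char_0}) set"
  assumes A: "admissible n A" and n: "n \<ge> 1"
  shows "\<exists>t f. f \<in> hpoly (Suc n) t \<and> f \<in> vpolys n A \<and> f \<noteq> 0"
proof (rule ccontr)
  assume none: "\<not> ?thesis"
  have kA: "vclosed n A" using A by (simp add: admissible_def)
  let ?H = "{x \<in> coords n. \<forall>F\<in>{X n}. peval F x = 0} :: (nat \<Rightarrow> 'k) set"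
  have "X n \<in> (hpoly (Suc n) 1 :: 'k mpoly set)" by (intro hpoly_X) simp
  then have H: "vclosed n ?H" by (intro vclosed_zeros) blast
  have co: "coords n \<subseteq> A"
  proof
    fix x :: "nat \<Rightarrow> 'k" assume "x \<in> coords n"
    then show "x \<in> A" using vclosed_sep[OF kA, of x] none by (metis peval_0)
  qed
  have "vchain n ?H (n - 1)"
  proof (rule surj_chain[OF H])
    show "unit_vec n \<notin> ?H" by (simp add: unit_vec_def)
    show "n - 1 < n" using n by simp
    show "surj_onto n (n - 1) ?H"
      unfolding surj_onto_def
    proof (intro ballI impI exI)
      fix y :: "nat \<Rightarrow> 'k" assume y: "y \<in> coords n" "\<forall>i>n - 1. y i = 0"
      then have "y(n := 0) = y" using n by (auto simp: fun_eq_iff)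
      then show "y(n := 0) \<in> ?H" using y n by auto
    qed
  qed
  then have "vchain n A (n - 1)" by (rule vchain_mono) (use co in blast)
  then show False using A by (simp add: admissible_def)
qed

text \<open>The projection of \<open>A\<close> from the last unit vector cannot be onto, since
  \<open>surj_chain\<close> would then give a chain of length \<open>n - 1\<close> in
  \<open>A\<close>; a point outside the image is separated by a form in the first \<open>n\<close>
  variables.\<close>

lemma admissible_ex_projected:
  fixes A :: "(nat \<Rightarrow> 'k::{alg_closed_field,field_char_0}) set"
  assumes A: "admissible n A" and n: "n \<ge> 1" and e: "unit_vec n \<notin> A"
  shows "\<exists>t f. f \<in> hpoly n t \<and> f \<in> vpolys n A \<and> f \<noteq> 0"
proof (rule ccontr)
  assume none: "\<not> ?thesis"
  have kA: "vclosed n A" using A by (simp add: admissible_def)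
  have "vchain n A (n - 1)"
  proof (rule surj_chain[OF kA e])
    show "n - 1 < n" using n by simp
    show "surj_onto n (n - 1) A"
      unfolding surj_onto_def
    proof (intro ballI impI)
      fix y :: "nat \<Rightarrow> 'k" assume y: "y \<in> coords n" "\<forall>i>n - 1. y i = 0"
      show "\<exists>c. y(n := c) \<in> A"
      proof (rule ccontr)
        assume "\<not> ?thesis"
        then obtain t g where "g \<in> hpoly n t" "g \<in> vpolys n A" "peval g y \<noteq> 0"
          using projection_sep[OF kA e y(1)] y(2) n by auto
        then show False using none by (metis peval_0)
      qed
    qed
  qed
  then show False using A by (simp add: admissible_def)
qed

text \<open>A point \<open>q\<close> outside the projection of \<open>A\<close> is moved to the unit
  vector of index \<open>m\<close>. The line joining it to the last unit vector, which stays fixed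
  because \<open>q (Suc m) = 0\<close>, then misses \<open>A\<close>.\<close>

lemma ex_noether_shear:
  fixes A :: "(nat \<Rightarrow> 'k::{alg_closed_field,field_char_0}) set"
  assumes A: "admissible (Suc m) A" and m: "m \<ge> 1" and e: "unit_vec (Suc m) \<notin> A"
  shows "\<exists>q. q m = 1 \<and> q (Suc m) = 0 \<and> noether m (pre (shear (Suc m) m q) A)"
proof -
  let ?n = "Suc m"
  obtain t f where f: "f \<in> hpoly ?n t" "f \<in> vpolys ?n A" "f \<noteq> 0"
    using admissible_ex_projected[OF A _ e] by auto
  \<comment> \<open>The factor \<open>X m\<close> makes the coordinate \<open>r m\<close> nonzero,
    so that the point can be normalised to \<open>q m = 1\<close>.\<close>
  have "f * X m \<noteq> 0" using f by simp
  moreover have "f * X m \<in> polys ?n" by (intro polys_mult hpoly_polys[OF f(1)] polys_X) simp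
  ultimately obtain r where r: "\<forall>i\<ge>?n. r i = 0" "peval (f * X m) r \<noteq> 0"
    using ex_peval_nonzero_polys by blast
  define q where "q i = r i / r m" for i
  have rm: "r m \<noteq> 0" "peval f r \<noteq> 0" using r by (auto simp: peval.mult)
  have rq: "r = (\<lambda>i. r m * q i)" using rm by (auto simp: q_def)
  have fq: "peval f q \<noteq> 0"
  proof
    assume "peval f q = 0"
    then have "peval f (\<lambda>i. r m * q i) = 0" by (simp add: peval_hpoly_scale[OF f(1)])
    then show False using rm rq by metis
  qed
  have qm: "q m = 1" "q ?n = 0" using rm r(1) by (auto simp: q_def)
  have kA: "vclosed ?n A" using A by (simp add: admissible_def)
  have "noether m (pre (shear ?n m q) A)"
    unfolding noether_def
  proof (rule ballI, rule ccontr)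
    fix x assume x: "x \<in> pre (shear ?n m q) A" and nx: "\<not> (\<exists>i<m. x i \<noteq> 0)"
    define z where "z = app (shear ?n m q) x"
    have z: "z \<in> A" using x by (simp add: pre_def z_def)
    have "z i = x m * q i" if "i < ?n" for i
      using nx that qm by (auto simp: z_def app_shear less_Suc_eq)
    then have "peval f z = peval f (\<lambda>i. x m * q i)" by (intro peval_cong[OF hpoly_polys[OF f(1)]]) simp
    then have "x m ^ t * peval f q = 0" using vidD[OF f(2) z] by (simp add: peval_hpoly_scale[OF f(1)])
    then have xm: "x m = 0" using fq by auto
    have zc: "z \<in> coords ?n" using z vclosed_coords[OF kA] by blast
    have "z i = z ?n * unit_vec ?n i" for i
    proof (cases "i < ?n")
      case True
      then show ?thesis using \<open>\<And>i. i < ?n \<Longrightarrow> z i = x m * q i\<close> xm by (simp add: unit_vec_def)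
    next
      case False
      then show ?thesis using coordsD[OF zc, of i] by (cases "i = ?n") (auto simp: unit_vec_def)
    qed
    then have zz: "z = (\<lambda>i. z ?n * unit_vec ?n i)" by (rule ext)
    then have "z ?n \<noteq> 0" using zc by (auto simp: coords_def)
    then have "(\<lambda>i. inverse (z ?n) * z i) \<in> A" using vclosed_scale[OF kA z] by simp
    moreover have "(\<lambda>i. inverse (z ?n) * z i) = unit_vec ?n"
    proof
      fix i show "inverse (z ?n) * z i = unit_vec ?n i"
        using fun_cong[OF zz, of i] \<open>z ?n \<noteq> 0\<close> by (simp add: field_simps)
    qed
    ultimately show False using e by simp
  qed
  then show ?thesis using qm by blast
qed



section \<open>The hypersurface obtained by projection from a point\<close>

lemma restrict_vars:
  fixes F :: "'k::field_char_0 mpoly"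
  assumes "F \<in> polys k" shows "msubst Cst (\<lambda>i. if i < k then X i else 0) F = F"
proof (rule peval_inj)
  fix a
  show "peval (msubst Cst (\<lambda>i. if i < k then X i else 0) F) a = peval F a"
    unfolding peval_msubst_Cst by (rule peval_cong[OF assms]) simp
qed

lemma restrict_vars_polys: "msubst Cst (\<lambda>i. if i < k then X i else 0) F \<in> polys k"
proof -
  obtain l where "F \<in> polys l" using ex_polys by blast
  then show ?thesis by (rule msubst_polys) auto
qed

text \<open>Divisibility refers to the ring in all variables. Putting the variables of index at
  least \<open>k\<close> to 0 brings the quotient into \<open>polys k\<close>, and comparing
  components of degree \<open>t\<close> makes it homogeneous.\<close>

lemma quotient_hpoly:
  fixes G H :: "'k::field_char_0 mpoly"
  assumes G: "G \<in> hpoly k s" and H: "H \<in> hpoly k t" and dv: "G dvd H"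
  shows "\<exists>Q\<in>hpoly k (t - s). H = G * Q \<and> (t < s \<longrightarrow> H = 0)"
proof -
  obtain Q0 where Q0: "H = G * Q0" using dv by (rule dvdE)
  define h where "h = msubst Cst (\<lambda>i. if i < k then X i else (0::'k mpoly))"
  interpret h: rhom h unfolding h_def by (rule rhom.rhom_msubst[OF rhom_Cst])
  define Q1 where "Q1 = h Q0"
  have "h H = h G * h Q0" by (simp add: Q0 h.mult)
  then have HQ: "H = G * Q1"
    using restrict_vars[OF hpoly_polys[OF G]] restrict_vars[OF hpoly_polys[OF H]] by (simp add: h_def Q1_def)
  have Q1: "Q1 \<in> polys k" by (simp add: Q1_def h_def restrict_vars_polys)
  show ?thesis
  proof (cases "t < s")
    case True
    have "peval H a = 0" for a
    proof -
      have "scaling_poly H a = monom (peval G a) s * scaling_poly Q1 a"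
        by (rule poly_ext) (simp add: poly_scaling_poly poly_monom HQ peval.mult peval_hpoly_scale[OF G])
      then have "coeff (scaling_poly H a) t = 0" using True by (simp add: coeff_monom_mult)
      then show ?thesis using hcomp_of_hpoly[OF H, of t] by (simp add: coeff_scaling_poly)
    qed
    then have "H = 0" using ex_peval_nonzero by blast
    then show ?thesis by (intro bexI[of _ 0]) auto
  next
    case False
    have "hcomp ((t - s) + s) (G * Q1) = G * hcomp (t - s) Q1" by (rule hcomp_mult_hpoly[OF G])
    then have "hcomp t H = G * hcomp (t - s) Q1" using False HQ by simp
    then have "H = G * hcomp (t - s) Q1" using hcomp_of_hpoly[OF H, of t] by simp
    then show ?thesis using hcomp_hpoly[OF Q1] False by blast
  qed
qed

lemma X_power_dvd:
  fixes p q :: "'k::field_char_0 mpoly"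
  assumes "i \<noteq> j" "X i ^ k * p = X j ^ k * q" shows "X j ^ k dvd p"
proof -
  have e: "in_var j (X i ^ k * p) = smult (X i ^ k) (in_var j p)"
    using assms(1) by (simp add: in_var.mult in_var.power in_var_X poly_const_pow)
  have "in_var j (X j ^ k * q) = monom 1 k * in_var j q"
    by (simp add: in_var.mult in_var.power in_var_X monom_altdef)
  then have eq: "smult (X i ^ k) (in_var j p) = monom 1 k * in_var j q" using e assms(2) by simp
  have "coeff (in_var j p) l = 0" if "l < k" for l
  proof -
    have "X i ^ k * coeff (in_var j p) l = 0" using arg_cong[OF eq, of "\<lambda>P. coeff P l"] that by (simp add: coeff_monom_mult)
    then show ?thesis by simp
  qed
  then have "monom 1 k dvd in_var j p" by (simp add: monom_1_dvd_iff')
  then obtain Q where "in_var j p = monom 1 k * Q" by (rule dvdE)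
  then have "poly (in_var j p) (X j) = X j ^ k * poly Q (X j)" by (simp add: poly_monom)
  then show ?thesis by (simp add: poly_in_var)
qed

lemma monic_dvd_same_degree:
  fixes P Q :: "'a::idom poly"
  assumes "lead_coeff P = 1" "lead_coeff Q = 1" "degree P = degree Q" "P dvd Q" shows "P = Q"
proof -
  obtain R where R: "Q = P * R" using assms(4) by (rule dvdE)
  have nz: "P \<noteq> 0" "R \<noteq> 0" using assms(1,2) R by auto
  have "degree R = 0" using degree_mult_eq[OF nz] R assms(3) by simp
  then obtain c where c: "R = [:c:]" by (rule degree_eq_zeroE)
  have Q: "Q = smult c P" using R c by simp
  have "c = 1" using assms(1,2) unfolding Q lead_coeff_smult by simp
  then show ?thesis using Q by simp
qed

text \<open>Here n = m + 1. The base ring is \<open>polys m\<close>, the projection from the last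
  unit vector leads to the ring \<open>polys (Suc m)\<close>, and \<open>A\<close> lives in
  \<open>polys (Suc (Suc m))\<close>.\<close>

locale noether_frame =
  fixes m :: nat and A :: "(nat \<Rightarrow> 'k::{alg_closed_field,field_char_0}) set"
  assumes m2: "m \<ge> 2" and admissible: "admissible (Suc m) A" and noeth: "noether m A"
begin

lemma kA: "vclosed (Suc m) A" and Ane: "A \<noteq> {}"
  using admissible by (simp_all add: admissible_def)

lemma tf: "a \<in> polys m \<Longrightarrow> a \<noteq> 0 \<Longrightarrow> g \<in> polys (Suc (Suc m)) \<Longrightarrow> a * g \<in> vpolys (Suc m) A \<Longrightarrow> g \<in> vpolys (Suc m) A"
  by (rule torsion_free[OF m2 admissible noeth])

lemma nondeg: "L \<in> hpoly (Suc (Suc m)) 1 \<Longrightarrow> L \<in> vpolys (Suc m) A \<Longrightarrow> L = 0"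
  using admissible by (simp add: admissible_def)

lemma tf_rel_ideal: "\<exists>p\<in>rel_ideal m \<epsilon> A. p \<noteq> 0 \<Longrightarrow> tf_radical_ideal (rel_ideal m \<epsilon> A)"
proof
  show "0 \<in> rel_ideal m \<epsilon> A" by (simp add: rel_ideal_def)
  show "1 \<notin> rel_ideal m \<epsilon> A" using Ane by (auto simp: rel_ideal_def eval2.one)
  show "p \<in> rel_ideal m \<epsilon> A" if "smult c p \<in> rel_ideal m \<epsilon> A" "c \<noteq> 0" for c p
  proof (rule rel_ideal_torsion_free[where c = c])
    show "g \<in> vpolys (Suc m) A"
      if "a \<in> polys m" "a \<noteq> 0" "g \<in> polys (Suc (Suc m))" "a * g \<in> vpolys (Suc m) A" for a g
      using that by (rule tf)
  qed (fact that)+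
qed (auto intro: rel_ideal_add rel_ideal_mult rel_ideal_power)

text \<open>\<open>F\<close> is an equation of the projection of \<open>A\<close> from the last unit
  vector. The divisibility is demanded for relations with arbitrary parameters in the coefficients,
  which contains the case of forms in \<open>m + 1\<close> variables.\<close>

definition is_gen :: "nat \<Rightarrow> 'k mpoly \<Rightarrow> bool" where
  "is_gen e F \<longleftrightarrow> F \<in> hpoly (Suc m) e \<and> F \<in> vpolys (Suc m) A \<and> lead_coeff (in_var m F) = 1 \<and> degree (in_var m F) = e \<and>
     e \<ge> 2 \<and> (\<forall>H\<in>rel_ideal m 0 A. in_var m F dvd H)"

text \<open>The monic generator \<open>P\<close> of the relations is shown to be homogeneous over
  the base: specialising its parameters and taking the component of degree \<open>e\<close> gives
  another monic relation of the same degree, which \<open>P\<close> divides and therefore equals.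
  Degree 1 would be a linear form vanishing on \<open>A\<close>.\<close>

lemma ex_gen: "\<exists>e F. is_gen e F"
proof -
  let ?n = "Suc m"
  let ?J = "rel_ideal m 0 A"
  obtain s f where f: "f \<in> hpoly (Suc m) s" "f \<in> vpolys ?n A" "peval f (unit_vec m) \<noteq> 0"
    using noether_monic(1)[OF kA noeth] by blast
  define \<kappa> where "\<kappa> = peval f (unit_vec m)"
  define f1 where "f1 = smult (Cst (inverse \<kappa>)) (in_var m f)"
  have f1J: "f1 \<in> ?J"
    using rel_ideal_mult[OF rel_ideal_in_var[OF f(2) hpoly_polys[OF f(1)]], of "[:Cst (inverse \<kappa>):]"] by (simp add: f1_def)
  have f1l: "lead_coeff f1 = 1"
    using f(3) in_var_lead_coeff(2)[OF f(1,3)]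
    by (simp add: f1_def \<kappa>_def flip: rhom.mult[OF rhom_Cst])
  then have "f1 \<noteq> 0" by auto
  then have tfJ: "tf_radical_ideal ?J" using f1J by (intro tf_rel_ideal) blast
  obtain P where P: "P \<in> ?J" "lead_coeff P = 1" "degree P > 0" "\<forall>H\<in>?J. P dvd H"
    using ex_monic_generator[OF tfJ f1J f1l] by blast
  define e where "e = degree P"
  \<comment> \<open>The coefficients of \<open>P\<close> may involve parameters of index at least
    \<open>m\<close>. These are put to 0, which keeps \<open>P\<close> monic and a relation.\<close>
  let ?h = "msubst Cst (\<lambda>i. if i < m then X i else (0::'k mpoly))"
  have hr: "rhom ?h" by (rule rhom.rhom_msubst[OF rhom_Cst])
  define P0 where "P0 = map_poly ?h P"
  define F0 where "F0 = poly P0 (X m)"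
  define F where "F = hcomp e F0"
  have cP0: "coeff P0 j = ?h (coeff P j)" for j by (simp add: P0_def rhom.coeff_map[OF hr])
  have P0p: "\<forall>j. coeff P0 j \<in> polys m" by (simp add: cP0 restrict_vars_polys)
  have tpF0: "in_var m F0 = P0" unfolding F0_def by (rule in_var_poly[OF P0p])
  have F0p: "F0 \<in> polys (Suc m)"
    unfolding F0_def using P0p polys_mono[of _ m "Suc m"] by (intro polys_poly) auto
  have F0v: "F0 \<in> vpolys ?n A"
  proof (rule vidI)
    show "F0 \<in> polys (Suc ?n)" using F0p polys_mono by force
    fix x assume x: "x \<in> A"
    have "\<forall>b. (\<forall>i<m. b i = x i) \<longrightarrow> eval2 b P (x m + 0 * b m * x (Suc m)) = 0"
      using P(1) x unfolding rel_ideal_def by blast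
    from spec[OF this, of "\<lambda>i. if i < m then x i else 0"]
    have "eval2 (\<lambda>i. if i < m then x i else 0) P (x m) = 0" by simp
    moreover have "peval (?h c) x = peval c (\<lambda>i. if i < m then x i else 0)" for c
      unfolding peval_msubst_Cst by (rule arg_cong[of _ _ "peval c"]) auto
    then have "map_poly (\<lambda>c. peval c x) P0 = map_poly (\<lambda>c. peval c (\<lambda>i. if i < m then x i else 0)) P"
      by (intro poly_eqI) (simp add: peval.coeff_map cP0)
    ultimately show "peval F0 x = 0" by (simp add: F0_def peval_poly eval2_def)
  qed
  have Fh: "F \<in> hpoly (Suc m) e" unfolding F_def by (rule hcomp_hpoly[OF F0p])
  have Fv: "F \<in> vpolys ?n A" unfolding F_def by (rule vpolys_hcomp[OF kA F0v])
  have dF: "degree (in_var m F) \<le> e" by (rule in_var_lead(1)[OF Fh])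
  have lF: "coeff (in_var m F) e = 1"
  proof -
    obtain D where D: "F0 = (\<Sum>t\<le>D. hcomp t F0)" using sum_hcomp by blast
    have "coeff P0 e = 1" using P(2) by (simp add: cP0 e_def rhom.one[OF hr])
    then have "1 = peval (coeff (in_var m F0) e) (\<lambda>_. 0)" by (simp add: tpF0)
    also have "in_var m F0 = (\<Sum>t\<le>D. in_var m (hcomp t F0))" by (subst D) (rule in_var.sum)
    also have "peval (coeff (\<Sum>t\<le>D. in_var m (hcomp t F0)) e) (\<lambda>_. 0) = (\<Sum>t\<le>D. peval (coeff (in_var m (hcomp t F0)) e) (\<lambda>_. 0))"
      by (simp add: coeff_sum peval.sum)
    \<comment> \<open>Only \<open>t = e\<close> contributes at the origin: for \<open>t > e\<close>
      the coefficient of degree \<open>e\<close> is a form of positive degree, and for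
      \<open>t < e\<close> it is 0.\<close>
    also have "\<dots> = (\<Sum>t\<le>D. if t = e then peval (coeff (in_var m F) e) (\<lambda>_. 0) else 0)"
    proof (rule sum.cong[OF refl])
      fix t
      have g: "graded m t (in_var m (hcomp t F0))" by (rule graded_in_var[OF hcomp_hpoly[OF F0p]])
      show "peval (coeff (in_var m (hcomp t F0)) e) (\<lambda>_. 0) = (if t = e then peval (coeff (in_var m F) e) (\<lambda>_. 0) else 0)"
      proof (cases "e < t")
        case True
        then have "coeff (in_var m (hcomp t F0)) e \<in> hpoly m (t - e)" using g by (auto simp: graded_def dest: spec[of _ e])
        from peval_hpoly_scale[OF this, of 0 "\<lambda>_. 0"] show ?thesis using True by (simp add: power_0_left)
      next
        case False
        then show ?thesis using g by (cases "t = e") (auto simp: graded_def F_def dest: spec[of _ e])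
      qed
    qed
    also have "\<dots> = (if e \<le> D then peval (coeff (in_var m F) e) (\<lambda>_. 0) else 0)" by (simp add: sum.delta)
    finally have "peval (coeff (in_var m F) e) (\<lambda>_. 0) = 1" by (auto split: if_splits)
    moreover obtain c where "coeff (in_var m F) e = Cst c" using in_var_lead(2)[OF Fh] by blast
    ultimately show ?thesis by simp
  qed
  have dF': "degree (in_var m F) = e" using dF lF by (intro antisym le_degree) auto
  have tFJ: "in_var m F \<in> ?J" by (rule rel_ideal_in_var[OF Fv hpoly_polys[OF Fh]])
  have "P = in_var m F"
    by (rule monic_dvd_same_degree[OF P(2)]) (use dF' lF P(4) tFJ e_def in auto)
  moreover have "e \<ge> 2"
  proof (rule ccontr)
    assume "\<not> e \<ge> 2"
    then have e1: "e = 1" using P(3) by (simp add: e_def)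
    have "F = 0" by (rule nondeg) (use hpoly_mono[OF Fh, of "Suc (Suc m)"] Fv e1 in auto)
    then show False using lF by simp
  qed
  ultimately have "is_gen e F" using Fh Fv P dF' by (simp add: is_gen_def)
  then show ?thesis by blast
qed

lemma is_genD:
  assumes "is_gen e F"
  shows "F \<in> hpoly (Suc m) e" "F \<in> vpolys (Suc m) A" "lead_coeff (in_var m F) = 1" "degree (in_var m F) = e" "e \<ge> 2"
    "H \<in> rel_ideal m 0 A \<Longrightarrow> in_var m F dvd H" "F \<noteq> 0"
  using assms by (auto simp: is_gen_def)

lemma gen_dvd:
  assumes "is_gen e F" "H \<in> polys (Suc m)" "H \<in> vpolys (Suc m) A" shows "F dvd H"
proof -
  have "in_var m F dvd in_var m H" by (rule is_genD(6)[OF assms(1) rel_ideal_in_var[OF assms(3,2)]])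
  then obtain Q where "in_var m H = in_var m F * Q" by (rule dvdE)
  then have "poly (in_var m H) (X m) = poly (in_var m F) (X m) * poly Q (X m)" by simp
  then show ?thesis by (simp add: poly_in_var)
qed

lemma gen_small_0:
  assumes "is_gen e F" "H \<in> rel_ideal m 0 A" "degree H < e" shows "H = 0"
proof (rule ccontr)
  assume "H \<noteq> 0"
  then have "degree (in_var m F) \<le> degree H" using is_genD(6)[OF assms(1,2)] dvd_imp_degree_le by blast
  then show False using assms(3) is_genD(4)[OF assms(1)] by simp
qed

lemma gen_hpoly_vpolys:
  assumes g: "is_gen e F" and t: "e \<le> t"
  shows "hpoly (Suc m) t \<inter> vpolys (Suc m) A = (*) F ` hpoly (Suc m) (t - e)"
proof (intro subset_antisym subsetI)
  fix H assume H: "H \<in> hpoly (Suc m) t \<inter> vpolys (Suc m) A"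
  then have "F dvd H" using gen_dvd[OF g] hpoly_polys by blast
  then show "H \<in> (*) F ` hpoly (Suc m) (t - e)"
    using quotient_hpoly[OF is_genD(1)[OF g], of H t] H by blast
next
  fix H assume "H \<in> (*) F ` hpoly (Suc m) (t - e)"
  then obtain Q where Q: "H = F * Q" "Q \<in> hpoly (Suc m) (t - e)" by blast
  have "F * Q \<in> hpoly (Suc m) (e + (t - e))" by (rule hpoly_mult[OF is_genD(1)[OF g] Q(2)])
  moreover have "Q * F \<in> vpolys (Suc m) A"
    by (rule vpolys_mult[OF is_genD(2)[OF g]]) (use polys_mono[OF hpoly_polys[OF Q(2)], of "Suc (Suc m)"] in simp)
  ultimately show "H \<in> hpoly (Suc m) t \<inter> vpolys (Suc m) A" using t Q by (simp add: mult.commute)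
qed

section \<open>Comparison with the Hilbert function of the projected hypersurface\<close>

abbreviation "S t \<equiv> hpoly (Suc m) t :: 'k mpoly set"
abbreviation "I t \<equiv> hpoly (Suc (Suc m)) t \<inter> vpolys (Suc m) A"

lemma dim_sum_space_S_I:
  assumes g: "is_gen e F" and t: "e \<le> t"
  shows "fin_dim (sum_space (S t) (I t))" "sum_space (S t) (I t) \<subseteq> hpoly (Suc (Suc m)) t"
    "mpoly.dim (sum_space (S t) (I t)) + mpoly.dim (S (t - e)) = mpoly.dim (S t) + ideal_dim (Suc m) A t"
proof -
  have fI: "fin_dim (I t)" by (rule fin_dim_hpoly_vpolys) simp
  show "fin_dim (sum_space (S t) (I t))" by (rule fin_dim_dim_sum_space(1)[OF fin_dim_hpoly fI])
  have SR: "S t \<subseteq> hpoly (Suc (Suc m)) t" using hpoly_mono[of _ "Suc m" t "Suc (Suc m)"] by auto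
  show "sum_space (S t) (I t) \<subseteq> hpoly (Suc (Suc m)) t"
    by (rule sum_space_subset[OF hpoly_subspace SR]) auto
  have "S t \<inter> I t = hpoly (Suc m) t \<inter> vpolys (Suc m) A" using SR by blast
  then have "mpoly.dim (S t \<inter> I t) = mpoly.dim (S (t - e))"
    unfolding gen_hpoly_vpolys[OF g t] by (simp add: fin_dim_dim_mult(2)[OF fin_dim_hpoly is_genD(7)[OF g]])
  then show "mpoly.dim (sum_space (S t) (I t)) + mpoly.dim (S (t - e)) = mpoly.dim (S t) + ideal_dim (Suc m) A t"
    using fin_dim_dim_sum_space(2)[OF fin_dim_hpoly[of m t] fI] by (simp add: ideal_dim_def)
qed

text \<open>The forms in \<open>m + 1\<close> variables modulo the multiples of \<open>F\<close>
  embed into the coordinate ring of \<open>A\<close>; in terms of dimensions,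
  \<open>S t + I t\<close> has at most the dimension of all forms.\<close>

lemma hilb_lower:
  assumes g: "is_gen e F" and t: "e \<le> t"
  shows "int (mpoly.dim (S t)) - int (mpoly.dim (S (t - e))) \<le> hilb (Suc m) A t"
  using fin_dim_dim_mono[OF fin_dim_hpoly dim_sum_space_S_I(2)[OF g t]] dim_sum_space_S_I(3)[OF g t] unfolding hilb_def by linarith

text \<open>Modulo the ideal, \<open>X (Suc m)\<close> satisfies a monic equation of degree
  \<open>N\<close>, so only its powers below \<open>N\<close> matter, and \<open>a ^ N\<close> turns
  these into forms in \<open>m + 1\<close> variables by means of \<open>a * X (Suc m) = B\<close>.
  Multiplication by \<open>a ^ N\<close> is injective on the coordinate ring by
  torsion-freeness.\<close>

lemma hilb_upper:
  assumes g: "is_gen e F" and a: "a \<in> hpoly m \<alpha>" "a \<noteq> 0" and B: "B \<in> hpoly (Suc m) (Suc \<alpha>)"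
    and bir: "a * X (Suc m) - B \<in> vpolys (Suc m) A"
  shows "\<exists>c. \<forall>t\<ge>e. hilb (Suc m) A t \<le> int (mpoly.dim (S (t + c))) - int (mpoly.dim (S (t + c - e)))"
proof -
  let ?n = "Suc m"
  obtain N h where h: "h \<in> hpoly (Suc ?n) N" "h \<in> vpolys ?n A" "peval h (unit_vec ?n) \<noteq> 0"
    using noether_monic(2)[OF kA noeth] by blast
  \<comment> \<open>The degree of \<open>a ^ N\<close>.\<close>
  define c where "c = N * \<alpha>"
  have "hilb ?n A t \<le> int (mpoly.dim (S (t + c))) - int (mpoly.dim (S (t + c - e)))" if t: "e \<le> t" for t
  proof -
    let ?T = "sum_space (S (t + c)) (I (t + c))"
    define U where "U = {F. a ^ N * F \<in> ?T}"
    have T: "fin_dim ?T" using dim_sum_space_S_I(1)[OF g] t by simp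
    have sT: "mpoly.subspace ?T" by (rule fin_dim_subspace[OF T])
    have 0: "0 \<in> S (t + c)" "0 \<in> I (t + c)" by simp_all
    have sU: "mpoly.subspace U"
      unfolding mpoly.subspace_def U_def
      using mpoly.subspace_0[OF sT] mpoly.subspace_add[OF sT] mpoly.subspace_scale[OF sT]
      by (auto simp: distrib_left pscale_eq mult.left_commute)
    have aN: "a ^ N \<in> hpoly m c" using hpoly_power[OF a(1)] by (simp add: c_def)
    have aN': "a ^ N \<in> hpoly (Suc ?n) c" by (rule hpoly_mono[OF aN]) simp
    have aNI: "a ^ N * F \<in> I (t + c)" if "F \<in> I t" for F
      using hpoly_mult[OF aN', of F t] vpolys_mult[of F ?n A "a ^ N"] hpoly_polys[OF aN'] that
      by (simp add: add.commute)
    have RU: "hpoly (Suc ?n) t \<subseteq> U"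
    proof (rule monic_reduction[OF _ h sU])
      show "I t \<subseteq> U"
      proof
        fix F assume "F \<in> I t"
        then have "a ^ N * F \<in> I (t + c)" by (rule aNI)
        then have "a ^ N * F \<in> ?T" using sum_space_right[OF 0(1)] by (rule subsetD[rotated])
        then show "F \<in> U" unfolding U_def by (rule CollectI)
      qed
      fix d :: "'k mpoly" and j assume j: "j < N" "j \<le> t" and d: "d \<in> hpoly ?n (t - j)"
      have ap: "a \<in> polys (Suc ?n)" using polys_mono[OF hpoly_polys[OF a(1)]] by force
      have dp: "d \<in> polys (Suc ?n)" using polys_mono[OF hpoly_polys[OF d]] by force
      have Bp: "B \<in> polys (Suc ?n)" using polys_mono[OF hpoly_polys[OF B]] by force
      have "a * X ?n - B dvd (a * X ?n) ^ j - B ^ j" by (rule power_diff_sumr2[THEN dvdI])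
      then obtain q where q: "(a * X ?n) ^ j - B ^ j = (a * X ?n - B) * q" by (rule dvdE)
      \<comment> \<open>Of the \<open>N\<close> factors \<open>a\<close>, exactly \<open>j\<close>
        are combined with the powers of \<open>X ?n\<close> and replaced by \<open>B\<close>; the
        difference \<open>i0\<close> is a multiple of the birational relation.\<close>
      define s0 where "s0 = a ^ (N - j) * d * B ^ j"
      define i0 where "i0 = a ^ N * (d * X ?n ^ j) - s0"
      have "s0 \<in> hpoly ?n ((N - j) * \<alpha> + (t - j) + j * Suc \<alpha>)"
        unfolding s0_def by (intro hpoly_mult hpoly_power B d hpoly_mono[OF a(1)]) simp
      moreover have "(N - j) * \<alpha> + (t - j) + j * Suc \<alpha> = t + c"
      proof -
        have "(N - j) * \<alpha> + j * \<alpha> = c" using j by (simp add: c_def diff_mult_distrib)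
        then show ?thesis using j by simp
      qed
      ultimately have s0: "s0 \<in> S (t + c)" by metis
      have "a ^ N * (d * X ?n ^ j) \<in> hpoly (Suc ?n) (c + ((t - j) + j * 1))"
        by (intro hpoly_mult hpoly_power hpoly_X aN' hpoly_mono[OF d]) auto
      moreover have "c + ((t - j) + j * 1) = t + c" using j by simp
      ultimately have "a ^ N * (d * X ?n ^ j) \<in> hpoly (Suc ?n) (t + c)" by metis
      then have i0h: "i0 \<in> hpoly (Suc ?n) (t + c)"
        unfolding i0_def by (rule hpoly_diff) (rule hpoly_mono[OF s0], simp)
      have "a ^ N = a ^ (N - j) * a ^ j" using j by (simp flip: power_add)
      then have "i0 = a ^ (N - j) * d * ((a * X ?n) ^ j - B ^ j)"
        by (simp add: i0_def s0_def power_mult_distrib algebra_simps)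
      also have "\<dots> = (a ^ (N - j) * d * q) * (a * X ?n - B)" by (simp add: q)
      finally have i0e: "peval i0 x = 0" if "x \<in> A" for x
        using vidD[OF bir that] by (simp add: peval.mult)
      have "i0 \<in> vpolys ?n A" by (rule vidI[OF hpoly_polys[OF i0h] i0e])
      then have "s0 + i0 \<in> ?T" using s0 i0h unfolding sum_space_def by blast
      then show "d * X ?n ^ j \<in> U" by (simp add: U_def i0_def)
    qed simp
    let ?V = "(*) (a ^ N) ` hpoly (Suc ?n) t"
    have aN0: "a ^ N \<noteq> 0" using a(2) by simp
    have fV: "fin_dim ?V" "mpoly.dim ?V = mpoly.dim (hpoly (Suc ?n) t :: 'k mpoly set)"
      using fin_dim_dim_mult[OF fin_dim_hpoly aN0] by auto
    have fI: "fin_dim (I (t + c))" by (rule fin_dim_hpoly_vpolys) simp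
    have VI: "?V \<inter> I (t + c) \<subseteq> (*) (a ^ N) ` I t"
    proof
      fix G assume "G \<in> ?V \<inter> I (t + c)"
      then obtain F0 where F0: "G = a ^ N * F0" "F0 \<in> hpoly (Suc ?n) t" "a ^ N * F0 \<in> vpolys ?n A" by blast
      have "F0 \<in> vpolys ?n A" by (rule tf[OF hpoly_polys[OF aN] aN0 hpoly_polys[OF F0(2)] F0(3)])
      then show "G \<in> (*) (a ^ N) ` I t" using F0 by blast
    qed
    have fIt: "fin_dim (I t)" by (rule fin_dim_hpoly_vpolys) simp
    have "mpoly.dim (?V \<inter> I (t + c)) \<le> mpoly.dim ((*) (a ^ N) ` I t)"
      by (rule fin_dim_dim_mono[OF fin_dim_dim_mult(1)[OF fIt aN0] VI])
    then have d1: "mpoly.dim (?V \<inter> I (t + c)) \<le> ideal_dim ?n A t"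
      using fin_dim_dim_mult(2)[OF fIt aN0] by (simp add: ideal_dim_def)
    have d2: "mpoly.dim (sum_space ?V (I (t + c))) + mpoly.dim (?V \<inter> I (t + c)) = mpoly.dim ?V + mpoly.dim (I (t + c))"
      by (rule fin_dim_dim_sum_space(2)[OF fV(1) fI])
    have "sum_space ?V (I (t + c)) \<subseteq> ?T"
    proof (rule sum_space_subset[OF sT _ sum_space_right[OF 0(1)]])
      show "?V \<subseteq> ?T" using RU unfolding U_def by blast
    qed
    then have d3: "mpoly.dim (sum_space ?V (I (t + c))) \<le> mpoly.dim ?T" by (rule fin_dim_dim_mono[OF T])
    have d4: "mpoly.dim ?T + mpoly.dim (S (t + c - e)) = mpoly.dim (S (t + c)) + ideal_dim ?n A (t + c)"
      by (rule dim_sum_space_S_I(3)[OF g]) (use t in simp)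
    show ?thesis
      using d1 d2 d3 d4 fV(2) unfolding hilb_def ideal_dim_def by linarith
  qed
  then show ?thesis by blast
qed

text \<open>Since \<open>S e\<close> and \<open>I e\<close> meet in the scalar multiples of
  \<open>F\<close>, Grassmann's formula and Pascal's rule give the bound as soon as
  \<open>S e + I e\<close> is not the space of all forms: that single missing dimension pays for the
  one-dimensional intersection. The bound is the number of conditions that a point of multiplicity
  \<open>e\<close> imposes.\<close>

lemma ideal_dim_bound:
  assumes g: "is_gen e F" shows "ideal_dim (Suc m) A e \<le> mpoly.dim (hpoly (Suc (Suc m)) (e - 1) :: 'k mpoly set)"
proof -
  let ?n = "Suc m"
  define k where "k = e - 1"
  have ek: "e = Suc k" using is_genD(5)[OF g] by (simp add: k_def)
  note T = dim_sum_space_S_I[OF g order_refl]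
  have ne: "sum_space (S e) (I e) \<noteq> hpoly (Suc ?n) e"
  proof
    assume eq: "sum_space (S e) (I e) = hpoly (Suc ?n) e"
    have split: "\<exists>s\<in>S e. X i ^ k * X ?n - s \<in> vpolys ?n A \<and> degree (in_var m s) < e" if i: "i < m" for i
    proof -
      have "X i ^ k * X ?n \<in> hpoly (Suc ?n) (k * 1 + 1)" using i by (intro hpoly_mult hpoly_power hpoly_X) auto
      then have "X i ^ k * X ?n \<in> sum_space (S e) (I e)" using ek eq by simp
      then obtain s j where s: "X i ^ k * X ?n = s + j" "s \<in> S e" "j \<in> I e" by (auto simp: sum_space_def)
      obtain \<kappa> where \<kappa>: "coeff (in_var m s) e = Cst \<kappa>" using in_var_lead(2)[OF s(2)] by blast
      \<comment> \<open>Subtracting a multiple of the monic \<open>F\<close>, which lies in the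
        ideal, lowers the degree in \<open>X m\<close> below \<open>e\<close>.\<close>
      define s' where "s' = s - Cst \<kappa> * F"
      have s'S: "s' \<in> S e" unfolding s'_def by (rule hpoly_diff[OF s(2) hpoly_Cst_mult[OF is_genD(1)[OF g]]])
      have "X i ^ k * X ?n - s' = j + Cst \<kappa> * F" by (simp add: s'_def s(1))
      moreover have "j + Cst \<kappa> * F \<in> vpolys ?n A"
        using s(3) by (intro vpolys_add vpolys_mult is_genD(2)[OF g]) auto
      moreover have "degree (in_var m s') < e"
      proof -
        have "coeff (in_var m s') e = 0"
          using \<kappa> is_genD(3,4)[OF g] by (simp add: s'_def in_var.diff in_var.mult)
        then show ?thesis using in_var_lead(1)[OF s'S] ek
          by (metis le_neq_implies_less leading_coeff_0_iff degree_0 zero_less_Suc)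
      qed
      ultimately show ?thesis using s'S by metis
    qed
    have m01: "0 < m" "1 < m" using m2 by auto
    obtain s0 where s0: "s0 \<in> S e" "X 0 ^ k * X ?n - s0 \<in> vpolys ?n A" "degree (in_var m s0) < e" using split[OF m01(1)] by blast
    obtain s1 where s1: "s1 \<in> S e" "X 1 ^ k * X ?n - s1 \<in> vpolys ?n A" "degree (in_var m s1) < e" using split[OF m01(2)] by blast
    \<comment> \<open>\<open>X ?n\<close> is eliminated from the two relations. The result lies in
      the ideal, involves \<open>m + 1\<close> variables and has degree below \<open>e\<close> in
      \<open>X m\<close>, so it is 0 by minimality of \<open>F\<close>.\<close>
    define D where "D = X 1 ^ k * s0 - X 0 ^ k * s1"
    have "D = X 0 ^ k * (X 1 ^ k * X ?n - s1) - X 1 ^ k * (X 0 ^ k * X ?n - s0)"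
      by (simp add: D_def algebra_simps)
    then have Dv: "D \<in> vpolys ?n A" using s0(2) s1(2) by (auto intro!: vpolys_diff vpolys_mult polys_power polys_X)
    have Dp: "D \<in> polys (Suc m)"
      unfolding D_def using m2 by (intro polys_diff polys_mult polys_power polys_X hpoly_polys[OF s0(1)] hpoly_polys[OF s1(1)]) auto
    have "in_var m (X 1 ^ k) = [:X 1 ^ k :: 'k mpoly:]" "in_var m (X 0 ^ k) = [:X 0 ^ k :: 'k mpoly:]"
      using m2 by (simp_all add: in_var.power in_var_X poly_const_pow)
    then have "in_var m D = smult (X 1 ^ k) (in_var m s0) - smult (X 0 ^ k) (in_var m s1)"
      by (simp add: D_def in_var.diff in_var.mult)
    then have "degree (in_var m D) < e"
      using s0(3) s1(3) by (simp add: degree_diff_less)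
    then have "in_var m D = 0" using gen_small_0[OF g rel_ideal_in_var[OF Dv Dp]] by blast
    then have "D = 0" using poly_in_var[of m D] by simp
    then have "X 1 ^ k * s0 = X 0 ^ k * s1" by (simp add: D_def)
    then have "X 0 ^ k dvd s0" by (rule X_power_dvd[rotated]) simp
    moreover have "(X 0 ^ k :: 'k mpoly) \<in> hpoly (Suc m) (k * 1)" by (intro hpoly_power hpoly_X) simp
    ultimately obtain b where b: "b \<in> hpoly (Suc m) (e - k * 1)" "s0 = X 0 ^ k * b"
      using quotient_hpoly[OF _ s0(1)] by blast
    have b1: "b \<in> hpoly (Suc m) 1" using b(1) ek by simp
    \<comment> \<open>After dividing \<open>s0\<close> by \<open>X 0 ^ k\<close> the first relation
      reads \<open>X 0 ^ k * L\<close>, so torsion-freeness puts the linear form \<open>L\<close>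
      into the ideal, against non-degeneracy.\<close>
    define L where "L = X ?n - b"
    have Lh: "L \<in> hpoly (Suc ?n) 1" unfolding L_def by (intro hpoly_diff hpoly_X hpoly_mono[OF b1]) auto
    have "X 0 ^ k * L \<in> vpolys ?n A" using s0(2) b(2) by (simp add: L_def algebra_simps)
    then have "L \<in> vpolys ?n A"
      by (rule tf[rotated 3]) (use m2 hpoly_polys[OF Lh] in \<open>auto intro!: polys_power polys_X\<close>)
    then have "L = 0" by (rule nondeg[OF Lh])
    then have "X ?n = b" by (simp add: L_def)
    then have "peval b (unit_vec ?n) = (1::'k)" by (metis peval_X unit_vec_def)
    moreover have "peval b (unit_vec ?n) = peval b (\<lambda>_. 0)"
      by (rule peval_cong[OF hpoly_polys[OF b1]]) (auto simp: unit_vec_def)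
    moreover have "peval b (\<lambda>_. 0) = (0::'k)" using peval_hpoly_scale[OF b1, of 0 "\<lambda>_. 0"] by simp
    ultimately show False by simp
  qed
  have "mpoly.dim (sum_space (S e) (I e)) < mpoly.dim (hpoly (Suc ?n) e :: 'k mpoly set)"
    using T(2) ne by (intro fin_dim_dim_strict_mono[OF fin_dim_hpoly fin_dim_subspace[OF T(1)]]) auto
  moreover have "mpoly.dim (S (e - e)) = 1" unfolding dim_hpoly by simp
  moreover have "mpoly.dim (hpoly (Suc ?n) e :: 'k mpoly set) = mpoly.dim (S e) + mpoly.dim (hpoly (Suc ?n) (e - 1) :: 'k mpoly set)"
    unfolding dim_hpoly ek by simp
  ultimately show ?thesis using T(3) by linarith
qed

end



section \<open>A birational projection\<close>

lemma pderiv_poly_chain: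
  fixes Q :: "'a::idom poly poly"
  shows "pderiv (poly Q l) = poly (map_poly pderiv Q) l + poly (pderiv Q) l * pderiv l"
  by (induction Q) (simp_all add: map_poly_pCons pderiv_add pderiv_mult pderiv_pCons algebra_simps)

context noether_frame begin

text \<open>The combination of \<open>x m\<close> and \<open>x (Suc m)\<close> with variable slope
  is algebraic over the base with the slope adjoined. Its equation arises by eliminating
  \<open>x (Suc m)\<close> from its own monic equation and from the equation of \<open>x m\<close>,
  rewritten in terms of the combination.\<close>

lemma ex_rel_ideal_slope_nonzero: "\<exists>G\<in>rel_ideal m 1 A. G \<noteq> 0"
proof -
  let ?n = "Suc m"
  obtain s f where f: "f \<in> hpoly (Suc m) s" "f \<in> vpolys ?n A" "peval f (unit_vec m) \<noteq> 0"
    using noether_monic(1)[OF kA noeth] by blast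
  interpret E: frame ?n "exch m ?n" "exch m ?n :: nat \<Rightarrow> 'k mpoly" by (rule frame_exch) auto
  have "noether m (pre (exch m ?n) A)"
    unfolding noether_def
  proof
    fix x assume "x \<in> pre (exch m ?n) A"
    then have "app (exch m ?n) x \<in> A" by (simp add: pre_def)
    then obtain i where "i < m" "app (exch m ?n) x i \<noteq> 0" using noeth by (auto simp: noether_def)
    then show "\<exists>i<m. x i \<noteq> 0" by (auto simp: app_exch)
  qed
  then obtain s' g where g: "g \<in> hpoly (Suc m) s'" "g \<in> vpolys ?n (pre (exch m ?n) A)" "peval g (unit_vec m) \<noteq> 0"
    using noether_monic(1)[OF E.vclosed_pre[OF kA]] by blast
  \<comment> \<open>Here \<open>b m\<close> is the slope, \<open>b ?n\<close> stands for the
    combination \<open>x m + b m * x ?n\<close>, and the variable of the univariate polynomial for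
    \<open>x ?n\<close>, which is to be eliminated.\<close>
  define K where "K = {G. \<forall>x\<in>A. \<forall>b. (\<forall>i<m. b i = x i) \<longrightarrow> b ?n = x m + b m * x ?n \<longrightarrow> eval2 b G (x ?n) = 0}"
  define f1 where "f1 = msubst (\<lambda>c. [:Cst c:]) (\<lambda>i. if i < m then [:X i:] else [:X ?n, - X m:]) f"
  have f1h: "rhom (msubst (\<lambda>c::'k. [:Cst c:]) (\<lambda>i. if i < m then [:X i:] else [:X ?n, - X m:]))"
    by (rule rhom.rhom_msubst[OF rhom_const_Cst])
  \<comment> \<open>At slope 0 the combination is \<open>x m\<close> itself, so \<open>f1\<close>
    becomes the constant \<open>f2\<close>, which is nonzero; this certifies that the elimination
    does not return 0.\<close>
  let ?e = "msubst Cst (\<lambda>i. if i = m then 0 else X i) :: 'k mpoly \<Rightarrow> 'k mpoly"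
  interpret e: rhom ?e by (rule rhom.rhom_msubst[OF rhom_Cst])
  have eX: "?e (X i) = (if i = m then 0 else X i)" and eC: "?e (Cst c) = Cst c" for i c
    by (simp_all add: rhom.msubst_X rhom.msubst_Cst rhom_Cst)
  have f1K: "f1 \<in> K"
    unfolding K_def
  proof (intro CollectI ballI allI impI)
    fix x b assume x: "x \<in> A" "\<forall>i<m. b i = x i" "b ?n = x m + b m * x ?n"
    have "eval2 b f1 (x ?n) = msubst (\<lambda>c. eval2 b [:Cst c:] (x ?n)) (\<lambda>i. eval2 b (if i < m then [:X i:] else [:X ?n, - X m:]) (x ?n)) f"
      unfolding f1_def
      by (rule trans[OF rhom_mpoly_eq_msubst[OF rhom_comp[OF eval2.rhom_axioms f1h]]])
         (simp add: rhom.msubst_X rhom.msubst_Cst rhom_const_Cst)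
    also have "(\<lambda>c. eval2 b [:Cst c:] (x ?n)) = (\<lambda>c. c)" by (simp add: fun_eq_iff)
    also have "msubst (\<lambda>c. c) (\<lambda>i. eval2 b (if i < m then [:X i:] else [:X ?n, - X m:]) (x ?n)) f = msubst (\<lambda>c. c) x f"
    proof (rule msubst_cong[OF hpoly_polys[OF f(1)]])
      fix i assume "i < Suc m"
      then show "eval2 b (if i < m then [:X i:] else [:X ?n, - X m:]) (x ?n) = x i"
        using x by (cases "i < m") (auto simp: peval.uminus algebra_simps less_Suc_eq)
    qed
    also have "\<dots> = peval f x" by (simp only: peval_eq_msubst)
    finally show "eval2 b f1 (x ?n) = 0" using vidD[OF f(2) x(1)] by simp
  qed
  have f0K: "in_var m g \<in> K"
    unfolding K_def
  proof (intro CollectI ballI allI impI)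
    fix x b assume x: "x \<in> A" "\<forall>i<m. b i = x i"
    have "app (exch m ?n) x \<in> pre (exch m ?n) A" using x E.inv by (simp add: pre_def)
    then have "peval g (app (exch m ?n) x) = 0" using vidD[OF g(2)] by blast
    moreover have "peval g (app (exch m ?n) x) = peval g (b(m := x ?n))"
      by (rule peval_cong[OF hpoly_polys[OF g(1)]]) (use x in \<open>auto simp: app_exch less_Suc_eq\<close>)
    ultimately show "eval2 b (in_var m g) (x ?n) = 0" by (simp add: eval2_in_var)
  qed
  define f2 where "f2 = msubst Cst (\<lambda>i. if i < m then X i else X ?n) f"
  have ef1: "map_poly ?e f1 = [:f2:]"
  proof -
    have r1: "rhom (\<lambda>F. map_poly ?e (msubst (\<lambda>c::'k. [:Cst c:]) (\<lambda>i. if i < m then [:X i:] else [:X ?n, - X m:]) F))"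
      by (rule rhom_comp[OF e.rhom_map_poly f1h])
    have r2: "rhom (\<lambda>F. [:msubst Cst (\<lambda>i. if i < m then X i else X ?n) F :: 'k mpoly:])"
      by (rule rhom_comp[OF rhom_const rhom.rhom_msubst[OF rhom_Cst]])
    show ?thesis
      unfolding f1_def f2_def
    proof (rule rhom_mpoly_eqI[OF r1 r2])
      fix c i
      show "map_poly ?e (msubst (\<lambda>c::'k. [:Cst c:]) (\<lambda>i. if i < m then [:X i:] else [:X ?n, - X m:]) (Cst c)) =
        [:msubst Cst (\<lambda>i. if i < m then X i else X ?n) (Cst c):]"
        unfolding rhom.msubst_Cst[OF rhom_const_Cst] rhom.msubst_Cst[OF rhom_Cst]
        by (simp add: e.map_poly_pCons eC)
      show "map_poly ?e (msubst (\<lambda>c::'k. [:Cst c:]) (\<lambda>i. if i < m then [:X i:] else [:X ?n, - X m:]) (X i)) =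
        [:msubst Cst (\<lambda>i. if i < m then X i else X ?n) (X i):]"
        unfolding rhom.msubst_X[OF rhom_const_Cst] rhom.msubst_X[OF rhom_Cst]
        by (simp add: e.map_poly_pCons eX e.uminus)
    qed
  qed
  have cf1: "?e (coeff f1 j) = coeff [:f2:] j" for j unfolding ef1[symmetric] by (rule e.coeff_map[symmetric])
  have f20: "f2 \<noteq> 0"
  proof -
    have "peval f2 (unit_vec ?n) = peval f (unit_vec m)"
      unfolding f2_def peval_msubst_Cst
      by (rule peval_cong[OF hpoly_polys[OF f(1)]]) (auto simp: unit_vec_def)
    then show ?thesis using f(3) by auto
  qed
  have "\<exists>\<gamma>. [:\<gamma>:] \<in> K \<and> ?e \<gamma> \<noteq> 0"
  proof (rule resultant_elimination[OF e.rhom_axioms _ _ f0K _ f1K])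
    show "p - q \<in> K" if "p \<in> K" "q \<in> K" for p q using that by (simp add: K_def eval2.diff)
    show "r * p \<in> K" if "p \<in> K" for p r using that by (simp add: K_def eval2.mult)
    show "?e (lead_coeff (in_var m g)) \<noteq> 0" using in_var_lead_coeff(2)[OF g(1,3)] g(3) by (simp add: eC)
    show "?e (coeff f1 0) \<noteq> 0" using cf1[of 0] f20 by simp
    show "\<And>j. j > 0 \<Longrightarrow> ?e (coeff f1 j) = 0" using cf1 by (simp add: coeff_pCons split: nat.splits)
  qed
  then obtain \<gamma> where \<gamma>: "[:\<gamma>:] \<in> K" "?e \<gamma> \<noteq> 0" by blast
  \<comment> \<open>The variable \<open>X ?n\<close>, which carried the combination as a parameter,
    becomes the variable of the relation.\<close>
  have "in_var ?n \<gamma> \<in> rel_ideal m 1 A"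
    unfolding rel_ideal_def
  proof (intro CollectI ballI allI impI)
    fix x b assume x: "x \<in> A" "\<forall>i<m. b i = x i"
    define b' where "b' = b(?n := x m + 1 * b m * x ?n)"
    have "(\<forall>i<m. b' i = x i) \<longrightarrow> b' ?n = x m + b' m * x ?n \<longrightarrow> eval2 b' [:\<gamma>:] (x ?n) = 0"
      using \<gamma>(1) x(1) unfolding K_def by blast
    then have "peval \<gamma> b' = 0" using x by (simp add: b'_def)
    then show "eval2 b (in_var ?n \<gamma>) (x m + 1 * b m * x ?n) = 0" by (simp add: eval2_in_var b'_def)
  qed
  moreover have "in_var ?n \<gamma> \<noteq> 0"
  proof
    assume "in_var ?n \<gamma> = 0"
    then have "\<gamma> = 0" using poly_in_var[of ?n \<gamma>] by simp
    then show False using \<gamma>(2) by simp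
  qed
  ultimately show ?thesis by blast
qed

text \<open>The total derivative, with respect to the slope, of a relation along a fixed point
  \<open>x\<close>: the first summand comes from the coefficients, the second from the argument,
  whose derivative is \<open>x (Suc m)\<close>.\<close>

lemma slope_derivative:
  assumes G: "G \<in> rel_ideal m 1 A" and x: "x \<in> A" and b: "\<forall>i<m. b i = x i"
  shows "eval2 b (map_poly (\<lambda>c. poly (pderiv (in_var m c)) (X m)) G) (x m + b m * x (Suc m)) +
    x (Suc m) * eval2 b (pderiv G) (x m + b m * x (Suc m)) = 0"
proof -
  define \<rho> where "\<rho> c = map_poly (\<lambda>c. peval c b) (in_var m c)" for c
  have \<rho>: "rhom \<rho>" unfolding \<rho>_def by (rule rhom_comp[OF peval.rhom_map_poly in_var.rhom_axioms])
  define Q where "Q = map_poly \<rho> G"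
  define l where "l = [:x m, x (Suc m):]"
  have p\<rho>: "poly (\<rho> c) t = peval c (b(m := t))" for c t
    using eval2_in_var[of b m c t] by (simp add: \<rho>_def eval2_def)
  have Ql: "poly (poly (map_poly \<rho> H) l) t = eval2 (b(m := t)) H (x m + t * x (Suc m))" for t H
  proof -
    have "poly (poly (map_poly \<rho> H) l) t = poly (map_poly (\<lambda>p. poly p t) (map_poly \<rho> H)) (poly l t)"
      by (rule rhom.poly_map[OF rhom_poly])
    also have "map_poly (\<lambda>p. poly p t) (map_poly \<rho> H) = map_poly (\<lambda>c. peval c (b(m := t))) H"
      by (rule poly_eqI) (simp add: coeff_map_poly rhom.zero[OF \<rho>] p\<rho>)
    finally show ?thesis by (simp add: eval2_def l_def)
  qed
  have "poly (poly Q l) t = 0" for t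
  proof -
    have "\<forall>b. (\<forall>i<m. b i = x i) \<longrightarrow> eval2 b G (x m + 1 * b m * x (Suc m)) = 0"
      using G x unfolding rel_ideal_def by blast
    from spec[OF this, of "b(m := t)"] b show ?thesis by (simp add: Q_def Ql)
  qed
  then have "poly Q l = 0" using poly_all_0_iff_0 by blast
  then have "poly (map_poly pderiv Q) l + poly (pderiv Q) l * pderiv l = 0"
    using pderiv_poly_chain[of Q l] by simp
  then have "poly (poly (map_poly pderiv Q) l) (b m) + poly (poly (pderiv Q) l) (b m) * poly (pderiv l) (b m) = 0"
    by (metis poly_0 poly_add poly_mult)
  moreover have "poly (pderiv l) (b m) = x (Suc m)" by (simp add: l_def pderiv_pCons)
  moreover have "pderiv Q = map_poly \<rho> (pderiv G)" unfolding Q_def by (rule rhom_map_poly_pderiv[OF \<rho>, symmetric])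
  then have "poly (poly (pderiv Q) l) (b m) = eval2 b (pderiv G) (x m + b m * x (Suc m))"
    using Ql[of "pderiv G" "b m"] by simp
  moreover have "poly (poly (map_poly pderiv Q) l) (b m) =
      eval2 b (map_poly (\<lambda>c. poly (pderiv (in_var m c)) (X m)) G) (x m + b m * x (Suc m))"
  proof -
    have "poly (poly (map_poly pderiv Q) l) (b m) = poly (map_poly (\<lambda>p. poly p (b m)) (map_poly pderiv Q)) (poly l (b m))"
      by (rule rhom.poly_map[OF rhom_poly])
    also have "map_poly (\<lambda>p. poly p (b m)) (map_poly pderiv Q) =
        map_poly (\<lambda>c. peval c b) (map_poly (\<lambda>c. poly (pderiv (in_var m c)) (X m)) G)"
    proof (rule poly_eqI)
      fix i
      have "poly (pderiv (\<rho> c)) (b m) = peval (poly (pderiv (in_var m c)) (X m)) b" for c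
        unfolding peval_poly eval2_def \<rho>_def by (simp add: rhom_map_poly_pderiv[OF peval.rhom_axioms])
      then show "coeff (map_poly (\<lambda>p. poly p (b m)) (map_poly pderiv Q)) i =
          coeff (map_poly (\<lambda>c. peval c b) (map_poly (\<lambda>c. poly (pderiv (in_var m c)) (X m)) G)) i"
        by (simp add: coeff_map_poly Q_def rhom.zero[OF \<rho>])
    qed
    finally show ?thesis by (simp add: eval2_def l_def)
  qed
  ultimately show ?thesis by (simp add: mult.commute)
qed

text \<open>Differentiating a minimal equation of \<open>X m + t * X (Suc m)\<close> with respect to \<open>t\<close> expresses
  \<open>X (Suc m)\<close> rationally.\<close>

lemma ex_birational:
  "\<exists>t \<alpha> a B. let A' = pre (shear (Suc m) (Suc m) (\<lambda>i. if i = m then - t else if i = Suc m then 1 else 0)) A in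
     noether_frame m A' \<and> a \<in> hpoly m \<alpha> \<and> a \<noteq> 0 \<and> B \<in> hpoly (Suc m) (Suc \<alpha>) \<and> a * X (Suc m) - B \<in> vpolys (Suc m) A'"
proof -
  let ?n = "Suc m"
  interpret J: tf_radical_ideal "rel_ideal m 1 A" by (rule tf_rel_ideal[OF ex_rel_ideal_slope_nonzero])
  obtain G where G: "J.is_min G" using J.ex_min by blast
  have "inj (of_nat :: nat \<Rightarrow> 'k mpoly)" by (rule inj_of_nat)
  then obtain A0 b0 where Ab: "b0 \<noteq> 0" "[:b0:] - A0 * pderiv G \<in> rel_ideal m 1 A"
    using J.is_min_bezout_pderiv[OF G] by blast
  define GT where "GT = map_poly (\<lambda>c. poly (pderiv (in_var m c)) (X m)) G"
  \<comment> \<open>Multiplying the differentiated relation by \<open>A0\<close> replaces the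
    derivative of \<open>G\<close> by \<open>b0\<close> on \<open>A\<close>, which leaves
    \<open>b0 * x ?n = - A0 * GT\<close>.\<close>
  define Bz where "Bz = - A0 * GT"
  have key: "peval b0 b * x ?n = eval2 b Bz (x m + b m * x ?n)" if x: "x \<in> A" "\<forall>i<m. b i = x i" for x b
  proof -
    let ?z = "x m + b m * x ?n"
    have "\<forall>b. (\<forall>i<m. b i = x i) \<longrightarrow> eval2 b ([:b0:] - A0 * pderiv G) (x m + 1 * b m * x ?n) = 0"
      using Ab(2) x(1) unfolding rel_ideal_def by blast
    from spec[OF this, of b] x(2) have 1: "peval b0 b = eval2 b A0 ?z * eval2 b (pderiv G) ?z"
      by (simp add: eval2.diff eval2.mult)
    have 2: "eval2 b GT ?z + x ?n * eval2 b (pderiv G) ?z = 0"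
      unfolding GT_def by (rule slope_derivative[OF J.is_minD(1)[OF G] x])
    have "eval2 b Bz ?z = - eval2 b A0 ?z * eval2 b GT ?z" by (simp add: Bz_def eval2.mult eval2.uminus)
    also have "eval2 b GT ?z = - (x ?n * eval2 b (pderiv G) ?z)" using 2 by (simp add: eq_neg_iff_add_eq_0)
    finally show ?thesis using 1 by simp
  qed
  obtain b1 where b1: "peval b0 b1 \<noteq> 0" using ex_peval_nonzero[OF Ab(1)] by blast
  \<comment> \<open>All parameters are frozen at \<open>b1\<close>, where \<open>b0\<close> does not
    vanish; the slope among them determines the new coordinate.\<close>
  define t where "t = b1 m"
  let ?h = "msubst Cst (\<lambda>i. if i < m then X i else Cst (b1 i)) :: 'k mpoly \<Rightarrow> 'k mpoly"
  interpret h: rhom ?h by (rule rhom.rhom_msubst[OF rhom_Cst])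
  have hpoly: "?h F \<in> polys m" for F
  proof -
    obtain k where "F \<in> polys k" using ex_polys by blast
    then show ?thesis by (rule msubst_polys) auto
  qed
  have ph: "peval (?h F) y = peval F (\<lambda>i. if i < m then y i else b1 i)" for F y
    unfolding peval_msubst_Cst by (rule arg_cong[of _ _ "peval F"]) auto
  define B where "B = poly (map_poly ?h Bz) (X m)"
  have pB: "peval B y = eval2 (\<lambda>i. if i < m then y i else b1 i) Bz (y m)" for y
    unfolding B_def peval_poly eval2_def
    by (intro arg_cong2[where f = poly] poly_eqI) (simp_all add: peval.coeff_map h.coeff_map ph)
  have Bp: "B \<in> polys (Suc m)"
    unfolding B_def by (rule polys_poly) (auto simp: h.coeff_map intro: polys_mono[OF hpoly])
  let ?L = "shear ?n ?n (\<lambda>i. if i = m then - t else if i = ?n then 1 else 0) :: nat \<Rightarrow> 'k mpoly"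
  let ?q = "(\<lambda>i. if i = m then - t else if i = ?n then 1 else 0) :: nat \<Rightarrow> 'k"
  interpret L: frame ?n ?L "shear ?n ?n (\<lambda>i. if i = ?n then 1 / ?q ?n else - ?q i / ?q ?n)"
    by (rule frame_shear(1)) auto
  define A' where "A' = pre ?L A"
  have aL: "app ?L y i = (if i = m then y m - t * y ?n else y i)" for y i
    by (auto simp: app_shear)
  have nA': "noether_frame m A'"
  proof
    show "m \<ge> 2" by (rule m2)
    show "admissible ?n A'" unfolding A'_def by (rule L.admissible_pre[OF admissible])
    show "noether m A'"
      unfolding noether_def
    proof
      fix y assume "y \<in> A'"
      then have "app ?L y \<in> A" by (simp add: A'_def pre_def)
      then obtain i where "i < m" "app ?L y i \<noteq> 0" using noeth by (auto simp: noether_def)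
      then show "\<exists>i<m. y i \<noteq> 0" by (auto simp: aL)
    qed
  qed
  interpret A': noether_frame m A' by (rule nA')
  have h0: "?h b0 \<noteq> 0"
  proof
    assume "?h b0 = 0"
    then have "peval (?h b0) b1 = 0" by simp
    then show False using b1 by (simp add: ph)
  qed
  have bir: "?h b0 * X ?n - B \<in> vpolys ?n A'"
  proof (rule vidI)
    show "?h b0 * X ?n - B \<in> polys (Suc ?n)"
      by (intro polys_diff polys_mult polys_X polys_mono[OF hpoly] polys_mono[OF Bp]) auto
    fix y assume "y \<in> A'"
    then have x: "app ?L y \<in> A" by (simp add: A'_def pre_def)
    have "peval b0 (\<lambda>i. if i < m then y i else b1 i) * app ?L y ?n =
        eval2 (\<lambda>i. if i < m then y i else b1 i) Bz (app ?L y m + (if m < m then y m else b1 m) * app ?L y ?n)"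
      by (rule key[OF x]) (auto simp: aL)
    then show "peval (?h b0 * X ?n - B) y = 0"
      by (simp add: peval.diff peval.mult ph pB aL t_def)
  qed
  \<comment> \<open>Neither \<open>?h b0\<close> nor \<open>B\<close> need be homogeneous. The ideal
    is, so the component of degree \<open>Suc \<alpha>\<close> of the relation is again one.\<close>
  obtain \<alpha> where \<alpha>: "hcomp \<alpha> (?h b0) \<noteq> 0" using hcomp_eq_0D[OF _] h0 by blast
  define a where "a = hcomp \<alpha> (?h b0)"
  have "hcomp (Suc \<alpha>) (?h b0 * X ?n - B) = a * X ?n - hcomp (Suc \<alpha>) B"
  proof -
    have d: "hcomp s (F - H) = hcomp s F - hcomp s H" for s and F H :: "'k mpoly"
      by (rule poly_mapping_eqI) (simp add: lookup_hcomp lookup_minus)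
    have "hcomp (\<alpha> + 1) (X ?n * ?h b0) = X ?n * hcomp \<alpha> (?h b0)"
      by (rule hcomp_mult_hpoly[OF hpoly_X[of ?n "Suc ?n"]]) simp
    then show ?thesis by (simp add: d a_def mult.commute)
  qed
  then have "a * X ?n - hcomp (Suc \<alpha>) B \<in> vpolys ?n A'" using vpolys_hcomp[OF A'.kA bir, of "Suc \<alpha>"] by simp
  moreover have "a \<in> hpoly m \<alpha>" "a \<noteq> 0" using \<alpha> hcomp_hpoly[OF hpoly] by (simp_all add: a_def)
  moreover have "hcomp (Suc \<alpha>) B \<in> hpoly (Suc m) (Suc \<alpha>)" by (rule hcomp_hpoly[OF Bp])
  ultimately show ?thesis using nA' unfolding A'_def Let_def by blast
qed

end

section \<open>Hilbert functions and degree\<close>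

text \<open>Multiplied by \<open>fact k\<close>, the binomial coefficient is the product of the
  \<open>k\<close> factors \<open>x + 1\<close> up to \<open>x + k\<close>.\<close>

lemma choose_bounds:
  "real (x ^ k) \<le> fact k * real ((x + k) choose k)" "fact k * real ((x + k) choose k) \<le> real ((x + k) ^ k)"
proof -
  have e: "fact k * ((x + k) choose k) = (\<Prod>i=1..k. x + i)"
  proof (induction k)
    case (Suc k)
    have "Suc k * ((x + Suc k) choose Suc k) = (x + Suc k) * ((x + k) choose k)"
      using Suc_times_binomial_eq[of "x + k" k] by simp
    then have "fact k * (Suc k * ((x + Suc k) choose Suc k)) = fact k * ((x + Suc k) * ((x + k) choose k))"
      by (simp only:)
    then have "fact (Suc k) * ((x + Suc k) choose Suc k) = (x + Suc k) * (fact k * ((x + k) choose k))"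
      by (simp only: fact_Suc of_nat_id mult_ac)
    also have "\<dots> = (\<Prod>i=1..Suc k. x + i)" unfolding Suc by (simp add: mult.commute)
    finally show ?case .
  qed simp
  have "x ^ k \<le> fact k * ((x + k) choose k)"
  proof -
    have "(\<Prod>i=1..k. x) \<le> (\<Prod>i=1..k. x + i)" by (rule prod_mono) auto
    then show ?thesis using e by simp
  qed
  then have "real (x ^ k) \<le> real (fact k * ((x + k) choose k))" by (rule of_nat_mono)
  then show "real (x ^ k) \<le> fact k * real ((x + k) choose k)" by simp
  have "fact k * ((x + k) choose k) \<le> (x + k) ^ k"
  proof -
    have "(\<Prod>i=1..k. x + i) \<le> (\<Prod>i=1..k. x + k)" by (rule prod_mono) auto
    then show ?thesis using e by simp
  qed
  then have "real (fact k * ((x + k) choose k)) \<le> real ((x + k) ^ k)" by (rule of_nat_mono)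
  then show "fact k * real ((x + k) choose k) \<le> real ((x + k) ^ k)" by simp
qed

text \<open>The Hilbert function of a hypersurface of degree \<open>e\<close> in P^(k+1), for
  \<open>t\<close> at least \<open>e\<close>; below that the subtraction truncates.\<close>

definition step_fun :: "nat \<Rightarrow> nat \<Rightarrow> nat \<Rightarrow> int" where
  "step_fun k e t = int ((t + Suc k) choose Suc k) - int ((t - e + Suc k) choose Suc k)"

lemma step_fun_sum: "e \<le> t \<Longrightarrow> step_fun k e t = (\<Sum>i<e. int ((t - i + k) choose k))"
proof (induction e)
  case (Suc e)
  then obtain r where r: "t - e = Suc r" "t - Suc e = r" by (metis Suc_diff_Suc Suc_le_lessD)
  have "((t - e + Suc k) choose Suc k) = ((t - Suc e + Suc k) choose Suc k) + ((t - e + k) choose k)"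
    unfolding r by simp
  then have "step_fun k (Suc e) t = step_fun k e t + int ((t - e + k) choose k)"
    unfolding step_fun_def by linarith
  then show ?case using Suc by simp
qed (simp add: step_fun_def)

lemma step_fun_bounds:
  assumes "e \<le> t"
  shows "real e * (real t - real e) ^ k \<le> fact k * of_int (step_fun k e t)"
    "fact k * of_int (step_fun k e t) \<le> real e * (real t + real k) ^ k"
proof -
  have s: "fact k * of_int (step_fun k e t) = (\<Sum>i<e. fact k * real ((t - i + k) choose k))"
    unfolding step_fun_sum[OF assms] by (simp add: sum_distrib_left)
  have "(\<Sum>i<e. (real t - real e) ^ k) \<le> (\<Sum>i<e. fact k * real ((t - i + k) choose k))"
  proof (rule sum_mono)
    fix i assume "i \<in> {..<e}"
    then have "(real t - real e) ^ k \<le> real (t - i) ^ k" using assms by (intro power_mono) auto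
    also have "\<dots> \<le> fact k * real ((t - i + k) choose k)" using choose_bounds(1)[of "t - i" k] by simp
    finally show "(real t - real e) ^ k \<le> fact k * real ((t - i + k) choose k)" .
  qed
  then show "real e * (real t - real e) ^ k \<le> fact k * of_int (step_fun k e t)" unfolding s by simp
  have "(\<Sum>i<e. fact k * real ((t - i + k) choose k)) \<le> (\<Sum>i<e. (real t + real k) ^ k)"
  proof (rule sum_mono)
    fix i
    have "fact k * real ((t - i + k) choose k) \<le> real (t - i + k) ^ k" using choose_bounds(2)[of k "t - i"] by simp
    also have "\<dots> \<le> (real t + real k) ^ k" by (intro power_mono) auto
    finally show "fact k * real ((t - i + k) choose k) \<le> (real t + real k) ^ k" .
  qed
  then show "fact k * of_int (step_fun k e t) \<le> real e * (real t + real k) ^ k" unfolding s by simp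
qed

lemma lead_coeff_nonneg:
  fixes q :: "real poly"
  assumes "\<forall>\<^sub>F t in sequentially. 0 \<le> poly q (real t)" shows "0 \<le> lead_coeff q"
proof (rule ccontr)
  assume "\<not> 0 \<le> lead_coeff q"
  then have "lead_coeff (- q) > 0" by simp
  then obtain x where x: "\<forall>y\<ge>x. poly (- q) y \<ge> lead_coeff (- q)" using poly_pinfty_gt_lc by blast
  obtain N where N: "\<forall>t\<ge>N. 0 \<le> poly q (real t)" using assms by (auto simp: eventually_sequentially)
  define t where "t = max N (nat \<lceil>x\<rceil>)"
  have "real t \<ge> x" by (simp add: t_def) linarith
  then have "poly (- q) (real t) > 0" using x \<open>lead_coeff (- q) > 0\<close> by fastforce
  moreover have "0 \<le> poly q (real t)" using N by (simp add: t_def)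
  ultimately show False by simp
qed

lemma degree_linear_power: "degree ([:a, 1::real:] ^ k) = k" "coeff ([:a, 1::real:] ^ k) k = 1"
proof -
  show d: "degree ([:a, 1::real:] ^ k) = k" by (simp add: degree_power_eq)
  show "coeff ([:a, 1::real:] ^ k) k = 1" using lead_coeff_power[of "[:a, 1::real:]" k] unfolding d by simp
qed

lemma coeff_lower:
  fixes p :: "real poly"
  assumes "\<forall>\<^sub>F t in sequentially. real e * (real t - a) ^ k \<le> poly p (real t)" and "degree p \<le> k"
  shows "real e \<le> coeff p k"
proof -
  define q where "q = p - smult (real e) ([:- a, 1:] ^ k)"
  have "\<forall>\<^sub>F t in sequentially. 0 \<le> poly q (real t)"
    using assms(1) by eventually_elim (simp add: q_def algebra_simps)
  then have l: "0 \<le> lead_coeff q" by (rule lead_coeff_nonneg)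
  have c: "coeff q k = coeff p k - real e"
    using degree_linear_power[of "- a" k] by (simp add: q_def)
  have "degree q \<le> k"
    unfolding q_def using assms(2) degree_smult_le[of "real e" "[:- a, 1:] ^ k"]
    by (intro degree_diff_le) (simp_all add: degree_linear_power)
  then show ?thesis using l c by (cases "degree q = k") (auto simp: coeff_eq_0)
qed

lemma coeff_upper:
  fixes p :: "real poly"
  assumes "\<forall>\<^sub>F t in sequentially. poly p (real t) \<le> real e * (real t + a) ^ k" and "degree p \<le> k"
  shows "coeff p k \<le> real e"
proof -
  define q where "q = smult (real e) ([:a, 1:] ^ k) - p"
  have "\<forall>\<^sub>F t in sequentially. 0 \<le> poly q (real t)"
    using assms(1) by eventually_elim (simp add: q_def algebra_simps)
  then have l: "0 \<le> lead_coeff q" by (rule lead_coeff_nonneg)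
  have c: "coeff q k = real e - coeff p k"
    using degree_linear_power[of a k] by (simp add: q_def)
  have "degree q \<le> k"
    unfolding q_def using assms(2) degree_smult_le[of "real e" "[:a, 1:] ^ k"]
    by (intro degree_diff_le) (simp_all add: degree_linear_power)
  then show ?thesis using l c by (cases "degree q = k") (auto simp: coeff_eq_0)
qed

lemma degree_le_of_bounds:
  fixes p :: "real poly"
  assumes lo: "\<forall>\<^sub>F t in sequentially. real e * (real t - a) ^ k \<le> poly p (real t)"
    and up: "\<forall>\<^sub>F t in sequentially. poly p (real t) \<le> real e * (real t + b) ^ k"
  shows "degree p \<le> k"
proof (rule ccontr)
  assume k: "\<not> degree p \<le> k"
  let ?q1 = "smult (real e) ([:- a, 1:] ^ k)" and ?q2 = "smult (real e) ([:b, 1:] ^ k)"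
  have d: "degree ?q1 \<le> k" "degree ?q2 \<le> k"
    using degree_smult_le[of "real e" "[:- a, 1:] ^ k"] degree_smult_le[of "real e" "[:b, 1:] ^ k"]
    by (simp_all add: degree_linear_power)
  have "0 \<le> lead_coeff (p - ?q1)"
    by (rule lead_coeff_nonneg) (use lo in eventually_elim, simp add: algebra_simps)
  moreover have "lead_coeff (p - ?q1) = lead_coeff p"
    using lead_coeff_add_le[of "- ?q1" p] d k by simp
  moreover have "0 \<le> lead_coeff (?q2 - p)"
    by (rule lead_coeff_nonneg) (use up in eventually_elim, simp add: algebra_simps)
  moreover have "lead_coeff (?q2 - p) = - lead_coeff p"
    using lead_coeff_add_le[of ?q2 "- p"] d k by simp
  ultimately have "lead_coeff p = 0" by linarith
  then show False using k by simp
qed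

text \<open>Up to the factor \<open>fact k\<close>, the Hilbert polynomial is squeezed between
  \<open>e\<close> times \<open>k\<close>-th powers of linear polynomials with leading coefficient
  1. The shift by \<open>c\<close> affects neither its degree \<open>k\<close> nor its leading
  coefficient. The same lower estimate with another \<open>e'\<close> gives the second
  claim.\<close>

lemma hilbert_poly_degree:
  fixes h :: "rat poly"
  assumes h: "\<forall>\<^sub>F t in sequentially. poly h (of_nat t) = of_int (H t)"
    and lo: "\<And>t. e \<le> t \<Longrightarrow> step_fun k e t \<le> H t" and up: "\<And>t. e \<le> t \<Longrightarrow> H t \<le> step_fun k e (t + c)" and e: "e > 0"
    and d: "fact (degree h) * lead_coeff h = of_nat d"
  shows "d = e" "\<And>e'. (\<And>t. e' \<le> t \<Longrightarrow> step_fun k e' t \<le> H t) \<Longrightarrow> e' \<le> d"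
proof -
  define p where "p = smult (fact k) (map_poly of_rat h :: real poly)"
  have hr: "poly (map_poly of_rat h :: real poly) (of_rat x) = of_rat (poly h x)" for x
    by (induction h) (simp_all add: map_poly_pCons of_rat_add of_rat_mult)
  have p: "\<forall>\<^sub>F t in sequentially. poly p (real t) = fact k * of_int (H t)"
    using h
  proof eventually_elim
    case (elim t)
    have "poly (map_poly of_rat h :: real poly) (real t) = of_rat (poly h (of_nat t))"
      using hr[of "of_nat t"] by simp
    then show ?case by (simp add: p_def elim)
  qed
  have lo': "\<forall>\<^sub>F t in sequentially. real e' * (real t - real e') ^ k \<le> poly p (real t)"
    if "\<And>t. e' \<le> t \<Longrightarrow> step_fun k e' t \<le> H t" for e'
    using p eventually_ge_at_top[of e']
  proof eventually_elim
    case (elim t)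
    have "real e' * (real t - real e') ^ k \<le> fact k * of_int (step_fun k e' t)" by (rule step_fun_bounds(1)[OF elim(2)])
    also have "\<dots> \<le> fact k * of_int (H t)" using that[OF elim(2)] by (intro mult_left_mono) auto
    finally show ?case using elim by simp
  qed
  have up': "\<forall>\<^sub>F t in sequentially. poly p (real t) \<le> real e * (real t + real (c + k)) ^ k"
    using p eventually_ge_at_top[of e]
  proof eventually_elim
    case (elim t)
    have "fact k * of_int (H t) \<le> fact k * (of_int (step_fun k e (t + c)) :: real)"
      using up[OF elim(2)] by (intro mult_left_mono) auto
    also have "\<dots> \<le> real e * (real (t + c) + real k) ^ k" by (rule step_fun_bounds(2)) (use elim in simp)
    finally show ?case using elim by (simp add: add.assoc)
  qed
  have dp: "degree p \<le> k" by (rule degree_le_of_bounds[OF lo'[OF lo] up'])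
  have ck: "coeff p k = real e"
    using coeff_lower[OF lo'[OF lo] dp] coeff_upper[OF up' dp] by simp
  have cp: "coeff p j = fact k * of_rat (coeff h j)" for j by (simp add: p_def coeff_map_poly)
  have "coeff h k \<noteq> 0" using ck cp[of k] e by auto
  then have "k \<le> degree h" by (rule le_degree)
  moreover have "degree h \<le> k"
  proof (rule degree_le, intro allI impI)
    fix j assume "k < j"
    then have "coeff p j = 0" using dp by (intro coeff_eq_0) simp
    then show "coeff h j = 0" using cp[of j] by simp
  qed
  ultimately have dh: "degree h = k" by simp
  have "of_rat (of_nat d) = (of_rat (fact k * coeff h k) :: real)" using d dh by simp
  also have "\<dots> = coeff p k"
    unfolding cp using of_rat_of_nat_eq[of "fact k", where ?'a = real] by (simp add: of_rat_mult)
  finally have cd: "coeff p k = real d" by simp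
  then show "d = e" using ck by simp
  show "e' \<le> d" if "\<And>t. e' \<le> t \<Longrightarrow> step_fun k e' t \<le> H t" for e'
    using coeff_lower[OF lo'[OF that] dp] cd by simp
qed



section \<open>The ideals of the statement\<close>

lemma cring_poly_ring: "cring (poly_ring n :: 'k::comm_ring_1 mpoly ring)"
proof (rule cringI)
  let ?R = "poly_ring n :: 'k mpoly ring"
  have c: "carrier ?R = polys (Suc n)" by (rule carrier_poly_ring)
  show "abelian_group ?R"
  proof (rule abelian_groupI)
    fix x assume "x \<in> carrier ?R"
    then show "\<exists>y\<in>carrier ?R. y \<oplus>\<^bsub>?R\<^esub> x = \<zero>\<^bsub>?R\<^esub>"
      unfolding c by (intro bexI[of _ "- x"]) (auto simp: poly_ring_def polys_uminus)
  qed (auto simp: c, auto simp: poly_ring_def polys_add add_ac)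
  show "comm_monoid ?R"
    by (rule comm_monoidI) (auto simp: c, auto simp: poly_ring_def polys_mult mult_ac)
  show "\<And>x y z. x \<in> carrier ?R \<Longrightarrow> y \<in> carrier ?R \<Longrightarrow> z \<in> carrier ?R \<Longrightarrow>
      (x \<oplus>\<^bsub>?R\<^esub> y) \<otimes>\<^bsub>?R\<^esub> z = x \<otimes>\<^bsub>?R\<^esub> z \<oplus>\<^bsub>?R\<^esub> y \<otimes>\<^bsub>?R\<^esub> z"
    by (simp add: poly_ring_def distrib_right)
qed

lemma poly_ring_simps [simp]:
  "x \<oplus>\<^bsub>poly_ring n\<^esub> y = x + y" "x \<otimes>\<^bsub>poly_ring n\<^esub> y = x * y" "\<zero>\<^bsub>poly_ring n\<^esub> = 0" "\<one>\<^bsub>poly_ring n\<^esub> = 1"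
  by (simp_all add: poly_ring_def)

lemma vpolys_ideal: "ideal (vpolys n A) (poly_ring n)"
proof -
  interpret cring "poly_ring n :: 'a mpoly ring" by (rule cring_poly_ring)
  show ?thesis
  proof (rule idealI[OF ring_axioms])
    show "subgroup (vpolys n A) (add_monoid (poly_ring n))"
    proof (rule add.subgroupI)
      show "vpolys n A \<subseteq> carrier (poly_ring n)" by (auto simp: carrier_poly_ring vpolys_polys)
      show "vpolys n A \<noteq> {}" using vpolys_0 by blast
      fix a b assume a: "a \<in> vpolys n A"
      show "b \<in> vpolys n A \<Longrightarrow> a \<oplus>\<^bsub>poly_ring n\<^esub> b \<in> vpolys n A" using a by (simp add: vpolys_add)
      have "a + (- a) = 0" "- a \<in> vpolys n A" using vpolys_diff[OF vpolys_0 a] by simp_all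
      moreover have "\<ominus>\<^bsub>poly_ring n\<^esub> a = - a"
        by (rule minus_equality) (use a calculation in \<open>auto simp: carrier_poly_ring vpolys_polys\<close>)
      ultimately show "\<ominus>\<^bsub>poly_ring n\<^esub> a \<in> vpolys n A" by simp
    qed
  next
    fix a x :: "'a mpoly" assume "a \<in> vpolys n A" "x \<in> carrier (poly_ring n)"
    then have "x * a \<in> vpolys n A" by (intro vpolys_mult) (simp_all add: carrier_poly_ring)
    then show "x \<otimes>\<^bsub>poly_ring n\<^esub> a \<in> vpolys n A" "a \<otimes>\<^bsub>poly_ring n\<^esub> x \<in> vpolys n A" by (simp_all add: mult.commute)
  qed
qed

lemma vpolys_hcomp_scale:
  fixes A :: "(nat \<Rightarrow> 'k::field_char_0) set"
  assumes "\<And>x c. x \<in> A \<Longrightarrow> c \<noteq> 0 \<Longrightarrow> (\<lambda>i. c * x i) \<in> A" "F \<in> vpolys n A" shows "hcomp t F \<in> vpolys n A"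
proof (rule vidI)
  show "hcomp t F \<in> polys (Suc n)" using hpoly_polys[OF hcomp_hpoly[OF vpolys_polys[OF assms(2)]]] .
  fix x assume x: "x \<in> A"
  have "scaling_poly F x = 0"
    by (rule poly_0_if_0_on_units) (simp add: poly_scaling_poly vidD[OF assms(2)] assms(1)[OF x])
  then show "peval (hcomp t F) x = 0" using coeff_scaling_poly[of F x t] by simp
qed

text \<open>Any polynomial vanishing on the cone is the sum of its homogeneous components, which
  vanish there too and hence are generators.\<close>

lemma vanishing_ideal_eq_vpolys:
  fixes V :: "('k::field_char_0) point set"
  assumes V: "V \<subseteq> proj_space n" shows "vanishing_ideal n V = vpolys n (\<Union>V)"
proof -
  let ?S = "{F. (\<exists>t. F \<in> forms n t) \<and> (\<forall>P\<in>V. vanishes_at F P)} :: 'k mpoly set"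
  interpret cring "poly_ring n :: 'k mpoly ring" by (rule cring_poly_ring)
  have S: "?S \<subseteq> carrier (poly_ring n)" by (auto simp: forms_eq_hpoly carrier_poly_ring hpoly_polys)
  have sc: "(\<lambda>i. c * x i) \<in> \<Union>V" if x: "x \<in> \<Union>V" and c: "c \<noteq> 0" for x :: "nat \<Rightarrow> 'k" and c
  proof -
    obtain P where P: "P \<in> V" "x \<in> P" using x by blast
    then have "P = {b. \<exists>c. c \<noteq> 0 \<and> b = (\<lambda>i. c * x i)}" using proj_spaceE(2) V by blast
    then have "(\<lambda>i. c * x i) \<in> P" using c by blast
    then show ?thesis using P by blast
  qed
  have "vpolys n (\<Union>V) \<subseteq> genideal (poly_ring n) ?S"
  proof
    fix F assume F: "F \<in> vpolys n (\<Union>V)"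
    interpret I: ideal "genideal (poly_ring n) ?S" "poly_ring n" by (rule genideal_ideal[OF S])
    have h: "hcomp t F \<in> genideal (poly_ring n) ?S" for t
    proof -
      have "hcomp t F \<in> vpolys n (\<Union>V)" by (rule vpolys_hcomp_scale[OF sc F])
      then have "hcomp t F \<in> ?S" using hcomp_hpoly[OF vpolys_polys[OF F]]
        by (auto simp: forms_eq_hpoly vanishes_at_def vpolys_def)
      then show ?thesis using genideal_self[OF S] by blast
    qed
    obtain D where D: "F = (\<Sum>t\<le>D. hcomp t F)" using sum_hcomp by blast
    have "(\<Sum>t\<in>T. hcomp t F) \<in> genideal (poly_ring n) ?S" if "finite T" for T
      using that
    proof (induction T rule: finite_induct)
      case empty then show ?case using I.zero_closed by simp
    next
      case (insert t T) then show ?case using I.a_closed[OF h[of t] insert.IH] by simp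
    qed
    then have "(\<Sum>t\<le>D. hcomp t F) \<in> genideal (poly_ring n) ?S" by simp
    then show "F \<in> genideal (poly_ring n) ?S" using D by simp
  qed
  moreover have "genideal (poly_ring n) ?S \<subseteq> vpolys n (\<Union>V)"
    by (rule genideal_minimal[OF vpolys_ideal])
       (auto simp: vpolys_def forms_eq_hpoly hpoly_polys vanishes_at_def)
  ultimately show ?thesis unfolding vanishing_ideal_def by blast
qed

lemma graded_part_vpolys: "graded_part n (vpolys n A) t = hpoly (Suc n) t \<inter> vpolys n A"
  by (auto simp: graded_part_def forms_eq_hpoly)

lemma hilbert_fun_vpolys: "hilbert_fun n (vpolys n A) t = hilb n A t"
  by (simp add: hilbert_fun_def hilb_def ideal_dim_def graded_part_vpolys forms_eq_hpoly)

subsection \<open>Forms of degree \<open>d\<close> with multiplicity \<open>d\<close> at a point\<close>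

definition invar :: "(nat \<Rightarrow> 'k::comm_ring_1) \<Rightarrow> 'k mpoly \<Rightarrow> bool" where
  "invar p F \<longleftrightarrow> (\<forall>x s. peval F (\<lambda>i. x i + s * p i) = peval F x)"

definition ideal_pow :: "nat \<Rightarrow> (nat \<Rightarrow> 'k::field) set \<Rightarrow> nat \<Rightarrow> 'k mpoly set" where
  "ideal_pow n P d = (vpolys n P) [^]\<^bsub>ideals_set (poly_ring n)\<^esub> d"

lemma ideal_pow_0: "ideal_pow n P 0 = polys (Suc n)"
  by (simp add: ideal_pow_def nat_pow_def ideals_set_def carrier_poly_ring)

lemma ideal_pow_Suc: "ideal_pow n P (Suc d) = ideal_prod (poly_ring n) (ideal_pow n P d) (vpolys n P)"
  by (simp add: ideal_pow_def nat_pow_def ideals_set_def)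

lemma ideal_pow_mult: "G \<in> ideal_pow n P d \<Longrightarrow> H \<in> vpolys n P \<Longrightarrow> G * H \<in> ideal_pow n P (Suc d)"
  unfolding ideal_pow_Suc using ideal_prod.prod[of G "ideal_pow n P d" H "vpolys n P" "poly_ring n"] by simp

lemma ideal_pow_mult_power: "G \<in> ideal_pow n P d \<Longrightarrow> H \<in> vpolys n P \<Longrightarrow> G * H ^ e \<in> ideal_pow n P (d + e)"
proof (induction e)
  case (Suc e)
  then have "G * H ^ e * H \<in> ideal_pow n P (Suc (d + e))" by (intro ideal_pow_mult) auto
  then show ?case by (simp add: mult_ac)
qed simp

lemma ideal_pow_mult_prod:
  "finite S \<Longrightarrow> G \<in> ideal_pow n P d \<Longrightarrow> (\<And>i. i \<in> S \<Longrightarrow> l i \<in> vpolys n P) \<Longrightarrow> G * (\<Prod>i\<in>S. l i ^ e i) \<in> ideal_pow n P (d + (\<Sum>i\<in>S. e i))"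
proof (induction S rule: finite_induct)
  case (insert i S)
  then have "G * (\<Prod>i\<in>S. l i ^ e i) * l i ^ e i \<in> ideal_pow n P (d + (\<Sum>i\<in>S. e i) + e i)" by (intro ideal_pow_mult_power) auto
  then show ?case using insert.hyps by (simp add: mult_ac add_ac)
qed simp

lemma ideal_pow_add: "G \<in> ideal_pow n P d \<Longrightarrow> H \<in> ideal_pow n P d \<Longrightarrow> G + H \<in> ideal_pow n P d"
proof (cases d)
  case 0
  then show "G \<in> ideal_pow n P d \<Longrightarrow> H \<in> ideal_pow n P d \<Longrightarrow> G + H \<in> ideal_pow n P d" by (simp add: ideal_pow_0 polys_add)
next
  case (Suc e)
  then show "G \<in> ideal_pow n P d \<Longrightarrow> H \<in> ideal_pow n P d \<Longrightarrow> G + H \<in> ideal_pow n P d"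
    unfolding Suc ideal_pow_Suc using ideal_prod.sum[of G "poly_ring n" "ideal_pow n P e" "vpolys n P" H] by simp
qed

text \<open>Translating \<open>x\<close> along \<open>p\<close> to the hyperplane
  \<open>X k = 0\<close> shows that \<open>F\<close> is unchanged when each variable is replaced by
  a linear form \<open>l i\<close> vanishing at \<open>p\<close>. Each monomial of degree
  \<open>d\<close> then becomes a product of \<open>d\<close> elements of the ideal of the
  point.\<close>

lemma invar_in_ideal_pow:
  fixes p :: "nat \<Rightarrow> 'k::field_char_0"
  assumes P: "P \<in> proj_space n" "p \<in> P" and F: "F \<in> hpoly (Suc n) d" "invar p F"
  shows "F \<in> ideal_pow n P d"
proof -
  have pc: "p \<in> coords n" and Pe: "P = {b. \<exists>c. c \<noteq> 0 \<and> b = (\<lambda>i. c * p i)}" using proj_spaceE[OF P] by auto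
  obtain k where k: "p k \<noteq> 0" "k \<le> n" using pc by (auto simp: coords_def) (metis not_le)
  define l where "l i = X i - Cst (p i / p k) * X k" for i
  have pl: "peval (l i) x = x i + (- x k / p k) * p i" for i x
    by (simp add: l_def peval.diff peval.mult)
  have lv: "l i \<in> vpolys n P" if "i \<le> n" for i
  proof (rule vidI)
    show "l i \<in> polys (Suc n)" unfolding l_def using that k by (intro polys_diff polys_mult) auto
    fix x assume "x \<in> P"
    then obtain c where "x = (\<lambda>i. c * p i)" using Pe by blast
    then show "peval (l i) x = 0" using k by (simp add: pl)
  qed
  have "F = msubst Cst l F"
  proof (rule peval_inj)
    fix x
    show "peval F x = peval (msubst Cst l F) x"
      unfolding peval_msubst_Cst pl using F(2) unfolding invar_def by metis
  qed
  also have "\<dots> = (\<Sum>m\<in>Poly_Mapping.keys F. Cst (Poly_Mapping.lookup F m) * monom_eval l m)" by (simp add: msubst_def)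
  also have "\<dots> \<in> ideal_pow n P d"
  proof -
    have t: "Cst c * monom_eval l m \<in> ideal_pow n P d" if m: "m \<in> Poly_Mapping.keys F" for m c
    proof -
      have "Poly_Mapping.keys m \<subseteq> {..<Suc n}" using m F(1) by (simp add: hpoly_def polys_def)
      then have km: "i \<le> n" if "i \<in> Poly_Mapping.keys m" for i using that by auto
      have "Cst c * (\<Prod>i\<in>Poly_Mapping.keys m. l i ^ Poly_Mapping.lookup m i) \<in> ideal_pow n P (0 + (\<Sum>i\<in>Poly_Mapping.keys m. Poly_Mapping.lookup m i))"
        by (rule ideal_pow_mult_prod) (auto simp: ideal_pow_0 lv km)
      moreover have "(\<Sum>i\<in>Poly_Mapping.keys m. Poly_Mapping.lookup m i) = d"
        using m F(1) by (auto simp: hpoly_def monom_deg_def)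
      ultimately show ?thesis by (simp add: monom_eval_def)
    qed
    have z0: "0 \<in> ideal_pow n P d"
      using ideal_pow_mult_power[of 0 n P 0 "l k" d] lv[OF k(2)] by (simp add: ideal_pow_0)
    have sm: "(\<Sum>m\<in>M. Cst (Poly_Mapping.lookup F m) * monom_eval l m) \<in> ideal_pow n P d"
      if "finite M" "M \<subseteq> Poly_Mapping.keys F" "0 \<in> ideal_pow n P d" for M
      using that
    proof (induction M rule: finite_induct)
      case (insert m M)
      then show ?case using ideal_pow_add[OF t[of m "Poly_Mapping.lookup F m"] insert.IH] by simp
    qed simp
    show ?thesis by (rule sm[OF finite_keys order_refl z0])
  qed
  finally show ?thesis .
qed

text \<open>Membership in the power enters only through the order of vanishing at \<open>p\<close>
  along lines through \<open>p\<close>.\<close>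

lemma ideal_pow_order:
  fixes p :: "nat \<Rightarrow> 'k::field_char_0"
  assumes p: "p \<in> P" and F: "F \<in> ideal_pow n P d"
  shows "\<exists>q. \<forall>s. peval F (\<lambda>i. p i + s * x i) = s ^ d * poly q s"
  using F
proof (induction d arbitrary: F)
  case 0
  then show ?case by (intro exI[of _ "line p x F"]) (simp add: poly_line)
next
  case (Suc d)
  from Suc.prems have "F \<in> ideal_prod (poly_ring n) (ideal_pow n P d) (vpolys n P)" by (simp add: ideal_pow_Suc)
  then show ?case
  proof (induction rule: ideal_prod.induct)
    case (prod i j)
    obtain q where q: "\<forall>s. peval i (\<lambda>i. p i + s * x i) = s ^ d * poly q s" using Suc.IH[OF prod(1)] by blast
    have "poly (line p x j) 0 = 0" using vidD[OF prod(2) p] by (simp add: poly_line)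
    then have "[:-0, 1:] dvd line p x j" by (simp only: poly_eq_0_iff_dvd)
    then obtain r where r: "line p x j = [:-0, 1:] * r" by (rule dvdE)
    have "peval j (\<lambda>i. p i + s * x i) = s * poly r s" for s using poly_line[of p x j s] r by simp
    then show ?case using q by (intro exI[of _ "q * r"]) (simp add: peval.mult)
  next
    case (sum i j)
    then obtain q r where "\<forall>s. peval i (\<lambda>i. p i + s * x i) = s ^ Suc d * poly q s"
      "\<forall>s. peval j (\<lambda>i. p i + s * x i) = s ^ Suc d * poly r s" by blast
    then show ?case by (intro exI[of _ "q + r"]) (simp add: peval.add distrib_left)
  qed
qed

text \<open>By homogeneity, \<open>F\<close> at \<open>p + s * x\<close> is \<open>s ^ d\<close>
  times \<open>F\<close> at \<open>x + inverse s * p\<close>. Vanishing to order \<open>d\<close> in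
  \<open>s\<close> thus makes the latter a polynomial in \<open>s\<close>, while it is a polynomial
  in \<open>inverse s\<close> as well; such a polynomial is constant, which the reflected polynomial
  makes explicit.\<close>

lemma ideal_pow_invar:
  fixes p :: "nat \<Rightarrow> 'k::field_char_0"
  assumes p: "p \<in> P" and F: "F \<in> ideal_pow n P d" "F \<in> hpoly (Suc n) d"
  shows "invar p F"
  unfolding invar_def
proof (intro allI)
  fix x \<sigma>
  obtain q where q: "\<forall>s. peval F (\<lambda>i. p i + s * x i) = s ^ d * poly q s" using ideal_pow_order[OF p F(1)] by blast
  define r where "r = line x p F"
  have rq: "poly r (inverse s) = poly q s" if s: "s \<noteq> 0" for s
  proof -
    have "(\<lambda>i. p i + s * x i) = (\<lambda>i. s * (x i + inverse s * p i))" using s by (auto simp: field_simps)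
    then have "s ^ d * poly q s = s ^ d * peval F (\<lambda>i. x i + inverse s * p i)"
      using q peval_hpoly_scale[OF F(2), of s "\<lambda>i. x i + inverse s * p i"] by metis
    then show ?thesis using s by (simp add: r_def poly_line)
  qed
  have "reflect_poly r - monom 1 (degree r) * q = 0"
    by (rule poly_0_if_0_on_units) (simp add: poly_reflect_poly_nz poly_monom rq)
  then have "reflect_poly r = monom 1 (degree r) * q" by simp
  then have "poly (reflect_poly r) 0 = poly (monom 1 (degree r) * q) 0" by simp
  then have "lead_coeff r = 0 ^ degree r * poly q 0" by (simp add: poly_monom)
  then have "degree r = 0" by (metis degree_0 leading_coeff_0_iff mult_zero_left power_0_left)
  then obtain c where "r = [:c:]" by (rule degree_eq_zeroE)
  then have "poly r \<sigma> = poly r 0" by simp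
  then show "peval F (\<lambda>i. x i + \<sigma> * p i) = peval F x" by (simp add: r_def poly_line)
qed

lemma mult_forms_eq:
  fixes p :: "nat \<Rightarrow> 'k::field_char_0"
  assumes "P \<in> proj_space n" "p \<in> P"
  shows "mult_forms n (vpolys n A) d d P = {F \<in> hpoly (Suc n) d \<inter> vpolys n A. invar p F}"
proof -
  have "vanishing_ideal n {P} = vpolys n P" using vanishing_ideal_eq_vpolys[of "{P}" n] assms(1) by simp
  then show ?thesis
    unfolding mult_forms_def graded_part_def forms_eq_hpoly
    using invar_in_ideal_pow[OF assms] ideal_pow_invar[OF assms(2)] by (auto simp: ideal_pow_def)
qed

section \<open>Cones\<close>

text \<open>An equation of the cone over \<open>A\<close> with vertex \<open>p\<close>,
  characterised without preferred coordinates so that it can be carried through a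
  \<open>frame\<close>. The divisibility clause expresses that \<open>F\<close> generates the ideal
  of the cone, the last one that the zeros of \<open>F\<close> all lie on the cone.\<close>

definition cone_form :: "nat \<Rightarrow> (nat \<Rightarrow> 'k::field) \<Rightarrow> (nat \<Rightarrow> 'k) set \<Rightarrow> nat \<Rightarrow> 'k mpoly \<Rightarrow> bool" where
  "cone_form n p A e F \<longleftrightarrow> F \<in> hpoly (Suc n) e \<and> e \<ge> 2 \<and> F \<noteq> 0 \<and> F \<in> vpolys n A \<and> invar p F \<and>
     (\<forall>H\<in>polys (Suc n). (\<forall>b\<in>A. \<forall>c. peval H (\<lambda>i. b i + c * p i) = 0) \<longrightarrow> F dvd H) \<and>
     (\<forall>x\<in>coords n. peval F x = 0 \<longrightarrow> (\<exists>c. x = (\<lambda>i. c * p i)) \<or> (\<exists>b\<in>A. \<exists>c. x = (\<lambda>i. b i + c * p i)))"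

lemma (in frame) cone_form_pull:
  assumes "cone_form n p (pre L A) e F" shows "cone_form n (app L p) A e (pull L' F)"
proof -
  interpret F': frame n L' L by (rule swap)
  have F: "F \<in> hpoly (Suc n) e" "e \<ge> 2" "F \<noteq> 0" "F \<in> vpolys n (pre L A)" "invar p F"
    "\<And>H. H \<in> polys (Suc n) \<Longrightarrow> (\<forall>b\<in>pre L A. \<forall>c. peval H (\<lambda>i. b i + c * p i) = 0) \<Longrightarrow> F dvd H"
    "\<And>x. x \<in> coords n \<Longrightarrow> peval F x = 0 \<Longrightarrow> (\<exists>c. x = (\<lambda>i. c * p i)) \<or> (\<exists>b\<in>pre L A. \<exists>c. x = (\<lambda>i. b i + c * p i))"
    using assms by (auto simp: cone_form_def)
  have "pull L' F \<noteq> 0" using F(3) F'.pull_pull[of F] by (metis pull.zero)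
  moreover have "invar (app L p) (pull L' F)"
    unfolding invar_def
  proof (intro allI)
    fix x s
    have "app L' (\<lambda>i. x i + s * app L p i) = (\<lambda>i. app L' x i + s * p i)"
      using app_linear[OF L', of x s "app L p"] by (simp add: inv')
    then show "peval (pull L' F) (\<lambda>i. x i + s * app L p i) = peval (pull L' F) x"
      using F(5) by (simp add: peval_pull invar_def)
  qed
  moreover have "pull L' F dvd H"
    if H: "H \<in> polys (Suc n)" "\<forall>b\<in>A. \<forall>c. peval H (\<lambda>i. b i + c * app L p i) = 0" for H
  proof -
    have "F dvd pull L H"
    proof (rule F(6)[OF pull_polys[OF H(1)]], intro ballI allI)
      fix b c assume "b \<in> pre L A"
      then have "app L b \<in> A" by (simp add: pre_def)
      then show "peval (pull L H) (\<lambda>i. b i + c * p i) = 0"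
        using H(2) by (simp add: peval_pull app_linear[OF L])
    qed
    then obtain Q where "pull L H = F * Q" by (rule dvdE)
    then have "pull L' (pull L H) = pull L' F * pull L' Q" by (simp add: pull.mult)
    then show ?thesis by (simp add: pull_pull)
  qed
  moreover have "(\<exists>c. x = (\<lambda>i. c * app L p i)) \<or> (\<exists>b\<in>A. \<exists>c. x = (\<lambda>i. b i + c * app L p i))"
    if x: "x \<in> coords n" "peval (pull L' F) x = 0" for x
  proof -
    have "(\<exists>c. app L' x = (\<lambda>i. c * p i)) \<or> (\<exists>b\<in>pre L A. \<exists>c. app L' x = (\<lambda>i. b i + c * p i))"
      by (rule F(7)) (use x F'.app_coords in \<open>auto simp: peval_pull\<close>)
    then show ?thesis
    proof (elim disjE exE bexE)
      fix c assume "app L' x = (\<lambda>i. c * p i)"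
      then have "app L (app L' x) = (\<lambda>i. c * app L p i)" by (simp add: app_scale[OF L])
      then show ?thesis unfolding inv by blast
    next
      fix b c assume b: "b \<in> pre L A" "app L' x = (\<lambda>i. b i + c * p i)"
      then have "app L (app L' x) = (\<lambda>i. app L b i + c * app L p i)" by (simp add: app_linear[OF L])
      then show ?thesis using b(1) unfolding inv pre_def by blast
    qed
  qed
  ultimately show ?thesis
    using F'.pull_hpoly[OF F(1)] F(2) F'.vpolys_pre[OF F(4)] by (simp add: cone_form_def pre_pre)
qed

text \<open>A polynomial vanishing on the cone vanishes along all lines in the direction of the last
  coordinate, so its coefficients with respect to that coordinate vanish on \<open>A\<close> and are
  divisible by \<open>F\<close>. The zeros of \<open>F\<close> are covered because the image of the
  projection is closed.\<close>

lemma (in noether_frame) cone_form_gen: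
  assumes g: "is_gen e F" shows "cone_form (Suc m) (unit_vec (Suc m)) A e F"
  unfolding cone_form_def
proof (intro conjI ballI impI)
  let ?n = "Suc m"
  let ?p = "unit_vec ?n :: nat \<Rightarrow> 'k"
  show "F \<in> hpoly (Suc ?n) e" by (rule hpoly_mono[OF is_genD(1)[OF g]]) simp
  show "e \<ge> 2" "F \<noteq> 0" "F \<in> vpolys ?n A" using is_genD[OF g] by auto
  show "invar ?p F"
    unfolding invar_def
  proof (intro allI)
    fix x s show "peval F (\<lambda>i. x i + s * ?p i) = peval F x"
      by (rule peval_cong[OF hpoly_polys[OF is_genD(1)[OF g]]]) (simp add: unit_vec_def)
  qed
  fix H assume H: "H \<in> polys (Suc ?n)" "\<forall>b\<in>A. \<forall>c. peval H (\<lambda>i. b i + c * ?p i) = 0"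
  have "F dvd coeff (in_var ?n H) j" for j
  proof (rule gen_dvd[OF g coeff_in_var_polys[OF H(1)]], rule vidI)
    show "coeff (in_var ?n H) j \<in> polys (Suc ?n)" by (rule polys_mono[OF coeff_in_var_polys[OF H(1)]]) simp
    fix b assume b: "b \<in> A"
    have "poly (map_poly (\<lambda>c. peval c b) (in_var ?n H)) z = 0" for z
    proof -
      have "b(?n := z) = (\<lambda>i. b i + (z - b ?n) * ?p i)" by (auto simp: unit_vec_def)
      then show ?thesis using eval2_in_var[of b ?n H z] H(2) b by (simp add: eval2_def)
    qed
    then have "map_poly (\<lambda>c. peval c b) (in_var ?n H) = 0" using poly_all_0_iff_0 by blast
    then show "peval (coeff (in_var ?n H) j) b = 0" by (metis peval.coeff_map coeff_0)
  qed
  then have "F dvd (\<Sum>j\<le>degree (in_var ?n H). coeff (in_var ?n H) j * X ?n ^ j)" by (intro dvd_sum dvd_mult2) auto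
  then have "F dvd poly (in_var ?n H) (X ?n)" by (simp only: poly_altdef)
  then show "F dvd H" by (simp add: poly_in_var)
next
  let ?n = "Suc m"
  let ?p = "unit_vec ?n :: nat \<Rightarrow> 'k"
  fix x assume x: "x \<in> coords ?n" "peval F x = 0"
  define y where "y = x(?n := 0)"
  have xy: "x = (\<lambda>i. y i + x ?n * ?p i)" by (auto simp: y_def unit_vec_def)
  show "(\<exists>c. x = (\<lambda>i. c * ?p i)) \<or> (\<exists>b\<in>A. \<exists>c. x = (\<lambda>i. b i + c * ?p i))"
  proof (cases "\<exists>i. y i \<noteq> 0")
    case False
    then have "x i = x ?n * ?p i" for i using fun_cong[OF xy, of i] by simp
    then have "x = (\<lambda>i. x ?n * ?p i)" by (rule ext)
    then show ?thesis by (intro disjI1 exI[of _ "x ?n"])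
  next
    case True
    then have yc: "y \<in> coords ?n" using x(1) by (auto simp: coords_def y_def)
    have Fy: "peval F y = 0"
      using x(2) peval_cong[OF hpoly_polys[OF is_genD(1)[OF g]], of y x] by (simp add: y_def)
    have "\<exists>c. y(?n := c) \<in> A"
    proof (rule ccontr)
      assume "\<not> ?thesis"
      then obtain t h where h: "h \<in> hpoly ?n t" "h \<in> vpolys ?n A" "peval h y \<noteq> 0"
        using projection_sep[OF kA noether_unit_vec[OF noeth] yc] by (auto simp: y_def)
      have "F dvd h" by (rule gen_dvd[OF g hpoly_polys[OF h(1)] h(2)])
      then show False using Fy h(3) by (auto elim!: dvdE simp: peval.mult)
    qed
    then obtain c where c: "y(?n := c) \<in> A" by blast
    have "x = (\<lambda>i. (y(?n := c)) i + (x ?n - c) * ?p i)" by (auto simp: y_def unit_vec_def)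
    then show ?thesis using c by blast
  qed
qed

section \<open>Openness\<close>

text \<open>Linear independence of \<open>k\<close> vectors of values is an open condition on
  \<open>p\<close>, for an arbitrary index set of coordinates \<open>'j\<close>. Elimination with
  the pivot \<open>G k j0\<close> builds up a certificate \<open>D\<close>, in the manner of a
  nonvanishing minor.\<close>

lemma ex_independence_form:
  fixes G :: "nat \<Rightarrow> 'j \<Rightarrow> 'k::field_char_0 mpoly"
  assumes "\<And>i j. i < k \<Longrightarrow> G i j \<in> polys N"
    and "\<And>c. (\<forall>j. (\<Sum>i<k. c i * peval (G i j) p0) = 0) \<Longrightarrow> (\<forall>i<k. c i = 0)"
  shows "\<exists>D\<in>polys N. peval D p0 \<noteq> 0 \<and>
    (\<forall>p. peval D p \<noteq> 0 \<longrightarrow> (\<forall>c. (\<forall>j. (\<Sum>i<k. c i * peval (G i j) p) = 0) \<longrightarrow> (\<forall>i<k. c i = 0)))"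
  using assms
proof (induction k arbitrary: G)
  case 0
  show ?case by (intro bexI[of _ 1]) auto
next
  case (Suc k)
  have "\<exists>j0. peval (G k j0) p0 \<noteq> 0"
  proof (rule ccontr)
    assume a: "\<not> ?thesis"
    have "(\<Sum>i<Suc k. (if i = k then 1 else 0) * peval (G i j) p0) = 0" for j
      using a by (simp add: sum.delta if_distrib cong: if_cong)
    then have "\<forall>i<Suc k. (if i = k then 1 else 0 :: 'k) = 0" by (intro Suc.prems(2)) auto
    then show False by auto
  qed
  then obtain j0 where j0: "peval (G k j0) p0 \<noteq> 0" by blast
  define G' where "G' i j = G k j0 * G i j - G i j0 * G k j" for i j
  have s: "(\<Sum>i<k. c i * peval (G' i j) p) =
      (\<Sum>i<k. (c i * peval (G k j0) p) * peval (G i j) p) - (\<Sum>i<k. c i * peval (G i j0) p) * peval (G k j) p"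
    for c j p
    unfolding G'_def peval.diff peval.mult sum_distrib_right sum_subtractf[symmetric]
    by (rule sum.cong) (auto simp: algebra_simps)
  have "\<exists>D\<in>polys N. peval D p0 \<noteq> 0 \<and>
    (\<forall>p. peval D p \<noteq> 0 \<longrightarrow> (\<forall>c. (\<forall>j. (\<Sum>i<k. c i * peval (G' i j) p) = 0) \<longrightarrow> (\<forall>i<k. c i = 0)))"
  proof (rule Suc.IH)
    show "G' i j \<in> polys N" if "i < k" for i j
      unfolding G'_def using Suc.prems(1) that by (intro polys_diff polys_mult) auto
    fix c assume c: "\<forall>j. (\<Sum>i<k. c i * peval (G' i j) p0) = 0"
    \<comment> \<open>A relation among the reduced rows, multiplied by the pivot, is extended to the
      original rows by the coefficient of row \<open>k\<close> that the reduction
      prescribes.\<close>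
    define c' where "c' i = (if i = k then - (\<Sum>i<k. c i * peval (G i j0) p0) else c i * peval (G k j0) p0)" for i
    have "(\<Sum>i<Suc k. c' i * peval (G i j) p0) = 0" for j
    proof -
      have "(\<Sum>i<Suc k. c' i * peval (G i j) p0) = (\<Sum>i<k. c' i * peval (G i j) p0) + c' k * peval (G k j) p0"
        by simp
      also have "(\<Sum>i<k. c' i * peval (G i j) p0) = (\<Sum>i<k. (c i * peval (G k j0) p0) * peval (G i j) p0)"
        by (rule sum.cong) (auto simp: c'_def)
      finally show ?thesis using c s[of c j p0] by (simp add: c'_def)
    qed
    then have "\<forall>i<Suc k. c' i = 0" by (intro Suc.prems(2)) auto
    then have "c' i = 0" if "i < k" for i using that by auto
    then show "\<forall>i<k. c i = 0" using j0 by (auto simp: c'_def split: if_splits)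
  qed
  then obtain D where D: "D \<in> polys N" "peval D p0 \<noteq> 0"
    "\<And>p c. peval D p \<noteq> 0 \<Longrightarrow> (\<forall>j. (\<Sum>i<k. c i * peval (G' i j) p) = 0) \<Longrightarrow> (\<forall>i<k. c i = 0)" by blast
  show ?case
  proof (intro bexI[of _ "D * G k j0"] conjI allI impI)
    show "D * G k j0 \<in> polys N" using D(1) Suc.prems(1) by (intro polys_mult) auto
    show "peval (D * G k j0) p0 \<noteq> 0" using D(2) j0 by (simp add: peval.mult)
    fix p c i assume p: "peval (D * G k j0) p \<noteq> 0" and c: "\<forall>j. (\<Sum>i<Suc k. c i * peval (G i j) p) = 0" and i: "i < Suc k"
    have e: "(\<Sum>i<k. c i * peval (G i j) p) = - (c k * peval (G k j) p)" for j
      using spec[OF c, of j] by (simp add: eq_neg_iff_add_eq_0)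
    have "(\<Sum>i<k. c i * peval (G' i j) p) = 0" for j
    proof -
      have "(\<Sum>i<k. (c i * peval (G k j0) p) * peval (G i j) p) = peval (G k j0) p * (\<Sum>i<k. c i * peval (G i j) p)"
        by (simp add: sum_distrib_left mult_ac)
      then show ?thesis unfolding s e by simp
    qed
    then have z: "\<forall>i<k. c i = 0" using D(3)[of p c] p by (simp add: peval.mult)
    then have "c k * peval (G k j0) p = 0" using e[of j0] by simp
    then have "c k = 0" using p by (simp add: peval.mult)
    then show "c i = 0" using z i by (auto simp: less_Suc_eq)
  qed
qed

lemma invar_scale: "invar p F \<Longrightarrow> invar (\<lambda>i. s * p i) (F :: 'k::field mpoly)"
  unfolding invar_def by (metis (no_types, lifting) ext mult.assoc)

text \<open>For a basis \<open>f i\<close> of the space, a combination is invariant under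
  \<open>p\<close> iff the same combination of the differences \<open>G i (x, s)\<close> vanishes at
  \<open>p\<close> for all \<open>x\<close> and \<open>s\<close>. So the absence of invariant forms
  is linear independence of functions that depend polynomially on \<open>p\<close>.\<close>

lemma no_invar_open:
  fixes p0 :: "nat \<Rightarrow> 'k::field_char_0"
  assumes p0: "\<And>F. F \<in> hpoly (Suc n) t \<inter> vpolys n A \<Longrightarrow> invar p0 F \<Longrightarrow> F = 0"
  shows "\<exists>r D. D \<in> hpoly (Suc n) r \<and> peval D p0 \<noteq> 0 \<and>
    (\<forall>p F. peval D p \<noteq> 0 \<longrightarrow> F \<in> hpoly (Suc n) t \<inter> vpolys n A \<longrightarrow> invar p F \<longrightarrow> F = 0)"
proof -
  let ?I = "hpoly (Suc n) t \<inter> vpolys n A :: 'k mpoly set"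
  have sI: "mpoly.subspace ?I" by (rule mpoly.subspace_inter[OF hpoly_subspace vpolys_subspace])
  obtain C where C: "C \<subseteq> ?I" "mpoly.independent C" "finite C" "mpoly.span C = ?I"
    by (rule fin_dim_basis[OF fin_dim_hpoly_vpolys[of "Suc n" t n A]]) auto
  obtain f where f: "bij_betw f {..<card C} C" using ex_bij_betw_nat_finite[OF C(3)] by (auto simp: atLeast0LessThan)
  define k where "k = card C"
  have fC: "f i \<in> C" if "i < k" for i using f that by (auto simp: bij_betw_def k_def)
  define G where "G i j = msubst Cst (\<lambda>l. Cst (fst j l) + Cst (snd j) * X l) (f i) - Cst (peval (f i) (fst j))"
    for i and j :: "(nat \<Rightarrow> 'k) \<times> 'k"
  have pG: "peval (G i (x, s)) p = peval (f i) (\<lambda>l. x l + s * p l) - peval (f i) x" for i x s p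
    by (simp add: G_def peval.diff peval_msubst_Cst peval.add peval.mult)
  have Gp: "G i j \<in> polys (Suc n)" if "i < k" for i j
  proof -
    have "f i \<in> polys (Suc n)" using fC[OF that] C(1) hpoly_polys by blast
    then show ?thesis unfolding G_def
      by (intro polys_diff polys_Cst msubst_polys[of _ "Suc n"]) (auto intro!: polys_add polys_mult)
  qed
  have comb: "(\<Sum>i<k. c i * peval (G i (x, s)) p) =
      peval (\<Sum>i<k. Cst (c i) * f i) (\<lambda>l. x l + s * p l) - peval (\<Sum>i<k. Cst (c i) * f i) x" for c x s p
    by (simp add: pG peval.sum peval.mult right_diff_distrib sum_subtractf)
  have inI: "(\<Sum>i<k. Cst (c i) * f i) \<in> ?I" for c
    using fC C(1) unfolding pscale_eq[symmetric]
    by (intro mpoly.subspace_sum[OF sI] mpoly.subspace_scale[OF sI]) auto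
  have ind: "c i = 0" if z: "(\<Sum>i<k. Cst (c i) * f i) = 0" and i: "i < k" for c i
  proof -
    define u where "u v = c (the_inv_into {..<k} f v)" for v
    have inj: "inj_on f {..<k}" using f by (simp add: bij_betw_def k_def)
    have uf: "u (f i) = c i" if "i < k" for i
      using the_inv_into_f_f[OF inj] that by (simp add: u_def)
    have "(\<Sum>v\<in>C. pscale (u v) v) = (\<Sum>i<k. pscale (u (f i)) (f i))"
      using sum.reindex_bij_betw[OF f, of "\<lambda>v. pscale (u v) v"] by (simp add: k_def)
    also have "\<dots> = (\<Sum>i<k. Cst (c i) * f i)" by (rule sum.cong) (auto simp: uf pscale_eq)
    finally have "(\<Sum>v\<in>C. pscale (u v) v) = 0" using z by simp
    from mpoly.independentD[OF C(2,3) order_refl this fC[OF i]] show ?thesis using uf[OF i] by simp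
  qed
  have "\<exists>D\<in>polys (Suc n). peval D p0 \<noteq> 0 \<and>
    (\<forall>p. peval D p \<noteq> 0 \<longrightarrow> (\<forall>c. (\<forall>j. (\<Sum>i<k. c i * peval (G i j) p) = 0) \<longrightarrow> (\<forall>i<k. c i = 0)))"
  proof (rule ex_independence_form[OF Gp])
    fix c assume c: "\<forall>j. (\<Sum>i<k. c i * peval (G i j) p0) = 0"
    have "invar p0 (\<Sum>i<k. Cst (c i) * f i)"
      unfolding invar_def
    proof (intro allI)
      fix x s
      show "peval (\<Sum>i<k. Cst (c i) * f i) (\<lambda>i. x i + s * p0 i) = peval (\<Sum>i<k. Cst (c i) * f i) x"
        using spec[OF c, of "(x, s)"] unfolding comb by simp
    qed
    then have "(\<Sum>i<k. Cst (c i) * f i) = 0" by (rule p0[OF inI])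
    then show "\<forall>i<k. c i = 0" using ind by blast
  qed
  then obtain D where D: "D \<in> polys (Suc n)" "peval D p0 \<noteq> 0"
    "\<And>p c. peval D p \<noteq> 0 \<Longrightarrow> (\<forall>j. (\<Sum>i<k. c i * peval (G i j) p) = 0) \<Longrightarrow> (\<forall>i<k. c i = 0)" by blast
  have admissible: "F = 0" if p: "peval D p \<noteq> 0" and F: "F \<in> ?I" "invar p F" for p F
  proof -
    have "F \<in> mpoly.span C" using F(1) C(4) by simp
    then obtain u where u: "F = (\<Sum>v\<in>C. pscale (u v) v)" using C(3) by (auto simp: mpoly.span_finite)
    have e: "F = (\<Sum>i<k. Cst (u (f i)) * f i)"
      unfolding u using sum.reindex_bij_betw[OF f, of "\<lambda>v. pscale (u v) v"] by (simp add: k_def pscale_eq)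
    have "(\<Sum>i<k. u (f i) * peval (G i j) p) = 0" for j
    proof -
      obtain x s where j: "j = (x, s)" by fastforce
      show ?thesis using F(2) unfolding j comb[of "\<lambda>i. u (f i)"] e[symmetric] invar_def by simp
    qed
    then have "\<forall>i<k. u (f i) = 0" by (intro D(3)[OF p]) auto
    then show ?thesis using e by (simp add: sum.neutral)
  qed
  \<comment> \<open>A homogeneous component of \<open>D\<close> can replace \<open>D\<close>: where
    it is nonzero, \<open>D\<close> is nonzero at some nonzero multiple of \<open>p\<close>, and
    invariance does not distinguish between multiples.\<close>
  obtain N where "D = (\<Sum>r\<le>N. hcomp r D)" using sum_hcomp by blast
  then obtain r where r: "peval (hcomp r D) p0 \<noteq> 0" using D(2) by (metis (no_types, lifting) peval.sum sum.neutral)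
  have "F = 0" if p: "peval (hcomp r D) p \<noteq> 0" and F: "F \<in> ?I" "invar p F" for p F
  proof -
    have "coeff (scaling_poly D p) r \<noteq> 0" using p by (simp add: coeff_scaling_poly)
    then have "scaling_poly D p \<noteq> 0" by auto
    then obtain s where s: "s \<noteq> 0" "poly (scaling_poly D p) s \<noteq> 0" using poly_0_if_0_on_units by blast
    then have "peval D (\<lambda>i. s * p i) \<noteq> 0" by (simp add: poly_scaling_poly)
    then show ?thesis by (rule admissible[OF _ F(1) invar_scale[OF F(2)]])
  qed
  then show ?thesis using r hcomp_hpoly[OF D(1), of r] by blast
qed



section \<open>Bounding the degree of the projections\<close>

definition hilb_degree :: "(nat \<Rightarrow> int) \<Rightarrow> nat \<Rightarrow> bool" where
  "hilb_degree H d \<longleftrightarrow> (\<exists>h :: rat poly. (\<forall>\<^sub>F t in sequentially. poly h (of_nat t) = of_int (H t)) \<and>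
     fact (degree h) * lead_coeff h = of_nat d)"

context noether_frame begin

lemma step_fun_S: "step_fun (m - 1) e t = int (mpoly.dim (S t)) - int (mpoly.dim (S (t - e)))"
  using m2 by (simp add: step_fun_def dim_hpoly)

lemma birational_degree:
  assumes H: "hilb_degree (hilb (Suc m) A) d" and g: "is_gen e F"
    and a: "a \<in> hpoly m \<alpha>" "a \<noteq> 0" "B \<in> hpoly (Suc m) (Suc \<alpha>)" "a * X (Suc m) - B \<in> vpolys (Suc m) A"
  shows "d = e" "\<And>e'. (\<And>t. e' \<le> t \<Longrightarrow> step_fun (m - 1) e' t \<le> hilb (Suc m) A t) \<Longrightarrow> e' \<le> d"
proof -
  obtain h :: "rat poly" where h: "\<forall>\<^sub>F t in sequentially. poly h (of_nat t) = of_int (hilb (Suc m) A t)"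
    "fact (degree h) * lead_coeff h = of_nat d" using H by (auto simp: hilb_degree_def)
  obtain c where c: "\<forall>t\<ge>e. hilb (Suc m) A t \<le> int (mpoly.dim (S (t + c))) - int (mpoly.dim (S (t + c - e)))"
    using hilb_upper[OF g a] by blast
  have e0: "e > 0" using is_genD(5)[OF g] by simp
  have lo: "e \<le> t \<Longrightarrow> step_fun (m - 1) e t \<le> hilb (Suc m) A t" for t
    unfolding step_fun_S by (rule hilb_lower[OF g])
  have up: "e \<le> t \<Longrightarrow> hilb (Suc m) A t \<le> step_fun (m - 1) e (t + c)" for t
    unfolding step_fun_S using c by blast
  show "d = e" by (rule hilbert_poly_degree(1)[OF h(1) lo up e0 h(2)])
  show "\<And>e'. (\<And>t. e' \<le> t \<Longrightarrow> step_fun (m - 1) e' t \<le> hilb (Suc m) A t) \<Longrightarrow> e' \<le> d"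
    by (rule hilbert_poly_degree(2)[OF h(1) lo up e0 h(2)])
qed

text \<open>The Hilbert function is unchanged by the coordinates in which some projection is
  birational, and there its leading term is governed by \<open>d\<close>. The lower bound coming
  from the given projection therefore forces \<open>e\<close> to be at most
  \<open>d\<close>.\<close>

lemma gen_degree_le:
  assumes H: "hilb_degree (hilb (Suc m) A) d" and g: "is_gen e F" shows "e \<le> d"
proof -
  let ?n = "Suc m"
  obtain t \<alpha> a B where A': "noether_frame m (pre (shear ?n ?n (\<lambda>i. if i = m then - t else if i = ?n then 1 else 0)) A)"
    and a: "a \<in> hpoly m \<alpha>" "a \<noteq> 0" "B \<in> hpoly ?n (Suc \<alpha>)"
      "a * X ?n - B \<in> vpolys ?n (pre (shear ?n ?n (\<lambda>i. if i = m then - t else if i = ?n then 1 else 0)) A)"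
    using ex_birational unfolding Let_def by blast
  let ?q = "(\<lambda>i. if i = m then - t else if i = ?n then 1 else 0) :: nat \<Rightarrow> 'k"
  interpret L: frame ?n "shear ?n ?n ?q" "shear ?n ?n (\<lambda>i. if i = ?n then 1 / ?q ?n else - ?q i / ?q ?n)"
    by (rule frame_shear(1)) auto
  interpret A': noether_frame m "pre (shear ?n ?n ?q) A" by (rule A')
  obtain e1 F1 where g1: "A'.is_gen e1 F1" using A'.ex_gen by blast
  have H': "hilb ?n (pre (shear ?n ?n ?q) A) = hilb ?n A" by (rule ext) (rule L.hilb_pre)
  show ?thesis
  proof (rule A'.birational_degree(2)[OF _ g1 a])
    show "hilb_degree (hilb ?n (pre (shear ?n ?n ?q) A)) d" unfolding H' by (rule H)
    show "step_fun (m - 1) e s \<le> hilb ?n (pre (shear ?n ?n ?q) A) s" if "e \<le> s" for s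
      unfolding H' step_fun_S by (rule hilb_lower[OF g that])
  qed
qed

lemma noether_pre:
  assumes "frame (Suc m) L L'" "\<And>x i. i < m \<Longrightarrow> app L x i = x i" shows "noether_frame m (pre L A)"
proof
  show "m \<ge> 2" by (rule m2)
  show "admissible (Suc m) (pre L A)" by (rule frame.admissible_pre[OF assms(1) admissible])
  show "noether m (pre L A)"
    unfolding noether_def
  proof
    fix y assume "y \<in> pre L A"
    then have "app L y \<in> A" by (simp add: pre_def)
    then obtain i where "i < m" "app L y i \<noteq> 0" using noeth by (auto simp: noether_def)
    then show "\<exists>i<m. y i \<noteq> 0" using assms(2) by auto
  qed
qed

section \<open>Independence over the base and quadratic relations\<close>

lemma vpolys_base: "p \<in> polys m \<Longrightarrow> (\<And>x. x \<in> A \<Longrightarrow> peval p x = 0) \<Longrightarrow> p = 0"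
proof (rule ccontr)
  assume p: "p \<in> polys m" "\<And>x. x \<in> A \<Longrightarrow> peval p x = 0" "p \<noteq> 0"
  have "p * 1 \<in> vpolys (Suc m) A" by (rule vidI) (use p polys_mono[OF p(1), of "Suc (Suc m)"] in auto)
  then have "1 \<in> vpolys (Suc m) A" using tf[OF p(1,3)] by simp
  then show False using Ane by (auto simp: vpolys_def)
qed

lemma nondeg_fun:
  assumes "L \<in> hpoly (Suc (Suc m)) 1" "peval L y \<noteq> 0" shows "\<exists>x\<in>A. peval L x \<noteq> 0"
proof (rule ccontr)
  assume "\<not> ?thesis"
  then have "L \<in> vpolys (Suc m) A" using hpoly_polys[OF assms(1)] by (auto simp: vpolys_def)
  then show False using nondeg[OF assms(1)] assms(2) by auto
qed

text \<open>Over the base, 1 and \<open>x m\<close> are linearly independent on \<open>A\<close>,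
  because every relation for \<open>x m\<close> has degree at least 2. Coefficients are compared by
  means of this lemma in degree two.\<close>

lemma indep_u:
  assumes "a \<in> polys m" "g \<in> polys m" "\<And>x. x \<in> A \<Longrightarrow> peval a x * x m = peval g x" shows "a = 0"
proof -
  obtain e F where g: "is_gen e F" using ex_gen by blast
  define D where "D = a * X m - g"
  have Dp: "D \<in> polys (Suc m)"
    unfolding D_def by (intro polys_diff polys_mult polys_X polys_mono[OF assms(1)] polys_mono[OF assms(2)]) auto
  have "D \<in> vpolys (Suc m) A"
    by (rule vidI) (use polys_mono[OF Dp, of "Suc (Suc m)"] assms(3) in \<open>auto simp: D_def peval.diff peval.mult\<close>)
  then have J: "in_var m D \<in> rel_ideal m 0 A" by (rule rel_ideal_in_var[OF _ Dp])
  have t: "in_var m D = [:- g, a:]"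
    using in_var_eq_const[OF assms(1)] in_var_eq_const[OF assms(2)] by (simp add: D_def in_var.diff in_var.mult in_var_X)
  have "degree (in_var m D) < e" unfolding t using is_genD(5)[OF g] by simp
  then have "in_var m D = 0" by (rule gen_small_0[OF g J])
  then show ?thesis using t by simp
qed

text \<open>The bounds leave only degree 2 for the projected hypersurface; the square is
  completed.\<close>

lemma quadric:
  assumes "hilb_degree (hilb (Suc m) A) 2"
  shows "\<exists>h\<in>hpoly m 1. \<exists>q\<in>hpoly m 2. \<forall>x\<in>A. (x m + peval h x)\<^sup>2 = peval q x"
proof -
  obtain e F where g: "is_gen e F" using ex_gen by blast
  have e2: "e = 2" using gen_degree_le[OF assms g] is_genD(5)[OF g] by simp
  have Fh: "F \<in> hpoly (Suc m) 2" using is_genD(1)[OF g] e2 by simp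
  define c where "c j = coeff (in_var m F) j" for j
  have c: "c 0 \<in> hpoly m 2" "c 1 \<in> hpoly m 1"
    using hpoly_expand(2)[OF Fh, of 0] hpoly_expand(2)[OF Fh, of 1] by (simp_all add: c_def)
  have c2: "c 2 = 1" using is_genD(3,4)[OF g] e2 by (simp add: c_def)
  have Fe: "F = c 0 + c 1 * X m + X m ^ 2"
    using hpoly_expand(1)[OF Fh] c2 by (simp add: c_def numeral_2_eq_2)
  define h where "h = Cst (1 / 2) * c 1"
  define q where "q = h ^ 2 - c 0"
  have hh: "h \<in> hpoly m 1" unfolding h_def by (rule hpoly_Cst_mult[OF c(2)])
  have "h ^ 2 \<in> hpoly m (2 * 1)" by (rule hpoly_power[OF hh])
  then have qh: "q \<in> hpoly m 2" unfolding q_def by (intro hpoly_diff c(1)) simp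
  have "(x m + peval h x)\<^sup>2 = peval q x" if x: "x \<in> A" for x
  proof -
    have "peval F x = 0" using vidD[OF is_genD(2)[OF g] x] .
    then have "peval (c 0) x + peval (c 1) x * x m + (x m)\<^sup>2 = 0"
      unfolding Fe by (simp add: peval.add peval.mult peval.power)
    moreover have "peval (c 1) x = 2 * peval h x" by (simp add: h_def peval.mult)
    ultimately show ?thesis
      by (simp add: q_def peval.diff peval.mult peval.power power2_eq_square algebra_simps add_eq_0_iff)
  qed
  then show ?thesis using hh qh by blast
qed

end

section \<open>Quadrics obtained by projection in degree two\<close>

lemma polarize:
  fixes q :: "'k::field_char_0 mpoly"
  assumes q: "q \<in> hpoly k 2"
  shows "\<exists>B\<in>hpoly k 1. \<forall>x s. peval q (\<lambda>i. y i + s * x i) = peval q y + s * peval B x + s\<^sup>2 * peval q x"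
proof -
  define B where "B = msubst Cst (\<lambda>i. X i + Cst (y i)) q - q - Cst (peval q y)"
  have pB: "peval B x = peval q (\<lambda>i. y i + x i) - peval q x - peval q y" for x
    by (simp add: B_def peval.diff peval_msubst_Cst peval.add add.commute)
  have ex: "peval q (\<lambda>i. y i + s * x i) = peval q y + s * peval B x + s\<^sup>2 * peval q x" for x s
  proof (cases "q = 0")
    case False
    have tq: "top_deg q = 2"
    proof -
      have "hcomp (top_deg q) q \<noteq> 0" by (rule top_component_nonzero[OF False])
      then show ?thesis using hcomp_of_hpoly[OF q] by (metis (full_types))
    qed
    define l where "l = line y x q"
    have d: "degree l \<le> 2" "coeff l 2 = peval q x"
      using line_degree[of y x q] hcomp_of_hpoly[OF q] tq by (simp_all add: l_def)
    have pl: "poly l s = coeff l 0 + coeff l 1 * s + peval q x * s\<^sup>2" for s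
    proof -
      have "poly l s = (\<Sum>i\<le>degree l. coeff l i * s ^ i)" by (rule poly_altdef)
      also have "\<dots> = (\<Sum>i\<le>2. coeff l i * s ^ i)"
        using d(1) by (intro sum.mono_neutral_left) (auto simp: coeff_eq_0)
      finally show ?thesis using d(2) by (simp add: numeral_2_eq_2)
    qed
    have p: "poly l s = peval q (\<lambda>i. y i + s * x i)" for s by (simp add: l_def poly_line)
    have c0: "coeff l 0 = peval q y" using pl[of 0] p[of 0] by simp
    have "coeff l 1 = peval B x" using pl[of 1] p[of 1] c0 by (simp add: pB algebra_simps)
    then show ?thesis using pl[of s] p[of s] c0 by (simp add: mult.commute)
  qed (simp add: B_def rhom.zero[OF rhom.rhom_msubst[OF rhom_Cst]])
  have "B \<in> hpoly k 1"
  proof (rule hpI)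
    show "B \<in> polys k" unfolding B_def using hpoly_polys[OF q]
      by (intro polys_diff polys_Cst msubst_polys[of _ k]) (auto intro: polys_add)
    fix s x
    have "peval q (\<lambda>i. y i + 1 * (s * x i)) = peval q y + 1 * peval B (\<lambda>i. s * x i) + 1\<^sup>2 * peval q (\<lambda>i. s * x i)"
      by (rule ex)
    then show "peval B (\<lambda>i. s * x i) = s ^ 1 * peval B x"
      using ex[of s x] peval_hpoly_scale[OF q, of s x] by simp
  qed
  then show ?thesis using ex by blast
qed

lemma ex_sqrt: "\<exists>\<sigma>::'k::alg_closed_field. \<sigma>\<^sup>2 = \<kappa>"
proof -
  obtain z where "poly [:- \<kappa>, 0, 1:] z = 0" using alg_closed_imp_poly_has_root[of "[:- \<kappa>, 0, 1:]"] by auto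
  then show ?thesis by (intro exI[of _ z]) (simp add: power2_eq_square)
qed

text \<open>Restrict \<open>q * q' = p\<^sup>2\<close> to lines through \<open>y\<close>. The right
  side has a double zero there and \<open>q\<close> none, so \<open>q'\<close> has a double zero
  too, and the lowest coefficients give \<open>\<kappa> * q' = C\<^sup>2\<close> with a linear form
  \<open>C\<close>. A square root of \<kappa> then makes \<open>q'\<close> a square, and the next
  coefficients determine the other factor.\<close>

lemma quadric_factor:
  fixes q q' p :: "'k::{alg_closed_field,field_char_0} mpoly"
  assumes q: "q \<in> hpoly k 2" "q' \<in> hpoly k 2" "p \<in> hpoly k 2" and eq: "q * q' = p\<^sup>2"
    and y: "peval q y \<noteq> 0" "peval p y = 0" and q': "q' \<noteq> 0"
  shows "\<exists>\<nu>\<in>hpoly k 1. \<exists>\<mu>\<in>hpoly k 1. q = \<nu>\<^sup>2 \<and> q' = \<mu>\<^sup>2 \<and> p = \<mu> * \<nu>"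
proof -
  define \<kappa> where "\<kappa> = peval q y"
  have q'y: "peval q' y = 0"
    using arg_cong[OF eq, of "\<lambda>F. peval F y"] y by (simp add: peval.mult peval.power)
  obtain B where B: "B \<in> hpoly k 1" "\<And>x s. peval q (\<lambda>i. y i + s * x i) = \<kappa> + s * peval B x + s\<^sup>2 * peval q x"
    using polarize[OF q(1), of y] by (auto simp: \<kappa>_def)
  obtain B' where B': "B' \<in> hpoly k 1" "\<And>x s. peval q' (\<lambda>i. y i + s * x i) = s * peval B' x + s\<^sup>2 * peval q' x"
    using polarize[OF q(2), of y] q'y by auto
  obtain C where C: "C \<in> hpoly k 1" "\<And>x s. peval p (\<lambda>i. y i + s * x i) = s * peval C x + s\<^sup>2 * peval p x"
    using polarize[OF q(3), of y] y(2) by auto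
  have co: "\<kappa> * peval q' x = (peval C x)\<^sup>2 \<and> peval B x * peval q' x = 2 * peval C x * peval p x" for x
  proof -
    have "[:\<kappa>, peval B x, peval q x:] * [:0, peval B' x, peval q' x:] = [:0, peval C x, peval p x:] * [:0, peval C x, peval p x:]"
    proof (rule poly_ext)
      fix s
      have "peval (q * q') (\<lambda>i. y i + s * x i) = peval (p\<^sup>2) (\<lambda>i. y i + s * x i)" by (simp add: eq)
      then show "poly ([:\<kappa>, peval B x, peval q x:] * [:0, peval B' x, peval q' x:]) s =
          poly ([:0, peval C x, peval p x:] * [:0, peval C x, peval p x:]) s"
        by (simp add: peval.mult peval.power B(2) B'(2) C(2) power2_eq_square algebra_simps)
    qed
    then have c: "\<kappa> * peval B' x = 0" "\<kappa> * peval q' x + peval B x * peval B' x = peval C x * peval C x"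
      "peval B x * peval q' x + peval q x * peval B' x = peval C x * peval p x + peval p x * peval C x"
      by (simp_all add: algebra_simps)
    have "peval B' x = 0" using c(1) y(1) by (simp add: \<kappa>_def)
    then show ?thesis using c(2,3) by (simp add: power2_eq_square algebra_simps)
  qed
  obtain \<sigma> where \<sigma>: "\<sigma>\<^sup>2 = \<kappa>" using ex_sqrt by blast
  have \<sigma>0: "\<sigma> \<noteq> 0" using \<sigma> y(1) by (auto simp: \<kappa>_def)
  define \<mu> where "\<mu> = Cst (1 / \<sigma>) * C"
  define \<nu> where "\<nu> = Cst (1 / (2 * \<sigma>)) * B"
  have q'\<mu>: "q' = \<mu>\<^sup>2"
  proof (rule peval_inj)
    fix x show "peval q' x = peval (\<mu>\<^sup>2) x"
      using co[of x] \<sigma> y(1) by (simp add: \<mu>_def peval.mult peval.power power_divide \<kappa>_def field_simps)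
  qed
  then have \<mu>0: "\<mu> \<noteq> 0" using q' by auto
  have "\<mu> * (\<mu> * \<nu>) = \<mu> * p"
  proof (rule peval_inj)
    fix x
    have C: "peval C x = \<sigma> * peval \<mu> x" and B: "peval B x = 2 * \<sigma> * peval \<nu> x"
      using \<sigma>0 by (simp_all add: \<mu>_def \<nu>_def peval.mult)
    have "peval B x * (peval \<mu> x)\<^sup>2 = 2 * peval C x * peval p x" using co[of x] by (simp add: q'\<mu> peval.power)
    then have "2 * \<sigma> * (peval \<nu> x * (peval \<mu> x)\<^sup>2) = 2 * \<sigma> * (peval \<mu> x * peval p x)" by (simp add: C B mult_ac)
    then have "peval \<nu> x * (peval \<mu> x)\<^sup>2 = peval \<mu> x * peval p x" using \<sigma>0 by simp
    then show "peval (\<mu> * (\<mu> * \<nu>)) x = peval (\<mu> * p) x" by (simp add: peval.mult power2_eq_square mult_ac)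
  qed
  then have pe: "p = \<mu> * \<nu>" using \<mu>0 by simp
  have "\<mu>\<^sup>2 * q = \<mu>\<^sup>2 * \<nu>\<^sup>2" using eq by (simp add: q'\<mu> pe power_mult_distrib mult.commute)
  then have "q = \<nu>\<^sup>2" using \<mu>0 by simp
  then show ?thesis using q'\<mu> pe hpoly_Cst_mult[OF B(1), of "1 / (2 * \<sigma>)"] hpoly_Cst_mult[OF C(1), of "1 / \<sigma>"]
    unfolding \<mu>_def[symmetric] \<nu>_def[symmetric] by blast
qed

definition two_planes :: "nat \<Rightarrow> (nat \<Rightarrow> 'k::field) set \<Rightarrow> bool" where
  "two_planes n A \<longleftrightarrow> (\<exists>T1 T2. T1 \<subseteq> hpoly (Suc n) 1 \<and> T2 \<subseteq> hpoly (Suc n) 1 \<and>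
     A = {x \<in> coords n. \<forall>F\<in>T1. peval F x = 0} \<union> {x \<in> coords n. \<forall>F\<in>T2. peval F x = 0})"

lemma (in frame) two_planes_pre: "two_planes n A \<Longrightarrow> two_planes n (pre L A)"
proof -
  assume "two_planes n A"
  then obtain T1 T2 where T: "T1 \<subseteq> hpoly (Suc n) 1" "T2 \<subseteq> hpoly (Suc n) 1"
     "A = {x \<in> coords n. \<forall>F\<in>T1. peval F x = 0} \<union> {x \<in> coords n. \<forall>F\<in>T2. peval F x = 0}"
    unfolding two_planes_def by blast
  have c: "app L x \<in> coords n \<longleftrightarrow> x \<in> coords n" for x
    using app_coords[of x] frame.app_coords[OF swap, of "app L x"] by (auto simp: inv')
  have "pre L A = {x \<in> coords n. \<forall>F\<in>pull L ` T1. peval F x = 0} \<union> {x \<in> coords n. \<forall>F\<in>pull L ` T2. peval F x = 0}"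
    unfolding T(3) pre_def by (simp add: c peval_pull) blast
  moreover have "pull L ` T1 \<subseteq> hpoly (Suc n) 1" "pull L ` T2 \<subseteq> hpoly (Suc n) 1" using T(1,2) pull_hpoly by blast+
  ultimately show ?thesis unfolding two_planes_def by blast
qed

context noether_frame begin

text \<open>If some form vanished on \<open>A\<close> but not on all of the linear graph, its
  restriction to the graph would be a nonzero polynomial \<open>a\<close> of the base. The rest of
  \<open>A\<close> lies on the zeros of the linear form \<open>l\<close>, so \<open>a * l\<close>
  vanishes on \<open>A\<close>, and torsion-freeness puts \<open>l\<close> into the ideal, against
  non-degeneracy.\<close>

lemma graph_subset:
  assumes h: "h1 \<in> hpoly m 1" "h2 \<in> hpoly m 1" and nu: "\<nu> \<in> hpoly m 1" "\<mu> \<in> hpoly m 1"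
    and A: "\<And>x. x \<in> A \<Longrightarrow> (x m + peval h1 x = peval \<nu> x \<and> x (Suc m) + peval h2 x = peval \<mu> x) \<or> x m + peval h1 x = - peval \<nu> x"
    and x0: "x0 \<in> coords (Suc m)" "x0 m + peval h1 x0 = peval \<nu> x0" "x0 (Suc m) + peval h2 x0 = peval \<mu> x0"
  shows "x0 \<in> A"
proof (rule ccontr)
  assume "x0 \<notin> A"
  then obtain t f where f: "f \<in> hpoly (Suc (Suc m)) t" "f \<in> vpolys (Suc m) A" "peval f x0 \<noteq> 0"
    using vclosed_sep[OF kA x0(1)] by blast
  define a where "a = msubst Cst (\<lambda>i. if i < m then X i else if i = m then \<nu> - h1 else \<mu> - h2) f"
  have ap: "a \<in> polys m"
    unfolding a_def using h nu by (intro msubst_polys[OF hpoly_polys[OF f(1)]]) (auto intro: polys_diff hpoly_polys)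
  have pa: "peval a x = peval f x" if "x m + peval h1 x = peval \<nu> x" "x (Suc m) + peval h2 x = peval \<mu> x" for x
    unfolding a_def peval_msubst_Cst
    by (rule peval_cong[OF hpoly_polys[OF f(1)]]) (use that in \<open>auto simp: peval.diff less_Suc_eq algebra_simps\<close>)
  have a0: "a \<noteq> 0" using pa[OF x0(2,3)] f(3) by auto
  define l where "l = X m + (h1 + \<nu>)"
  have lh: "l \<in> hpoly (Suc (Suc m)) 1"
    unfolding l_def by (intro hpoly_add hpoly_X hpoly_mono[OF h(1)] hpoly_mono[OF nu(1)]) auto
  have "a * l \<in> vpolys (Suc m) A"
  proof (rule vidI)
    show "a * l \<in> polys (Suc (Suc m))" by (intro polys_mult polys_mono[OF ap] hpoly_polys[OF lh]) auto
    fix x assume x: "x \<in> A"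
    from A[OF x] show "peval (a * l) x = 0"
    proof
      assume "x m + peval h1 x = peval \<nu> x \<and> x (Suc m) + peval h2 x = peval \<mu> x"
      then have "peval a x = 0" using pa[of x] vidD[OF f(2) x] by simp
      then show ?thesis by (simp add: peval.mult)
    next
      assume "x m + peval h1 x = - peval \<nu> x"
      then have "peval l x = 0" by (simp add: l_def peval.add flip: add.assoc)
      then show ?thesis by (simp add: peval.mult)
    qed
  qed
  then have "l \<in> vpolys (Suc m) A" by (rule tf[OF ap a0 hpoly_polys[OF lh]])
  then have "l = 0" by (rule nondeg[OF lh])
  then have "peval l (unit_vec m) = 0" by simp
  moreover have "peval F (unit_vec m) = 0" if "F \<in> hpoly m 1" for F :: "'k mpoly"
  proof -
    have "peval F (unit_vec m) = peval F (\<lambda>i. 0 * 0)" by (rule peval_cong[OF hpoly_polys[OF that]]) (auto simp: unit_vec_def)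
    then show ?thesis using peval_hpoly_scale[OF that, of 0 "\<lambda>_. 0"] by simp
  qed
  ultimately show False using h nu by (simp add: l_def peval.add unit_vec_def)
qed

text \<open>The same relations for another linear coordinate in place of \<open>x m\<close>,
  obtained from a change of coordinates that fixes the base.\<close>

lemma quadric_pre:
  assumes H: "hilb_degree (hilb (Suc m) A) 2" and L: "frame (Suc m) L L'" and id: "\<And>x i. i < m \<Longrightarrow> app L x i = x i"
    "\<And>x i. i < m \<Longrightarrow> app L' x i = x i"
  shows "\<exists>h\<in>hpoly m 1. \<exists>q\<in>hpoly m 2. \<forall>x\<in>A. (app L' x m + peval h x)\<^sup>2 = peval q x"
    "\<And>a g. a \<in> polys m \<Longrightarrow> g \<in> polys m \<Longrightarrow> (\<And>x. x \<in> A \<Longrightarrow> peval a x * app L' x m = peval g x) \<Longrightarrow> a = 0"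
proof -
  interpret L: frame "Suc m" L L' by (rule L)
  interpret A': noether_frame m "pre L A" by (rule noether_pre[OF L id(1)])
  have H': "hilb (Suc m) (pre L A) = hilb (Suc m) A" by (rule ext) (rule L.hilb_pre)
  have pe: "peval F (app L' x) = peval F x" if "F \<in> polys m" for F x
    by (rule peval_cong[OF that]) (simp add: id(2))
  have inA: "app L' x \<in> pre L A" if "x \<in> A" for x using that by (simp add: pre_def L.inv)
  obtain h q where hq: "h \<in> hpoly m 1" "q \<in> hpoly m 2" "\<forall>x\<in>pre L A. (x m + peval h x)\<^sup>2 = peval q x"
    using A'.quadric H H' by auto
  show "\<exists>h\<in>hpoly m 1. \<exists>q\<in>hpoly m 2. \<forall>x\<in>A. (app L' x m + peval h x)\<^sup>2 = peval q x"
    using hq(3) inA pe[OF hpoly_polys[OF hq(1)]] pe[OF hpoly_polys[OF hq(2)]] by (intro bexI[OF _ hq(1)] bexI[OF _ hq(2)]) metis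
  fix a g assume a: "a \<in> polys m" "g \<in> polys m" "\<And>x. x \<in> A \<Longrightarrow> peval a x * app L' x m = peval g x"
  show "a = 0"
  proof (rule A'.indep_u[OF a(1,2)])
    fix x assume "x \<in> pre L A"
    then have "app L x \<in> A" by (simp add: pre_def)
    from a(3)[OF this] show "peval a x * x m = peval g x"
      using pe[OF a(1), of "app L x"] pe[OF a(2), of "app L x"] by (simp add: L.inv')
  qed
qed

text \<open>\<open>U\<close> and \<open>W\<close> are the two non-base coordinates after completing
  the square. Their quadrics and that of their difference, together with the birational relation,
  force \<open>U * W\<close> into the base. Then \<open>q1 * q2\<close> is a square, the quadrics
  split into linear factors after replacing \<open>W\<close> by a suitable combination, and a choice
  of sign separates the two linear spaces.\<close>

lemma degree_2_birational_imp_two_planes: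
  assumes H: "hilb_degree (hilb (Suc m) A) 2"
    and bir: "a \<in> hpoly m \<alpha>" "a \<noteq> 0" "B \<in> hpoly (Suc m) (Suc \<alpha>)" "a * X (Suc m) - B \<in> vpolys (Suc m) A"
  shows "two_planes (Suc m) A"
proof -
  let ?n = "Suc m"
  obtain h1 q1 where 1: "h1 \<in> hpoly m 1" "q1 \<in> hpoly m 2" "\<And>x. x \<in> A \<Longrightarrow> (x m + peval h1 x)\<^sup>2 = peval q1 x"
    using quadric[OF H] by blast
  have fe: "frame ?n (exch m ?n) (exch m ?n :: nat \<Rightarrow> 'k mpoly)" by (rule frame_exch) auto
  note E = quadric_pre[OF H fe, unfolded app_exch]
  obtain h2 q2 where 2: "h2 \<in> hpoly m 1" "q2 \<in> hpoly m 2" "\<And>x. x \<in> A \<Longrightarrow> (x ?n + peval h2 x)\<^sup>2 = peval q2 x"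
    using E(1) by auto
  have indw: "b = 0" if "b \<in> polys m" "g \<in> polys m" "\<And>x. x \<in> A \<Longrightarrow> peval b x * x ?n = peval g x" for b g
    by (rule E(2)[OF _ _ that(1,2)]) (use that(3) in auto)
  let ?q = "(\<lambda>i. if i = m \<or> i = ?n then 1 else 0) :: nat \<Rightarrow> 'k"
  have fs: "frame ?n (shear ?n ?n ?q) (shear ?n ?n (\<lambda>i. if i = ?n then 1 / ?q ?n else - ?q i / ?q ?n))"
    by (rule frame_shear(1)) auto
  obtain h3 q3 where 3: "h3 \<in> hpoly m 1" "q3 \<in> hpoly m 2" "\<And>x. x \<in> A \<Longrightarrow> (x m - x ?n + peval h3 x)\<^sup>2 = peval q3 x"
    using quadric_pre(1)[OF H fs, unfolded app_shear] by auto
  define U where "U x = x m + peval h1 x" for x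
  define W where "W x = x ?n + peval h2 x" for x
  \<comment> \<open>With this \<open>k\<close>, the coordinate \<open>x m - x ?n + h3\<close>
    becomes \<open>U - W + k\<close>, so expanding its square yields the mixed product
    \<open>U * W\<close>.\<close>
  define k where "k = h3 - h1 + h2"
  define r where "r = Cst (1 / 2) * (q1 + q2 + k ^ 2 - q3)"
  have kh: "k \<in> hpoly m 1" unfolding k_def by (intro hpoly_add hpoly_diff 1 2 3)
  have "k ^ 2 \<in> hpoly m (2 * 1)" by (rule hpoly_power[OF kh])
  then have rh: "r \<in> hpoly m 2" unfolding r_def by (intro hpoly_Cst_mult hpoly_add hpoly_diff 1 2 3) simp
  have U2: "(U x)\<^sup>2 = peval q1 x" and W2: "(W x)\<^sup>2 = peval q2 x" if "x \<in> A" for x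
    using 1 2 that by (simp_all add: U_def W_def)
  have UW: "U x * W x = peval k x * (U x - W x) + peval r x" if x: "x \<in> A" for x
  proof -
    have "(U x - W x + peval k x)\<^sup>2 = peval q3 x"
      using 3(3)[OF x] by (simp add: U_def W_def k_def peval.add peval.diff algebra_simps)
    then have "(U x)\<^sup>2 + (W x)\<^sup>2 + (peval k x)\<^sup>2 - peval q3 x = 2 * (U x * W x - peval k x * (U x - W x))"
      by (simp add: power2_eq_square algebra_simps)
    then have "2 * peval r x = 2 * (U x * W x - peval k x * (U x - W x))"
      using U2[OF x] W2[OF x] by (simp add: r_def peval.mult peval.add peval.diff peval.power)
    then have "peval r x = U x * W x - peval k x * (U x - W x)"
      by (rule iffD1[OF mult_left_cancel, rotated]) simp
    then show ?thesis by simp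
  qed
  have indU: "b = 0" if b: "b \<in> polys m" "g \<in> polys m" "\<And>x. x \<in> A \<Longrightarrow> peval b x * U x = peval g x" for b g
    by (rule indep_u[OF b(1) polys_diff[OF b(2) polys_mult[OF b(1) hpoly_polys[OF 1(1)]]]])
       (use b(3) in \<open>auto simp: U_def peval.diff peval.mult algebra_simps\<close>)
  note P1 = hpoly_polys[OF 1(1)] hpoly_polys[OF 2(1)] hpoly_polys[OF 1(2)] hpoly_polys[OF 2(2)] hpoly_polys[OF kh] hpoly_polys[OF rh] hpoly_polys[OF bir(1)]
  \<comment> \<open>The module spanned by 1 and \<open>U\<close> over the base is closed under
    multiplication by \<open>x m\<close>, because \<open>U\<close> squared lies in the base. Hence
    \<open>B\<close> reduces to an expression linear in \<open>U\<close>.\<close>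
  have pw: "\<exists>b\<in>polys m. \<exists>g\<in>polys m. \<forall>x\<in>A. x m ^ j = peval b x * U x + peval g x" for j
  proof (induction j)
    case 0
    show ?case by (intro bexI[of _ 0] bexI[of _ 1]) auto
  next
    case (Suc j)
    then obtain b g where bg: "b \<in> polys m" "g \<in> polys m" "\<forall>x\<in>A. x m ^ j = peval b x * U x + peval g x" by blast
    have "x m ^ Suc j = peval (g - h1 * b) x * U x + peval (b * q1 - h1 * g) x" if x: "x \<in> A" for x
    proof -
      have "x m ^ Suc j = (U x - peval h1 x) * (peval b x * U x + peval g x)" using bg x by (simp add: U_def)
      also have "\<dots> = peval b x * (U x)\<^sup>2 + (peval g x - peval h1 x * peval b x) * U x - peval h1 x * peval g x"
        by (simp add: power2_eq_square algebra_simps)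
      finally show ?thesis using U2[OF x] by (simp add: peval.diff peval.mult algebra_simps)
    qed
    moreover have "g - h1 * b \<in> polys m" "b * q1 - h1 * g \<in> polys m"
      using bg P1 by (auto intro!: polys_diff polys_mult)
    ultimately show ?case by blast
  qed
  then obtain bb gg where bg: "\<And>j. bb j \<in> polys m" "\<And>j. gg j \<in> polys m"
    "\<And>j x. x \<in> A \<Longrightarrow> x m ^ j = peval (bb j) x * U x + peval (gg j) x" by metis
  define c where "c j = coeff (in_var m B) j" for j
  have cp: "c j \<in> polys m" for j unfolding c_def by (rule coeff_in_var_polys[OF hpoly_polys[OF bir(3)]])
  define b where "b = (\<Sum>j\<le>Suc \<alpha>. c j * bb j)"
  define g where "g = (\<Sum>j\<le>Suc \<alpha>. c j * gg j) + a * h2"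
  have bp: "b \<in> polys m" unfolding b_def using cp bg(1) by (intro polys_sum polys_mult) auto
  have gp: "g \<in> polys m" unfolding g_def using cp bg(2) P1 by (intro polys_add polys_sum polys_mult) auto
  have aW: "peval a x * W x = peval b x * U x + peval g x" if x: "x \<in> A" for x
  proof -
    have "peval a x * x ?n = peval B x" using vidD[OF bir(4) x] by (simp add: peval.diff peval.mult)
    also have "B = (\<Sum>j\<le>Suc \<alpha>. c j * X m ^ j)" unfolding c_def by (rule hpoly_expand(1)[OF bir(3)])
    also have "peval \<dots> x = (\<Sum>j\<le>Suc \<alpha>. peval (c j) x * (peval (bb j) x * U x + peval (gg j) x))"
      using bg(3)[OF x] by (simp only: peval.sum peval.mult peval.power peval_X)
    finally show ?thesis
      by (simp only: W_def b_def g_def peval.add peval.sum peval.mult distrib_left sum.distrib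
          sum_distrib_right mult.assoc) (simp add: mult_ac)
  qed
  \<comment> \<open>Squaring \<open>a * W = b * U + g\<close> leaves \<open>2 * b * g * U\<close> as
    the only term outside the base.\<close>
  have "Cst 2 * b * g = 0"
  proof (rule indU)
    show "Cst 2 * b * g \<in> polys m" "a ^ 2 * q2 - b ^ 2 * q1 - g ^ 2 \<in> polys m"
      using bp gp P1 by (auto intro!: polys_mult polys_diff polys_power)
    fix x assume x: "x \<in> A"
    have "(peval a x)\<^sup>2 * (W x)\<^sup>2 = (peval b x * U x + peval g x)\<^sup>2" using aW[OF x] by (metis power_mult_distrib)
    also have "\<dots> = (peval b x)\<^sup>2 * (U x)\<^sup>2 + 2 * peval b x * peval g x * U x + (peval g x)\<^sup>2"
      by (simp add: power2_eq_square algebra_simps)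
    finally show "peval (Cst 2 * b * g) x * U x = peval (a ^ 2 * q2 - b ^ 2 * q1 - g ^ 2) x"
      using U2[OF x] W2[OF x] by (simp add: peval.mult peval.diff peval.power)
  qed
  moreover have "b \<noteq> 0"
  proof
    assume "b = 0"
    then have "peval a x * x ?n = peval (g - a * h2) x" if "x \<in> A" for x
      using aW[OF that] by (simp add: W_def peval.diff peval.mult algebra_simps)
    then have "a = 0" using gp P1 by (intro indw[of a "g - a * h2"]) (auto intro!: polys_diff polys_mult)
    then show False using bir(2) by simp
  qed
  ultimately have g0: "g = 0" by simp
  have aW': "peval a x * W x = peval b x * U x" if "x \<in> A" for x using aW[OF that] g0 by simp
  \<comment> \<open>Multiply the formula for \<open>U * W\<close> by \<open>a\<close>, replace
    \<open>a * W\<close> by \<open>b * U\<close>, and compare the coefficients of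
    \<open>U\<close>.\<close>
  have "k * (a - b) = 0"
  proof (rule indU)
    show "k * (a - b) \<in> polys m" "b * q1 - a * r \<in> polys m" using bp P1 by (auto intro!: polys_mult polys_diff)
    fix x assume x: "x \<in> A"
    have "peval b x * (U x)\<^sup>2 = U x * (peval a x * W x)" using aW'[OF x] by (simp add: power2_eq_square)
    also have "\<dots> = peval a x * (peval k x * (U x - W x) + peval r x)" using UW[OF x] by (simp add: mult_ac)
    also have "\<dots> = peval k x * (peval a x * U x - peval a x * W x) + peval a x * peval r x" by (simp add: algebra_simps)
    also have "\<dots> = peval k x * (peval a x - peval b x) * U x + peval a x * peval r x"
      using aW'[OF x] by (simp add: algebra_simps)
    finally show "peval (k * (a - b)) x * U x = peval (b * q1 - a * r) x"
      using U2[OF x] by (simp add: peval.mult peval.diff)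
  qed
  moreover have van: "peval F (unit_vec ?n) = 0" if "F \<in> hpoly m 1" for F :: "'k mpoly"
  proof -
    have "peval F (unit_vec ?n) = peval F (\<lambda>i. 0 * 0)" by (rule peval_cong[OF hpoly_polys[OF that]]) (auto simp: unit_vec_def)
    then show ?thesis using peval_hpoly_scale[OF that, of 0 "\<lambda>_. 0"] by simp
  qed
  have lin: "\<exists>x\<in>A. W x - s * U x \<noteq> z * peval f x" if f: "f \<in> hpoly m 1" for s z f
  proof -
    define l where "l = X ?n + h2 - Cst s * (X m + h1) - Cst z * f"
    have "l \<in> hpoly (Suc ?n) 1"
      unfolding l_def by (intro hpoly_diff hpoly_add hpoly_Cst_mult hpoly_X hpoly_mono[OF 1(1)] hpoly_mono[OF 2(1)] hpoly_mono[OF f]) auto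
    moreover have "peval l (unit_vec ?n) = 1"
      using van[OF 1(1)] van[OF 2(1)] van[OF f] by (simp add: l_def peval.add peval.diff peval.mult unit_vec_def)
    ultimately obtain x where "x \<in> A" "peval l x \<noteq> 0" using nondeg_fun[of l "unit_vec ?n"] by auto
    then show ?thesis by (intro bexI[of _ x]) (auto simp: l_def peval.add peval.diff peval.mult U_def W_def)
  qed
  moreover have "a \<noteq> b"
  proof
    assume ab: "a = b"
    define l where "l = X ?n + h2 - (X m + h1)"
    have lp: "l \<in> polys (Suc ?n)"
      unfolding l_def by (intro polys_diff polys_add polys_X polys_mono[OF P1(1)] polys_mono[OF P1(2)]) auto
    have "a * l \<in> vpolys ?n A"
    proof (rule vidI)
      show "a * l \<in> polys (Suc ?n)" by (intro polys_mult polys_mono[OF P1(7)] lp) auto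
      fix x assume "x \<in> A"
      then show "peval (a * l) x = 0" using aW'[of x] ab
        by (simp add: l_def peval.mult peval.diff peval.add U_def W_def algebra_simps)
    qed
    then have "l \<in> vpolys ?n A" by (rule tf[OF P1(7) bir(2) lp])
    then have "W x - 1 * U x = 0 * peval h1 x" if "x \<in> A" for x
      using vidD that by (fastforce simp: l_def peval.diff peval.add U_def W_def)
    then show False using lin[OF 1(1), of 1 0] by blast
  qed
  ultimately have k0: "k = 0" by simp
  have UWr: "U x * W x = peval r x" if "x \<in> A" for x using UW[OF that] k0 by simp
  have "r\<^sup>2 - q1 * q2 = 0"
  proof (rule vpolys_base)
    show "r\<^sup>2 - q1 * q2 \<in> polys m" using P1 by (intro polys_diff polys_mult polys_power)
    fix x assume x: "x \<in> A"
    have "(peval r x)\<^sup>2 = (U x)\<^sup>2 * (W x)\<^sup>2" using UWr[OF x] by (metis power_mult_distrib)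
    then show "peval (r\<^sup>2 - q1 * q2) x = 0" using U2[OF x] W2[OF x] by (simp add: peval.diff peval.power peval.mult)
  qed
  then have rq: "r\<^sup>2 = q1 * q2" by simp
  have "q1 \<noteq> 0"
  proof
    assume "q1 = 0"
    then have U0: "U x = 0" if "x \<in> A" for x using U2[OF that] by simp
    have "(1 :: 'k mpoly) = 0" by (rule indU[of 1 0]) (use U0 in auto)
    then show False by simp
  qed
  then obtain y where y: "peval q1 y \<noteq> 0" using ex_peval_nonzero by blast
  \<comment> \<open>The value for which \<open>p\<close> vanishes at \<open>y\<close> while
    \<open>q1\<close> does not, as the factorisation requires.\<close>
  define t where "t = peval r y / peval q1 y"
  define p where "p = r - Cst t * q1"
  define q' where "q' = q2 - Cst (2 * t) * r + Cst (t\<^sup>2) * q1"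
  have ph: "p \<in> hpoly m 2" unfolding p_def by (intro hpoly_diff hpoly_Cst_mult rh 1)
  have q'h: "q' \<in> hpoly m 2" unfolding q'_def by (intro hpoly_add hpoly_diff hpoly_Cst_mult rh 1 2)
  define v where "v x = W x - t * U x" for x
  have v2: "(v x)\<^sup>2 = peval q' x" and Uv: "U x * v x = peval p x" if x: "x \<in> A" for x
  proof -
    have "(v x)\<^sup>2 = (W x)\<^sup>2 - 2 * t * (U x * W x) + t\<^sup>2 * (U x)\<^sup>2" by (simp add: v_def power2_eq_square algebra_simps)
    then show "(v x)\<^sup>2 = peval q' x" unfolding UWr[OF x] U2[OF x] W2[OF x] by (simp add: q'_def peval.add peval.diff peval.mult)
    have "U x * v x = U x * W x - t * (U x)\<^sup>2" by (simp add: v_def power2_eq_square algebra_simps)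
    then show "U x * v x = peval p x" unfolding UWr[OF x] U2[OF x] by (simp add: p_def peval.diff peval.mult)
  qed
  have eq: "q1 * q' = p\<^sup>2"
  proof -
    have "Cst (2 * t) = Cst t + Cst t" "Cst (t\<^sup>2) = Cst t * Cst t"
      by (simp_all add: power2_eq_square flip: rhom.add[OF rhom_Cst] rhom.mult[OF rhom_Cst])
    then have "q1 * q' = q1 * q2 - (Cst t + Cst t) * r * q1 + Cst t * Cst t * q1 * q1"
      by (simp add: q'_def algebra_simps)
    also have "\<dots> = p\<^sup>2" unfolding rq[symmetric] by (simp add: p_def power2_eq_square algebra_simps)
    finally show ?thesis .
  qed
  have "q' \<noteq> 0"
  proof
    assume "q' = 0"
    then have "v x = 0" if "x \<in> A" for x using v2[OF that] by simp
    then show False using lin[OF 1(1), of t 0] by (simp add: v_def)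
  qed
  moreover have "peval p y = 0" using y by (simp add: p_def peval.diff peval.mult t_def)
  ultimately obtain \<nu> \<mu> where nm: "\<nu> \<in> hpoly m 1" "\<mu> \<in> hpoly m 1" "q1 = \<nu>\<^sup>2" "q' = \<mu>\<^sup>2" "p = \<mu> * \<nu>"
    using quadric_factor[OF 1(2) q'h ph eq y] by blast
  have sgn: "(U x = peval \<nu> x \<and> v x = peval \<mu> x) \<or> (U x = - peval \<nu> x \<and> v x = - peval \<mu> x)" if x: "x \<in> A" for x
  proof -
    have e: "(U x)\<^sup>2 = (peval \<nu> x)\<^sup>2" "(v x)\<^sup>2 = (peval \<mu> x)\<^sup>2" "U x * v x = peval \<mu> x * peval \<nu> x"
      using U2[OF x] v2[OF x] Uv[OF x] by (simp_all add: nm peval.power peval.mult)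
    have uv: "U x = peval \<nu> x \<or> U x = - peval \<nu> x" "v x = peval \<mu> x \<or> v x = - peval \<mu> x"
      using e(1,2) by (simp_all add: power2_eq_iff)
    show ?thesis
    proof (cases "peval \<nu> x = 0")
      case True then show ?thesis using uv by auto
    next
      case False
      then show ?thesis using uv e(3) by (auto simp: mult.commute)
    qed
  qed
  have gs: "x \<in> A" if x: "x \<in> coords ?n" "U x = z * peval \<nu> x" "v x = z * peval \<mu> x" and z: "z = 1 \<or> z = -1" for x z
  proof (rule graph_subset[OF 1(1) 2(1), of "Cst z * \<nu>" "Cst z * (\<mu> + Cst t * \<nu>)"])
    show "Cst z * \<nu> \<in> hpoly m 1" "Cst z * (\<mu> + Cst t * \<nu>) \<in> hpoly m 1" by (intro hpoly_Cst_mult hpoly_add nm)+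
    show "x \<in> coords ?n" by fact
    show "x m + peval h1 x = peval (Cst z * \<nu>) x" using x(2) by (simp add: U_def peval.mult)
    show "x ?n + peval h2 x = peval (Cst z * (\<mu> + Cst t * \<nu>)) x"
      using x(2,3) by (simp add: U_def W_def v_def peval.mult peval.add algebra_simps)
    fix x' assume x': "x' \<in> A"
    show "x' m + peval h1 x' = peval (Cst z * \<nu>) x' \<and> x' ?n + peval h2 x' = peval (Cst z * (\<mu> + Cst t * \<nu>)) x' \<or>
        x' m + peval h1 x' = - peval (Cst z * \<nu>) x'"
      using sgn[OF x'] z unfolding v_def U_def[symmetric] W_def[symmetric]
      by (auto simp: peval.mult peval.add algebra_simps) (simp add: eq_neg_iff_add_eq_0 ac_simps)
  qed
  define T where "T z = {X m + h1 - Cst z * \<nu>, X ?n + h2 - Cst t * (X m + h1) - Cst z * \<mu>}" for z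
  have T1: "T z \<subseteq> hpoly (Suc ?n) 1" for z
    unfolding T_def
    by (auto intro!: hpoly_diff hpoly_add hpoly_Cst_mult hpoly_X[of _ "Suc ?n", simplified] hpoly_mono[OF 1(1), of "Suc ?n", simplified]
      hpoly_mono[OF 2(1), of "Suc ?n", simplified] hpoly_mono[OF nm(1), of "Suc ?n", simplified] hpoly_mono[OF nm(2), of "Suc ?n", simplified])
  have TU: "(\<forall>F\<in>T z. peval F x = 0) \<longleftrightarrow> U x = z * peval \<nu> x \<and> v x = z * peval \<mu> x" for z x
    by (auto simp: T_def peval.add peval.diff peval.mult U_def W_def v_def)
  have "A = {x \<in> coords ?n. \<forall>F\<in>T 1. peval F x = 0} \<union> {x \<in> coords ?n. \<forall>F\<in>T (-1). peval F x = 0}"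
    unfolding TU
  proof (intro subset_antisym subsetI)
    fix x assume x: "x \<in> A"
    then have "x \<in> coords ?n" using vclosed_coords[OF kA] by blast
    then show "x \<in> {x \<in> coords ?n. U x = 1 * peval \<nu> x \<and> v x = 1 * peval \<mu> x} \<union> {x \<in> coords ?n. U x = - 1 * peval \<nu> x \<and> v x = - 1 * peval \<mu> x}"
      using sgn[OF x] by auto
  next
    fix x assume "x \<in> {x \<in> coords ?n. U x = 1 * peval \<nu> x \<and> v x = 1 * peval \<mu> x} \<union> {x \<in> coords ?n. U x = - 1 * peval \<nu> x \<and> v x = - 1 * peval \<mu> x}"
    then show "x \<in> A" using gs by blast
  qed
  then show ?thesis unfolding two_planes_def using T1 by blast
qed

lemma degree_2_imp_two_planes:
  assumes H: "hilb_degree (hilb (Suc m) A) 2" shows "two_planes (Suc m) A"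
proof -
  let ?n = "Suc m"
  obtain t \<alpha> a B where A': "noether_frame m (pre (shear ?n ?n (\<lambda>i. if i = m then - t else if i = ?n then 1 else 0)) A)"
    and a: "a \<in> hpoly m \<alpha>" "a \<noteq> 0" "B \<in> hpoly ?n (Suc \<alpha>)"
      "a * X ?n - B \<in> vpolys ?n (pre (shear ?n ?n (\<lambda>i. if i = m then - t else if i = ?n then 1 else 0)) A)"
    using ex_birational unfolding Let_def by blast
  let ?q = "(\<lambda>i. if i = m then - t else if i = ?n then 1 else 0) :: nat \<Rightarrow> 'k"
  interpret L: frame ?n "shear ?n ?n ?q" "shear ?n ?n (\<lambda>i. if i = ?n then 1 / ?q ?n else - ?q i / ?q ?n)"
    by (rule frame_shear(1)) auto
  interpret A': noether_frame m "pre (shear ?n ?n ?q) A" by (rule A')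
  have H': "hilb ?n (pre (shear ?n ?n ?q) A) = hilb ?n A" by (rule ext) (rule L.hilb_pre)
  have "two_planes ?n (pre (shear ?n ?n ?q) A)"
    by (rule A'.degree_2_birational_imp_two_planes[OF _ a]) (simp add: H' H)
  from frame.two_planes_pre[OF L.swap this] show ?thesis by (simp add: L.pre_pre)
qed

end



section \<open>General projections\<close>

lemma app_shear_unit_vec:
  assumes "p \<in> coords n" shows "app (shear n n p) (unit_vec n) = p"
proof
  fix i show "app (shear n n p) (unit_vec n) i = p i"
    using coordsD[OF assms, of i] by (auto simp: app_shear unit_vec_def)
qed

text \<open>The first shear moves the vertex to the last unit vector, for which
  \<open>p (Suc m)\<close> must be nonzero. The second fixes that vector and makes the remaining
  projection finite.\<close>

lemma ex_noether_coordinates: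
  fixes A :: "(nat \<Rightarrow> 'k::{alg_closed_field,field_char_0}) set"
  assumes m: "m \<ge> 2" and A: "admissible (Suc m) A" and p: "p \<in> coords (Suc m)" "p (Suc m) \<noteq> 0" "p \<notin> A"
  shows "\<exists>A1 q L1 L2. frame (Suc m) (shear (Suc m) (Suc m) p) L1 \<and>
    frame (Suc m) (shear (Suc m) m q) L2 \<and> q (Suc m) = 0 \<and>
    A1 = pre (shear (Suc m) m q) (pre (shear (Suc m) (Suc m) p) A) \<and> noether_frame m A1 \<and>
    app (shear (Suc m) m q) (unit_vec (Suc m)) = unit_vec (Suc m)"
proof -
  let ?n = "Suc m"
  let ?L1 = "shear ?n ?n (\<lambda>i. if i = ?n then 1 / p ?n else - p i / p ?n)"
  have f1: "frame ?n (shear ?n ?n p) ?L1" by (rule frame_shear(1)) (use p in auto)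
  have g1: "admissible ?n (pre (shear ?n ?n p) A)" by (rule frame.admissible_pre[OF f1 A])
  have "unit_vec ?n \<notin> pre (shear ?n ?n p) A" using app_shear_unit_vec[OF p(1)] p(3) by (simp add: pre_def)
  then obtain q where q: "q m = 1" "q ?n = 0" "noether m (pre (shear ?n m q) (pre (shear ?n ?n p) A))"
    using ex_noether_shear[OF g1] m by auto
  have f2: "frame ?n (shear ?n m q) (shear ?n m (\<lambda>i. if i = m then 1 / q m else - q i / q m))"
    by (rule frame_shear(1)) (use q in auto)
  have "noether_frame m (pre (shear ?n m q) (pre (shear ?n ?n p) A))"
    by unfold_locales (use m frame.admissible_pre[OF f2 g1] q in auto)
  moreover have "app (shear ?n m q) (unit_vec ?n) = unit_vec ?n"
    by (auto simp: app_shear unit_vec_def)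
  ultimately show ?thesis using f1 f2 q(2) by blast
qed

lemma cone_form_general:
  fixes A :: "(nat \<Rightarrow> 'k::{alg_closed_field,field_char_0}) set"
  assumes m: "m \<ge> 2" and A: "admissible (Suc m) A" and H: "hilb_degree (hilb (Suc m) A) d"
    and p: "p \<in> coords (Suc m)" "p (Suc m) \<noteq> 0" "p \<notin> A"
  shows "\<exists>e F. cone_form (Suc m) p A e F \<and> e \<le> d \<and> ideal_dim (Suc m) A e \<le> (e - 1 + Suc m) choose Suc m"
proof -
  let ?n = "Suc m"
  obtain A1 q L1 L2 where L: "frame ?n (shear ?n ?n p) L1" "frame ?n (shear ?n m q) L2" and A1: "A1 = pre (shear ?n m q) (pre (shear ?n ?n p) A)"
    and nf: "noether_frame m A1" and e: "app (shear ?n m q) (unit_vec ?n) = unit_vec ?n"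
    using ex_noether_coordinates[OF m A p] by blast
  interpret noether_frame m A1 by (rule nf)
  have hA: "hilb ?n A1 = hilb ?n A" unfolding A1 by (rule ext) (simp add: frame.hilb_pre[OF L(1)] frame.hilb_pre[OF L(2)])
  have iA: "ideal_dim ?n A1 t = ideal_dim ?n A t" for t unfolding A1 by (simp add: frame.ideal_dim_pre[OF L(1)] frame.ideal_dim_pre[OF L(2)])
  obtain e F where g: "is_gen e F" using ex_gen by blast
  have "cone_form ?n (unit_vec ?n) A1 e F" by (rule cone_form_gen[OF g])
  from frame.cone_form_pull[OF L(2) this[unfolded A1]]
  have "cone_form ?n (unit_vec ?n) (pre (shear ?n ?n p) A) e (pull L2 F)" by (simp add: e)
  from frame.cone_form_pull[OF L(1) this]
  have "cone_form ?n p A e (pull L1 (pull L2 F))" by (simp add: app_shear_unit_vec[OF p(1)])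
  moreover have "e \<le> d" by (rule gen_degree_le[OF _ g]) (simp add: hA H)
  moreover have "ideal_dim ?n A e \<le> (e - 1 + ?n) choose ?n" using ideal_dim_bound[OF g] by (simp add: iA dim_hpoly)
  ultimately show ?thesis by blast
qed

text \<open>A vertex for which the cone has degree exactly \<open>d\<close>: in the coordinates with
  a birational projection, the last unit vector is such a vertex, and it is carried back to the
  original coordinates.\<close>

lemma cone_form_exists_degree:
  fixes A :: "(nat \<Rightarrow> 'k::{alg_closed_field,field_char_0}) set"
  assumes m: "m \<ge> 2" and A: "admissible (Suc m) A" and H: "hilb_degree (hilb (Suc m) A) d"
  shows "\<exists>p F. p \<in> coords (Suc m) \<and> p (Suc m) \<noteq> 0 \<and> p \<notin> A \<and> cone_form (Suc m) p A d F"
    "d = 2 \<Longrightarrow> two_planes (Suc m) A"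
proof -
  let ?n = "Suc m"
  have kA: "vclosed ?n A" using A by (simp add: admissible_def)
  obtain t f where f: "f \<in> hpoly (Suc ?n) t" "f \<in> vpolys ?n A" "f \<noteq> 0" using admissible_ex_nonzero[OF A] by auto
  \<comment> \<open>The factor \<open>X ?n\<close> makes the last coordinate of \<open>p\<close>
    nonzero, so that the shear with column \<open>p\<close> is invertible.\<close>
  have "f * X ?n \<noteq> 0" using f by simp
  moreover have "f * X ?n \<in> polys (Suc ?n)" by (intro polys_mult hpoly_polys[OF f(1)] polys_X) simp
  ultimately obtain p where p: "\<forall>i\<ge>Suc ?n. p i = 0" "peval (f * X ?n) p \<noteq> 0"
    using ex_peval_nonzero_polys by blast
  have pn: "p ?n \<noteq> 0" "peval f p \<noteq> 0" using p(2) by (auto simp: peval.mult)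
  have pc: "p \<in> coords ?n" using pn p(1) by (auto simp: coords_def)
  have pA: "p \<notin> A" using vidD[OF f(2)] pn by blast
  obtain A1 q L1 L2 where L: "frame ?n (shear ?n ?n p) L1" "frame ?n (shear ?n m q) L2" and q: "q ?n = 0"
    and A1: "A1 = pre (shear ?n m q) (pre (shear ?n ?n p) A)" and nf: "noether_frame m A1"
    using ex_noether_coordinates[OF m A pc pn(1) pA] by blast
  interpret A1: noether_frame m A1 by (rule nf)
  have hA: "hilb ?n A1 = hilb ?n A" unfolding A1 by (rule ext) (simp add: frame.hilb_pre[OF L(1)] frame.hilb_pre[OF L(2)])
  show "d = 2 \<Longrightarrow> two_planes ?n A"
  proof -
    assume "d = 2"
    then have "two_planes ?n A1" by (intro A1.degree_2_imp_two_planes) (use hA H in simp)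
    then have "two_planes ?n (pre (shear ?n ?n p) A)"
      using frame.two_planes_pre[OF frame.swap[OF L(2)]] frame.pre_pre[OF L(2)] unfolding A1 by metis
    then show ?thesis
      using frame.two_planes_pre[OF frame.swap[OF L(1)]] frame.pre_pre[OF L(1)] by metis
  qed
  obtain t \<alpha> a B where A2: "noether_frame m (pre (shear ?n ?n (\<lambda>i. if i = m then - t else if i = ?n then 1 else 0)) A1)"
    and a: "a \<in> hpoly m \<alpha>" "a \<noteq> 0" "B \<in> hpoly ?n (Suc \<alpha>)"
      "a * X ?n - B \<in> vpolys ?n (pre (shear ?n ?n (\<lambda>i. if i = m then - t else if i = ?n then 1 else 0)) A1)"
    using A1.ex_birational unfolding Let_def by blast
  define r where "r = (\<lambda>i. if i = m then - t else if i = ?n then 1 else 0)"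
  have L3: "frame ?n (shear ?n ?n r) (shear ?n ?n (\<lambda>i. if i = ?n then 1 / r ?n else - r i / r ?n))"
    by (rule frame_shear(1)) (auto simp: r_def)
  interpret A2: noether_frame m "pre (shear ?n ?n r) A1" using A2 by (simp only: r_def)
  have hA2: "hilb ?n (pre (shear ?n ?n r) A1) = hilb ?n A"
    unfolding hA[symmetric] by (rule ext) (rule frame.hilb_pre[OF L3])
  obtain e F where g: "A2.is_gen e F" using A2.ex_gen by blast
  have de: "d = e" by (rule A2.birational_degree(1)[OF _ g a[folded r_def]]) (simp add: hA2 H)
  define L3' where "L3' = shear ?n ?n (\<lambda>i. if i = ?n then 1 / r ?n else - r i / r ?n)"
  have cf3: "cone_form ?n (unit_vec ?n) (pre (shear ?n ?n r) A1) d F" unfolding de by (rule A2.cone_form_gen[OF g])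
  have cf2: "cone_form ?n (app (shear ?n ?n r) (unit_vec ?n)) A1 d (pull L3' F)"
    using frame.cone_form_pull[OF L3 cf3] by (simp only: L3'_def)
  \<comment> \<open>The vertex is traced back through the three changes of coordinates.\<close>
  define p1 where "p1 = app (shear ?n ?n r) (unit_vec ?n)"
  define p2 where "p2 = app (shear ?n m q) p1"
  define p3 where "p3 = app (shear ?n ?n p) p2"
  have "cone_form ?n p2 (pre (shear ?n ?n p) A) d (pull L2 (pull L3' F))"
    unfolding p2_def p1_def by (rule frame.cone_form_pull[OF L(2) cf2[unfolded A1]])
  from frame.cone_form_pull[OF L(1) this]
  have cf: "cone_form ?n p3 A d (pull L1 (pull L2 (pull L3' F)))" unfolding p3_def .
  have p3n: "p3 ?n \<noteq> 0"
    using pn(1) q by (simp add: p3_def p2_def p1_def app_shear r_def unit_vec_def)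
  have p3c: "p3 \<in> coords ?n" unfolding p3_def p2_def p1_def
    by (intro frame.app_coords[OF L(1)] frame.app_coords[OF L(2)] frame.app_coords[OF L3] unit_vec_coords) simp
  have "unit_vec ?n \<notin> pre (shear ?n ?n r) A1" by (rule noether_unit_vec[OF A2.noeth]) simp
  then have "p3 \<notin> A" by (simp add: p3_def p2_def p1_def A1 pre_def)
  then show "\<exists>p F. p \<in> coords ?n \<and> p ?n \<noteq> 0 \<and> p \<notin> A \<and> cone_form ?n p A d F" using p3n p3c cf by blast
qed

lemma cone_form_dvd:
  assumes "cone_form n p A e F" "H \<in> polys (Suc n)" "\<And>b c. b \<in> A \<Longrightarrow> peval H (\<lambda>i. b i + c * p i) = 0"
  shows "F dvd H"
  using assms(1)[unfolded cone_form_def] assms(2,3) by blast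

lemma cone_form_dvd_invar:
  assumes "cone_form n p A e F" "G \<in> vpolys n A" "invar p G" shows "F dvd G"
  by (rule cone_form_dvd[OF assms(1) vpolys_polys[OF assms(2)]])
     (use assms(3) vidD[OF assms(2)] in \<open>simp add: invar_def\<close>)

lemma cone_form_no_smaller:
  fixes A :: "(nat \<Rightarrow> 'k::field_char_0) set"
  assumes F: "cone_form n p A e F" and G: "G \<in> hpoly (Suc n) t \<inter> vpolys n A" "invar p G" "t < e"
  shows "G = 0"
proof -
  have "F dvd G" by (rule cone_form_dvd_invar[OF F _ G(2)]) (use G(1) in blast)
  then show ?thesis using quotient_hpoly[of F "Suc n" e G t] F G by (auto simp: cone_form_def)
qed

text \<open>At one vertex the degree is \<open>d\<close>, so no nonzero invariant form of degree
  \<open>d - 1\<close> vanishes on \<open>A\<close>, and this persists on an open set. There a cone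
  of smaller degree is impossible, as it could be completed to such a form.\<close>

lemma general_degree:
  fixes A :: "(nat \<Rightarrow> 'k::{alg_closed_field,field_char_0}) set"
  assumes m: "m \<ge> 2" and A: "admissible (Suc m) A" and H: "hilb_degree (hilb (Suc m) A) d"
  shows "d \<ge> 2" "\<exists>r E. E \<in> hpoly (Suc (Suc m)) r \<and> (\<exists>p\<in>coords (Suc m). peval E p \<noteq> 0) \<and>
    (\<forall>p\<in>coords (Suc m). peval E p \<noteq> 0 \<longrightarrow> p \<notin> A \<and>
       (\<exists>F. cone_form (Suc m) p A d F \<and> ideal_dim (Suc m) A d \<le> (d - 1 + Suc m) choose Suc m))"
proof -
  let ?n = "Suc m"
  have kA: "vclosed ?n A" using A by (simp add: admissible_def)
  obtain p0 F0 where p0: "p0 \<in> coords ?n" "p0 ?n \<noteq> 0" "p0 \<notin> A" and F0: "cone_form ?n p0 A d F0"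
    using cone_form_exists_degree(1)[OF m A H] by blast
  show d2: "d \<ge> 2" using F0 by (simp add: cone_form_def)
  obtain t f where f: "f \<in> hpoly (Suc ?n) t" "f \<in> vpolys ?n A" "peval f p0 \<noteq> 0" using vclosed_sep[OF kA p0(1,3)] by blast
  have z: "G = 0" if "G \<in> hpoly (Suc ?n) (d - 1) \<inter> vpolys ?n A" "invar p0 G" for G
    by (rule cone_form_no_smaller[OF F0 that]) (use d2 in simp)
  obtain s D where D: "D \<in> hpoly (Suc ?n) s" "peval D p0 \<noteq> 0"
    "\<And>p G. peval D p \<noteq> 0 \<Longrightarrow> G \<in> hpoly (Suc ?n) (d - 1) \<inter> vpolys ?n A \<Longrightarrow> invar p G \<Longrightarrow> G = 0"
    using no_invar_open[of ?n "d - 1" A p0] z by metis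
  \<comment> \<open>The factors guarantee in turn that \<open>p\<close> is outside \<open>A\<close>,
    that \<open>p\<close> can serve as a column of the shear, and that there is no invariant form of
    degree \<open>d - 1\<close>.\<close>
  define E where "E = f * X ?n * D"
  have Eh: "E \<in> hpoly (Suc ?n) (t + 1 + s)" unfolding E_def by (intro hpoly_mult f D hpoly_X) simp
  have "p \<notin> A \<and> (\<exists>F. cone_form ?n p A d F \<and> ideal_dim ?n A d \<le> (d - 1 + ?n) choose ?n)"
    if p: "p \<in> coords ?n" and Ep: "peval E p \<noteq> 0" for p
  proof
    have nz: "peval f p \<noteq> 0" "p ?n \<noteq> 0" "peval D p \<noteq> 0" using Ep by (auto simp: E_def peval.mult)
    show pA: "p \<notin> A" using nz(1) vidD[OF f(2)] by blast
    obtain e F where F: "cone_form ?n p A e F" "e \<le> d" "ideal_dim ?n A e \<le> (e - 1 + ?n) choose ?n"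
      using cone_form_general[OF m A H p nz(2) pA] by blast
    have "e = d"
    proof (rule ccontr)
      assume "e \<noteq> d"
      then have ed: "e \<le> d - 1" using F(2) by simp
      \<comment> \<open>A nonzero linear form vanishing at \<open>p\<close>, hence invariant; its
        powers raise the degree of \<open>F\<close> to \<open>d - 1\<close> without leaving the
        invariant forms.\<close>
      define l where "l = Cst (p ?n) * X 0 - Cst (p 0) * X ?n"
      have lh: "l \<in> hpoly (Suc ?n) 1" unfolding l_def by (intro hpoly_diff hpoly_Cst_mult hpoly_X) auto
      have lp: "peval l p = 0" by (simp add: l_def peval.diff peval.mult)
      have "peval l (unit_vec 0) = p ?n" by (simp add: l_def peval.diff peval.mult unit_vec_def)
      then have l0: "l \<noteq> 0" using nz(2) by auto
      have li: "invar p l" unfolding invar_def using peval_hpoly_1_linear[OF lh] lp by simp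
      define G where "G = l ^ (d - 1 - e) * F"
      have "G \<in> hpoly (Suc ?n) ((d - 1 - e) * 1 + e)" unfolding G_def
        using F(1) by (intro hpoly_mult hpoly_power lh) (simp add: cone_form_def)
      moreover have "(d - 1 - e) * 1 + e = d - 1" using ed by simp
      ultimately have "G \<in> hpoly (Suc ?n) (d - 1)" by metis
      moreover have "G \<in> vpolys ?n A" unfolding G_def
        using F(1) by (intro vpolys_mult polys_power hpoly_polys[OF lh]) (simp add: cone_form_def)
      moreover have "invar p G" using F(1) li by (simp add: G_def invar_def cone_form_def peval.mult peval.power)
      ultimately have "G = 0" using D(3)[OF nz(3)] by blast
      then show False using l0 F(1) by (simp add: G_def cone_form_def)
    qed
    then show "\<exists>F. cone_form ?n p A d F \<and> ideal_dim ?n A d \<le> (d - 1 + ?n) choose ?n" using F by blast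
  qed
  moreover have "peval E p0 \<noteq> 0" using f(3) p0(2) D(2) by (simp add: E_def peval.mult)
  ultimately show "\<exists>r E. E \<in> hpoly (Suc ?n) r \<and> (\<exists>p\<in>coords ?n. peval E p \<noteq> 0) \<and>
    (\<forall>p\<in>coords ?n. peval E p \<noteq> 0 \<longrightarrow> p \<notin> A \<and>
       (\<exists>F. cone_form ?n p A d F \<and> ideal_dim ?n A d \<le> (d - 1 + ?n) choose ?n))"
    using Eh p0(1) by blast
qed

section \<open>The unexpected cone\<close>

lemma cone_eq_pset:
  fixes V :: "('k::field_char_0) point set"
  assumes V: "V \<subseteq> proj_space n" "V \<noteq> {}" and P: "P \<in> proj_space n" "p \<in> P" and F: "cone_form n p (\<Union>V) d F"
  shows "cone n P V = pset n {x \<in> coords n. peval F x = 0}"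
proof (intro subset_antisym subsetI)
  have Fh: "F \<in> hpoly (Suc n) d" "invar p F" "F \<in> vpolys n (\<Union>V)" "d \<ge> 2" using F by (simp_all add: cone_form_def)
  fix Y assume "Y \<in> cone n P V"
  then obtain Q a b s t where Y: "Y \<in> proj_space n" and Q: "Q \<in> V" "a \<in> P" "b \<in> Q" "(\<lambda>i. s * a i + t * b i) \<in> Y"
    by (auto simp: cone_def proj_line_def)
  obtain c where c: "a = (\<lambda>i. c * p i)" using proj_spaceE(2)[OF P] Q(2) by blast
  have "peval F (\<lambda>i. s * a i + t * b i) = peval F (\<lambda>i. t * b i + (s * c) * p i)"
    unfolding c by (rule arg_cong[of _ _ "peval F"]) (auto simp: mult_ac)
  also have "\<dots> = t ^ d * peval F b" using Fh(2) by (simp add: invar_def peval_hpoly_scale[OF Fh(1)])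
  also have "\<dots> = 0" using Fh(3) Q(1,3) by (auto simp: vpolys_def)
  finally have y: "peval F (\<lambda>i. s * a i + t * b i) = 0" .
  have "Y \<subseteq> {x \<in> coords n. peval F x = 0}"
  proof
    fix x assume x: "x \<in> Y"
    then obtain e where "x = (\<lambda>i. e * (s * a i + t * b i))" using proj_spaceE(2)[OF Y Q(4)] by blast
    then have "peval F x = 0" using y by (simp add: peval_hpoly_scale[OF Fh(1)])
    then show "x \<in> {x \<in> coords n. peval F x = 0}" using proj_spaceE(1)[OF Y x] by simp
  qed
  then show "Y \<in> pset n {x \<in> coords n. peval F x = 0}" using Y by (simp add: pset_def)
next
  fix Y assume Y: "Y \<in> pset n {x \<in> coords n. peval F x = 0}"
  then have Yp: "Y \<in> proj_space n" by (simp add: pset_def)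
  obtain x where x: "x \<in> Y" using proj_space_nonempty[OF Yp] by blast
  have "(\<exists>c. x = (\<lambda>i. c * p i)) \<or> (\<exists>b\<in>\<Union>V. \<exists>c. x = (\<lambda>i. b i + c * p i))"
    using F x Y by (auto simp: cone_form_def pset_def)
  then show "Y \<in> cone n P V"
  proof (elim disjE exE bexE)
    fix c assume c: "x = (\<lambda>i. c * p i)"
    obtain Q where Q: "Q \<in> V" using V(2) by blast
    then obtain b where b: "b \<in> Q" using proj_space_nonempty V(1) by blast
    have "(\<lambda>i. c * p i + 0 * b i) \<in> Y" using x c by simp
    then show ?thesis using Q b P Yp unfolding cone_def proj_line_def by blast
  next
    fix b c assume b: "b \<in> \<Union>V" "x = (\<lambda>i. b i + c * p i)"
    then obtain Q where Q: "Q \<in> V" "b \<in> Q" by blast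
    have "(\<lambda>i. c * p i + 1 * b i) \<in> Y" using x b(2) by (simp add: add.commute)
    then show ?thesis using Q P Yp unfolding cone_def proj_line_def by blast
  qed
qed

lemma cgenideal_poly_ring: "cgenideal (poly_ring n) F = (\<lambda>G. G * F) ` polys (Suc n)"
  by (auto simp: cgenideal_def carrier_poly_ring)

text \<open>The reduced cone and the hypersurface \<open>F = 0\<close> agree as schemes, so the
  unexpected hypersurface is the cone without multiplicities.\<close>

lemma vpolys_cone_form:
  fixes A :: "(nat \<Rightarrow> 'k::field_char_0) set"
  assumes A: "vclosed n A" and p: "p \<in> coords n" "p \<notin> A" and F: "cone_form n p A d F"
  shows "vpolys n {x \<in> coords n. peval F x = 0} = cgenideal (poly_ring n) F"
  unfolding cgenideal_poly_ring
proof (intro subset_antisym subsetI)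
  have Fh: "F \<in> hpoly (Suc n) d" "invar p F" "F \<in> vpolys n A" using F by (simp_all add: cone_form_def)
  note Fp = hpoly_polys[OF Fh(1)]
  fix H assume H: "H \<in> vpolys n {x \<in> coords n. peval F x = 0}"
  have "peval H (\<lambda>i. b i + c * p i) = 0" if b: "b \<in> A" for b c
  proof (rule vidD[OF H], rule CollectI, rule conjI)
    have bc: "b \<in> coords n" using b vclosed_coords[OF A] by blast
    show "peval F (\<lambda>i. b i + c * p i) = 0" using Fh(2) vidD[OF Fh(3) b] by (simp add: invar_def)
    \<comment> \<open>Otherwise \<open>p\<close> would be proportional to \<open>b\<close> and so
      belong to \<open>A\<close>.\<close>
    have "\<exists>i. b i + c * p i \<noteq> 0"
    proof (rule ccontr)
      assume "\<not> ?thesis"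
      then have e: "b i = - c * p i" for i by (simp add: eq_neg_iff_add_eq_0)
      then have c: "c \<noteq> 0" using bc by (auto simp: coords_def)
      have "(\<lambda>i. (- (1 / c)) * b i) \<in> A" by (rule vclosed_scale[OF A b]) (use c in simp)
      moreover have "(\<lambda>i. (- (1 / c)) * b i) = p" using e c by (auto simp: fun_eq_iff)
      ultimately show False using p(2) by simp
    qed
    then show "(\<lambda>i. b i + c * p i) \<in> coords n" using coordsD[OF bc] coordsD[OF p(1)] by (auto simp: coords_def)
  qed
  then have "F dvd H" by (rule cone_form_dvd[OF F vpolys_polys[OF H]])
  then obtain Q where Q: "H = F * Q" by (rule dvdE)
  define h where "h = msubst Cst (\<lambda>i. if i < Suc n then X i else (0::'k mpoly))"
  interpret h: rhom h unfolding h_def by (rule rhom.rhom_msubst[OF rhom_Cst])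
  have "h H = h F * h Q" by (simp add: Q h.mult)
  then have "H = h Q * F" using restrict_vars[OF Fp] restrict_vars[OF vpolys_polys[OF H]] by (simp add: h_def mult.commute)
  moreover have "h Q \<in> polys (Suc n)" unfolding h_def by (rule restrict_vars_polys)
  ultimately show "H \<in> (\<lambda>G. G * F) ` polys (Suc n)" by blast
next
  fix H assume "H \<in> (\<lambda>G. G * F) ` polys (Suc n)"
  then obtain G where G: "H = G * F" "G \<in> polys (Suc n)" by blast
  have "F \<in> polys (Suc n)" using F hpoly_polys by (auto simp: cone_form_def)
  then show "H \<in> vpolys n {x \<in> coords n. peval F x = 0}"
    unfolding G(1) using G(2) by (intro vidI polys_mult) (auto simp: peval.mult)
qed

text \<open>An invariant form of degree \<open>d\<close> in the ideal is a multiple of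
  \<open>F\<close>, and by degree a scalar multiple. So the actual dimension is 1, whereas the bound
  on \<open>ideal_dim\<close> makes the expected one 0. Scalar multiples generate the same ideal,
  which gives uniqueness.\<close>

lemma unexpected_cone:
  fixes V :: "('k::field_char_0) point set"
  assumes V: "zclosed n V" "V \<noteq> {}" and P: "P \<in> proj_space n" "p \<in> P" "p \<notin> \<Union>V"
    and F: "cone_form n p (\<Union>V) d F" and bd: "ideal_dim n (\<Union>V) d \<le> (d - 1 + n) choose n"
  shows "zclosed n (cone n P V)"
    "unexpected_hypersurfaces n (vanishing_ideal n V) d d P = {vanishing_ideal n (cone n P V)}"
proof -
  let ?A = "\<Union>V"
  have A: "vclosed n ?A" and Vp: "V = pset n ?A" using zclosedD[OF V(1)] by auto
  have VP: "V \<subseteq> proj_space n" using Vp by (auto simp: pset_def)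
  have Fh: "F \<in> hpoly (Suc n) d" "invar p F" "F \<in> vpolys n ?A" "d \<ge> 2" "F \<noteq> 0" using F by (simp_all add: cone_form_def)
  define Z where "Z = {x \<in> coords n. peval F x = 0}"
  have "Z = {x \<in> coords n. \<forall>G\<in>{F}. peval G x = 0}" by (simp add: Z_def)
  then have kZ: "vclosed n Z" using vclosed_zeros[of "{F}" n] Fh(1) by auto
  have cZ: "cone n P V = pset n Z" unfolding Z_def by (rule cone_eq_pset[OF VP V(2) P(1,2) F])
  show "zclosed n (cone n P V)" unfolding cZ by (rule zclosed_pset[OF kZ])
  have pc: "p \<in> coords n" by (rule proj_spaceE(1)[OF P(1,2)])
  have vi: "vanishing_ideal n V = vpolys n ?A" by (rule vanishing_ideal_eq_vpolys[OF VP])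
  have "pset n Z \<subseteq> proj_space n" by (auto simp: pset_def)
  then have "vanishing_ideal n (cone n P V) = vpolys n (\<Union>(pset n Z))" unfolding cZ by (rule vanishing_ideal_eq_vpolys)
  also have "\<dots> = cgenideal (poly_ring n) F"
    unfolding Union_pset[OF kZ] unfolding Z_def by (rule vpolys_cone_form[OF A pc P(3) F])
  finally have vc: "vanishing_ideal n (cone n P V) = cgenideal (poly_ring n) F" .
  have mf: "mult_forms n (vpolys n ?A) d d P = (*) F ` hpoly (Suc n) 0"
    unfolding mult_forms_eq[OF P(1,2)]
  proof (intro subset_antisym subsetI)
    fix G assume "G \<in> {F \<in> hpoly (Suc n) d \<inter> vpolys n ?A. invar p F}"
    then have G: "G \<in> hpoly (Suc n) d" "G \<in> vpolys n ?A" "invar p G" by auto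
    have "F dvd G" by (rule cone_form_dvd_invar[OF F G(2,3)])
    then show "G \<in> (*) F ` hpoly (Suc n) 0" using quotient_hpoly[OF Fh(1) G(1)] by auto
  next
    fix G assume "G \<in> (*) F ` hpoly (Suc n) 0"
    then obtain Q where "G = F * Q" "Q \<in> hpoly (Suc n) 0" by blast
    then obtain c where c: "G = Cst c * F" using hpoly_0_const by (metis mult.commute)
    have "G \<in> hpoly (Suc n) d" unfolding c by (rule hpoly_Cst_mult[OF Fh(1)])
    moreover have "G \<in> vpolys n ?A" unfolding c by (rule vpolys_mult[OF Fh(3) polys_Cst])
    moreover have "invar p G" using Fh(2) by (simp add: c invar_def peval.mult)
    ultimately show "G \<in> {F \<in> hpoly (Suc n) d \<inter> vpolys n ?A. invar p F}" by simp
  qed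
  have "mpoly.dim (mult_forms n (vpolys n ?A) d d P) = 1"
    unfolding mf by (simp add: fin_dim_dim_mult(2)[OF fin_dim_hpoly Fh(5)] dim_hpoly)
  moreover have "(d - 1 + n) choose n = (d + n - 1) choose n" using Fh(4) by simp
  ultimately have ad: "admits_unexpected n (vpolys n ?A) d d P"
    using bd unfolding admits_unexpected_def graded_part_vpolys ideal_dim_def[symmetric] by simp
  have "cgenideal (poly_ring n) G = cgenideal (poly_ring n) F" if G: "G \<in> (*) F ` hpoly (Suc n) 0" "G \<noteq> 0" for G
  proof -
    obtain Q where "G = F * Q" "Q \<in> hpoly (Suc n) 0" using G(1) by blast
    then obtain c where c: "G = Cst c * F" using hpoly_0_const by (metis mult.commute)
    have c0: "c \<noteq> 0" using G(2) c by auto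
    have e1: "H * F = (Cst (1 / c) * H) * G" for H :: "'k mpoly"
    proof -
      have "Cst (1 / c) * Cst c = (1 :: 'k mpoly)" using c0 by (simp flip: rhom.mult[OF rhom_Cst])
      then show ?thesis unfolding c by (metis mult.assoc mult.left_commute mult_1)
    qed
    have e2: "H * G = (Cst c * H) * F" for H :: "'k mpoly" unfolding c by (simp only: mult_ac)
    show ?thesis
      unfolding cgenideal_poly_ring
    proof (intro subset_antisym image_subsetI)
      fix H :: "'k mpoly" assume H: "H \<in> polys (Suc n)"
      show "H * G \<in> (\<lambda>H. H * F) ` polys (Suc n)"
        unfolding e2 by (rule imageI[OF polys_mult[OF polys_Cst H]])
      show "H * F \<in> (\<lambda>H. H * G) ` polys (Suc n)"
        unfolding e1 by (rule imageI[OF polys_mult[OF polys_Cst H]])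
    qed
  qed
  moreover have "F \<in> (*) F ` hpoly (Suc n) 0" by (rule image_eqI[of _ _ 1]) auto
  ultimately show "unexpected_hypersurfaces n (vanishing_ideal n V) d d P = {vanishing_ideal n (cone n P V)}"
    unfolding unexpected_hypersurfaces_def vc vi mf using ad Fh(5) by blast
qed

section \<open>Two linear spaces\<close>

text \<open>If one linear space contained the other, \<open>A\<close> would itself be linear. Its
  equations vanish by non-degeneracy, so it would be everything. A point on only one of the two
  spaces then lies on an irreducible set with a chain of length \<open>n - 2\<close>, which must be
  contained in that space; this gives the codimension.\<close>

lemma two_planes_projective:
  fixes V :: "('k::{alg_closed_field,field_char_0}) point set"
  assumes n: "n \<ge> 3" and V: "zclosed n V" and cd: "has_codim n V 2" and g: "admissible n (\<Union>V)"
    and t: "two_planes n (\<Union>V)"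
  shows "\<exists>L M. linear_space n L \<and> has_codim n L 2 \<and> linear_space n M \<and> has_codim n M 2 \<and> L \<noteq> M \<and> V = L \<union> M"
proof -
  let ?Z = "\<lambda>T. {x \<in> coords n. \<forall>F\<in>T. peval F x = 0}"
  let ?A = "\<Union>V"
  have Vp: "V = pset n ?A" using zclosedD[OF V] by auto
  obtain T1 T2 where T: "T1 \<subseteq> hpoly (Suc n) 1" "T2 \<subseteq> hpoly (Suc n) 1" "?A = ?Z T1 \<union> ?Z T2"
    using t unfolding two_planes_def by blast
  have k: "vclosed n (?Z T)" if "T \<subseteq> hpoly (Suc n) 1" for T by (rule vclosed_zeros) (use that in blast)
  have lin: "linear_space n (pset n (?Z T))" if "T \<subseteq> hpoly (Suc n) 1" for T
  proof -
    have "zeros n T = pset n (?Z T)" by (rule zeros_eq_pset) (use that in blast)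
    then show ?thesis unfolding linear_space_def forms_eq_hpoly using that by blast
  qed
  obtain t0 f where f: "f \<in> hpoly (Suc n) t0" "f \<in> vpolys n ?A" "f \<noteq> 0" using admissible_ex_nonzero[OF g] n by auto
  have notsub: "\<not> ?A \<subseteq> ?Z T" if T': "T \<subseteq> hpoly (Suc n) 1" "?Z T \<subseteq> ?A" for T
  proof
    assume s: "?A \<subseteq> ?Z T"
    have z0: "F = 0" if F: "F \<in> T" for F
    proof -
      have Fh: "F \<in> hpoly (Suc n) 1" using F T'(1) by blast
      have "F \<in> vpolys n ?A" by (rule vidI[OF hpoly_polys[OF Fh]]) (use s F in blast)
      then show ?thesis using g Fh unfolding admissible_def by blast
    qed
    have "\<forall>F\<in>T. peval F x = 0" for x using z0 peval_0 by metis
    then have "coords n \<subseteq> ?Z T" by simp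
    then have "coords n \<subseteq> ?A" using T'(2) by blast
    have "f * X 0 \<in> polys (Suc n)" by (intro polys_mult hpoly_polys[OF f(1)] polys_X) simp
    then obtain a where a: "\<forall>i\<ge>Suc n. a i = 0" "peval (f * X 0) a \<noteq> 0"
      using ex_peval_nonzero_polys[of "f * X 0" "Suc n"] f(3) by auto
    have "a \<in> coords n" using a by (auto simp: coords_def peval.mult)
    then have "peval f a = 0" using \<open>coords n \<subseteq> ?A\<close> vidD[OF f(2)] by blast
    then show False using a(2) by (simp add: peval.mult)
  qed
  have n12: "\<not> ?Z T1 \<subseteq> ?Z T2" "\<not> ?Z T2 \<subseteq> ?Z T1" using notsub[OF T(2)] notsub[OF T(1)] T(3) by blast+
  have dV: "has_dim n V (n - 2)" using cd by (auto simp: has_codim_def)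
  have cod: "has_codim n (pset n (?Z T)) 2" if T': "T \<subseteq> hpoly (Suc n) 1" "T' \<subseteq> hpoly (Suc n) 1" "?A = ?Z T \<union> ?Z T'" "\<not> ?Z T \<subseteq> ?Z T'" for T T'
  proof -
    obtain x where x: "x \<in> ?Z T" "x \<notin> ?Z T'" using T'(4) by blast
    then have "x \<in> ?A" using T'(3) by blast
    then obtain Y where Y: "virreducible n Y" "x \<in> Y" "Y \<subseteq> ?A" "vchain n Y (n - 2)" using g unfolding admissible_def by blast
    have "Y \<subseteq> ?Z T \<or> Y \<subseteq> ?Z T'" by (rule kirrD[OF Y(1) k[OF T'(1)] k[OF T'(2)]]) (use Y(3) T'(3) in blast)
    then have "Y \<subseteq> ?Z T" using Y(2) x(2) by blast
    then have c1: "vchain n (?Z T) (n - 2)" by (rule vchain_mono[OF Y(4)])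
    have "has_dim n (pset n (?Z T)) (n - 2)"
      unfolding has_dim_def has_irreducible_chain_pset[OF k[OF T'(1)]]
    proof (intro conjI allI impI c1)
      fix r assume "vchain n (?Z T) r"
      then have "vchain n ?A r" by (rule vchain_mono) (use T'(3) in blast)
      then have "has_irreducible_chain n V r" using has_irreducible_chain_pset[OF zclosedD(1)[OF V]] Vp by metis
      then show "r \<le> n - 2" using dV by (simp add: has_dim_def)
    qed
    then show ?thesis unfolding has_codim_def using n by (intro exI[of _ "n - 2"]) auto
  qed
  have "V = pset n (?Z T1) \<union> pset n (?Z T2)"
    using Vp unfolding T(3) using pset_Un[OF k[OF T(1)] k[OF T(2)]] by metis
  moreover have "pset n (?Z T1) \<noteq> pset n (?Z T2)" using pset_eq_iff[OF k[OF T(1)] k[OF T(2)]] n12 by blast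
  moreover have "has_codim n (pset n (?Z T1)) 2" by (rule cod[OF T n12(1)])
  moreover have "has_codim n (pset n (?Z T2)) 2" by (rule cod[OF T(2,1) _ n12(2)]) (use T(3) in blast)
  ultimately show ?thesis using lin[OF T(1)] lin[OF T(2)] by blast
qed

theorem proposition2p4:
  fixes V :: "('k :: {alg_closed_field, field_char_0}) point set" and n d :: nat
  assumes "n \<ge> 3"
    and "zclosed n V"
    and "equidimensional n V"
    and "has_codim n V 2"
    and "nondegenerate n V"
    and "has_degree n (vanishing_ideal n V) d"
  shows "d \<ge> 2 \<and>
    (d = 2 \<longrightarrow> (\<exists>L M. linear_space n L \<and> has_codim n L 2 \<and> linear_space n M \<and> has_codim n M 2 \<and>
                     L \<noteq> M \<and> V = L \<union> M)) \<and>
    (\<exists>U. zopen n U \<and> U \<noteq> {} \<and>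
      (\<forall>P\<in>U. zclosed n (cone n P V) \<and>
         unexpected_hypersurfaces n (vanishing_ideal n V) d d P = {vanishing_ideal n (cone n P V)}))"
proof -
  define m where "m = n - 1"
  have nm: "n = Suc m" and m: "m \<ge> 2" using assms(1) by (auto simp: m_def)
  let ?A = "\<Union>V"
  have admissible: "admissible n ?A" by (rule goodI) (use assms in auto)
  have VP: "V \<subseteq> proj_space n" using zclosedD(2)[OF assms(2)] by (auto simp: pset_def)
  have Vne: "V \<noteq> {}" using admissible by (auto simp: admissible_def)
  have vi: "vanishing_ideal n V = vpolys n ?A" by (rule vanishing_ideal_eq_vpolys[OF VP])
  have H: "hilb_degree (hilb n ?A) d"
    using assms(6) unfolding has_degree_def is_hilbert_poly_def hilb_degree_def vi hilbert_fun_vpolys .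
  have d2: "d \<ge> 2" by (rule general_degree(1)[OF m admissible[unfolded nm] H[unfolded nm]])
  obtain r E where E: "E \<in> hpoly (Suc n) r" "\<exists>p\<in>coords n. peval E p \<noteq> 0"
    "\<And>p. p \<in> coords n \<Longrightarrow> peval E p \<noteq> 0 \<Longrightarrow> p \<notin> ?A \<and> (\<exists>F. cone_form n p ?A d F \<and> ideal_dim n ?A d \<le> (d - 1 + n) choose n)"
    using general_degree(2)[OF m admissible[unfolded nm] H[unfolded nm]] unfolding nm[symmetric] by blast
  define U where "U = proj_space n - zeros n {E}"
  have Uo: "zopen n U"
    unfolding zopen_def zclosed_def U_def forms_eq_hpoly
    by (intro exI[of _ "zeros n {E}"] conjI refl exI[of _ "{E}"]) (use E(1) in auto)
  have Une: "U \<noteq> {}"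
  proof -
    obtain p where p: "p \<in> coords n" "peval E p \<noteq> 0" using E(2) by blast
    have "cls n p \<in> U" using cls_in[OF p(1)] p(2) self_in_cls[of p n] by (auto simp: U_def zeros_def vanishes_at_def)
    then show ?thesis by blast
  qed
  have un: "zclosed n (cone n P V) \<and>
      unexpected_hypersurfaces n (vanishing_ideal n V) d d P = {vanishing_ideal n (cone n P V)}" if PU: "P \<in> U" for P
  proof -
    have P: "P \<in> proj_space n" "\<not> vanishes_at E P" using PU by (auto simp: U_def zeros_def)
    obtain p where p: "p \<in> P" using proj_space_nonempty[OF P(1)] by blast
    have Ep: "peval E p \<noteq> 0" using vanishes_at_iff[OF E(1) P(1) p] P(2) by simp
    obtain F where F: "p \<notin> ?A" "cone_form n p ?A d F" "ideal_dim n ?A d \<le> (d - 1 + n) choose n"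
      using E(3)[OF proj_spaceE(1)[OF P(1) p] Ep] by blast
    show ?thesis using unexpected_cone[OF assms(2) Vne P(1) p F] by blast
  qed
  have two: "\<exists>L M. linear_space n L \<and> has_codim n L 2 \<and> linear_space n M \<and> has_codim n M 2 \<and> L \<noteq> M \<and> V = L \<union> M"
    if "d = 2"
    by (rule two_planes_projective[OF assms(1,2,4) admissible])
       (use cone_form_exists_degree(2)[OF m admissible[unfolded nm] H[unfolded nm] that] nm in simp)
  show ?thesis using d2 two Uo Une un by blast
qed


end
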